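(* Let $\mathbf{X}=(X_k)_{k\ge 0}$ be a $\beta$-null recurrent Markov chain ($\beta\in(0,1)$) on $(E,\mathcal{E})$ with an accessible atom $\boldsymbol{\alpha}$ and arbitrary initial distribution, and let $f:E\to\mathbb{R}$ be a $\pi_{\boldsymbol{\alpha}}$-integrable function such that $\mathbb{E}[f(\mathcal{B}_1)^2]<+\infty$ and $\operatorname{Var}(f(\mathcal{B}_1))>0$. Define $$\widehat{\mu}_{T(n)}=\frac{1}{T(n)}\sum_{i=1}^{T(n)}f(\mathcal{B}_i),\qquad \widehat{\sigma}^2_{T(n)}=\frac{1}{T(n)}\sum_{j=1}^{T(n)}\bigl(f(\mathcal{B}_j)-\widehat{\mu}_{T(n)}\bigr)^2 .$$ Let $T^{\ast}=T^{\ast}(n,T(n))$ and $\mathcal{B}^{\ast}_{1,T(n)},\mathcal{B}^{\ast}_{2,T(n)},\ldots$ be the number of blocks and the resampled blocks of the regenerative block bootstrap (RBB). Then for every $x\in\mathbb{R}$, $$\mathbb{P}^{\ast}\left(\frac{\sqrt{T^{\ast}}}{\widehat{\sigma}_{T(n)}}\left(\frac{1}{T^{\ast}}\sum_{j=1}^{T^{\ast}}\bigl(f(\mathcal{B}^{\ast}_{j,T(n)})-\widehat{\mu}_{T(n)}\bigr)\right)\le x\right)\longrightarrow \Phi(x)\quad\text{in probability as } n\to\infty,$$ where $\Phi$ is the standard normal distribution function.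
   Context: Standing assumptions. $\mathbf{X}=(X_k)_{k\ge0}$ is a homogeneous Markov chain with transition kernel $P$ on a countably generated state space $(E,\mathcal{E})$; it is aperiodic and irreducible with maximal irreducibility measure $\psi$. An accessible atom is a set $\boldsymbol{\alpha}\in\mathcal{E}$ with $\psi(\boldsymbol{\alpha})>0$ and $P(x,\cdot)=P(y,\cdot)$ for all $x,y\in\boldsymbol{\alpha}$. $\mathbb{P}_{\boldsymbol{\alpha}},\mathbb{E}_{\boldsymbol{\alpha}}$ denote probability and expectation given $X_0\in\boldsymbol{\alpha}$. The chain is recurrent, and from every starting point $x\in E$ it visits $\boldsymbol{\alpha}$ infinitely often with probability one. Return times: $\tau_{\boldsymbol{\alpha}}=\tau_{\boldsymbol{\alpha}}(1)=\inf\{n\ge1:X_n\in\boldsymbol{\alpha}\}$ and $\tau_{\boldsymbol{\alpha}}(k)=\min\{n>\tau_{\boldsymbol{\alpha}}(k-1):X_n\in\boldsymbol{\alpha}\}$ for $k\ge 2$. $\beta$-null recurrence: there are $\beta\in(0,1)$ and a function $L$ slowly varying at $+\infty$ such that $\mathbb{P}_{\boldsymbol{\alpha}}(\tau_{\boldsymbol{\alpha}}>n)\sim \dfrac{1}{\Gamma(1-\beta)\,n^{\beta}L(n)}$ as $n\to\infty$. Invariant measure: $\pi_{\boldsymbol{\alpha}}(A)=\mathbb{E}_{\boldsymbol{\alpha}}\bigl(\sum_{j=1}^{\tau_{\boldsymbol{\alpha}}}\mathbb{I}\{X_j\in A\}\bigr)$, $A\in\mathcal{E}$. Regeneration blocks: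 for $j\ge1$, $\mathcal{B}_j=(X_{\tau_{\boldsymbol{\alpha}}(j)+1},\ldots,X_{\tau_{\boldsymbol{\alpha}}(j+1)})$, with length $\ell(\mathcal{B}_j)=\tau_{\boldsymbol{\alpha}}(j+1)-\tau_{\boldsymbol{\alpha}}(j)$ and $f(\mathcal{B}_j)=\sum_{i=\tau_{\boldsymbol{\alpha}}(j)+1}^{\tau_{\boldsymbol{\alpha}}(j+1)}f(X_i)$. The blocks $(\mathcal{B}_j)_{j\ge1}$ are i.i.d. For a general finite block $\mathcal{B}$ of states, $\ell(\mathcal{B})$ is its length and $f(\mathcal{B})$ the sum of $f$ over its entries. $T(n)$ is the number of complete regeneration blocks $\mathcal{B}_1,\mathcal{B}_2,\ldots$ observed up to time $n$, i.e. $T(n)=\max\{k\ge0: k=0 \text{ or } \tau_{\boldsymbol{\alpha}}(k+1)\le n\}$; $T(n)\to\infty$ almost surely. RBB: let $\mathbf{X}^{(n)}=(X_0,\ldots,X_n)$ be the data and $\mathbb{P}^{\ast}(\cdot)=\mathbb{P}(\cdot\mid\mathbf{X}^{(n)})$. Conditionally on $\mathbf{X}^{(n)}$, the blocks $\mathcal{B}^{\ast}_{1,T(n)},\mathcal{B}^{\ast}_{2,T(n)},\ldots$ are drawn independently from the empirical distribution $T(n)^{-1}\sum_{j=1}^{T(n)}\delta_{\mathcal{B}_j}$. Put $\ell^{\ast}(k)=\sum_{j=1}^{k}\ell(\mathcal{B}^{\ast}_{j,T(n)})$ and $T^{\ast}(n,T(n))=\inf\{k\ge1:\ell^{\ast}(k)>n\}-1$.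 Quantities that are undefined because $T(n)=0$ or $\widehat\sigma_{T(n)}=0$ may be assigned arbitrary values (this concerns events of probability tending to $0$). *)

theory Defs
  imports "HOL-Probability.Probability" "HOL-Library.Landau_Symbols"
begin

section \<open>Markov kernels and their path laws\<close>

text \<open>
  The state space is a measure \<open>E\<close> of which only the underlying measurable space matters; a
  transition kernel is a measurable map \<open>P\<close> from \<open>E\<close> into the probability measures on \<open>E\<close>.
\<close>

definition countably_generated :: "'e measure \<Rightarrow> bool" where
  "countably_generated E \<longleftrightarrow>
     (\<exists>G. countable G \<and> G \<subseteq> Pow (space E) \<and> sets E = sigma_sets (space E) G)"

abbreviation transition_kernel :: "'e measure \<Rightarrow> ('e \<Rightarrow> 'e measure) \<Rightarrow> bool" where
  "transition_kernel E P \<equiv> P \<in> E \<rightarrow>\<^sub>M prob_algebra E"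

primrec kernel_pow :: "'e measure \<Rightarrow> ('e \<Rightarrow> 'e measure) \<Rightarrow> nat \<Rightarrow> 'e \<Rightarrow> 'e measure" where
  "kernel_pow E P 0 x = return E x"
| "kernel_pow E P (Suc n) x = kernel_pow E P n x \<bind> P"

definition path_kernel ::
  "'e measure \<Rightarrow> ('e \<Rightarrow> 'e measure) \<Rightarrow> 'e \<Rightarrow> nat \<Rightarrow> (nat \<Rightarrow> 'e) \<Rightarrow> 'e measure" where
  "path_kernel E P x n w = (if n = 0 then return E x else P (w (n - 1)))"

text \<open>
  The law, on the trajectory space, of the chain started at \<open>x\<close>: the projective limit supplied
  by the Ionescu-Tulcea theorem.
\<close>

definition path_law :: "'e measure \<Rightarrow> ('e \<Rightarrow> 'e measure) \<Rightarrow> 'e \<Rightarrow> (nat \<Rightarrow> 'e) measure" where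
  "path_law E P x =
     projective_family.lim UNIV (Ionescu_Tulcea.CI (path_kernel E P x) (\<lambda>_. E)) (\<lambda>_. E)"

lemma Ionescu_Tulcea_path_kernel:
  assumes P: "transition_kernel E P" and x: "x \<in> space E"
  shows "Ionescu_Tulcea (path_kernel E P x) (\<lambda>_. E)"
proof (rule Ionescu_Tulcea.intro)
  show "path_kernel E P x n \<in> (\<Pi>\<^sub>M i\<in>{0..<n}. E) \<rightarrow>\<^sub>M subprob_algebra E" for n
  proof (cases n)
    case 0
    then show ?thesis
      using x by (auto simp: path_kernel_def[abs_def] space_subprob_algebra
        intro!: measurable_const prob_space_imp_subprob_space prob_space_return)
  next
    case (Suc m)
    have "(\<lambda>w. w m) \<in> (\<Pi>\<^sub>M i\<in>{0..<n}. E) \<rightarrow>\<^sub>M E"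
      using Suc by (intro measurable_component_singleton) auto
    from measurable_compose[OF this measurable_prob_algebraD[OF P]] Suc show ?thesis
      by (simp add: path_kernel_def[abs_def])
  qed
  show "prob_space (path_kernel E P x n w)" if w: "w \<in> space (\<Pi>\<^sub>M i\<in>{0..<n}. E)" for n w
  proof (cases n)
    case 0
    then show ?thesis using x by (simp add: path_kernel_def prob_space_return)
  next
    case (Suc m)
    then have "w m \<in> space E" using w by (auto simp: space_PiM PiE_iff)
    from measurable_space[OF P this] Suc show ?thesis
      by (simp add: path_kernel_def space_prob_algebra)
  qed
qed

section \<open>Irreducibility, aperiodicity, recurrence, atoms\<close>

definition irreducibility_measure ::
  "'e measure \<Rightarrow> ('e \<Rightarrow> 'e measure) \<Rightarrow> 'e measure \<Rightarrow> bool" where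
  "irreducibility_measure E P \<phi> \<longleftrightarrow>
     sets \<phi> = sets E \<and> sigma_finite_measure \<phi> \<and> emeasure \<phi> (space E) > 0 \<and>
     (\<forall>A\<in>sets E. emeasure \<phi> A > 0 \<longrightarrow>
        (\<forall>x\<in>space E. \<exists>n\<ge>1. emeasure (kernel_pow E P n x) A > 0))"

definition maximal_irreducibility_measure ::
  "'e measure \<Rightarrow> ('e \<Rightarrow> 'e measure) \<Rightarrow> 'e measure \<Rightarrow> bool" where
  "maximal_irreducibility_measure E P \<psi> \<longleftrightarrow>
     irreducibility_measure E P \<psi> \<and>
     (\<forall>\<phi>. irreducibility_measure E P \<phi> \<longrightarrow> absolutely_continuous \<psi> \<phi>)"

text \<open>A \<open>d\<close>-cycle in the sense of Meyn and Tweedie; aperiodicity means that the period is 1.\<close>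

definition d_cycle ::
  "'e measure \<Rightarrow> ('e \<Rightarrow> 'e measure) \<Rightarrow> 'e measure \<Rightarrow> nat \<Rightarrow> (nat \<Rightarrow> 'e set) \<Rightarrow> bool" where
  "d_cycle E P \<psi> d D \<longleftrightarrow>
     (\<forall>i<d. D i \<in> sets E) \<and> disjoint_family_on D {..<d} \<and>
     (\<forall>i<d. \<forall>x\<in>D i. emeasure (P x) (D (Suc i mod d)) = 1) \<and>
     emeasure \<psi> (space E - (\<Union>i<d. D i)) = 0"

definition aperiodic_chain ::
  "'e measure \<Rightarrow> ('e \<Rightarrow> 'e measure) \<Rightarrow> 'e measure \<Rightarrow> bool" where
  "aperiodic_chain E P \<psi> \<longleftrightarrow> \<not> (\<exists>d\<ge>2. \<exists>D. d_cycle E P \<psi> d D)"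

definition recurrent_chain ::
  "'e measure \<Rightarrow> ('e \<Rightarrow> 'e measure) \<Rightarrow> 'e measure \<Rightarrow> bool" where
  "recurrent_chain E P \<psi> \<longleftrightarrow>
     (\<forall>A\<in>sets E. emeasure \<psi> A > 0 \<longrightarrow>
        (\<forall>x\<in>space E. (\<Sum>n. emeasure (kernel_pow E P (Suc n) x) A) = \<infinity>))"

definition accessible_atom ::
  "'e measure \<Rightarrow> ('e \<Rightarrow> 'e measure) \<Rightarrow> 'e measure \<Rightarrow> 'e set \<Rightarrow> bool" where
  "accessible_atom E P \<psi> \<alpha> \<longleftrightarrow>
     \<alpha> \<in> sets E \<and> emeasure \<psi> \<alpha> > 0 \<and> (\<forall>x\<in>\<alpha>. \<forall>y\<in>\<alpha>. P x = P y)"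

section \<open>Return times and regeneration blocks of a trajectory\<close>

text \<open>
  For \<open>k \<ge> 1\<close> this is the \<open>k\<close>-th return time, \<open>\<infinity>\<close> if there is none; the value 0 at
  \<open>k = 0\<close> makes the first return time the infimum over \<open>n \<ge> 1\<close>.
\<close>

primrec return_time :: "'e set \<Rightarrow> (nat \<Rightarrow> 'e) \<Rightarrow> nat \<Rightarrow> enat" where
  "return_time \<alpha> w 0 = 0"
| "return_time \<alpha> w (Suc k) = (INF n\<in>{n. return_time \<alpha> w k < enat n \<and> w n \<in> \<alpha>}. enat n)"

text \<open>Only meaningful when the return times \<open>j\<close> and \<open>Suc j\<close> are finite.\<close>

definition regen_block :: "'e set \<Rightarrow> (nat \<Rightarrow> 'e) \<Rightarrow> nat \<Rightarrow> 'e list" where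
  "regen_block \<alpha> w j =
     map w [Suc (the_enat (return_time \<alpha> w j)) ..< Suc (the_enat (return_time \<alpha> w (Suc j)))]"

definition block_sum :: "('e \<Rightarrow> real) \<Rightarrow> 'e list \<Rightarrow> real" where
  "block_sum f B = (\<Sum>y\<leftarrow>B. f y)"

definition num_blocks :: "'e set \<Rightarrow> (nat \<Rightarrow> 'e) \<Rightarrow> nat \<Rightarrow> nat" where
  "num_blocks \<alpha> w n = Max {k. k = 0 \<or> return_time \<alpha> w (Suc k) \<le> enat n}"

section \<open>The chain started in the atom\<close>

text \<open>
  \<open>X\<^sub>1, X\<^sub>2, \<dots>\<close> have the same law from every starting point of the atom, and only these
  variables enter below, so the choice of the representative is immaterial.
\<close>

definition atom_law :: "'e measure \<Rightarrow> ('e \<Rightarrow> 'e measure) \<Rightarrow> 'e set \<Rightarrow> (nat \<Rightarrow> 'e) measure" where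
  "atom_law E P \<alpha> = path_law E P (SOME x. x \<in> \<alpha>)"

definition atom_measure :: "'e measure \<Rightarrow> ('e \<Rightarrow> 'e measure) \<Rightarrow> 'e set \<Rightarrow> 'e measure" where
  "atom_measure E P \<alpha> = measure_of (space E) (sets E)
     (\<lambda>A. \<integral>\<^sup>+w. (\<Sum>j. if 1 \<le> j \<and> enat j \<le> return_time \<alpha> w 1 then indicator A (w j) else 0)
            \<partial>atom_law E P \<alpha>)"

definition slowly_varying :: "(real \<Rightarrow> real) \<Rightarrow> bool" where
  "slowly_varying L \<longleftrightarrow>
     (\<exists>a. set_borel_measurable borel {a..} L \<and> (\<forall>x\<ge>a. L x > 0)) \<and>
     (\<forall>t>0. ((\<lambda>x. L (t * x) / L x) \<longlongrightarrow> 1) at_top)"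

definition beta_null_recurrent ::
  "'e measure \<Rightarrow> ('e \<Rightarrow> 'e measure) \<Rightarrow> 'e set \<Rightarrow> real \<Rightarrow> bool" where
  "beta_null_recurrent E P \<alpha> \<beta> \<longleftrightarrow>
     0 < \<beta> \<and> \<beta> < 1 \<and>
     (\<exists>L. slowly_varying L \<and>
        (\<lambda>n. measure (atom_law E P \<alpha>)
               {w \<in> space (atom_law E P \<alpha>). enat n < return_time \<alpha> w 1})
        \<sim>[at_top] (\<lambda>n. 1 / (Gamma (1 - \<beta>) * real n powr \<beta> * L (real n))))"

section \<open>Markov chains on a probability space\<close>

definition natural_filtration ::
  "'w measure \<Rightarrow> 'e measure \<Rightarrow> (nat \<Rightarrow> 'w \<Rightarrow> 'e) \<Rightarrow> nat \<Rightarrow> 'w measure" where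
  "natural_filtration M E X n =
     vimage_algebra (space M) (\<lambda>\<omega>. \<lambda>i\<in>{..n}. X i \<omega>) (\<Pi>\<^sub>M i\<in>{..n}. E)"

text \<open>The initial distribution, i.e. the law of \<open>X 0\<close>, is left unconstrained.\<close>

definition markov_chain ::
  "'e measure \<Rightarrow> ('e \<Rightarrow> 'e measure) \<Rightarrow> 'w measure \<Rightarrow> (nat \<Rightarrow> 'w \<Rightarrow> 'e) \<Rightarrow> bool" where
  "markov_chain E P M X \<longleftrightarrow>
     prob_space M \<and> (\<forall>n. X n \<in> M \<rightarrow>\<^sub>M E) \<and>
     (\<forall>n. \<forall>A\<in>sets E. AE \<omega> in M.
        real_cond_exp M (natural_filtration M E X n)
          (indicator {\<omega> \<in> space M. X (Suc n) \<omega> \<in> A}) \<omega> = measure (P (X n \<omega>)) A)"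

definition tendsto_in_probability ::
  "'w measure \<Rightarrow> (nat \<Rightarrow> 'w \<Rightarrow> real) \<Rightarrow> real \<Rightarrow> bool" where
  "tendsto_in_probability M Z c \<longleftrightarrow>
     (\<forall>n. Z n \<in> borel_measurable M) \<and>
     (\<forall>\<epsilon>>0. (\<lambda>n. measure M {\<omega> \<in> space M. \<bar>Z n \<omega> - c\<bar> > \<epsilon>}) \<longlonglongrightarrow> 0)"

section \<open>The regenerative block bootstrap\<close>

definition mu_hat :: "'e set \<Rightarrow> ('e \<Rightarrow> real) \<Rightarrow> (nat \<Rightarrow> 'e) \<Rightarrow> nat \<Rightarrow> real" where
  "mu_hat \<alpha> f w n =
     (\<Sum>i=1..num_blocks \<alpha> w n. block_sum f (regen_block \<alpha> w i)) / real (num_blocks \<alpha> w n)"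

definition sigma_hat :: "'e set \<Rightarrow> ('e \<Rightarrow> real) \<Rightarrow> (nat \<Rightarrow> 'e) \<Rightarrow> nat \<Rightarrow> real" where
  "sigma_hat \<alpha> f w n =
     sqrt ((\<Sum>j=1..num_blocks \<alpha> w n. (block_sum f (regen_block \<alpha> w j) - mu_hat \<alpha> f w n)\<^sup>2)
            / real (num_blocks \<alpha> w n))"

text \<open>If there is no complete block, this is an unspecified distribution.\<close>

definition empirical_block_pmf :: "'e set \<Rightarrow> (nat \<Rightarrow> 'e) \<Rightarrow> nat \<Rightarrow> 'e list pmf" where
  "empirical_block_pmf \<alpha> w n = map_pmf (regen_block \<alpha> w) (pmf_of_set {1..num_blocks \<alpha> w n})"

text \<open>
  The conditional law, given that the data are \<open>w 0, \<dots>, w n\<close>, of the sequence of resampled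
  blocks; as a function of the data it is a regular version of the conditional probability.
  Blocks are used from index 1 on; the coordinate 0 plays no role.
\<close>

definition rbb_law :: "'e set \<Rightarrow> (nat \<Rightarrow> 'e) \<Rightarrow> nat \<Rightarrow> (nat \<Rightarrow> 'e list) measure" where
  "rbb_law \<alpha> w n = (\<Pi>\<^sub>M j\<in>UNIV. measure_pmf (empirical_block_pmf \<alpha> w n))"

definition boot_length :: "(nat \<Rightarrow> 'e list) \<Rightarrow> nat \<Rightarrow> nat" where
  "boot_length b k = (\<Sum>j=1..k. length (b j))"

definition boot_num :: "nat \<Rightarrow> (nat \<Rightarrow> 'e list) \<Rightarrow> nat" where
  "boot_num n b = (LEAST k. 1 \<le> k \<and> boot_length b k > n) - 1"

definition rbb_stat ::
  "'e set \<Rightarrow> ('e \<Rightarrow> real) \<Rightarrow> (nat \<Rightarrow> 'e) \<Rightarrow> nat \<Rightarrow> (nat \<Rightarrow> 'e list) \<Rightarrow> real" where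
  "rbb_stat \<alpha> f w n b =
     sqrt (real (boot_num n b)) / sigma_hat \<alpha> f w n *
     (1 / real (boot_num n b) * (\<Sum>j=1..boot_num n b. (block_sum f (b j) - mu_hat \<alpha> f w n)))"

definition rbb_prob_le ::
  "'e set \<Rightarrow> ('e \<Rightarrow> real) \<Rightarrow> (nat \<Rightarrow> 'e) \<Rightarrow> nat \<Rightarrow> real \<Rightarrow> real" where
  "rbb_prob_le \<alpha> f w n x =
     measure (rbb_law \<alpha> w n) {b \<in> space (rbb_law \<alpha> w n). rbb_stat \<alpha> f w n b \<le> x}"

end

theory Submission
  imports Defs "HOL-Real_Asymp.Real_Asymp"
begin

text \<open>The bootstrap stops at the random time \<open>T\<^sup>*\<close> at which the resampled lengths exceed \<open>n\<close>, and
  block sums and block lengths are dependent, so the central limit theorem cannot be applied to a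
  fixed number of summands. The way out is that the length accumulated by time \<open>n\<close> is carried by
  boundedly many big blocks, those longer than \<open>\<epsilon> n\<close>, whereas the sum of the \<open>f\<close>-values is carried by the
  small ones. Conditionally on the data, a draw from the empirical distribution is a draw that is
  replaced, whenever it is small, by an independent draw from the small blocks. The time \<open>m\<close> at which
  the big lengths alone pass \<open>(1 - \<eta>) n\<close> is then independent of the replacements, it satisfies
  \<open>m \<le> T\<^sup>* \<le> m + 2 h\<close> with \<open>h\<close> small compared to \<open>m\<close>, and exchanging the big blocks for small ones changes
  the sum by a bounded number of terms only. Hence the statistic is close to a sum of \<open>m\<close> i.i.d. terms
  with \<open>m\<close> independent of them, whose characteristic function is close to the Gaussian one by a
  Taylor expansion; Kolmogorov's maximal inequality controls the change from \<open>m\<close> to \<open>T\<^sup>*\<close>.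

  What this needs about the data holds with high probability: regular variation of the tail of the
  block length gives, through a Karamata-type bound on truncated means, that \<open>T(n)\<close> is of the order of
  \<open>1 / P(\<ell> > n)\<close>, that many blocks are longer than \<open>n / \<lambda>\<close>, and that the blocks shorter than \<open>n / \<lambda>'\<close>
  have a small total length; square integrability of the block sums gives that the standardised
  block sums are \<open>o(\<surd>T(n))\<close>.\<close>

section \<open>Independent draws from a finite distribution\<close>

text \<open>Random-index limit theorems of Anscombe type need an index that concentrates around a
  deterministic value. For \<beta> < 1 a total length is governed by its few largest terms, so
  \<open>T\<^sup>*\<close> stays random on its own scale and only genuine independence of index and
  summands helps; the split into big and small draws manufactures it. The conditions on the lengths
  hold in probability only, so there is no almost sure limit to pass to along a trajectory. All
  bootstrap estimates are therefore inequalities for one trajectory and one \<open>n\<close>. The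
  conditions on the block sums hold almost surely for all large sample sizes and may be evaluated at
  the random size \<open>T(n)\<close>, however it depends on the blocks. Hence the data estimates
  use the independence of the lengths and that of the sums separately; their dependence matters only
  inside the empirical law, where the resampling handles it. The sample mean and deviation
  standardise the empirical law exactly, so what the data must supply about the deviation is a lower
  bound.\<close>

lemma Pi_pmf_bind_map:
  assumes "finite I"
  shows "Pi_pmf I d (\<lambda>_. bind_pmf p (\<lambda>x. map_pmf (h x) q)) =
    map_pmf (\<lambda>(b, u) i. if i \<in> I then h (b i) (u i) else d)
      (pair_pmf (Pi_pmf I d (\<lambda>_. p)) (Pi_pmf I d (\<lambda>_. q)))"
proof -
  have "Pi_pmf I d (\<lambda>_. bind_pmf p (\<lambda>x. map_pmf (h x) q)) =
    Pi_pmf I d (\<lambda>_. p) \<bind> (\<lambda>b. Pi_pmf I d (\<lambda>i. map_pmf (h (b i)) q))"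
    by (rule Pi_pmf_bind[OF assms])
  also have "(\<lambda>b. Pi_pmf I d (\<lambda>i. map_pmf (h (b i)) q)) =
    (\<lambda>b. Pi_pmf I d (\<lambda>_. q) \<bind> (\<lambda>u. return_pmf (\<lambda>i. if i \<in> I then h (b i) (u i) else d)))"
    unfolding map_pmf_def
    by (subst Pi_pmf_bind[OF assms, where d' = d]) (simp add: assms)
  finally show ?thesis
    by (simp add: map_pmf_def pair_pmf_def bind_assoc_pmf bind_return_pmf)
qed

text \<open>Given that a draw falls into \<open>S\<close>, its law is \<open>cond_pmf p S\<close>,
  so exchanging it for a fresh draw from that law cannot be noticed. With \<open>S\<close> the small
  blocks, one vector of draws decides where the big blocks are and what they look like, and an
  independent vector supplies all small ones.\<close>

lemma bind_pmf_resample_cond_pmf: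
  assumes S: "set_pmf p \<inter> S \<noteq> {}"
  shows "bind_pmf p (\<lambda>x. map_pmf (\<lambda>u. if x \<in> S then u else x) (cond_pmf p S)) = p"
proof (rule pmf_eqI)
  fix y
  have pos: "measure (measure_pmf p) S > 0"
    using S measure_pmf_zero_iff[of p S] by (simp add: zero_less_measure_iff)
  have eq: "pmf (map_pmf (\<lambda>u. if x \<in> S then u else x) (cond_pmf p S)) y =
      indicator S x * pmf (cond_pmf p S) y + indicator ({y} - S) x" for x
    by (cases "x \<in> S") (auto simp: map_pmf_const indicator_def)
  have "pmf (bind_pmf p (\<lambda>x. map_pmf (\<lambda>u. if x \<in> S then u else x) (cond_pmf p S))) y =
     (\<integral>x. indicator S x * pmf (cond_pmf p S) y + indicator ({y} - S) x \<partial>measure_pmf p)"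
    by (simp add: pmf_bind eq)
  also have "\<dots> = measure p S * pmf (cond_pmf p S) y + measure p ({y} - S)"
  proof -
    have int: "integrable (measure_pmf p) (indicator A :: _ \<Rightarrow> real)" for A
      by (rule measure_pmf.integrable_const_bound[where B = 1]) (auto simp: indicator_def)
    show ?thesis
      by (simp add: int)
  qed
  also have "\<dots> = pmf p y"
    using pos by (cases "y \<in> S") (auto simp: pmf_cond[OF S] measure_pmf_single insert_Diff_if)
  finally show "pmf (bind_pmf p (\<lambda>x. map_pmf (\<lambda>u. if x \<in> S then u else x) (cond_pmf p S))) y = pmf p y" .
qed

lemma measure_bind_pmf:
  "measure_pmf.prob (bind_pmf p f) A = measure_pmf.expectation p (\<lambda>x. measure_pmf.prob (f x) A)"
  unfolding measure_pmf_bind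
  by (rule measure_pmf.measure_bind[where N = "count_space UNIV"])
    (auto simp: measure_pmf_in_subprob_algebra)

text \<open>Kolmogorov's maximal inequality from an arbitrary start \<open>s\<close>: the first
  increment moves the start to \<open>s + g y\<close>, so the induction on \<open>h\<close> needs
  all starts at once. The bound reproduces itself, because a centred increment adds exactly its
  variance to the mean square, and it is at least 1 once
  \<open>\<bar>s\<bar> \<ge> a\<close>.\<close>

lemma Pi_pmf_kolmogorov:
  fixes g :: "'b \<Rightarrow> real"
  assumes fin: "finite (set_pmf q)" and mean: "measure_pmf.expectation q g = 0"
    and var: "measure_pmf.expectation q (\<lambda>y. (g y)\<^sup>2) = v" and a: "a > 0"
    and I: "finite I" "{m<..m + h} \<subseteq> I"
  shows "measure_pmf.prob (Pi_pmf I d (\<lambda>_. q)) {u. \<exists>k\<in>{m..m + h}. \<bar>s + (\<Sum>i\<in>{m<..k}. g (u i))\<bar> \<ge> a}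
    \<le> (s\<^sup>2 + real h * v) / a\<^sup>2"
  using I
proof (induction h arbitrary: I m s)
  case 0
  show ?case
  proof (cases "\<bar>s\<bar> \<ge> a")
    case True
    then have "a\<^sup>2 \<le> s\<^sup>2" using a by (metis abs_le_square_iff abs_of_pos)
    then show ?thesis using a True by (auto simp: field_simps)
  qed (use a in auto)
next
  case (Suc h)
  have v: "v \<ge> 0" unfolding var[symmetric] by simp
  let ?B = "\<lambda>m h s u. \<exists>k\<in>{m..m + h}. \<bar>s + (\<Sum>i\<in>{m<..k}. g (u i))\<bar> \<ge> a"
  show ?case
  proof (cases "\<bar>s\<bar> \<ge> a")
    case True
    then have "a\<^sup>2 \<le> s\<^sup>2" using a by (metis abs_le_square_iff abs_of_pos)
    then have "1 \<le> (s\<^sup>2 + real (Suc h) * v) / a\<^sup>2" using a v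
      by (simp add: le_divide_eq add_increasing2)
    then show ?thesis using order_trans[OF measure_pmf.prob_le_1] by blast
  next
    case False
    define I' where "I' = I - {Suc m}"
    have I': "finite I'" "{Suc m<..Suc m + h} \<subseteq> I'" "Suc m \<notin> I'" "I = insert (Suc m) I'"
      using Suc.prems by (auto simp: I'_def)
    have step: "?B m (Suc h) s (u(Suc m := y)) \<longleftrightarrow> ?B (Suc m) h (s + g y) u" for u y
    proof -
      have split: "s + (\<Sum>i\<in>{m<..k}. g ((u(Suc m := y)) i)) = (s + g y) + (\<Sum>i\<in>{Suc m<..k}. g (u i))"
        if "Suc m \<le> k" for k
      proof -
        have "{m<..k} = insert (Suc m) {Suc m<..k}" using that by auto
        then show ?thesis by simp
      qed
      have "{m..m + Suc h} = insert m {Suc m..Suc m + h}" by auto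
      then have "?B m (Suc h) s (u(Suc m := y)) \<longleftrightarrow>
        (\<exists>k\<in>{Suc m..Suc m + h}. \<bar>s + (\<Sum>i\<in>{m<..k}. g ((u(Suc m := y)) i))\<bar> \<ge> a)"
        using False by simp
      also have "\<dots> \<longleftrightarrow> ?B (Suc m) h (s + g y) u"
        by (intro bex_cong refl) (subst split, auto)
      finally show ?thesis .
    qed
    have "measure_pmf.prob (Pi_pmf I d (\<lambda>_. q)) {u. ?B m (Suc h) s u} =
      measure_pmf.prob (bind_pmf q (\<lambda>y. map_pmf (\<lambda>u. u(Suc m := y)) (Pi_pmf I' d (\<lambda>_. q)))) {u. ?B m (Suc h) s u}"
      unfolding I'(4) by (subst Pi_pmf_insert'[OF I'(1,3)]) (simp add: map_pmf_def)
    also have "\<dots> = measure_pmf.expectation q (\<lambda>y. measure_pmf.prob (map_pmf (\<lambda>u. u(Suc m := y)) (Pi_pmf I' d (\<lambda>_. q))) {u. ?B m (Suc h) s u})"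
      by (rule measure_bind_pmf)
    also have "\<dots> = measure_pmf.expectation q (\<lambda>y. measure_pmf.prob (Pi_pmf I' d (\<lambda>_. q)) {u. ?B (Suc m) h (s + g y) u})"
      by (simp only: measure_map_pmf vimage_def mem_Collect_eq step)
    also have "\<dots> \<le> measure_pmf.expectation q (\<lambda>y. ((s + g y)\<^sup>2 + real h * v) / a\<^sup>2)"
      by (intro integral_mono integrable_measure_pmf_finite fin Suc.IH I')
    also have "\<dots> = (s\<^sup>2 + v + real h * v) / a\<^sup>2"
      by (simp add: power2_sum add_divide_distrib integrable_measure_pmf_finite[OF fin] mean var mult.assoc)
    finally show ?thesis by (simp add: algebra_simps)
  qed
qed

text \<open>Taylor expansion to second order; in the cubic remainder one factor
  \<open>\<bar>g y\<bar>\<close> is traded for \<open>G\<close>. Mean and second moment stay general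
  because the law of the small draws is only nearly standardised.\<close>

lemma expectation_iexp_approx:
  fixes g :: "'b \<Rightarrow> real"
  assumes fin: "finite (set_pmf q)" and G: "\<And>y. y \<in> set_pmf q \<Longrightarrow> \<bar>g y\<bar> \<le> G"
  defines "\<mu> \<equiv> measure_pmf.expectation q g"
    and "v \<equiv> measure_pmf.expectation q (\<lambda>y. (g y)\<^sup>2)"
  shows "cmod (measure_pmf.expectation q (\<lambda>y. iexp (s * g y)) - (1 - s\<^sup>2 / 2))
    \<le> \<bar>s\<bar> * \<bar>\<mu>\<bar> + s\<^sup>2 * \<bar>v - 1\<bar> / 2 + \<bar>s\<bar> ^ 3 * G * v / 6"
proof -
  note int = integrable_measure_pmf_finite[OF fin]
  let ?T = "\<lambda>y. \<Sum>k\<le>2. (\<i> * complex_of_real (s * g y)) ^ k / fact k"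
  let ?E = "measure_pmf.expectation q"
  have T: "?T y = 1 + \<i> * complex_of_real (s * g y) - complex_of_real ((s\<^sup>2 / 2) * (g y)\<^sup>2)" for y
  proof -
    have "?T y = 1 + \<i> * complex_of_real (s * g y) + (\<i> * complex_of_real (s * g y))\<^sup>2 / 2"
      by (simp add: eval_nat_numeral)
    also have "(\<i> * complex_of_real (s * g y))\<^sup>2 = - complex_of_real (s\<^sup>2 * (g y)\<^sup>2)"
      by (simp add: power_mult_distrib)
    finally show ?thesis by simp
  qed
  have ET: "?E ?T = 1 + \<i> * of_real (s * \<mu>) - of_real ((s\<^sup>2 / 2) * v)"
  proof -
    have "?E (\<lambda>y. complex_of_real (s * g y)) = of_real (s * \<mu>)"
      unfolding \<mu>_def by (subst integral_complex_of_real) simp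
    moreover have "?E (\<lambda>y. complex_of_real ((s\<^sup>2 / 2) * (g y)\<^sup>2)) = of_real ((s\<^sup>2 / 2) * v)"
      unfolding v_def by (subst integral_complex_of_real) simp
    ultimately show ?thesis
      unfolding T by (simp only: Bochner_Integration.integral_diff Bochner_Integration.integral_add
          int Bochner_Integration.integral_mult_right_zero) simp
  qed
  have "cmod (?E (\<lambda>y. iexp (s * g y)) - ?E ?T) \<le> ?E (\<lambda>y. cmod (iexp (s * g y) - ?T y))"
    by (subst Bochner_Integration.integral_diff[symmetric]) (auto intro!: int integral_norm_bound)
  also have "\<dots> \<le> ?E (\<lambda>y. \<bar>s\<bar> ^ 3 * G / 6 * (g y)\<^sup>2)"
  proof (intro integral_mono_AE int AE_pmfI)
    fix y assume y: "y \<in> set_pmf q"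
    have "cmod (iexp (s * g y) - ?T y) \<le> \<bar>s * g y\<bar> ^ Suc 2 / fact (Suc 2)"
      by (rule iexp_approx1)
    also have "\<dots> = \<bar>s\<bar> ^ 3 / 6 * (g y)\<^sup>2 * \<bar>g y\<bar>"
      by (simp add: abs_mult power_mult_distrib eval_nat_numeral power2_eq_square flip: abs_mult)
    also have "\<dots> \<le> \<bar>s\<bar> ^ 3 / 6 * (g y)\<^sup>2 * G"
      by (intro mult_left_mono G y) auto
    finally show "cmod (iexp (s * g y) - ?T y) \<le> \<bar>s\<bar> ^ 3 * G / 6 * (g y)\<^sup>2"
      by (simp add: mult_ac)
  qed
  also have "\<dots> = \<bar>s\<bar> ^ 3 * G * v / 6" by (simp add: v_def)
  finally have 1: "cmod (?E (\<lambda>y. iexp (s * g y)) - ?E ?T) \<le> \<bar>s\<bar> ^ 3 * G * v / 6" .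
  have "?E ?T - (1 - s\<^sup>2 / 2) = \<i> * of_real (s * \<mu>) - of_real ((s\<^sup>2 / 2) * (v - 1))"
    unfolding ET by (simp add: field_simps)
  also have "cmod \<dots> \<le> cmod (\<i> * of_real (s * \<mu>)) + cmod (of_real ((s\<^sup>2 / 2) * (v - 1)))"
    by (rule norm_triangle_ineq4)
  also have "\<dots> = \<bar>s\<bar> * \<bar>\<mu>\<bar> + s\<^sup>2 * \<bar>v - 1\<bar> / 2"
    unfolding norm_mult norm_of_real by (simp add: abs_mult)
  finally have 2: "cmod (?E ?T - (1 - s\<^sup>2 / 2)) \<le> \<bar>s\<bar> * \<bar>\<mu>\<bar> + s\<^sup>2 * \<bar>v - 1\<bar> / 2" .
  show ?thesis
    using norm_diff_triangle_le[OF 1 2] by (simp only: add_ac)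
qed

lemma expectation_iexp_sum_Pi_pmf:
  fixes g :: "'b \<Rightarrow> real"
  assumes I: "finite I" "J \<subseteq> I"
  shows "measure_pmf.expectation (Pi_pmf I d (\<lambda>_. q)) (\<lambda>u. iexp (s * (\<Sum>i\<in>J. g (u i)))) =
    measure_pmf.expectation q (\<lambda>y. iexp (s * g y)) ^ card J"
proof -
  let ?M = "measure_pmf (Pi_pmf I d (\<lambda>_. q))"
  have "prob_space.indep_vars ?M (\<lambda>_. count_space UNIV) (\<lambda>x f. f x) J"
    using I(2) by (intro prob_space.indep_vars_subset[OF _ indep_vars_Pi_pmf[OF I(1)]] measure_pmf.prob_space_axioms)
  then have "prob_space.indep_vars ?M (\<lambda>_. borel) (\<lambda>i u. g (u i)) J"
    by (rule prob_space.indep_vars_compose2[OF measure_pmf.prob_space_axioms]) auto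
  then have "char (distr ?M borel (\<lambda>u. \<Sum>i\<in>J. g (u i))) s = (\<Prod>i\<in>J. char (distr ?M borel (\<lambda>u. g (u i))) s)"
    by (rule prob_space.char_distr_sum[OF measure_pmf.prob_space_axioms])
  also have "\<dots> = (\<Prod>i\<in>J. measure_pmf.expectation q (\<lambda>y. iexp (s * g y)))"
  proof (rule prod.cong[OF refl])
    fix i assume i: "i \<in> J"
    have "char (distr ?M borel (\<lambda>u. g (u i))) s = measure_pmf.expectation (map_pmf (\<lambda>u. u i) (Pi_pmf I d (\<lambda>_. q))) (\<lambda>y. iexp (s * g y))"
      by (simp add: char_def integral_distr)
    also have "map_pmf (\<lambda>u. u i) (Pi_pmf I d (\<lambda>_. q)) = q"
      using i I by (subst Pi_pmf_component) auto
    finally show "char (distr ?M borel (\<lambda>u. g (u i))) s = measure_pmf.expectation q (\<lambda>y. iexp (s * g y))" .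
  qed
  finally show ?thesis by (simp add: char_def integral_distr)
qed

lemma exp_minus_quadratic_bound:
  assumes "0 \<le> (y::real)"
  shows "\<bar>exp (- y) - (1 - y)\<bar> \<le> y\<^sup>2 / 2"
proof -
  have "exp (- y) \<ge> 1 - y" using exp_ge_add_one_self[of "- y"] by simp
  moreover have "exp (- y) \<le> 1 - y + y\<^sup>2 / 2"
  proof -
    have "(\<lambda>y. 1 - y + y\<^sup>2 / 2 - exp (- y)) 0 \<le> (\<lambda>y. 1 - y + y\<^sup>2 / 2 - exp (- y)) y"
    proof (rule DERIV_nonneg_imp_nondecreasing[OF assms])
      fix x :: real assume "0 \<le> x"
      show "\<exists>z. ((\<lambda>y. 1 - y + y\<^sup>2 / 2 - exp (- y)) has_real_derivative z) (at x) \<and> 0 \<le> z"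
        using exp_ge_add_one_self[of "- x"]
        by (intro exI[of _ "- 1 + x + exp (- x)"]) (auto intro!: derivative_eq_intros)
    qed
    then show ?thesis by simp
  qed
  ultimately show ?thesis by simp
qed

text \<open>In the unit disc, \<open>m\<close>-th powers differ by at most \<open>m\<close> times
  the difference of the bases, so the one-step errors add up. The Gaussian target is itself an
  \<open>m\<close>-th power, of \<open>exp (- (s\<^sup>2 / 2))\<close> with
  \<open>s = t / sqrt m\<close>; its distance from \<open>1 - s\<^sup>2 / 2\<close> produces the
  term with \<open>t ^ 4\<close>.\<close>

lemma expectation_iexp_normalized_sum_Pi_pmf:
  fixes g :: "'b \<Rightarrow> real"
  assumes fin: "finite (set_pmf q)" and G: "\<And>y. y \<in> set_pmf q \<Longrightarrow> \<bar>g y\<bar> \<le> G"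
    and I: "finite I" "J \<subseteq> I" and m: "card J > 0"
  defines "\<mu> \<equiv> measure_pmf.expectation q g"
    and "v \<equiv> measure_pmf.expectation q (\<lambda>y. (g y)\<^sup>2)" and "m \<equiv> real (card J)"
  shows "cmod (measure_pmf.expectation (Pi_pmf I d (\<lambda>_. q)) (\<lambda>u. iexp (t * ((\<Sum>i\<in>J. g (u i)) / sqrt m)))
      - exp (- (t\<^sup>2 / 2)))
    \<le> \<bar>t\<bar> * sqrt m * \<bar>\<mu>\<bar> + t\<^sup>2 * \<bar>v - 1\<bar> / 2 + \<bar>t\<bar> ^ 3 * G * v / (6 * sqrt m) + t ^ 4 / (8 * m)"
proof -
  have m0: "m > 0" using m by (simp add: m_def)
  define s where "s = t / sqrt m"
  have s2: "s\<^sup>2 = t\<^sup>2 / m" using m0 by (simp add: s_def power_divide)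
  define \<phi> where "\<phi> = measure_pmf.expectation q (\<lambda>y. iexp (s * g y))"
  have eq: "measure_pmf.expectation (Pi_pmf I d (\<lambda>_. q)) (\<lambda>u. iexp (t * ((\<Sum>i\<in>J. g (u i)) / sqrt m))) = \<phi> ^ card J"
    unfolding \<phi>_def by (subst expectation_iexp_sum_Pi_pmf[OF I, symmetric]) (simp add: s_def)
  have \<phi>1: "cmod \<phi> \<le> 1"
    unfolding \<phi>_def by (rule order_trans[OF integral_norm_bound]) simp
  define w where "w = complex_of_real (exp (- (s\<^sup>2 / 2)))"
  have w1: "cmod w \<le> 1" by (simp add: w_def)
  have wm: "w ^ card J = complex_of_real (exp (- (t\<^sup>2 / 2)))"
    using m0 unfolding w_def s2 of_real_power[symmetric] exp_of_nat_mult[symmetric]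
    by (simp add: m_def)
  have "cmod (\<phi> ^ card J - w ^ card J) \<le> m * cmod (\<phi> - w)"
    unfolding m_def by (rule norm_power_diff) (use \<phi>1 w1 in auto)
  also have "cmod (\<phi> - w) \<le> cmod (\<phi> - (1 - s\<^sup>2 / 2)) + cmod ((1 - s\<^sup>2 / 2) - w)"
    using norm_triangle_ineq[of "\<phi> - (1 - s\<^sup>2 / 2)" "(1 - s\<^sup>2 / 2) - w"] by simp
  also have "cmod (complex_of_real (1 - s\<^sup>2 / 2) - w) = \<bar>exp (- (s\<^sup>2 / 2)) - (1 - s\<^sup>2 / 2)\<bar>"
    unfolding w_def of_real_diff[symmetric] norm_of_real by simp
  also have "\<dots> \<le> (s\<^sup>2 / 2)\<^sup>2 / 2" by (rule exp_minus_quadratic_bound) simp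
  also have "cmod (\<phi> - (1 - s\<^sup>2 / 2)) \<le> \<bar>s\<bar> * \<bar>\<mu>\<bar> + s\<^sup>2 * \<bar>v - 1\<bar> / 2 + \<bar>s\<bar> ^ 3 * G * v / 6"
    unfolding \<phi>_def \<mu>_def v_def by (rule expectation_iexp_approx[OF fin G])
  also have "m * (\<bar>s\<bar> * \<bar>\<mu>\<bar> + s\<^sup>2 * \<bar>v - 1\<bar> / 2 + \<bar>s\<bar> ^ 3 * G * v / 6 + (s\<^sup>2 / 2)\<^sup>2 / 2) =
    \<bar>t\<bar> * sqrt m * \<bar>\<mu>\<bar> + t\<^sup>2 * \<bar>v - 1\<bar> / 2 + \<bar>t\<bar> ^ 3 * G * v / (6 * sqrt m) + t ^ 4 / (8 * m)"
  proof -
    have a: "m * \<bar>s\<bar> = \<bar>t\<bar> * sqrt m" "m * s\<^sup>2 = t\<^sup>2"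
      using m0 by (simp_all add: s2) (simp add: s_def real_div_sqrt mult.commute[of m] abs_divide
        times_divide_eq_right[symmetric] del: times_divide_eq_right)
    have b: "m * \<bar>s\<bar> ^ 3 = \<bar>t\<bar> ^ 3 / sqrt m"
    proof -
      have "m * \<bar>s\<bar> ^ 3 = m * s\<^sup>2 * \<bar>s\<bar>" by (simp add: eval_nat_numeral)
      also have "\<dots> = \<bar>t\<bar> ^ 3 / sqrt m" unfolding a(2) using m0 by (simp add: s_def eval_nat_numeral)
      finally show ?thesis .
    qed
    have c: "m * (s\<^sup>2)\<^sup>2 = t ^ 4 / m"
      unfolding s2 using m0 by (simp add: power2_eq_square eval_nat_numeral)
    have "m * (\<bar>s\<bar> * \<bar>\<mu>\<bar> + s\<^sup>2 * \<bar>v - 1\<bar> / 2 + \<bar>s\<bar> ^ 3 * G * v / 6 + (s\<^sup>2 / 2)\<^sup>2 / 2) =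
       (m * \<bar>s\<bar>) * \<bar>\<mu>\<bar> + (m * s\<^sup>2) * \<bar>v - 1\<bar> / 2 + (m * \<bar>s\<bar> ^ 3) * G * v / 6 + (m * (s\<^sup>2)\<^sup>2) / 8"
      by (simp add: algebra_simps power_divide)
    then show ?thesis unfolding a b c by (simp add: mult_ac)
  qed
  finally show ?thesis unfolding eq wm using m0 by simp
qed

section \<open>First passage times and the bootstrap central limit theorem\<close>

definition big_length :: "real \<Rightarrow> (nat \<Rightarrow> nat) \<Rightarrow> nat \<Rightarrow> real" where
  "big_length \<theta> l k = (\<Sum>j=1..k. if real (l j) > \<theta> then real (l j) else 0)"

text \<open>The \<open>- 1\<close> matches \<open>boot_num\<close>, which counts the draws before
  the level is passed; for \<open>y \<ge> 0\<close> the index 0 never qualifies, as the empty sum is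
  0. Only values above \<open>\<theta>\<close> enter, so exchanging small values for other small
  ones leaves the index alone.\<close>

definition big_passage :: "real \<Rightarrow> real \<Rightarrow> (nat \<Rightarrow> nat) \<Rightarrow> nat" where
  "big_passage \<theta> y l = (LEAST k. y < big_length \<theta> l k) - 1"

definition passage :: "nat \<Rightarrow> (nat \<Rightarrow> nat) \<Rightarrow> nat" where
  "passage n l = (LEAST k. 1 \<le> k \<and> n < (\<Sum>j=1..k. l j)) - 1"

lemma big_length_Suc:
  "big_length \<theta> l (Suc k) = big_length \<theta> l k + (if real (l (Suc k)) > \<theta> then real (l (Suc k)) else 0)"
  by (simp add: big_length_def)

lemma big_length_mono: "k \<le> k' \<Longrightarrow> big_length \<theta> l k \<le> big_length \<theta> l k'"
  unfolding big_length_def by (rule sum_mono2) auto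

lemma big_length_jump:
  assumes "i \<in> {a<..b}" "\<theta> < real (l i)"
  shows "big_length \<theta> l a + real (l i) \<le> big_length \<theta> l b"
proof -
  have "big_length \<theta> l a + real (l i) \<le> big_length \<theta> l i"
  proof -
    obtain j where "i = Suc j" using assms by (cases i) auto
    then show ?thesis using assms big_length_mono[of a j \<theta> l] by (simp add: big_length_Suc)
  qed
  also have "\<dots> \<le> big_length \<theta> l b" by (rule big_length_mono) (use assms in auto)
  finally show ?thesis .
qed

lemma big_length_le_total: "big_length \<theta> l k \<le> real (\<Sum>j=1..k. l j)"
  unfolding big_length_def of_nat_sum by (rule sum_mono) auto

text \<open>The index set is cut into \<open>W\<close> windows of length \<open>h\<close>, each of which contains a summand exceeding
  \<open>\<eta> n\<close>; two full windows after the big summands have passed \<open>(1 - \<eta>) n\<close>, the level \<open>n\<close> is passed too.\<close>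

lemma passage_close:
  fixes l :: "nat \<Rightarrow> nat" and \<epsilon> \<eta> :: real
  assumes n: "n \<ge> 1" and \<epsilon>: "0 < \<epsilon>" "\<epsilon> \<le> \<eta>" "\<eta> < 1" and h: "h \<ge> 1" and W: "real W * \<eta> \<ge> 1"
    and windows: "\<And>w. w < W \<Longrightarrow> \<exists>i\<in>{w * h<..w * h + h}. real (l i) > \<eta> * n"
    and small: "(\<Sum>j=1..W * h. if real (l j) > \<epsilon> * n then 0 else real (l j)) \<le> \<eta> * n"
  defines "T \<equiv> passage n l" and "m \<equiv> big_passage (\<epsilon> * n) ((1 - \<eta>) * n) l"
  shows "m \<le> T" "T \<le> m + 2 * h" "T < W * h" "real (card {j\<in>{1..T}. real (l j) > \<epsilon> * n}) \<le> 1 / \<epsilon>"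
    "n < (\<Sum>j=1..Suc T. l j)"
proof -
  let ?B = "big_length (\<epsilon> * n) l" and ?L = "\<lambda>k. \<Sum>j=1..k. l j"
  have n0: "real n > 0" using n by simp
  have big: "real (l i) > \<epsilon> * n" if "real (l i) > \<eta> * n" for i
  proof -
    have "\<epsilon> * n \<le> \<eta> * n" using \<epsilon> n0 by simp
    then show ?thesis using that by linarith
  qed
  \<comment> \<open>Each window adds more than \<open>\<eta> * n\<close>. Strictness for
    \<open>w > 0\<close> is carried along because passing \<open>n\<close> is a strict
    inequality.\<close>
  have Bw: "real w * (\<eta> * n) \<le> ?B (w * h) \<and> (w > 0 \<longrightarrow> real w * (\<eta> * n) < ?B (w * h))" if "w \<le> W" for w
    using that
  proof (induction w)
    case 0
    show ?case by (simp add: big_length_def)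
  next
    case (Suc w)
    obtain i where i: "i \<in> {w * h<..w * h + h}" "real (l i) > \<eta> * n" using windows[of w] Suc.prems by auto
    have "?B (w * h) + real (l i) \<le> ?B (w * h + h)" using big_length_jump i(1) big[OF i(2)] by blast
    then show ?case using Suc i by (simp add: algebra_simps)
  qed
  have W0: "W > 0" using W \<epsilon> by (cases W) auto
  have BK: "?B (W * h) > n"
  proof -
    have "n \<le> real W * \<eta> * n" using W n0 by simp
    then show ?thesis using Bw[of W] W0 by (simp add: mult.assoc)
  qed
  \<comment> \<open>Big lengths over \<open>n\<close>, all lengths over \<open>n\<close>, big
    lengths over \<open>(1 - \<eta>) * n\<close>: the claim is the sandwich
    \<open>\<tau>2 \<le> \<tau> \<le> \<tau>1 \<le> \<tau>2 + 2 * h\<close>.\<close>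
  define \<tau>1 where "\<tau>1 = (LEAST k. real n < ?B k)"
  define \<tau> where "\<tau> = (LEAST k. 1 \<le> k \<and> n < ?L k)"
  define \<tau>2 where "\<tau>2 = (LEAST k. (1 - \<eta>) * n < ?B k)"
  have \<tau>1: "real n < ?B \<tau>1" "\<tau>1 \<le> W * h"
    unfolding \<tau>1_def by (rule LeastI[of "\<lambda>k. real n < ?B k", OF BK], rule Least_le[of "\<lambda>k. real n < ?B k", OF BK])
  have \<tau>1_less: "?B k \<le> n" if "k < \<tau>1" for k
    using not_less_Least[of k "\<lambda>k. real n < ?B k"] that unfolding \<tau>1_def by auto
  have \<tau>1_ge: "\<tau>1 \<ge> 1" using \<tau>1 by (cases \<tau>1) (auto simp: big_length_def)
  have L\<tau>1: "n < ?L \<tau>1" using \<tau>1(1) big_length_le_total[of "\<epsilon> * n" l \<tau>1] by linarith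
  have \<tau>_ex: "1 \<le> \<tau>1 \<and> n < ?L \<tau>1" using \<tau>1_ge L\<tau>1 by simp
  have \<tau>: "1 \<le> \<tau>" "n < ?L \<tau>" "\<tau> \<le> \<tau>1"
    unfolding \<tau>_def using LeastI[of "\<lambda>k. 1 \<le> k \<and> n < ?L k", OF \<tau>_ex] Least_le[of "\<lambda>k. 1 \<le> k \<and> n < ?L k", OF \<tau>_ex] by auto
  have "(1 - \<eta>) * n \<le> n" using \<epsilon> n0 by simp
  then have \<tau>2_ex: "(1 - \<eta>) * n < ?B \<tau>1" using \<tau>1(1) by linarith
  have \<tau>2: "(1 - \<eta>) * n < ?B \<tau>2" unfolding \<tau>2_def by (rule LeastI[of "\<lambda>k. (1 - \<eta>) * n < ?B k", OF \<tau>2_ex])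
  have \<tau>2_le: "\<tau>2 \<le> k" if "(1 - \<eta>) * n < ?B k" for k
    unfolding \<tau>2_def by (rule Least_le[of "\<lambda>k. (1 - \<eta>) * n < ?B k", OF that])
  have "\<tau>2 \<noteq> 0"
  proof
    assume "\<tau>2 = 0"
    then have "(1 - \<eta>) * n < 0" using \<tau>2 by (simp add: big_length_def)
    then show False using \<epsilon> n0 by (simp add: mult_less_0_iff)
  qed
  then have \<tau>2_ge: "\<tau>2 \<ge> 1" by simp
  \<comment> \<open>Among the first \<open>\<tau>\<close> draws the small ones total at most
    \<open>\<eta> * n\<close>, so the big ones must account for the rest of the level.\<close>
  have \<tau>2\<tau>: "\<tau>2 \<le> \<tau>"
  proof (rule \<tau>2_le)
    have "real (?L \<tau>) = ?B \<tau> + (\<Sum>j=1..\<tau>. if real (l j) > \<epsilon> * n then 0 else real (l j))"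
      unfolding big_length_def sum.distrib[symmetric] of_nat_sum by (intro sum.cong) auto
    also have "(\<Sum>j=1..\<tau>. if real (l j) > \<epsilon> * n then 0 else real (l j)) \<le>
      (\<Sum>j=1..W * h. if real (l j) > \<epsilon> * n then 0 else real (l j))"
      by (rule sum_mono2) (use \<tau>(3) \<tau>1(2) in auto)
    also note small
    finally have "real (?L \<tau>) \<le> ?B \<tau> + \<eta> * n" by simp
    moreover have "real n < real (?L \<tau>)" using \<tau>(2) by (simp only: of_nat_less_iff)
    ultimately have "real n < ?B \<tau> + \<eta> * n" by linarith
    then show "(1 - \<eta>) * n < ?B \<tau>" by (simp add: algebra_simps)
  qed
  have \<tau>1\<tau>2: "\<tau>1 \<le> \<tau>2 + 2 * h"
  proof (cases "\<tau>2 + 2 * h \<ge> W * h")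
    case True
    then show ?thesis using \<tau>1(2) by simp
  next
    case False
    \<comment> \<open>Division rounding up: the first window lying entirely beyond
      \<open>\<tau>2\<close>. It ends before \<open>\<tau>2 + 2 * h\<close>, and its long block
      lifts the big length from above \<open>(1 - \<eta>) * n\<close> to above
      \<open>n\<close>.\<close>
    define w where "w = (\<tau>2 + h - 1) div h"
    have w1: "w * h \<ge> \<tau>2" and w2: "w * h \<le> \<tau>2 + h - 1"
    proof -
      have "w * h + (\<tau>2 + h - 1) mod h = \<tau>2 + h - 1" unfolding w_def by simp
      moreover have "(\<tau>2 + h - 1) mod h < h" using h by simp
      ultimately show "w * h \<ge> \<tau>2" "w * h \<le> \<tau>2 + h - 1" using h by linarith+
    qed
    have "w * h < W * h" using w2 False h by linarith
    then have "w < W" by simp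
    from windows[OF this] obtain i where i: "i \<in> {w * h<..w * h + h}" "real (l i) > \<eta> * n" by auto
    have "i \<in> {\<tau>2<..\<tau>2 + 2 * h}" using i w1 w2 h by auto
    then have "?B \<tau>2 + real (l i) \<le> ?B (\<tau>2 + 2 * h)"
      using big_length_jump big[OF i(2)] by blast
    then have "real n < ?B (\<tau>2 + 2 * h)" using \<tau>2 i(2) by (simp add: algebra_simps)
    then show ?thesis unfolding \<tau>1_def by (rule Least_le)
  qed
  have m: "m = \<tau>2 - 1" by (simp add: m_def big_passage_def \<tau>2_def)
  have T: "T = \<tau> - 1" by (simp add: T_def passage_def \<tau>_def)
  show "m \<le> T" using \<tau>2\<tau> by (simp add: m T)
  show "T \<le> m + 2 * h" using \<tau>(3) \<tau>1\<tau>2 \<tau>2_ge by (simp add: m T)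
  show "T < W * h" using \<tau>(1,3) \<tau>1(2) by (simp add: T)
  show "n < (\<Sum>j=1..Suc T. l j)" using \<tau>(1,2) by (simp add: T)
  have "T < \<tau>1" using \<tau> by (simp add: T)
  \<comment> \<open>Before \<open>\<tau>1\<close> the big lengths total at most \<open>n\<close>,
    and each of them exceeds \<open>\<epsilon> * n\<close>.\<close>
  let ?C = "{j\<in>{1..T}. real (l j) > \<epsilon> * n}"
  have "real (card ?C) * (\<epsilon> * n) = (\<Sum>j\<in>?C. \<epsilon> * n)" by simp
  also have "\<dots> \<le> (\<Sum>j\<in>?C. real (l j))" by (rule sum_mono) auto
  also have "\<dots> = ?B T" unfolding big_length_def by (rule sum.inter_filter) simp
  also have "\<dots> \<le> n" by (rule \<tau>1_less) fact
  finally have "real (card ?C) * \<epsilon> \<le> 1" using n0 by (simp add: mult.assoc[symmetric])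
  then show "real (card ?C) \<le> 1 / \<epsilon>" using \<epsilon> by (simp add: field_simps)
qed

text \<open>The first hypothesis makes the set of passage indices nonempty; otherwise the
  \<open>LEAST\<close> would be unspecified.\<close>

lemma passage_ge:
  assumes "n < (\<Sum>j=1..Suc T. l j)" "(\<Sum>j=1..k. l j) \<le> n"
  shows "k \<le> passage n l"
proof -
  let ?Q = "\<lambda>k. 1 \<le> k \<and> n < (\<Sum>j=1..k. l j)"
  have Q: "?Q (Least ?Q)" using assms(1) by (intro LeastI[of ?Q "Suc T"]) simp
  have "k < Least ?Q"
  proof (rule ccontr)
    assume "\<not> k < Least ?Q"
    then have "(\<Sum>j=1..Least ?Q. l j) \<le> (\<Sum>j=1..k. l j)" by (intro sum_mono2) auto
    then show False using Q assms(2) by simp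
  qed
  then show ?thesis by (simp add: passage_def)
qed

text \<open>Numerator and normalisation are exchanged one after the other. Passing from
  \<open>S T\<close> to \<open>Z m\<close> under \<open>sqrt T\<close> costs
  \<open>(D + a) / sqrt k\<close>; passing from \<open>sqrt T\<close> to \<open>sqrt m\<close> costs
  the factor \<open>1 - sqrt (m / T)\<close>, which is at most \<open>1 - m / T\<close> because a
  number in the unit interval lies below its square root.\<close>

lemma normalized_sum_close:
  fixes S :: "nat \<Rightarrow> real" and Z :: "nat \<Rightarrow> real"
  assumes T: "m \<le> T" "T \<le> m + h" "k \<le> T" "1 \<le> k" "1 \<le> m"
    and d: "\<bar>S T - Z T\<bar> \<le> D" "\<bar>Z T - Z m\<bar> \<le> a" "\<bar>Z m\<bar> \<le> B * sqrt m"
  shows "\<bar>S T / sqrt T - Z m / sqrt m\<bar> \<le> (D + a) / sqrt k + B * h / k"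
proof -
  have pos: "0 < real k" "0 < real m" "0 < real T" "real k \<le> real T" "real m \<le> real T" using T by auto
  have D: "D + a \<ge> 0" using d by linarith
  have B: "B \<ge> 0" using d(3) pos by (smt (verit) mult_neg_pos real_sqrt_gt_zero)
  have "\<bar>S T / sqrt T - Z m / sqrt T\<bar> = \<bar>S T - Z m\<bar> / sqrt T"
    by (simp add: diff_divide_distrib[symmetric] abs_divide)
  also have "\<dots> \<le> (D + a) / sqrt T" using d pos by (intro divide_right_mono) auto
  also have "\<dots> \<le> (D + a) / sqrt k" using D pos by (intro divide_left_mono) auto
  finally have 1: "\<bar>S T / sqrt T - Z m / sqrt T\<bar> \<le> (D + a) / sqrt k" .
  have q: "m / T \<le> sqrt (m / T)"
    using pos power_decreasing[of 1 2 "m / T"] by (intro real_le_rsqrt) simp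
  have q1: "sqrt (m / T) \<le> 1" using pos by simp
  have "Z m / sqrt T - Z m / sqrt m = - (Z m / sqrt m * (1 - sqrt (m / T)))"
    using pos by (simp add: real_sqrt_divide field_simps)
  then have "\<bar>Z m / sqrt T - Z m / sqrt m\<bar> = \<bar>Z m\<bar> / sqrt m * (1 - sqrt (m / T))"
    using q1 pos by (simp add: abs_mult abs_divide)
  also have "\<dots> \<le> B * (1 - m / T)"
    using d(3) pos q q1 B by (intro mult_mono) (auto simp: field_simps)
  also have "1 - m / T = (real T - real m) / T" using pos by (simp add: diff_divide_distrib)
  also have "\<dots> \<le> h / T" using pos T by (intro divide_right_mono) auto
  also have "h / T \<le> h / k" using pos by (intro divide_left_mono) auto
  finally have 2: "\<bar>Z m / sqrt T - Z m / sqrt m\<bar> \<le> B * (h / k)" using B by (simp add: mult_left_mono)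
  show ?thesis using 1 2 by simp
qed

section \<open>Expectations and tail bounds under finite product laws\<close>

lemma expectation_pair_pmf:
  fixes f :: "'a \<times> 'b \<Rightarrow> 'c :: {banach, second_countable_topology}"
  assumes "finite (set_pmf p)" "finite (set_pmf q)"
  shows "measure_pmf.expectation (pair_pmf p q) f =
    measure_pmf.expectation p (\<lambda>x. measure_pmf.expectation q (\<lambda>y. f (x, y)))"
proof -
  have "pair_pmf p q = p \<bind> (\<lambda>x. map_pmf (Pair x) q)"
    by (simp add: pair_pmf_def map_pmf_def)
  then have "measure_pmf.expectation (pair_pmf p q) f = measure_pmf.expectation (p \<bind> (\<lambda>x. map_pmf (Pair x) q)) f"
    by simp
  also have "\<dots> = (\<Sum>a\<in>set_pmf p. pmf p a *\<^sub>R measure_pmf.expectation (map_pmf (Pair a) q) f)"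
    by (rule pmf_expectation_bind) (use assms in auto)
  also have "\<dots> = measure_pmf.expectation p (\<lambda>x. measure_pmf.expectation q (\<lambda>y. f (x, y)))"
    using assms by (subst integral_measure_pmf[of "set_pmf p"]) auto
  finally show ?thesis .
qed

lemma prob_pair_pmf:
  "measure_pmf.prob (pair_pmf p q) A = measure_pmf.expectation p (\<lambda>x. measure_pmf.prob q {y. (x, y) \<in> A})"
proof -
  have "pair_pmf p q = p \<bind> (\<lambda>x. map_pmf (Pair x) q)"
    by (simp add: pair_pmf_def map_pmf_def)
  then show ?thesis by (simp add: measure_bind_pmf vimage_def)
qed

text \<open>Freezing the first vector turns every index computed from it into a constant. A maximal
  inequality that is uniform in a fixed index thus carries over to the random one.\<close>

lemma prob_pair_pmf_le:
  assumes "\<And>x. x \<in> set_pmf p \<Longrightarrow> measure_pmf.prob q {y. (x, y) \<in> A} \<le> c"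
  shows "measure_pmf.prob (pair_pmf p q) A \<le> c"
proof -
  have "measure_pmf.prob (pair_pmf p q) A = measure_pmf.expectation p (\<lambda>x. measure_pmf.prob q {y. (x, y) \<in> A})"
    by (rule prob_pair_pmf)
  also have "\<dots> \<le> measure_pmf.expectation p (\<lambda>x. c)"
  proof (intro integral_mono_AE AE_pmfI)
    show "integrable (measure_pmf p) (\<lambda>x. measure_pmf.prob q {y. (x, y) \<in> A})"
      by (rule measure_pmf.integrable_const_bound[where B = 1]) auto
  qed (use assms in auto)
  finally show ?thesis by simp
qed

lemma finite_set_Pi_pmf:
  "finite I \<Longrightarrow> finite (set_pmf q) \<Longrightarrow> finite (set_pmf (Pi_pmf I d (\<lambda>_. q)))"
  by (simp add: set_Pi_pmf finite_PiE_dflt)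

lemma expectation_sum_Pi_pmf_subset:
  fixes \<phi> :: "'b \<Rightarrow> real"
  assumes "finite I" "finite (set_pmf q)" "J \<subseteq> I"
  shows "measure_pmf.expectation (Pi_pmf I d (\<lambda>_. q)) (\<lambda>c. \<Sum>j\<in>J. \<phi> (c j)) =
    real (card J) * measure_pmf.expectation q \<phi>"
proof -
  have "measure_pmf.expectation (Pi_pmf I d (\<lambda>_. q)) (\<lambda>c. \<phi> (c j)) = measure_pmf.expectation q \<phi>"
    if "j \<in> J" for j
  proof -
    have "measure_pmf.expectation (map_pmf (\<lambda>c. c j) (Pi_pmf I d (\<lambda>_. q))) \<phi> = measure_pmf.expectation q \<phi>"
      using that assms by (subst Pi_pmf_component) auto
    then show ?thesis by simp
  qed
  then show ?thesis
    by (subst Bochner_Integration.integral_sum)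
      (auto intro!: integrable_measure_pmf_finite finite_set_Pi_pmf assms)
qed

lemma prob_sum_Pi_pmf_le:
  fixes \<phi> :: "'b \<Rightarrow> real"
  assumes "finite I" "finite (set_pmf q)" "J \<subseteq> I" and \<phi>: "\<And>y. \<phi> y \<ge> 0"
    and le: "measure_pmf.expectation q \<phi> \<le> e" and a: "a > 0"
  shows "measure_pmf.prob (Pi_pmf I d (\<lambda>_. q)) {c. a < (\<Sum>j\<in>J. \<phi> (c j))} \<le> real (card J) * e / a"
proof -
  let ?P = "Pi_pmf I d (\<lambda>_. q)"
  have "measure_pmf.prob ?P {c. a < (\<Sum>j\<in>J. \<phi> (c j))} \<le> measure_pmf.prob ?P {c. a \<le> (\<Sum>j\<in>J. \<phi> (c j))}"
    by (intro measure_pmf.finite_measure_mono) auto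
  also have "\<dots> \<le> measure_pmf.expectation ?P (\<lambda>c. \<Sum>j\<in>J. \<phi> (c j)) / a"
    using integral_Markov_inequality_measure[where M = "measure_pmf ?P" and A = "{}" and u = "\<lambda>c. \<Sum>j\<in>J. \<phi> (c j)" and c = a] a \<phi>
    by (simp add: integrable_measure_pmf_finite[OF finite_set_Pi_pmf[OF assms(1,2)]] sum_nonneg)
  also have "\<dots> = real (card J) * measure_pmf.expectation q \<phi> / a"
    by (simp add: expectation_sum_Pi_pmf_subset[OF assms(1-3)])
  also have "\<dots> \<le> real (card J) * e / a"
    using le a by (intro divide_right_mono mult_left_mono) auto
  finally show ?thesis .
qed

lemma prob_none_Pi_pmf:
  assumes "finite I" "J \<subseteq> I"
  shows "measure_pmf.prob (Pi_pmf I d (\<lambda>_. q)) {c. \<forall>i\<in>J. c i \<notin> A} = (1 - measure_pmf.prob q A) ^ card J"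
proof -
  have "{c. \<forall>i\<in>J. c i \<notin> A} = Pi I (\<lambda>i. if i \<in> J then - A else UNIV)"
    using assms by (auto simp: Pi_def)
  then have "measure_pmf.prob (Pi_pmf I d (\<lambda>_. q)) {c. \<forall>i\<in>J. c i \<notin> A} =
    (\<Prod>i\<in>I. measure_pmf.prob q (if i \<in> J then - A else UNIV))"
    by (simp add: measure_Pi_pmf_Pi[OF assms(1)])
  also have "\<dots> = (\<Prod>i\<in>I. if i \<in> J then 1 - measure_pmf.prob q A else 1)"
    using measure_pmf.prob_compl[of A q] by (intro prod.cong refl) (simp add: Compl_eq_Diff_UNIV)
  also have "\<dots> = (\<Prod>i\<in>J. 1 - measure_pmf.prob q A)"
    using assms by (subst prod.inter_restrict[symmetric]) (simp_all add: Int_absorb1)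
  finally show ?thesis by simp
qed

text \<open>The drift over \<open>h\<close> steps uses up at most \<open>a / 2\<close>, and the
  centred sum has to produce the other half; hence the factor 4. The drift is there because
  conditioning on the small blocks destroys the exact centring.\<close>

lemma Pi_pmf_kolmogorov_drift:
  fixes g :: "'b \<Rightarrow> real"
  assumes fin: "finite (set_pmf q)" and drift: "real h * \<bar>measure_pmf.expectation q g\<bar> \<le> a / 2"
    and var: "measure_pmf.expectation q (\<lambda>y. (g y)\<^sup>2) \<le> v" and a: "a > 0"
    and I: "finite I" "{m<..m + h} \<subseteq> I"
  shows "measure_pmf.prob (Pi_pmf I d (\<lambda>_. q)) {u. \<exists>k\<in>{m..m + h}. \<bar>\<Sum>i\<in>{m<..k}. g (u i)\<bar> \<ge> a}
    \<le> 4 * real h * v / a\<^sup>2"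
proof -
  define \<mu> where "\<mu> = measure_pmf.expectation q g"
  note int = integrable_measure_pmf_finite[OF fin]
  have v: "measure_pmf.expectation q (\<lambda>y. (g y - \<mu>)\<^sup>2) \<le> v"
  proof -
    have "measure_pmf.expectation q (\<lambda>y. (g y - \<mu>)\<^sup>2) = measure_pmf.expectation q (\<lambda>y. (g y)\<^sup>2) - \<mu>\<^sup>2"
      unfolding \<mu>_def by (rule measure_pmf.variance_eq[OF int int])
    then show ?thesis using var by (smt (verit) zero_le_power2)
  qed
  let ?drift = "{u. \<exists>k\<in>{m..m + h}. \<bar>\<Sum>i\<in>{m<..k}. g (u i)\<bar> \<ge> a}"
  let ?centred = "{u. \<exists>k\<in>{m..m + h}. \<bar>0 + (\<Sum>i\<in>{m<..k}. (g (u i) - \<mu>))\<bar> \<ge> a / 2}"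
  have "?drift \<subseteq> ?centred"
  proof clarify
    fix u k assume k: "k \<in> {m..m + h}" "a \<le> \<bar>\<Sum>i\<in>{m<..k}. g (u i)\<bar>"
    have "(\<Sum>i\<in>{m<..k}. (g (u i) - \<mu>)) = (\<Sum>i\<in>{m<..k}. g (u i)) - real (k - m) * \<mu>"
      by (simp add: sum_subtractf)
    moreover have "\<bar>real (k - m) * \<mu>\<bar> \<le> a / 2"
    proof -
      have "\<bar>real (k - m) * \<mu>\<bar> \<le> real h * \<bar>\<mu>\<bar>"
        using k by (simp add: abs_mult mult_right_mono)
      then show ?thesis using drift by (simp add: \<mu>_def)
    qed
    ultimately have "a / 2 \<le> \<bar>0 + (\<Sum>i\<in>{m<..k}. (g (u i) - \<mu>))\<bar>" using k(2) by linarith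
    then show "\<exists>k\<in>{m..m + h}. a / 2 \<le> \<bar>0 + (\<Sum>i\<in>{m<..k}. (g (u i) - \<mu>))\<bar>" using k(1) by blast
  qed
  then have "measure_pmf.prob (Pi_pmf I d (\<lambda>_. q)) ?drift \<le> measure_pmf.prob (Pi_pmf I d (\<lambda>_. q)) ?centred"
    by (rule measure_pmf.finite_measure_mono) simp
  also have "\<dots> \<le> (0\<^sup>2 + real h * measure_pmf.expectation q (\<lambda>y. (g y - \<mu>)\<^sup>2)) / (a / 2)\<^sup>2"
    by (rule Pi_pmf_kolmogorov[OF fin _ refl])
      (use a I in \<open>auto simp: \<mu>_def Bochner_Integration.integral_diff[OF int int]\<close>)
  also have "\<dots> \<le> (0\<^sup>2 + real h * v) / (a / 2)\<^sup>2"
    by (intro divide_right_mono add_mono mult_left_mono v) auto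
  finally show ?thesis by (simp add: power_divide mult_ac)
qed

text \<open>Conditioning removes mass at most \<open>b\<close>, on which \<open>g\<close> is bounded
  by \<open>G\<close>, and divides by a probability of at least 1/2, whence the factors 2. In the
  application \<open>b\<close> is of order \<open>1 / N\<close> and \<open>G\<close> is a small
  multiple of \<open>sqrt N\<close>, so the new mean stays harmless even when about \<open>N\<close>
  terms are summed and divided by \<open>sqrt N\<close>.\<close>

lemma cond_pmf_moments:
  fixes g :: "'b \<Rightarrow> real"
  assumes fin: "finite (set_pmf p)" and G: "\<And>y. y \<in> set_pmf p \<Longrightarrow> \<bar>g y\<bar> \<le> G"
    and mean: "measure_pmf.expectation p g = 0" and var: "measure_pmf.expectation p (\<lambda>y. (g y)\<^sup>2) = 1"
    and b: "measure_pmf.prob p (- S) \<le> b" "b \<le> 1 / 2"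
  defines "q \<equiv> cond_pmf p S"
  shows "set_pmf p \<inter> S \<noteq> {}" "\<bar>measure_pmf.expectation q g\<bar> \<le> 2 * G * b"
    "\<bar>measure_pmf.expectation q (\<lambda>y. (g y)\<^sup>2) - 1\<bar> \<le> 2 * (1 + G\<^sup>2) * b"
    "measure_pmf.expectation q (\<lambda>y. (g y)\<^sup>2) \<le> 2"
proof -
  note int = integrable_measure_pmf_finite[OF fin]
  have PS: "measure_pmf.prob p S = 1 - measure_pmf.prob p (- S)"
    using measure_pmf.prob_compl[of S p] by (simp add: Compl_eq_Diff_UNIV)
  then have half: "measure_pmf.prob p S \<ge> 1 / 2" using b by simp
  show ne: "set_pmf p \<inter> S \<noteq> {}"
    using half measure_pmf_zero_iff[of p S] by auto
  have Eq: "measure_pmf.expectation q \<phi> = measure_pmf.expectation p (\<lambda>y. indicator S y * \<phi> y) / measure_pmf.prob p S"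
    for \<phi> :: "'b \<Rightarrow> real"
  proof -
    have "measure_pmf.expectation q \<phi> = (\<Sum>y\<in>set_pmf p. pmf q y * \<phi> y)"
      using fin by (subst integral_measure_pmf[of "set_pmf p"]) (auto simp: q_def set_cond_pmf[OF ne])
    also have "\<dots> = (\<Sum>y\<in>set_pmf p. pmf p y * (indicator S y * \<phi> y)) / measure_pmf.prob p S"
      unfolding sum_divide_distrib by (intro sum.cong) (auto simp: q_def pmf_cond[OF ne] indicator_def)
    also have "(\<Sum>y\<in>set_pmf p. pmf p y * (indicator S y * \<phi> y)) = measure_pmf.expectation p (\<lambda>y. indicator S y * \<phi> y)"
      using fin by (subst integral_measure_pmf[of "set_pmf p"]) auto
    finally show ?thesis .
  qed
  have split: "measure_pmf.expectation p (\<lambda>y. indicator S y * \<phi> y) =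
    measure_pmf.expectation p \<phi> - measure_pmf.expectation p (\<lambda>y. indicator (- S) y * \<phi> y)" for \<phi> :: "'b \<Rightarrow> real"
    by (subst Bochner_Integration.integral_diff[symmetric]) (auto intro!: int Bochner_Integration.integral_cong simp: indicator_def)
  have bnd: "\<bar>measure_pmf.expectation p (\<lambda>y. indicator (- S) y * \<phi> y)\<bar> \<le> C * measure_pmf.prob p (- S)"
    if "\<And>y. y \<in> set_pmf p \<Longrightarrow> \<bar>\<phi> y\<bar> \<le> C" for \<phi> :: "'b \<Rightarrow> real" and C
  proof -
    have "\<bar>measure_pmf.expectation p (\<lambda>y. indicator (- S) y * \<phi> y)\<bar> \<le> measure_pmf.expectation p (\<lambda>y. \<bar>indicator (- S) y * \<phi> y\<bar>)"
      by (rule integral_abs_bound)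
    also have "\<dots> \<le> measure_pmf.expectation p (\<lambda>y. C * indicator (- S) y)"
      by (intro integral_mono_AE int AE_pmfI) (auto simp: abs_mult indicator_def that)
    finally show ?thesis by simp
  qed
  have P0: "measure_pmf.prob p S > 0" using half by simp
  have dbl: "x / measure_pmf.prob p S \<le> 2 * x" if "x \<ge> 0" for x
  proof -
    have "x / measure_pmf.prob p S \<le> x / (1 / 2)" by (rule divide_left_mono) (use half that in auto)
    then show ?thesis by simp
  qed
  have G0: "G \<ge> 0" using ne G by force
  have g2: "\<bar>(g y)\<^sup>2\<bar> \<le> G\<^sup>2" if "y \<in> set_pmf p" for y
    using G[OF that] by (simp add: abs_le_square_iff[symmetric] G0)
  have "\<bar>measure_pmf.expectation q g\<bar> \<le> (G * measure_pmf.prob p (- S)) / measure_pmf.prob p S"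
    unfolding Eq split mean using bnd[of g G] G P0 by (simp add: abs_divide divide_right_mono)
  also have "\<dots> \<le> 2 * (G * measure_pmf.prob p (- S))" by (rule dbl) (use G0 in auto)
  also have "\<dots> \<le> 2 * (G * b)" using b G0 by (intro mult_left_mono) auto
  finally show "\<bar>measure_pmf.expectation q g\<bar> \<le> 2 * G * b" by simp
  have "measure_pmf.expectation q (\<lambda>y. (g y)\<^sup>2) \<le> 1 / measure_pmf.prob p S"
  proof -
    have "measure_pmf.expectation p (\<lambda>y. indicator S y * (g y)\<^sup>2) \<le> measure_pmf.expectation p (\<lambda>y. (g y)\<^sup>2)"
      by (intro integral_mono int) (auto simp: indicator_def)
    then show ?thesis
      unfolding Eq var using P0 by (intro divide_right_mono) auto
  qed
  also have "\<dots> \<le> 2" using dbl[of 1] by simp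
  finally show "measure_pmf.expectation q (\<lambda>y. (g y)\<^sup>2) \<le> 2" .
  have "measure_pmf.expectation q (\<lambda>y. (g y)\<^sup>2) - 1 =
      (measure_pmf.prob p (- S) - measure_pmf.expectation p (\<lambda>y. indicator (- S) y * (g y)\<^sup>2)) / measure_pmf.prob p S"
    unfolding Eq split var using P0 PS by (simp add: field_simps)
  then have "\<bar>measure_pmf.expectation q (\<lambda>y. (g y)\<^sup>2) - 1\<bar> =
      \<bar>measure_pmf.prob p (- S) - measure_pmf.expectation p (\<lambda>y. indicator (- S) y * (g y)\<^sup>2)\<bar> / measure_pmf.prob p S"
    by (simp add: abs_divide)
  also have "\<dots> \<le> ((1 + G\<^sup>2) * measure_pmf.prob p (- S)) / measure_pmf.prob p S"
  proof (intro divide_right_mono)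
    have "\<bar>measure_pmf.expectation p (\<lambda>y. indicator (- S) y * (g y)\<^sup>2)\<bar> \<le> G\<^sup>2 * measure_pmf.prob p (- S)"
      by (rule bnd) (rule g2)
    then show "\<bar>measure_pmf.prob p (- S) - measure_pmf.expectation p (\<lambda>y. indicator (- S) y * (g y)\<^sup>2)\<bar>
        \<le> (1 + G\<^sup>2) * measure_pmf.prob p (- S)"
      using measure_nonneg[of p "- S"] unfolding distrib_right by linarith
  qed (use P0 in auto)
  also have "\<dots> \<le> 2 * ((1 + G\<^sup>2) * measure_pmf.prob p (- S))" by (rule dbl) auto
  also have "\<dots> \<le> 2 * ((1 + G\<^sup>2) * b)" using b by (intro mult_left_mono) auto
  finally show "\<bar>measure_pmf.expectation q (\<lambda>y. (g y)\<^sup>2) - 1\<bar> \<le> 2 * (1 + G\<^sup>2) * b" by (simp only: mult.assoc)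
qed

lemma cmod_iexp_diff_le: "cmod (iexp x - iexp y) \<le> \<bar>x - y\<bar>"
proof -
  have "iexp x - iexp y = iexp y * (iexp (x - y) - 1)"
    by (simp add: algebra_simps exp_diff)
  then have "cmod (iexp x - iexp y) = cmod (iexp (x - y) - 1)" by (simp add: norm_mult)
  also have "\<dots> \<le> \<bar>x - y\<bar>" using iexp_approx1[of "x - y" 0] by simp
  finally show ?thesis .
qed

text \<open>\<open>p\<close> stands for the empirical block law of \<open>N\<close> blocks,
  \<open>g\<close> for the standardised block sum. The bound has three groups. The first is twice
  the probability of five bad events: a window without a long block, too much small length, passage
  before \<open>k0\<close>, a large oscillation over \<open>2 * h\<close> indices, a large partial
  sum up to \<open>m\<close>. The second bounds the distance, off these events, between the
  statistic and a sum with an independent number of terms. The third is the error of the central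
  limit theorem for that sum. The index set exceeds \<open>W * h\<close> by \<open>2 * h\<close>
  because the oscillation is controlled that far beyond \<open>m\<close>.\<close>

lemma bootstrap_char_bound:
  fixes p :: "'b pmf" and len :: "'b \<Rightarrow> nat" and g :: "'b \<Rightarrow> real"
    and N n h W k0 :: nat and A r \<epsilon> \<eta> a B G t :: real
  assumes fin: "finite (set_pmf p)" and N: "N \<ge> 1" and n: "n \<ge> 1"
    and mean: "measure_pmf.expectation p g = 0" and var: "measure_pmf.expectation p (\<lambda>y. (g y)\<^sup>2) = 1"
    and G: "\<And>y. y \<in> set_pmf p \<Longrightarrow> \<bar>g y\<bar> \<le> G"
    and Elen: "measure_pmf.expectation p (\<lambda>y. real (len y)) \<le> n / N"
    and big: "A / N \<le> measure_pmf.prob p {y. real (len y) > \<eta> * n}"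
    and small: "measure_pmf.expectation p (\<lambda>y. if real (len y) > \<epsilon> * n then 0 else real (len y)) \<le> r * n / N"
    and \<epsilon>: "0 < \<epsilon>" "\<epsilon> \<le> \<eta>" "\<eta> < 1" "\<epsilon> * N \<ge> 2" and h: "h \<ge> 1" and W: "real W * \<eta> \<ge> 1"
    and k0: "2 * h + 1 \<le> k0" "k0 \<le> W * h"
    and a: "a > 0" "8 * h * G \<le> a * \<epsilon> * N" and B: "B > 0" "4 * sqrt (W * h) * G \<le> B * \<epsilon> * N"
    and I: "finite I" "{1..W * h + 2 * h} \<subseteq> I"
  defines "T \<equiv> \<lambda>c. passage n (\<lambda>j. len (c j))"
  defines "Y \<equiv> \<lambda>c. (\<Sum>j=1..T c. g (c j)) / sqrt (T c)"
  shows "cmod (measure_pmf.expectation (Pi_pmf I d (\<lambda>_. p)) (\<lambda>c. iexp (t * Y c)) - exp (- (t\<^sup>2 / 2)))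
    \<le> 2 * (W * exp (- (A * h / N)) + W * h * r / (N * \<eta>) + k0 / N + 16 * h / a\<^sup>2 + 8 / B\<^sup>2)
      + \<bar>t\<bar> * ((2 * G / \<epsilon> + a) / sqrt k0 + B * (2 * h) / k0)
      + (\<bar>t\<bar> * sqrt (W * h) * (2 * G / (\<epsilon> * N)) + t\<^sup>2 * (1 + G\<^sup>2) / (\<epsilon> * N)
         + \<bar>t\<bar> ^ 3 * G / (3 * sqrt (k0 - 2 * h)) + t ^ 4 / (8 * (k0 - 2 * h)))"
proof -
  define K where "K = W * h"
  define k1 where "k1 = k0 - 2 * h"
  have k1: "k1 \<ge> 1" "k1 \<le> K" "k0 = k1 + 2 * h" using k0 by (auto simp: k1_def K_def)
  note int = integrable_measure_pmf_finite
  have n0: "real n > 0" "real N > 0" using n N by auto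
  define S where "S = {y. \<not> real (len y) > \<epsilon> * n}"
  \<comment> \<open>Markov's inequality: the mean length is at most \<open>n / N\<close> and a big
    draw exceeds \<open>\<epsilon> * n\<close>.\<close>
  define b where "b = 1 / (\<epsilon> * N)"
  have bpos: "b > 0" and b2: "b \<le> 1 / 2" using \<epsilon> n0 by (auto simp: b_def field_simps)
  have PS: "measure_pmf.prob p (- S) \<le> b"
  proof -
    have "measure_pmf.prob p (- S) \<le> measure_pmf.prob p {y. real (len y) \<ge> \<epsilon> * n}"
      by (intro measure_pmf.finite_measure_mono) (auto simp: S_def)
    also have "\<dots> \<le> measure_pmf.expectation p (\<lambda>y. real (len y)) / (\<epsilon> * n)"
      using integral_Markov_inequality_measure[where M = "measure_pmf p" and A = "{}" and u = "\<lambda>y. real (len y)" and c = "\<epsilon> * n"]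
        \<epsilon> n0 by (simp add: int[OF fin])
    also have "\<dots> \<le> (n / N) / (\<epsilon> * n)" using Elen \<epsilon> n0 by (intro divide_right_mono) auto
    also have "\<dots> = b" using n0 by (simp add: b_def field_simps)
    finally show ?thesis .
  qed
  define q where "q = cond_pmf p S"
  note mom = cond_pmf_moments[OF fin G mean var PS b2, folded q_def]
  have finq: "finite (set_pmf q)" using fin by (simp add: q_def set_cond_pmf[OF mom(1)])
  have qS: "y \<in> S" "y \<in> set_pmf p" if "y \<in> set_pmf q" for y using that by (auto simp: q_def set_cond_pmf[OF mom(1)])
  have G0: "G \<ge> 0" using mom(1) G by force
  let ?Pp = "Pi_pmf I d (\<lambda>_. p)" and ?Pq = "Pi_pmf I d (\<lambda>_. q)"
  let ?Q = "pair_pmf ?Pp ?Pq"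
  note finPp = finite_set_Pi_pmf[OF I(1) fin, of d] and finPq = finite_set_Pi_pmf[OF I(1) finq, of d]
  have finQ: "finite (set_pmf ?Q)" using finPp finPq by simp
  \<comment> \<open>The resampled blocks: big draws are kept, small ones are redrawn independently.\<close>
  define c where "c = (\<lambda>bu i. if i \<in> I then (if fst bu i \<in> S then snd bu i else fst bu i) else d)"
  have map_c: "map_pmf c ?Q = ?Pp"
  proof -
    have r: "bind_pmf p (\<lambda>x. map_pmf (\<lambda>u. if x \<in> S then u else x) q) = p"
      unfolding q_def by (rule bind_pmf_resample_cond_pmf[OF mom(1)])
    have "?Pp = Pi_pmf I d (\<lambda>_. bind_pmf p (\<lambda>x. map_pmf (\<lambda>u. if x \<in> S then u else x) q))"
      unfolding r ..
    also have "\<dots> = map_pmf (\<lambda>(b, u) i. if i \<in> I then (if b i \<in> S then u i else b i) else d) ?Q"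
      by (rule Pi_pmf_bind_map[OF I(1)])
    also have "(\<lambda>(b, u) i. if i \<in> I then (if b i \<in> S then u i else b i) else d) = c"
      by (auto simp: c_def fun_eq_iff)
    finally show ?thesis by simp
  qed
  have prob_c: "measure_pmf.prob ?Q {z. R (c z)} = measure_pmf.prob ?Pp {x. R x}" for R
    by (subst map_c[symmetric]) (simp add: vimage_def del: map_c)
  \<comment> \<open>Clipping to \<open>[k1, K]\<close> keeps the normalisation bounded everywhere; off the bad events it has no effect.\<close>
  define m where "m = (\<lambda>x. max k1 (min K (big_passage (\<epsilon> * n) ((1 - \<eta>) * n) (\<lambda>j. len (x j)))))"
  have m_bounds: "k1 \<le> m x" "m x \<le> K" for x using k1 by (auto simp: m_def)
  define Z where "Z = (\<lambda>u (k :: nat). \<Sum>j=1..k. g (u j))"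
  define V where "V = (\<lambda>z :: (nat \<Rightarrow> 'b) \<times> (nat \<Rightarrow> 'b). Z (snd z) (m (fst z)) / sqrt (m (fst z)))"
  define D where "D = (2 * G / \<epsilon> + a) / sqrt k0 + B * (2 * h) / k0"
  have D0: "D \<ge> 0" using G0 \<epsilon> a B by (simp add: D_def)
  \<comment> \<open>The first three events concern the resampled blocks \<open>c z\<close>, whose
    law is the product of \<open>p\<close>. The last two concern the fresh draws
    \<open>snd z\<close> at an index computed from \<open>fst z\<close>, so the maximal inequality
    applies to them with the index frozen.\<close>
  define bad1 where "bad1 = {z. \<exists>w<W. \<forall>i\<in>{w * h<..w * h + h}. c z i \<notin> {y. real (len y) > \<eta> * n}}"
  define bad2 where "bad2 = {z. \<eta> * n < (\<Sum>j\<in>{1..K}. if real (len (c z j)) > \<epsilon> * n then 0 else real (len (c z j)))}"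
  define bad3 where "bad3 = {z. n < (\<Sum>j\<in>{1..k0}. real (len (c z j)))}"
  define bad4 where "bad4 = {z. \<exists>k\<in>{m (fst z)..m (fst z) + 2 * h}. \<bar>\<Sum>i\<in>{m (fst z)<..k}. g (snd z i)\<bar> \<ge> a}"
  define bad5 where "bad5 = {z :: (nat \<Rightarrow> 'b) \<times> (nat \<Rightarrow> 'b). \<exists>k\<in>{0..0 + m (fst z)}. \<bar>\<Sum>i\<in>{0<..k}. g (snd z i)\<bar> \<ge> B * sqrt (m (fst z))}"
  define bad where "bad = bad1 \<union> bad2 \<union> bad3 \<union> bad4 \<union> bad5"
  let ?pr = "measure_pmf.prob ?Q"
  have K_I: "{1..K} \<subseteq> I" "{1..k0} \<subseteq> I" using I k0 by (auto simp: K_def)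
  have p1: "?pr bad1 \<le> W * exp (- (A * h / N))"
  proof -
    have "bad1 = (\<Union>w\<in>{..<W}. {z. \<forall>i\<in>{w * h<..w * h + h}. c z i \<notin> {y. real (len y) > \<eta> * n}})"
      by (auto simp: bad1_def)
    then have "?pr bad1 \<le> (\<Sum>w<W. ?pr {z. \<forall>i\<in>{w * h<..w * h + h}. c z i \<notin> {y. real (len y) > \<eta> * n}})"
      by (simp add: measure_pmf.finite_measure_subadditive_finite)
    also have "\<dots> \<le> (\<Sum>w<W. exp (- (A * h / N)))"
    proof (rule sum_mono)
      fix w assume w: "w \<in> {..<W}"
      have "w * h + h = (w + 1) * h" by simp
      also have "\<dots> \<le> W * h" using w by (intro mult_right_mono) auto
      finally have J: "{w * h<..w * h + h} \<subseteq> I" using I by auto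
      let ?\<pi> = "measure_pmf.prob p {y. real (len y) > \<eta> * n}"
      have "?pr {z. \<forall>i\<in>{w * h<..w * h + h}. c z i \<notin> {y. real (len y) > \<eta> * n}} = (1 - ?\<pi>) ^ h"
        by (subst prob_c, subst prob_none_Pi_pmf[OF I(1) J]) simp
      also have "\<dots> \<le> exp (- ?\<pi>) ^ h"
        using exp_ge_add_one_self[of "- ?\<pi>"] by (intro power_mono) auto
      also have "\<dots> = exp (- (real h * ?\<pi>))" by (simp add: exp_of_nat_mult[symmetric])
      also have "\<dots> \<le> exp (- (A * h / N))"
        using mult_left_mono[OF big, of "real h"] by (simp add: mult.commute)
      finally show "?pr {z. \<forall>i\<in>{w * h<..w * h + h}. c z i \<notin> {y. real (len y) > \<eta> * n}} \<le> exp (- (A * h / N))" .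
    qed
    finally show ?thesis by simp
  qed
  have p2: "?pr bad2 \<le> W * h * r / (N * \<eta>)"
  proof -
    have "?pr bad2 \<le> real (card {1..K}) * (r * n / N) / (\<eta> * n)"
      unfolding bad2_def
      by (subst prob_c, rule prob_sum_Pi_pmf_le[OF I(1) fin K_I(1) _ small]) (use \<epsilon> n0 in auto)
    also have "\<dots> = W * h * r / (N * \<eta>)" using n0 by (simp add: K_def)
    finally show ?thesis .
  qed
  have p3: "?pr bad3 \<le> k0 / N"
  proof -
    have "?pr bad3 \<le> real (card {1..k0}) * (n / N) / n"
      unfolding bad3_def
      by (subst prob_c, rule prob_sum_Pi_pmf_le[OF I(1) fin K_I(2) _ Elen]) (use n0 in auto)
    also have "\<dots> = k0 / N" using n0 by simp
    finally show ?thesis .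
  qed
  have \<mu>: "\<bar>measure_pmf.expectation q g\<bar> \<le> 2 * G / (\<epsilon> * N)" using mom(2) by (simp add: b_def)
  have p4: "?pr bad4 \<le> 16 * h / a\<^sup>2"
  proof (rule prob_pair_pmf_le)
    fix x assume "x \<in> set_pmf ?Pp"
    \<comment> \<open>The second condition in \<open>a\<close> is tailored to this drift bound. Over
      a stretch of \<open>2 * h\<close> indices with second moment at most 2, the maximal inequality
      then gives the numerator \<open>4 * (2 * h) * 2 = 16 * h\<close>.\<close>
    have "real (2 * h) * \<bar>measure_pmf.expectation q g\<bar> \<le> real (2 * h) * (2 * G / (\<epsilon> * N))"
      using \<mu> by (rule mult_left_mono) simp
    also have "\<dots> \<le> a / 2" using a(2) \<epsilon>(1) n0 by (simp add: field_simps)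
    finally have "measure_pmf.prob ?Pq {u. \<exists>k\<in>{m x..m x + 2 * h}. \<bar>\<Sum>i\<in>{m x<..k}. g (u i)\<bar> \<ge> a} \<le> 4 * real (2 * h) * 2 / a\<^sup>2"
      using m_bounds[of x] I
      by (intro Pi_pmf_kolmogorov_drift[OF finq _ mom(4) a(1) I(1)]) (auto simp: K_def)
    then show "measure_pmf.prob ?Pq {u. (x, u) \<in> bad4} \<le> 16 * h / a\<^sup>2"
      by (simp add: bad4_def)
  qed
  have p5: "?pr bad5 \<le> 8 / B\<^sup>2"
  proof (rule prob_pair_pmf_le)
    fix x assume "x \<in> set_pmf ?Pp"
    have mx: "real (m x) > 0" using m_bounds(1)[of x] k1 by simp
    have "real (m x) * \<bar>measure_pmf.expectation q g\<bar> \<le> real (m x) * (2 * G / (\<epsilon> * N))"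
      using \<mu> by (rule mult_left_mono) simp
    also have "\<dots> = sqrt (m x) * (sqrt (m x) * (2 * G / (\<epsilon> * N)))" by simp
    also have "\<dots> \<le> sqrt (m x) * (sqrt (W * h) * (2 * G / (\<epsilon> * N)))"
      using m_bounds(2)[of x] G0 \<epsilon> n0 by (intro mult_left_mono mult_right_mono real_sqrt_le_mono) (auto simp: K_def simp flip: of_nat_mult)
    also have "\<dots> \<le> sqrt (m x) * (B / 2)"
      using B(2) \<epsilon>(1) n0 by (intro mult_left_mono) (auto simp: field_simps)
    finally have "measure_pmf.prob ?Pq {u. \<exists>k\<in>{0..0 + m x}. \<bar>\<Sum>i\<in>{0<..k}. g (u i)\<bar> \<ge> B * sqrt (m x)} \<le> 4 * real (m x) * 2 / (B * sqrt (m x))\<^sup>2"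
      using m_bounds[of x] I B mx
      by (intro Pi_pmf_kolmogorov_drift[OF finq _ mom(4) _ I(1)]) (auto simp: K_def mult.commute[of B])
    also have "\<dots> = 8 / B\<^sup>2" using mx B(1) by (simp add: power_mult_distrib)
    finally show "measure_pmf.prob ?Pq {u. (x, u) \<in> bad5} \<le> 8 / B\<^sup>2"
      by (simp add: bad5_def)
  qed
  have pbad: "?pr bad \<le> W * exp (- (A * h / N)) + W * h * r / (N * \<eta>) + k0 / N + 16 * h / a\<^sup>2 + 8 / B\<^sup>2"
    unfolding bad_def
    using measure_Un_le[of bad1 ?Q bad2] measure_Un_le[of "bad1 \<union> bad2" ?Q bad3]
      measure_Un_le[of "bad1 \<union> bad2 \<union> bad3" ?Q bad4]
      measure_Un_le[of "bad1 \<union> bad2 \<union> bad3 \<union> bad4" ?Q bad5] p1 p2 p3 p4 p5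
    by simp
  have close: "\<bar>Y (c z) - V z\<bar> \<le> D" if z: "z \<in> set_pmf ?Q" "z \<notin> bad" for z
  proof -
    obtain x u where xu: "z = (x, u)" by (cases z)
    have x: "x i \<in> set_pmf p" if "i \<in> I" for i
      using z(1) that set_Pi_pmf[OF I(1), of d "\<lambda>_. p"] by (auto simp: xu PiE_dflt_def)
    have xd: "x i = d" if "i \<notin> I" for i
      using z(1) that set_Pi_pmf[OF I(1), of d "\<lambda>_. p"] by (auto simp: xu PiE_dflt_def)
    have u: "u i \<in> set_pmf q" if "i \<in> I" for i
      using z(1) that set_Pi_pmf[OF I(1), of d "\<lambda>_. q"] by (auto simp: xu PiE_dflt_def)
    let ?c = "c z"
    have c_big: "real (len (?c i)) > \<epsilon> * n \<longleftrightarrow> real (len (x i)) > \<epsilon> * n" "real (len (x i)) > \<epsilon> * n \<Longrightarrow> ?c i = x i" for i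
      using qS[OF u[of i]] xd[of i] by (auto simp: c_def xu S_def)
    have c_small: "?c i = u i" if "i \<in> I" "\<not> real (len (?c i)) > \<epsilon> * n" for i
      using that by (auto simp: c_def xu S_def split: if_splits)
    have c_p: "?c i \<in> set_pmf p" if "i \<in> I" for i
      using x[OF that] qS[OF u[OF that]] by (auto simp: c_def xu that)
    define M where "M = big_passage (\<epsilon> * n) ((1 - \<eta>) * n) (\<lambda>j. len (?c j))"
    \<comment> \<open>Redrawn values lie in \<open>S\<close>, so the resampled vector and the first
      vector \<open>x\<close> have the same big entries. The passage index of the big lengths is
      therefore a function of \<open>x\<close> alone.\<close>
    have M: "M = big_passage (\<epsilon> * n) ((1 - \<eta>) * n) (\<lambda>j. len (x j))"
    proof -
      have "(if real (len (?c j)) > \<epsilon> * n then real (len (?c j)) else 0) =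
        (if real (len (x j)) > \<epsilon> * n then real (len (x j)) else 0)" for j
        using c_big[of j] by (cases "real (len (x j)) > \<epsilon> * n") simp_all
      then show ?thesis unfolding M_def big_passage_def big_length_def by simp
    qed
    have good1: "\<exists>i\<in>{w * h<..w * h + h}. real (len (?c i)) > \<eta> * n" if "w < W" for w
      using z(2) that by (force simp: bad_def bad1_def)
    have good2: "(\<Sum>j=1..W * h. if real (len (?c j)) > \<epsilon> * n then 0 else real (len (?c j))) \<le> \<eta> * n"
      using z(2) by (simp add: bad_def bad2_def K_def)
    have good3: "(\<Sum>j=1..k0. len (?c j)) \<le> n"
    proof -
      have "\<not> real n < real (\<Sum>j=1..k0. len (?c j))"
        using z(2) by (simp add: bad_def bad3_def)
      then show ?thesis by (simp only: of_nat_less_iff not_less)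
    qed
    note pc = passage_close[of n \<epsilon> \<eta> h W "\<lambda>j. len (?c j)", OF n \<epsilon>(1,2,3) h W good1 good2, folded M_def T_def]
    have Tc: "passage n (\<lambda>j. len (?c j)) = T ?c" by (simp add: T_def)
    note pc = pc[unfolded Tc]
    have k0T: "k0 \<le> T ?c" using passage_ge[OF pc(5) good3] by (simp add: T_def)
    have "k1 \<le> M" using k0T pc(2) k1 by linarith
    moreover have "M \<le> K" using pc(1,3) by (simp add: K_def)
    ultimately have mM: "m x = M" by (simp add: m_def M[symmetric])
    let ?S = "\<lambda>k. \<Sum>j=1..k. g (?c j)"
    \<comment> \<open>The resampled sum and the sum of fresh draws differ only at big draws. There
      are at most \<open>1 / \<epsilon>\<close> of these up to \<open>T\<close>, each costing at
      most \<open>2 * G\<close>.\<close>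
    have d1: "\<bar>?S (T ?c) - Z u (T ?c)\<bar> \<le> 2 * G / \<epsilon>"
    proof -
      let ?C = "{j\<in>{1..T ?c}. real (len (?c j)) > \<epsilon> * n}"
      have TI: "{1..T ?c} \<subseteq> I" using pc(3) I by auto
      have "?S (T ?c) - Z u (T ?c) = (\<Sum>j=1..T ?c. g (?c j) - g (u j))"
        by (simp add: Z_def sum_subtractf)
      also have "\<dots> = (\<Sum>j\<in>?C. g (?c j) - g (u j))"
      proof (rule sum.mono_neutral_right)
        show "\<forall>j\<in>{1..T ?c} - ?C. g (?c j) - g (u j) = 0"
        proof
          fix j assume j: "j \<in> {1..T ?c} - ?C"
          then have "?c j = u j" using TI by (intro c_small) auto
          then show "g (?c j) - g (u j) = 0" by simp
        qed
      qed auto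
      finally have "\<bar>?S (T ?c) - Z u (T ?c)\<bar> \<le> (\<Sum>j\<in>?C. \<bar>g (?c j) - g (u j)\<bar>)"
        by (simp only: sum_abs)
      also have "\<dots> \<le> (\<Sum>j\<in>?C. 2 * G)"
      proof (rule sum_mono)
        fix j assume "j \<in> ?C"
        then have "j \<in> I" using TI by auto
        then show "\<bar>g (?c j) - g (u j)\<bar> \<le> 2 * G"
          using G[OF c_p[of j]] G[OF qS(2)[OF u[of j]]] by linarith
      qed
      also have "\<dots> = real (card ?C) * (2 * G)" by simp
      also have "\<dots> \<le> (1 / \<epsilon>) * (2 * G)" using pc(4) G0 by (intro mult_right_mono) auto
      finally show ?thesis by simp
    qed
    have d2: "\<bar>Z u (T ?c) - Z u M\<bar> \<le> a"
    proof -
      have "{1..T ?c} = {1..M} \<union> {M<..T ?c}" using pc(1) by auto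
      then have "Z u (T ?c) - Z u M = (\<Sum>i\<in>{M<..T ?c}. g (u i))"
        using sum.union_disjoint[of "{1..M}" "{M<..T ?c}" "\<lambda>j. g (u j)"]
        by (simp add: Z_def ivl_disj_int)
      moreover have "\<not> \<bar>\<Sum>i\<in>{M<..T ?c}. g (u i)\<bar> \<ge> a"
        using z(2) pc(1,2) by (auto simp: bad_def bad4_def xu mM)
      ultimately show ?thesis by simp
    qed
    have d3: "\<bar>Z u M\<bar> \<le> B * sqrt M"
    proof -
      have "{0<..M} = {1..M}" by auto
      moreover have "\<not> \<bar>\<Sum>i\<in>{0<..M}. g (u i)\<bar> \<ge> B * sqrt M"
        using z(2) by (auto simp: bad_def bad5_def xu mM)
      ultimately show ?thesis by (simp add: Z_def)
    qed
    have "\<bar>?S (T ?c) / sqrt (T ?c) - Z u M / sqrt M\<bar> \<le> (2 * G / \<epsilon> + a) / sqrt k0 + B * real (2 * h) / k0"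
      by (rule normalized_sum_close[where S = ?S and Z = "Z u", OF _ _ k0T _ _ d1 d2 d3])
        (use k1 mM m_bounds(1)[of x] pc(1,2) in auto)
    then show ?thesis by (simp add: Y_def V_def D_def xu mM)
  qed
  let ?E = "measure_pmf.expectation"
  have e1: "cmod (?E ?Pp (\<lambda>c. iexp (t * Y c)) - ?E ?Q (\<lambda>z. iexp (t * V z))) \<le> 2 * ?pr bad + \<bar>t\<bar> * D"
  proof -
    have "?E ?Pp (\<lambda>c. iexp (t * Y c)) = ?E ?Q (\<lambda>z. iexp (t * Y (c z)))"
      by (subst map_c[symmetric]) (simp del: map_c)
    then have "cmod (?E ?Pp (\<lambda>c. iexp (t * Y c)) - ?E ?Q (\<lambda>z. iexp (t * V z))) =
      cmod (?E ?Q (\<lambda>z. iexp (t * Y (c z)) - iexp (t * V z)))"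
      by (simp only: Bochner_Integration.integral_diff int[OF finQ])
    also have "\<dots> \<le> ?E ?Q (\<lambda>z. cmod (iexp (t * Y (c z)) - iexp (t * V z)))"
      by (rule integral_norm_bound)
    also have "\<dots> \<le> ?E ?Q (\<lambda>z. 2 * indicator bad z + \<bar>t\<bar> * D)"
    proof (intro integral_mono_AE int[OF finQ] AE_pmfI)
      fix z assume z: "z \<in> set_pmf ?Q"
      show "cmod (iexp (t * Y (c z)) - iexp (t * V z)) \<le> 2 * indicator bad z + \<bar>t\<bar> * D"
      proof (cases "z \<in> bad")
        case True
        have "cmod (iexp (t * Y (c z)) - iexp (t * V z)) \<le> cmod (iexp (t * Y (c z))) + cmod (iexp (t * V z))"
          by (rule norm_triangle_ineq4)
        also have "\<dots> = 2" by (simp only: norm_exp_i_times)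
        finally show ?thesis using True D0 by (simp add: add_increasing2)
      next
        case False
        have "cmod (iexp (t * Y (c z)) - iexp (t * V z)) \<le> \<bar>t * Y (c z) - t * V z\<bar>"
          by (rule cmod_iexp_diff_le)
        also have "\<dots> = \<bar>t\<bar> * \<bar>Y (c z) - V z\<bar>" by (simp add: right_diff_distrib[symmetric] abs_mult)
        also have "\<dots> \<le> \<bar>t\<bar> * D" by (intro mult_left_mono close z False) auto
        finally show ?thesis using False by simp
      qed
    qed
    also have "\<dots> = 2 * ?pr bad + \<bar>t\<bar> * D"
      by (subst Bochner_Integration.integral_add) (auto intro!: int finPp finPq)
    finally show ?thesis .
  qed
  define C where "C = \<bar>t\<bar> * sqrt (W * h) * (2 * G / (\<epsilon> * N)) + t\<^sup>2 * (1 + G\<^sup>2) / (\<epsilon> * N)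
         + \<bar>t\<bar> ^ 3 * G / (3 * sqrt k1) + t ^ 4 / (8 * k1)"
  have e2: "cmod (?E ?Q (\<lambda>z. iexp (t * V z)) - exp (- (t\<^sup>2 / 2))) \<le> C"
  proof -
    \<comment> \<open>With \<open>x\<close> fixed, the number of summands is a constant between
      \<open>k1\<close> and \<open>K\<close>. The error \<open>C\<close> depends on these bounds
      only, so it survives averaging over \<open>x\<close>.\<close>
    have inner: "cmod (?E ?Pq (\<lambda>u. iexp (t * V (x, u))) - exp (- (t\<^sup>2 / 2))) \<le> C" for x
    proof -
      have mx: "1 \<le> m x" "k1 \<le> m x" "real (m x) \<le> W * h" using m_bounds[of x] k1 by (auto simp: K_def simp flip: of_nat_mult)
      have k1m: "real k1 > 0" "real k1 \<le> real (m x)" using mx k1 by auto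
      have "cmod (?E ?Pq (\<lambda>u. iexp (t * ((\<Sum>i\<in>{1..m x}. g (u i)) / sqrt (real (card {1..m x}))))) - exp (- (t\<^sup>2 / 2)))
        \<le> \<bar>t\<bar> * sqrt (real (card {1..m x})) * \<bar>?E q g\<bar> + t\<^sup>2 * \<bar>?E q (\<lambda>y. (g y)\<^sup>2) - 1\<bar> / 2
          + \<bar>t\<bar> ^ 3 * G * ?E q (\<lambda>y. (g y)\<^sup>2) / (6 * sqrt (real (card {1..m x}))) + t ^ 4 / (8 * real (card {1..m x}))"
        by (rule expectation_iexp_normalized_sum_Pi_pmf[OF finq]) (use G qS mx m_bounds[of x] I in \<open>auto simp: K_def\<close>)
      also have "\<dots> \<le> C"
        unfolding C_def
      proof (intro add_mono)
        show "\<bar>t\<bar> * sqrt (real (card {1..m x})) * \<bar>?E q g\<bar> \<le> \<bar>t\<bar> * sqrt (W * h) * (2 * G / (\<epsilon> * N))"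
          using mx \<mu> by (intro mult_mono) (auto)
        have "t\<^sup>2 * \<bar>?E q (\<lambda>y. (g y)\<^sup>2) - 1\<bar> / 2 \<le> t\<^sup>2 * (2 * (1 + G\<^sup>2) * b) / 2"
          by (intro divide_right_mono mult_left_mono mom(3)) auto
        also have "\<dots> = t\<^sup>2 * (1 + G\<^sup>2) / (\<epsilon> * N)"
          using \<epsilon>(1) n0 by (simp add: b_def field_simps)
        finally show "t\<^sup>2 * \<bar>?E q (\<lambda>y. (g y)\<^sup>2) - 1\<bar> / 2 \<le> t\<^sup>2 * (1 + G\<^sup>2) / (\<epsilon> * N)" .
        have "\<bar>t\<bar> ^ 3 * G * ?E q (\<lambda>y. (g y)\<^sup>2) / (6 * sqrt (real (card {1..m x}))) \<le> \<bar>t\<bar> ^ 3 * G * 2 / (6 * sqrt k1)"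
          using mom(4) G0 k1m by (intro frac_le mult_left_mono) auto
        then show "\<bar>t\<bar> ^ 3 * G * ?E q (\<lambda>y. (g y)\<^sup>2) / (6 * sqrt (real (card {1..m x}))) \<le> \<bar>t\<bar> ^ 3 * G / (3 * sqrt k1)"
          by (simp add: mult.commute[of G])
        show "t ^ 4 / (8 * real (card {1..m x})) \<le> t ^ 4 / real (8 * k1)"
          using k1m by (intro divide_left_mono) auto
      qed
      finally show ?thesis by (simp add: V_def Z_def)
    qed
    have "?E ?Q (\<lambda>z. iexp (t * V z)) - exp (- (t\<^sup>2 / 2)) = ?E ?Pp (\<lambda>x. ?E ?Pq (\<lambda>u. iexp (t * V (x, u))) - exp (- (t\<^sup>2 / 2)))"
      by (subst expectation_pair_pmf[OF finPp finPq]) (simp add: Bochner_Integration.integral_diff int[OF finPp])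
    also have "cmod \<dots> \<le> ?E ?Pp (\<lambda>x. cmod (?E ?Pq (\<lambda>u. iexp (t * V (x, u))) - exp (- (t\<^sup>2 / 2))))"
      by (rule integral_norm_bound)
    also have "\<dots> \<le> ?E ?Pp (\<lambda>x. C)"
      by (intro integral_mono int[OF finPp] inner)
    finally show ?thesis by simp
  qed
  have "cmod (?E ?Pp (\<lambda>c. iexp (t * Y c)) - exp (- (t\<^sup>2 / 2))) \<le> 2 * ?pr bad + \<bar>t\<bar> * D + C"
    using norm_diff_triangle_le[OF e1 e2] .
  also have "\<dots> \<le> 2 * (W * exp (- (A * h / N)) + W * h * r / (N * \<eta>) + k0 / N + 16 * h / a\<^sup>2 + 8 / B\<^sup>2) + \<bar>t\<bar> * D + C"
    using pbad by simp
  finally show ?thesis by (simp only: C_def D_def k1_def of_nat_mult of_nat_numeral)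
qed

section \<open>Choice of the constants\<close>

lemma nat_floor_bounds:
  assumes "1 \<le> (x::real)"
  shows "x / 2 \<le> real (nat \<lfloor>x\<rfloor>)" "real (nat \<lfloor>x\<rfloor>) \<le> x" "1 \<le> nat \<lfloor>x\<rfloor>"
proof -
  have "real (nat \<lfloor>x\<rfloor>) = of_int \<lfloor>x\<rfloor>" using assms by simp
  moreover have "of_int \<lfloor>x\<rfloor> \<le> x" "x < of_int \<lfloor>x\<rfloor> + 1" "(1::int) \<le> \<lfloor>x\<rfloor>" using assms by linarith+
  ultimately show "x / 2 \<le> real (nat \<lfloor>x\<rfloor>)" "real (nat \<lfloor>x\<rfloor>) \<le> x" "1 \<le> nat \<lfloor>x\<rfloor>"
    using assms by linarith+
qed

text \<open>The order of the quantifiers matters: \<open>lam\<close> fixes the threshold of the long blocks and \<open>r\<close> the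
  admissible mass of the short ones before \<open>\<epsilon>\<close> is known, since \<open>\<epsilon>\<close> will be chosen depending on \<open>r\<close>.\<close>

lemma bootstrap_char_close:
  fixes e R d \<beta> :: real and lam0 :: nat
  assumes e: "e > 0" and R: "R > 0" and d: "d > 0" and \<beta>: "\<beta> > 0"
  shows "\<exists>lam::nat. max 2 lam0 \<le> lam \<and> (\<exists>r>0. \<forall>\<epsilon>. 0 < \<epsilon> \<and> \<epsilon> \<le> 1 / lam \<longrightarrow> (\<exists>\<gamma>0>0. \<exists>N0. \<forall>\<gamma> N n H.
    \<forall>(p :: 'b pmf) (len :: 'b \<Rightarrow> nat) (g :: 'b \<Rightarrow> real) (dflt :: 'b) (t :: real).
      0 < \<gamma> \<and> \<gamma> \<le> \<gamma>0 \<and> N0 \<le> N \<and> 1 \<le> n \<and> (lam + 2) * N \<le> H \<and> finite (set_pmf p) \<and>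
      measure_pmf.expectation p g = 0 \<and> measure_pmf.expectation p (\<lambda>y. (g y)\<^sup>2) = 1 \<and>
      (\<forall>y\<in>set_pmf p. \<bar>g y\<bar> \<le> \<gamma> * sqrt N) \<and>
      measure_pmf.expectation p (\<lambda>y. real (len y)) \<le> n / N \<and>
      d * lam powr \<beta> / N \<le> measure_pmf.prob p {y. real (len y) > 1 / lam * n} \<and>
      measure_pmf.expectation p (\<lambda>y. if real (len y) > \<epsilon> * n then 0 else real (len y)) \<le> r * n / N \<and>
      \<bar>t\<bar> \<le> R \<longrightarrow>
      cmod (measure_pmf.expectation (Pi_pmf {1..H} dflt (\<lambda>_. p))
          (\<lambda>c. iexp (t * ((\<Sum>j=1..passage n (\<lambda>j. len (c j)). g (c j)) / sqrt (passage n (\<lambda>j. len (c j))))))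
        - exp (- (t\<^sup>2 / 2))) \<le> e))"
proof -
  \<comment> \<open>The error budget: each of the five probabilities gets \<open>e / 20\<close>, as
    it enters twice, and each of the four remaining groups \<open>e / 10\<close>. With
    \<open>k0\<close> about \<open>\<delta> * N\<close>, the chance of passing the level before
    \<open>k0\<close> is at most \<open>\<delta>\<close>.\<close>
  define \<delta> where "\<delta> = min 1 (e / 20)"
  have \<delta>: "0 < \<delta>" "\<delta> \<le> 1" "2 * \<delta> \<le> e / 10" using e by (auto simp: \<delta>_def)
  define B where "B = sqrt (160 / e)"
  have B: "B > 0" "16 / B\<^sup>2 = e / 10" using e by (auto simp: B_def)
  \<comment> \<open>The oscillation threshold will be \<open>a = \<rho> * sqrt N\<close>; compared
    with \<open>sqrt k0\<close>, which is at least \<open>sqrt (\<delta> / 2) * sqrt N\<close>, it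
    must cost no more than \<open>e / 10\<close>.\<close>
  define \<rho> where "\<rho> = e / 10 * sqrt (\<delta> / 2) / R"
  have \<rho>: "\<rho> > 0" "R * (\<rho> / sqrt (\<delta> / 2)) = e / 10" using e R \<delta> by (auto simp: \<rho>_def)
  \<comment> \<open>The window length \<open>h\<close> will be about \<open>\<kappa> * N\<close>.
    The three terms of the minimum make two windows short compared to \<open>k0\<close>, the
    oscillation over them improbable, and the change of normalisation small.\<close>
  define \<kappa> where "\<kappa> = min (\<delta> / 8) (min (e / 320 * \<rho>\<^sup>2) (e * \<delta> / (40 * R * B)))"
  have \<kappa>: "\<kappa> > 0" "\<kappa> \<le> \<delta> / 8" "32 * \<kappa> / \<rho>\<^sup>2 \<le> e / 10" "R * (4 * B * \<kappa> / \<delta>) \<le> e / 10"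
  proof -
    show "\<kappa> > 0" using \<delta> e \<rho> R B by (auto simp: \<kappa>_def)
    show "\<kappa> \<le> \<delta> / 8" by (simp add: \<kappa>_def)
    have "\<kappa> \<le> e / 320 * \<rho>\<^sup>2" by (simp add: \<kappa>_def)
    then show "32 * \<kappa> / \<rho>\<^sup>2 \<le> e / 10" using \<rho> by (simp add: field_simps)
    have "\<kappa> \<le> e * \<delta> / (40 * R * B)" by (simp add: \<kappa>_def)
    then show "R * (4 * B * \<kappa> / \<delta>) \<le> e / 10" using R B \<delta> by (simp add: field_simps)
  qed
  \<comment> \<open>There will be \<open>lam\<close> windows and \<open>\<eta> = 1 / lam\<close>. A
    window misses the long blocks with probability at most
    \<open>exp (- (d * lam powr \<beta> * \<kappa> / 2))\<close>; as \<beta> > 0 this beats the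
    factor \<open>lam\<close> from the union over windows.\<close>
  have "((\<lambda>x::real. 2 * x * exp (- (d * x powr \<beta> * \<kappa> / 2))) \<longlongrightarrow> 0) at_top"
    using d \<beta> \<kappa>(1) by real_asymp
  then have "((\<lambda>n::nat. 2 * real n * exp (- (d * real n powr \<beta> * \<kappa> / 2))) \<longlongrightarrow> 0) sequentially"
    using filterlim_compose filterlim_real_sequentially by blast
  then have "\<forall>\<^sub>F n in sequentially. 2 * real n * exp (- (d * real n powr \<beta> * \<kappa> / 2)) < e / 10"
    using e by (intro order_tendstoD) auto
  moreover have "\<forall>\<^sub>F n in sequentially. max 2 lam0 \<le> n \<and> \<delta> * 2 / \<kappa> \<le> real n"
    by (intro eventually_conj eventually_ge_at_top) real_asymp
  ultimately have "\<forall>\<^sub>F n in sequentially. 2 * real n * exp (- (d * real n powr \<beta> * \<kappa> / 2)) < e / 10 \<and> max 2 lam0 \<le> n \<and> \<delta> * 2 / \<kappa> \<le> real n"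
    by eventually_elim simp
  then obtain lam :: nat where lam: "2 * real lam * exp (- (d * real lam powr \<beta> * \<kappa> / 2)) < e / 10" "2 \<le> lam" "\<delta> * 2 / \<kappa> \<le> real lam" "max 2 lam0 \<le> lam"
    by (auto simp: eventually_at_top_linorder)
  have lam2: "2 * \<delta> \<le> lam * \<kappa>" using lam(3) \<kappa>(1) by (simp add: field_simps)
  \<comment> \<open>The first \<open>lam * h\<close> draws have expected small length at most about
    \<open>lam * \<kappa> * r * n\<close>, to be compared with \<open>\<eta> * n = n / lam\<close>.
    This is where \<open>(real lam)\<^sup>2 * \<kappa>\<close> comes from.\<close>
  define r where "r = e / (20 * (real lam)\<^sup>2 * \<kappa>)"
  have r: "r > 0" "2 * ((real lam)\<^sup>2 * \<kappa> * r) = e / 10" using e lam \<kappa> by (auto simp: r_def)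
  show ?thesis
  proof (rule exI[of _ lam], rule conjI[OF lam(4)], rule exI[of _ r], rule conjI[OF r(1)], intro allI impI)
    fix \<epsilon> :: real assume \<epsilon>: "0 < \<epsilon> \<and> \<epsilon> \<le> 1 / lam"
    \<comment> \<open>All contributions that vanish with the bound \<open>\<gamma> * sqrt N\<close>
      on the summands: exchanged big blocks, shifted mean, shifted variance, cubic remainder. As
      they involve \<open>1 / \<epsilon>\<close>, \<open>\<gamma>\<close> has to be chosen after
      \<open>\<epsilon>\<close>.\<close>
    define F where "F = (\<lambda>\<gamma>. R * ((2 * \<gamma> / \<epsilon>) / sqrt (\<delta> / 2)) + R * (sqrt (lam * \<kappa>) * (2 * \<gamma> / \<epsilon>)) + R\<^sup>2 * (\<gamma>\<^sup>2 / \<epsilon>) + R ^ 3 * (2 * \<gamma> / (3 * sqrt \<delta>)))"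
    have "(F \<longlongrightarrow> F 0) (at_right 0)"
      unfolding F_def using \<epsilon> \<delta> by (intro tendsto_intros) auto
    then have "\<forall>\<^sub>F \<gamma> in at_right 0. F \<gamma> < e / 10"
      using e by (intro order_tendstoD) (auto simp: F_def)
    moreover have "((\<lambda>\<gamma>. 8 * \<kappa> * \<gamma>) \<longlongrightarrow> 8 * \<kappa> * 0) (at_right 0)" by (intro tendsto_intros)
    then have "\<forall>\<^sub>F \<gamma> in at_right 0. 8 * \<kappa> * \<gamma> < \<rho> * \<epsilon>"
      using \<rho> \<epsilon> by (intro order_tendstoD) auto
    moreover have "((\<lambda>\<gamma>. 4 * sqrt (lam * \<kappa>) * \<gamma>) \<longlongrightarrow> 4 * sqrt (lam * \<kappa>) * 0) (at_right 0)" by (intro tendsto_intros)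
    then have "\<forall>\<^sub>F \<gamma> in at_right 0. 4 * sqrt (lam * \<kappa>) * \<gamma> < B * \<epsilon>"
      using B \<epsilon> by (intro order_tendstoD) auto
    ultimately have "\<forall>\<^sub>F \<gamma> in at_right 0. F \<gamma> < e / 10 \<and> 8 * \<kappa> * \<gamma> < \<rho> * \<epsilon> \<and> 4 * sqrt (lam * \<kappa>) * \<gamma> < B * \<epsilon>"
      by eventually_elim simp
    then obtain b where b: "b > 0" "\<And>\<gamma>. 0 < \<gamma> \<Longrightarrow> \<gamma> < b \<Longrightarrow> F \<gamma> < e / 10 \<and> 8 * \<kappa> * \<gamma> < \<rho> * \<epsilon> \<and> 4 * sqrt (lam * \<kappa>) * \<gamma> < B * \<epsilon>"
      by (auto simp: eventually_at_right_field)
    have "\<forall>\<^sub>F N in sequentially. 1 \<le> \<kappa> * real N \<and> 8 \<le> \<delta> * real N \<and> 2 \<le> \<epsilon> * real N \<and> R\<^sup>2 / (\<epsilon> * real N) + R ^ 4 / (2 * \<delta> * real N) \<le> e / 10 \<and> 1 \<le> N"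
      using \<kappa>(1) \<delta>(1) \<epsilon> e by (intro eventually_conj eventually_ge_at_top) real_asymp+
    then obtain N0 where N0: "\<And>N. N \<ge> N0 \<Longrightarrow> 1 \<le> \<kappa> * real N \<and> 8 \<le> \<delta> * real N \<and> 2 \<le> \<epsilon> * real N \<and> R\<^sup>2 / (\<epsilon> * real N) + R ^ 4 / (2 * \<delta> * real N) \<le> e / 10 \<and> 1 \<le> N"
      by (auto simp: eventually_at_top_linorder)
    show "\<exists>\<gamma>0>0. \<exists>N0. \<forall>\<gamma> N n H.
    \<forall>(p :: 'b pmf) (len :: 'b \<Rightarrow> nat) (g :: 'b \<Rightarrow> real) (dflt :: 'b) (t :: real).
      0 < \<gamma> \<and> \<gamma> \<le> \<gamma>0 \<and> N0 \<le> N \<and> 1 \<le> n \<and> (lam + 2) * N \<le> H \<and> finite (set_pmf p) \<and>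
      measure_pmf.expectation p g = 0 \<and> measure_pmf.expectation p (\<lambda>y. (g y)\<^sup>2) = 1 \<and>
      (\<forall>y\<in>set_pmf p. \<bar>g y\<bar> \<le> \<gamma> * sqrt N) \<and>
      measure_pmf.expectation p (\<lambda>y. real (len y)) \<le> n / N \<and>
      d * lam powr \<beta> / N \<le> measure_pmf.prob p {y. real (len y) > 1 / lam * n} \<and>
      measure_pmf.expectation p (\<lambda>y. if real (len y) > \<epsilon> * n then 0 else real (len y)) \<le> r * n / N \<and>
      \<bar>t\<bar> \<le> R \<longrightarrow>
      cmod (measure_pmf.expectation (Pi_pmf {1..H} dflt (\<lambda>_. p))
          (\<lambda>c. iexp (t * ((\<Sum>j=1..passage n (\<lambda>j. len (c j)). g (c j)) / sqrt (passage n (\<lambda>j. len (c j))))))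
        - exp (- (t\<^sup>2 / 2))) \<le> e"
    proof (intro exI[of _ "b / 2"] conjI exI[of _ N0] allI impI; (elim conjE)?)
      show "0 < b / 2" using b by simp
      fix \<gamma> :: real and N n H :: nat and p :: "'b pmf" and len :: "'b \<Rightarrow> nat" and g :: "'b \<Rightarrow> real" and dflt :: 'b and t :: real
      assume \<gamma>: "0 < \<gamma>" "\<gamma> \<le> b / 2" and N: "N0 \<le> N" and n: "1 \<le> n" and H: "(lam + 2) * N \<le> H"
        and p: "finite (set_pmf p)" "measure_pmf.expectation p g = 0" "measure_pmf.expectation p (\<lambda>y. (g y)\<^sup>2) = 1"
        "\<forall>y\<in>set_pmf p. \<bar>g y\<bar> \<le> \<gamma> * sqrt N" "measure_pmf.expectation p (\<lambda>y. real (len y)) \<le> n / N"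
        "d * lam powr \<beta> / N \<le> measure_pmf.prob p {y. real (len y) > 1 / lam * n}"
        "measure_pmf.expectation p (\<lambda>y. if real (len y) > \<epsilon> * n then 0 else real (len y)) \<le> r * n / N"
        and t: "\<bar>t\<bar> \<le> R"
      have \<gamma>b: "F \<gamma> < e / 10" "8 * \<kappa> * \<gamma> < \<rho> * \<epsilon>" "4 * sqrt (lam * \<kappa>) * \<gamma> < B * \<epsilon>"
        using b(2)[of \<gamma>] \<gamma> b(1) by auto
      have NN: "1 \<le> \<kappa> * real N" "8 \<le> \<delta> * real N" "2 \<le> \<epsilon> * real N" "R\<^sup>2 / (\<epsilon> * real N) + R ^ 4 / (2 * \<delta> * real N) \<le> e / 10" "1 \<le> N"
        using N0[OF N] by auto
      have N1: "real N > 0" using NN(5) by simp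
      define h where "h = nat \<lfloor>\<kappa> * N\<rfloor>"
      define k0 where "k0 = nat \<lfloor>\<delta> * N\<rfloor>"
      define G where "G = \<gamma> * sqrt N"
      define a where "a = \<rho> * sqrt N"
      have h: "\<kappa> * N / 2 \<le> h" "h \<le> \<kappa> * N" "1 \<le> h" unfolding h_def using nat_floor_bounds[OF NN(1)] by auto
      have k0: "\<delta> * N / 2 \<le> k0" "k0 \<le> \<delta> * N" unfolding k0_def using nat_floor_bounds[of "\<delta> * N"] NN(2) by auto
      have hk: "real h \<le> \<delta> * N / 8"
        using h(2) mult_right_mono[OF \<kappa>(2), of "real N"] by simp
      have "real (2 * h + 1) \<le> real k0" using hk k0 NN(2) by simp
      then have hk0: "2 * h + 1 \<le> k0" by (simp only: of_nat_le_iff)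
      have k1: "\<delta> * N / 4 \<le> real (k0 - 2 * h)" using hk k0(1) hk0 by simp
      have "\<delta> * N \<le> lam * (\<kappa> * N / 2)" using lam2 N1 mult_right_mono[OF lam2, of "real N"] by simp
      also have "\<dots> \<le> real lam * real h" using h(1) by (intro mult_left_mono) auto
      finally have "real k0 \<le> real (lam * h)" using k0(2) by simp
      then have k0W: "k0 \<le> lam * h" by (simp only: of_nat_le_iff)
      have "real h \<le> real N" using hk N1 mult_right_mono[OF \<delta>(2), of "real N"] by linarith
      then have "h \<le> N" by simp
      then have HI: "{1..lam * h + 2 * h} \<subseteq> {1..H}"
        using H mult_right_mono[of h N "lam + 2"] by (auto simp: algebra_simps)
      have sN: "sqrt N > 0" "sqrt N * sqrt N = N" using N1 by auto
      have a1: "a > 0" using \<rho> sN by (simp add: a_def)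
      have a2: "8 * h * G \<le> a * \<epsilon> * N"
      proof -
        have "8 * h * G \<le> 8 * (\<kappa> * N) * (\<gamma> * sqrt N)"
          unfolding G_def using h(2) \<gamma> by (intro mult_right_mono mult_left_mono) auto
        also have "\<dots> = (8 * \<kappa> * \<gamma>) * (sqrt N * N)" by simp
        also have "\<dots> \<le> (\<rho> * \<epsilon>) * (sqrt N * N)" using \<gamma>b(2) by (intro mult_right_mono) auto
        also have "\<dots> = a * \<epsilon> * N" by (simp add: a_def)
        finally show ?thesis .
      qed
      have sWh: "sqrt (lam * h) \<le> sqrt (lam * \<kappa>) * sqrt N"
        unfolding real_sqrt_mult[symmetric] using h(2) mult_left_mono[OF h(2), of "real lam"] by (intro real_sqrt_le_mono) (simp add: mult.assoc)
      have B2: "4 * sqrt (lam * h) * G \<le> B * \<epsilon> * N"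
      proof -
        have "4 * sqrt (lam * h) * G \<le> 4 * (sqrt (lam * \<kappa>) * sqrt N) * (\<gamma> * sqrt N)"
          unfolding G_def using sWh \<gamma> by (intro mult_right_mono mult_left_mono) auto
        also have "\<dots> = (4 * sqrt (lam * \<kappa>) * \<gamma>) * (sqrt N * sqrt N)" by (simp only: mult_ac)
        also have "\<dots> \<le> (B * \<epsilon>) * (sqrt N * sqrt N)" using \<gamma>b(3) by (intro mult_right_mono) auto
        finally show ?thesis by (simp add: sN)
      qed
      have \<eta>: "1 / real lam < 1" "real lam * (1 / real lam) \<ge> 1" using lam(2) by auto
      let ?C = "cmod (measure_pmf.expectation (Pi_pmf {1..H} dflt (\<lambda>_. p))
          (\<lambda>c. iexp (t * ((\<Sum>j=1..passage n (\<lambda>j. len (c j)). g (c j)) / sqrt (passage n (\<lambda>j. len (c j))))))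
        - exp (- (t\<^sup>2 / 2)))"
      have bnd: "?C \<le> 2 * (lam * exp (- (d * lam powr \<beta> * h / N)) + lam * h * r / (N * (1 / lam)) + k0 / N + 16 * h / a\<^sup>2 + 8 / B\<^sup>2)
      + \<bar>t\<bar> * ((2 * G / \<epsilon> + a) / sqrt k0 + B * (2 * h) / k0)
      + (\<bar>t\<bar> * sqrt (lam * h) * (2 * G / (\<epsilon> * N)) + t\<^sup>2 * (1 + G\<^sup>2) / (\<epsilon> * N)
         + \<bar>t\<bar> ^ 3 * G / (3 * sqrt (k0 - 2 * h)) + t ^ 4 / (8 * (k0 - 2 * h)))"
        by (rule bootstrap_char_bound[where G = G and a = a and B = B and r = r and A = "d * lam powr \<beta>" and \<eta> = "1 / lam" and \<epsilon> = \<epsilon>])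
          (use p n NN \<epsilon> \<eta> h hk0 k0W a1 a2 B B2 HI in \<open>auto simp: G_def\<close>)
      have t1: "lam * exp (- (d * lam powr \<beta> * h / N)) \<le> e / 20"
      proof -
        have "d * lam powr \<beta> * \<kappa> / 2 \<le> d * lam powr \<beta> * h / N"
          using mult_left_mono[OF h(1), of "d * lam powr \<beta>"] d N1 by (simp add: field_simps)
        then have "lam * exp (- (d * lam powr \<beta> * h / N)) \<le> lam * exp (- (d * lam powr \<beta> * \<kappa> / 2))"
          by (intro mult_left_mono) auto
        then show ?thesis using lam(1) by simp
      qed
      have t2: "lam * h * r / (N * (1 / lam)) \<le> e / 20"
      proof -
        have "lam * h * r / (N * (1 / lam)) = (real lam)\<^sup>2 * r * (h / N)" by (simp add: power2_eq_square)
        also have "\<dots> \<le> (real lam)\<^sup>2 * r * \<kappa>" using h(2) N1 r(1) by (intro mult_left_mono) (auto simp: field_simps)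
        also have "\<dots> = e / 20" using r(2) by (simp add: mult_ac)
        finally show ?thesis .
      qed
      have t3: "k0 / N \<le> e / 20" using k0(2) N1 \<delta>(3) order_trans[of "k0 / N" \<delta> "e / 20"] by (simp add: field_simps)
      have t4: "16 * h / a\<^sup>2 \<le> e / 20"
      proof -
        have "16 * h / a\<^sup>2 = 16 * (h / N) / \<rho>\<^sup>2" using N1 by (simp add: a_def power_mult_distrib)
        also have "\<dots> \<le> 16 * \<kappa> / \<rho>\<^sup>2" using h(2) N1 by (intro divide_right_mono mult_left_mono) (auto simp: field_simps)
        finally show ?thesis using \<kappa>(3) by simp
      qed
      have k0p: "real k0 > 0" "sqrt (\<delta> / 2) * sqrt N \<le> sqrt k0"
      proof -
        show "real k0 > 0" using k0(1) \<delta> N1 by (smt (verit) mult_pos_pos divide_pos_pos)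
        show "sqrt (\<delta> / 2) * sqrt N \<le> sqrt k0"
          unfolding real_sqrt_mult[symmetric] using k0(1) by (intro real_sqrt_le_mono) simp
      qed
      have t6: "\<bar>t\<bar> * ((2 * G / \<epsilon> + a) / sqrt k0 + B * (2 * h) / k0) \<le> R * ((2 * \<gamma> / \<epsilon>) / sqrt (\<delta> / 2)) + R * (\<rho> / sqrt (\<delta> / 2)) + R * (4 * B * \<kappa> / \<delta>)"
      proof -
        have "(2 * G / \<epsilon> + a) / sqrt k0 \<le> (2 * G / \<epsilon> + a) / (sqrt (\<delta> / 2) * sqrt N)"
          using k0p \<delta> N1 \<gamma> \<epsilon> a1 by (intro divide_left_mono) (auto simp: G_def)
        also have "\<dots> = (2 * \<gamma> / \<epsilon> + \<rho>) / sqrt (\<delta> / 2)"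
        proof -
          have "2 * G / \<epsilon> + a = (2 * \<gamma> / \<epsilon> + \<rho>) * sqrt N" by (simp add: G_def a_def distrib_right)
          then show ?thesis using sN(1) by simp
        qed
        finally have 1: "(2 * G / \<epsilon> + a) / sqrt k0 \<le> (2 * \<gamma> / \<epsilon> + \<rho>) / sqrt (\<delta> / 2)" .
        have "B * (2 * h) / k0 \<le> B * (2 * (\<kappa> * N)) / (\<delta> * N / 2)"
          using k0 h(2) B \<delta> N1 \<kappa> by (intro frac_le) auto
        also have "\<dots> = 4 * B * \<kappa> / \<delta>" using N1 by (simp add: field_simps)
        finally have "(2 * G / \<epsilon> + a) / sqrt k0 + B * (2 * h) / k0 \<le> (2 * \<gamma> / \<epsilon> + \<rho>) / sqrt (\<delta> / 2) + 4 * B * \<kappa> / \<delta>"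
          using 1 by simp
        then have "\<bar>t\<bar> * ((2 * G / \<epsilon> + a) / sqrt k0 + B * (2 * h) / k0) \<le> R * ((2 * \<gamma> / \<epsilon> + \<rho>) / sqrt (\<delta> / 2) + 4 * B * \<kappa> / \<delta>)"
          using t k0p \<gamma> \<epsilon> a1 B N1 by (intro mult_mono) (auto simp: G_def)
        also have "\<dots> = R * ((2 * \<gamma> / \<epsilon>) / sqrt (\<delta> / 2)) + R * (\<rho> / sqrt (\<delta> / 2)) + R * (4 * B * \<kappa> / \<delta>)"
          by (simp only: add_divide_distrib distrib_left)
        finally show ?thesis .
      qed
      have t7: "\<bar>t\<bar> * sqrt (lam * h) * (2 * G / (\<epsilon> * N)) \<le> R * (sqrt (lam * \<kappa>) * (2 * \<gamma> / \<epsilon>))"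
      proof -
        have "\<bar>t\<bar> * sqrt (lam * h) * (2 * G / (\<epsilon> * N)) \<le> R * (sqrt (lam * \<kappa>) * sqrt N) * (2 * G / (\<epsilon> * N))"
          using t sWh R \<gamma> \<epsilon> N1 by (intro mult_right_mono mult_mono) (auto simp: G_def)
        also have "\<dots> = R * (sqrt (lam * \<kappa>) * (sqrt N * (2 * G / (\<epsilon> * N))))" by (simp only: mult.assoc)
        also have "sqrt N * (2 * G / (\<epsilon> * N)) = 2 * \<gamma> / \<epsilon>"
        proof -
          have "2 * G / (\<epsilon> * N) = 2 * (\<gamma> * sqrt N) / (\<epsilon> * (sqrt N * sqrt N))" by (simp only: G_def sN(2))
          then show ?thesis using sN(1) N1 by (simp del: real_sqrt_mult_self)
        qed
        finally show ?thesis .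
      qed
      have t8: "t\<^sup>2 * (1 + G\<^sup>2) / (\<epsilon> * N) \<le> R\<^sup>2 / (\<epsilon> * N) + R\<^sup>2 * (\<gamma>\<^sup>2 / \<epsilon>)"
      proof -
        have "t\<^sup>2 \<le> R\<^sup>2" using t R by (simp add: abs_le_square_iff[symmetric])
        then have "t\<^sup>2 * (1 + G\<^sup>2) / (\<epsilon> * N) \<le> R\<^sup>2 * (1 + G\<^sup>2) / (\<epsilon> * N)"
          using \<epsilon> N1 by (intro divide_right_mono mult_right_mono) auto
        also have "\<dots> = R\<^sup>2 / (\<epsilon> * N) + R\<^sup>2 * (\<gamma>\<^sup>2 / \<epsilon>)"
          using N1 \<epsilon> by (simp add: G_def power_mult_distrib field_simps)
        finally show ?thesis .
      qed
      have sk1: "sqrt \<delta> * sqrt N / 2 \<le> sqrt (k0 - 2 * h)"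
      proof -
        have "sqrt (\<delta> * N / 4) \<le> sqrt (k0 - 2 * h)" using k1 by (rule real_sqrt_le_mono)
        then show ?thesis by (simp add: real_sqrt_mult real_sqrt_divide)
      qed
      have t9: "\<bar>t\<bar> ^ 3 * G / (3 * sqrt (k0 - 2 * h)) \<le> R ^ 3 * (2 * \<gamma> / (3 * sqrt \<delta>))"
      proof -
        have "\<bar>t\<bar> ^ 3 * G / (3 * sqrt (k0 - 2 * h)) \<le> R ^ 3 * G / (3 * (sqrt \<delta> * sqrt N / 2))"
          using t R sk1 \<gamma> N1 \<delta> by (intro frac_le mult_mono power_mono) (auto simp: G_def)
        also have "\<dots> = R ^ 3 * (2 * \<gamma> / (3 * sqrt \<delta>))" using sN(1) by (simp add: G_def)
        finally show ?thesis .
      qed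
      have t10: "t ^ 4 / (8 * (k0 - 2 * h)) \<le> R ^ 4 / (2 * \<delta> * N)"
      proof -
        have "t ^ 4 = \<bar>t\<bar> ^ 4" by simp
        also have "\<bar>t\<bar> ^ 4 / (8 * (k0 - 2 * h)) \<le> R ^ 4 / (8 * (\<delta> * N / 4))"
          using t R k1 \<delta> N1 by (intro frac_le power_mono) auto
        finally show ?thesis by simp
      qed
      have t5: "8 / B\<^sup>2 \<le> e / 20" using B(2) by simp
      have arith: "2 * (e / 20 + e / 20 + e / 20 + e / 20 + e / 20) + (x1 + y1 + y2) + (x2 + (z1 + x3) + x4 + z2) \<le> e"
        if "x1 + x2 + x3 + x4 < e / 10" "z1 + z2 \<le> e / 10" "y1 = e / 10" "y2 \<le> e / 10" for x1 x2 x3 x4 y1 y2 z1 z2 :: real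
        using that e by (simp add: field_simps)
      show "?C \<le> e"
        by (rule order_trans[OF bnd], rule order_trans[OF _ arith[OF \<gamma>b(1)[unfolded F_def] NN(4) \<rho>(2) \<kappa>(4)]],
            intro add_mono mult_left_mono t1 t2 t3 t4 t5 t6 t7 t8 t9 t10) simp
    qed
  qed
qed

text \<open>Levy's continuity theorem made uniform by contradiction: laws violating the claim for
  \<open>d = 1 / Suc n\<close> would converge weakly to the normal law, whose distribution function
  is continuous at \<open>x\<close>. The uniform form is what can be applied to one data set and one
  \<open>n\<close> at a time.\<close>

lemma cdf_close_of_char_close:
  assumes e: "e > 0"
  shows "\<exists>d>0. \<forall>\<mu>. real_distribution \<mu> \<longrightarrow>
    (\<forall>t. \<bar>t\<bar> \<le> 1 / d \<longrightarrow> cmod (char \<mu> t - exp (- (t\<^sup>2 / 2))) \<le> d) \<longrightarrow>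
    \<bar>cdf \<mu> x - cdf std_normal_distribution x\<bar> \<le> e"
proof (rule ccontr)
  assume "\<not> ?thesis"
  then have *: "\<exists>\<mu>. real_distribution \<mu> \<and>
      (\<forall>t. \<bar>t\<bar> \<le> 1 / d \<longrightarrow> cmod (char \<mu> t - exp (- (t\<^sup>2 / 2))) \<le> d) \<and>
      \<not> \<bar>cdf \<mu> x - cdf std_normal_distribution x\<bar> \<le> e" if "d > 0" for d
    using that by blast
  have "\<forall>n. \<exists>\<mu>. real_distribution \<mu> \<and>
      (\<forall>t. \<bar>t\<bar> \<le> 1 / (1 / real (Suc n)) \<longrightarrow> cmod (char \<mu> t - exp (- (t\<^sup>2 / 2))) \<le> 1 / real (Suc n)) \<and>
      \<not> \<bar>cdf \<mu> x - cdf std_normal_distribution x\<bar> \<le> e"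
    by (intro allI *) simp
  then obtain \<mu> where \<mu>: "\<And>n. real_distribution (\<mu> n)"
      "\<And>n t. \<bar>t\<bar> \<le> 1 / (1 / real (Suc n)) \<Longrightarrow> cmod (char (\<mu> n) t - exp (- (t\<^sup>2 / 2))) \<le> 1 / real (Suc n)"
      "\<And>n. \<not> \<bar>cdf (\<mu> n) x - cdf std_normal_distribution x\<bar> \<le> e"
    by metis
  have "(\<lambda>n. char (\<mu> n) t) \<longlonglongrightarrow> char std_normal_distribution t" for t
  proof -
    have "(\<lambda>n. char (\<mu> n) t - exp (- (t\<^sup>2 / 2))) \<longlonglongrightarrow> 0"
    proof (rule Lim_null_comparison)
      show "\<forall>\<^sub>F n in sequentially. cmod (char (\<mu> n) t - exp (- (t\<^sup>2 / 2))) \<le> 1 / real (Suc n)"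
        using eventually_ge_at_top[of "nat \<lceil>\<bar>t\<bar>\<rceil>"]
      proof eventually_elim
        case (elim n)
        then have "\<bar>t\<bar> \<le> real (Suc n)" by linarith
        then show ?case by (intro \<mu>(2)) simp
      qed
      show "(\<lambda>n. 1 / real (Suc n)) \<longlonglongrightarrow> 0" by (rule LIMSEQ_Suc[OF lim_1_over_n])
    qed
    then have "(\<lambda>n. char (\<mu> n) t) \<longlonglongrightarrow> exp (- (t\<^sup>2 / 2))" by (simp add: Lim_null[symmetric])
    then show ?thesis by (simp add: char_std_normal_distribution)
  qed
  then have "weak_conv_m \<mu> std_normal_distribution"
    by (intro levy_continuity \<mu>(1) real_dist_normal_dist)
  moreover have "isCont (cdf std_normal_distribution) x"
  proof -
    interpret real_distribution std_normal_distribution by (rule real_dist_normal_dist)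
    have "measure std_normal_distribution {x} = 0"
      by (simp add: measure_def emeasure_density nn_integral_null_set)
    then show ?thesis by (simp add: isCont_cdf)
  qed
  ultimately have "(\<lambda>n. cdf (\<mu> n) x) \<longlonglongrightarrow> cdf std_normal_distribution x"
    by (simp add: weak_conv_m_def weak_conv_def)
  then have "\<forall>\<^sub>F n in sequentially. dist (cdf (\<mu> n) x) (cdf std_normal_distribution x) < e"
    using e by (rule tendstoD)
  then obtain n where "\<bar>cdf (\<mu> n) x - cdf std_normal_distribution x\<bar> < e"
    by (auto simp: dist_real_def eventually_sequentially)
  then show False using \<mu>(3)[of n] by simp
qed

section \<open>Markov chains and excursions from an atom\<close>

text \<open>The Markov property is stated in integrated form, on events of the past. It then covers
  the given chain and the coordinate process under \<open>path_law\<close> alike, and one step is an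
  identity of integrals that can be iterated.\<close>

locale markov_process = prob_space N for N :: "'w measure" +
  fixes E :: "'e measure" and P :: "'e \<Rightarrow> 'e measure" and X :: "nat \<Rightarrow> 'w \<Rightarrow> 'e"
  assumes P[measurable]: "transition_kernel E P"
    and X[measurable]: "X n \<in> N \<rightarrow>\<^sub>M E"
    and markov_step: "\<And>n A B. A \<in> sets (natural_filtration N E X n) \<Longrightarrow> B \<in> sets E \<Longrightarrow>
      emeasure N (A \<inter> {\<omega> \<in> space N. X (Suc n) \<omega> \<in> B}) = (\<integral>\<^sup>+\<omega>. indicator A \<omega> * emeasure (P (X n \<omega>)) B \<partial>N)"
begin

abbreviation past :: "nat \<Rightarrow> 'w measure" where
  "past \<equiv> natural_filtration N E X"

lemma space_past [simp]: "space (past n) = space N"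
  by (simp add: natural_filtration_def)

lemma past_map_in: "(\<lambda>\<omega>. \<lambda>i\<in>{..n}. X i \<omega>) \<in> space N \<rightarrow> space (\<Pi>\<^sub>M i\<in>{..n}. E)"
  using measurable_space[OF X] by (auto simp: space_PiM)

lemma X_past: "i \<le> n \<Longrightarrow> X i \<in> past n \<rightarrow>\<^sub>M E"
proof -
  assume i: "i \<le> n"
  have "(\<lambda>w. w i) \<circ> (\<lambda>\<omega>. \<lambda>i\<in>{..n}. X i \<omega>) \<in> past n \<rightarrow>\<^sub>M E"
    unfolding natural_filtration_def
    by (rule measurable_comp[OF measurable_vimage_algebra1[OF past_map_in]])
      (use i in \<open>auto intro!: measurable_component_singleton\<close>)
  then show ?thesis using i by (simp add: comp_def)
qed

lemma past_universal:
  assumes "\<And>i. i \<le> n \<Longrightarrow> X i \<in> K \<rightarrow>\<^sub>M E" "space K = space N"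
  shows "sets (past n) \<subseteq> sets K"
proof -
  have "(\<lambda>\<omega>. \<lambda>i\<in>{..n}. X i \<omega>) \<in> K \<rightarrow>\<^sub>M (\<Pi>\<^sub>M i\<in>{..n}. E)"
    by (rule measurable_restrict) (use assms in auto)
  then show ?thesis
    unfolding natural_filtration_def by (rule sets_image_in_sets[OF assms(2)])
qed

lemma past_mono: "m \<le> n \<Longrightarrow> sets (past m) \<subseteq> sets (past n)"
  by (rule past_universal) (auto intro: X_past)

lemma past_subset: "sets (past n) \<subseteq> sets N"
  by (rule past_universal) auto

lemma past_measurable_mono: "m \<le> n \<Longrightarrow> S \<in> past m \<rightarrow>\<^sub>M K \<Longrightarrow> S \<in> past n \<rightarrow>\<^sub>M K"
  using past_mono[of m n] by (auto simp: measurable_def)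

lemma past_measurable: "S \<in> past m \<rightarrow>\<^sub>M K \<Longrightarrow> S \<in> N \<rightarrow>\<^sub>M K"
  using past_subset[of m] by (auto simp: measurable_def)

lemma subprob_P [measurable]: "P \<in> E \<rightarrow>\<^sub>M subprob_algebra E"
  by (rule measurable_prob_algebraD[OF P])

lemma P_space: "y \<in> space E \<Longrightarrow> prob_space (P y)" "y \<in> space E \<Longrightarrow> sets (P y) = sets E"
  using measurable_space[OF P] by (auto simp: space_prob_algebra)

text \<open>Both sides are integrals of \<open>\<phi>\<close> against finite measures on pairs
  (statistic of the past, state), so agreement on rectangles is enough, and there the condition on
  \<open>S\<close> can be absorbed into the event \<open>A\<close>. In the excursions
  \<open>S\<close> carries the sum of \<open>f\<close> accumulated so far.\<close>

lemma nn_integral_markov_step: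
  assumes A: "A \<in> sets (past n)" and S: "S \<in> past n \<rightarrow>\<^sub>M (borel :: real measure)"
    and \<phi>[measurable]: "\<phi> \<in> borel_measurable (borel \<Otimes>\<^sub>M E)"
  shows "(\<integral>\<^sup>+\<omega>. indicator A \<omega> * \<phi> (S \<omega>, X (Suc n) \<omega>) \<partial>N) =
    (\<integral>\<^sup>+\<omega>. indicator A \<omega> * (\<integral>\<^sup>+z. \<phi> (S \<omega>, z) \<partial>P (X n \<omega>)) \<partial>N)"
proof -
  have [measurable]: "A \<in> sets N" using A past_subset by auto
  have [measurable]: "S \<in> borel_measurable N" by (rule past_measurable[OF S])
  let ?BE = "borel \<Otimes>\<^sub>M E :: (real \<times> 'e) measure"
  let ?D = "density N (indicator A)"
  let ?\<mu> = "distr ?D ?BE (\<lambda>\<omega>. (S \<omega>, X (Suc n) \<omega>))"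
  let ?b = "distr ?D ?BE (\<lambda>\<omega>. (S \<omega>, X n \<omega>))"
  let ?k = "\<lambda>(s, y). distr (P y) ?BE (\<lambda>z. (s, z))"
  have k: "?k \<in> ?BE \<rightarrow>\<^sub>M subprob_algebra ?BE"
    unfolding split_beta' by (rule measurable_distr2[where M = E]) measurable
  have k': "?k \<in> ?b \<rightarrow>\<^sub>M subprob_algebra ?BE" using k by simp
  have sp: "space ?b \<noteq> {}"
    using not_empty measurable_space[OF X] by (auto simp: space_pair_measure)
  have nn_D: "(\<integral>\<^sup>+z. \<psi> z \<partial>distr ?D ?BE T) = (\<integral>\<^sup>+\<omega>. indicator A \<omega> * \<psi> (T \<omega>) \<partial>N)"
    if [measurable]: "\<psi> \<in> borel_measurable ?BE" "T \<in> N \<rightarrow>\<^sub>M ?BE" for \<psi> T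
  proof -
    have "(\<integral>\<^sup>+z. \<psi> z \<partial>distr ?D ?BE T) = (\<integral>\<^sup>+\<omega>. \<psi> (T \<omega>) \<partial>?D)"
      by (rule nn_integral_distr) simp_all
    also have "\<dots> = (\<integral>\<^sup>+\<omega>. indicator A \<omega> * \<psi> (T \<omega>) \<partial>N)"
      by (rule nn_integral_density) simp_all
    finally show ?thesis .
  qed
  \<comment> \<open>Left: the joint law of \<open>S\<close> and the next state on \<open>A\<close>.
    Right: the joint law with the current state, pushed through one transition that keeps the first
    component.\<close>
  have "?\<mu> = ?b \<bind> ?k"
  proof (rule measure_eqI_generator_eq[OF Int_stable_pair_measure_generator[of borel E], where \<Omega> = "space borel \<times> space E" and A = "\<lambda>_. space borel \<times> space E"])
    show "{a \<times> b |a b. a \<in> sets borel \<and> b \<in> sets E} \<subseteq> Pow (space borel \<times> space E)"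
      using sets.space_closed[of borel] sets.space_closed[of E] by blast
    show "sets ?\<mu> = sigma_sets (space borel \<times> space E) {a \<times> b |a b. a \<in> sets borel \<and> b \<in> sets E}"
      by (simp add: sets_pair_measure)
    show "sets (?b \<bind> ?k) = sigma_sets (space borel \<times> space E) {a \<times> b |a b. a \<in> sets borel \<and> b \<in> sets E}"
      using sets_bind[OF sets_kernel[OF k'] sp] by (simp add: sets_pair_measure)
    show "emeasure ?\<mu> (space borel \<times> space E) \<noteq> \<infinity>" for i :: nat
    proof -
      interpret D: finite_measure ?D
        by (rule finite_measureI) (simp add: emeasure_density emeasure_eq_measure)
      interpret \<mu>: finite_measure ?\<mu> by (rule D.finite_measure_distr) simp
      show ?thesis by simp
    qed
    fix Q assume "Q \<in> {a \<times> b |a b. a \<in> sets (borel :: real measure) \<and> b \<in> sets E}"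
    then obtain a b where Q: "Q = a \<times> b" and [measurable]: "a \<in> sets borel" "b \<in> sets E" by auto
    have Sa: "A \<inter> (S -` a \<inter> space (past n)) \<in> sets (past n)"
      using measurable_sets[OF S, of a] A by auto
    have "emeasure ?\<mu> Q = (\<integral>\<^sup>+\<omega>. indicator A \<omega> * indicator Q (S \<omega>, X (Suc n) \<omega>) \<partial>N)"
      by (subst nn_D[symmetric]) (simp_all add: Q)
    also have "\<dots> = (\<integral>\<^sup>+\<omega>. indicator ((A \<inter> (S -` a \<inter> space (past n))) \<inter> {\<omega> \<in> space N. X (Suc n) \<omega> \<in> b}) \<omega> \<partial>N)"
      by (intro nn_integral_cong) (auto simp: Q indicator_def)
    also have "\<dots> = emeasure N ((A \<inter> (S -` a \<inter> space (past n))) \<inter> {\<omega> \<in> space N. X (Suc n) \<omega> \<in> b})"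
      by (rule nn_integral_indicator) simp
    also have "\<dots> = (\<integral>\<^sup>+\<omega>. indicator (A \<inter> (S -` a \<inter> space (past n))) \<omega> * emeasure (P (X n \<omega>)) b \<partial>N)"
      by (rule markov_step[OF Sa]) simp
    also have "\<dots> = (\<integral>\<^sup>+\<omega>. indicator A \<omega> * emeasure (?k (S \<omega>, X n \<omega>)) Q \<partial>N)"
    proof (intro nn_integral_cong)
      fix \<omega> assume \<omega>: "\<omega> \<in> space N"
      have Xs: "X n \<omega> \<in> space E" using measurable_space[OF X \<omega>] .
      have sp: "space (P (X n \<omega>)) = space E" using P_space(2)[OF Xs] by (rule sets_eq_imp_space_eq)
      have m: "(\<lambda>z. (S \<omega>, z)) \<in> P (X n \<omega>) \<rightarrow>\<^sub>M ?BE"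
        using P_space(2)[OF Xs] by (simp cong: measurable_cong_sets)
      have "emeasure (?k (S \<omega>, X n \<omega>)) Q = emeasure (P (X n \<omega>)) ((\<lambda>z. (S \<omega>, z)) -` Q \<inter> space E)"
        using m by (simp add: emeasure_distr sp Q)
      also have "(\<lambda>z. (S \<omega>, z)) -` Q \<inter> space E = (if S \<omega> \<in> a then b else {})"
        using sets.sets_into_space[of b E] by (auto simp: Q)
      finally show "indicator (A \<inter> (S -` a \<inter> space (past n))) \<omega> * emeasure (P (X n \<omega>)) b =
        indicator A \<omega> * emeasure (?k (S \<omega>, X n \<omega>)) Q"
        using \<omega> by (auto simp: indicator_def)
    qed
    also have "\<dots> = emeasure (?b \<bind> ?k) Q"
    proof -
      have [measurable]: "Q \<in> sets ?BE" by (simp add: Q)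
      have [measurable]: "(\<lambda>z. emeasure (?k z) Q) \<in> borel_measurable ?BE"
        by (rule measurable_emeasure_kernel[OF k]) simp
      have "emeasure (?b \<bind> ?k) Q = (\<integral>\<^sup>+z. emeasure (?k z) Q \<partial>?b)"
        by (rule emeasure_bind[OF sp k']) simp
      also have "\<dots> = (\<integral>\<^sup>+\<omega>. indicator A \<omega> * emeasure (?k (S \<omega>, X n \<omega>)) Q \<partial>N)"
        by (rule nn_D) simp_all
      finally show ?thesis ..
    qed
    finally show "emeasure ?\<mu> Q = emeasure (?b \<bind> ?k) Q" .
  qed (auto intro!: exI[of _ "UNIV :: real set"] exI[of _ "space E"])
  then have "(\<integral>\<^sup>+z. \<phi> z \<partial>?\<mu>) = (\<integral>\<^sup>+z. \<phi> z \<partial>(?b \<bind> ?k))" by simp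
  also have "\<dots> = (\<integral>\<^sup>+z. (\<integral>\<^sup>+z'. \<phi> z' \<partial>?k z) \<partial>?b)"
    by (rule nn_integral_bind[OF \<phi> k'])
  also have "\<dots> = (\<integral>\<^sup>+\<omega>. indicator A \<omega> * (\<integral>\<^sup>+z'. \<phi> z' \<partial>?k (S \<omega>, X n \<omega>)) \<partial>N)"
  proof -
    have [measurable]: "(\<lambda>z. \<integral>\<^sup>+z'. \<phi> z' \<partial>?k z) \<in> borel_measurable ?BE"
      by (rule nn_integral_measurable_subprob_algebra2[OF _ k]) simp
    show ?thesis by (rule nn_D) simp_all
  qed
  also have "\<dots> = (\<integral>\<^sup>+\<omega>. indicator A \<omega> * (\<integral>\<^sup>+z. \<phi> (S \<omega>, z) \<partial>P (X n \<omega>)) \<partial>N)"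
  proof (intro nn_integral_cong)
    fix \<omega> assume \<omega>: "\<omega> \<in> space N"
    have Xs: "X n \<omega> \<in> space E" using measurable_space[OF X \<omega>] .
    have m: "(\<lambda>z. (S \<omega>, z)) \<in> P (X n \<omega>) \<rightarrow>\<^sub>M ?BE"
      using P_space(2)[OF Xs] by (simp cong: measurable_cong_sets)
    show "indicator A \<omega> * (\<integral>\<^sup>+z'. \<phi> z' \<partial>?k (S \<omega>, X n \<omega>)) = indicator A \<omega> * (\<integral>\<^sup>+z. \<phi> (S \<omega>, z) \<partial>P (X n \<omega>))"
      using m by (simp add: nn_integral_distr)
  qed
  finally show ?thesis by (simp add: nn_D)
qed

end

text \<open>Integrating the conditional probability over an event \<open>A\<close> of the past gives
  the step identity; the passage between real and extended integrals rests on all quantities being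
  bounded by 1.\<close>

lemma markov_process_markov_chain:
  assumes P: "transition_kernel E P" and M: "markov_chain E P M X"
  shows "markov_process M E P X"
proof -
  interpret prob_space M using M by (simp add: markov_chain_def)
  have X[measurable]: "X n \<in> M \<rightarrow>\<^sub>M E" for n using M by (simp add: markov_chain_def)
  show ?thesis
  proof (unfold_locales; (fact P X)?)
    fix n A B assume A: "A \<in> sets (natural_filtration M E X n)" and B: "B \<in> sets E"
    let ?F = "natural_filtration M E X n"
    have "(\<lambda>\<omega>. \<lambda>i\<in>{..n}. X i \<omega>) \<in> M \<rightarrow>\<^sub>M (\<Pi>\<^sub>M i\<in>{..n}. E)" by (rule measurable_restrict) simp
    then have sub: "subalgebra M ?F"
      unfolding subalgebra_def natural_filtration_def by (simp add: sets_image_in_sets)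
    interpret F: finite_measure_subalgebra M ?F by unfold_locales (rule sub)
    have [measurable]: "A \<in> sets M" using A sub by (auto simp: subalgebra_def)
    let ?I = "{\<omega> \<in> space M. X (Suc n) \<omega> \<in> B}"
    have [measurable]: "?I \<in> sets M" using B by measurable
    have mk: "(\<lambda>\<omega>. measure (P (X n \<omega>)) B) \<in> borel_measurable M"
      unfolding measure_def
      using measurable_compose[OF X measurable_emeasure_kernel[OF measurable_prob_algebraD[OF P] B]]
      by measurable
    have AE: "AE \<omega> in M. real_cond_exp M ?F (indicator ?I) \<omega> = measure (P (X n \<omega>)) B"
      using M B by (simp add: markov_chain_def)
    have "(\<integral>\<omega>\<in>A. indicator ?I \<omega> \<partial>M) = (\<integral>\<omega>\<in>A. real_cond_exp M ?F (indicator ?I) \<omega> \<partial>M)"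
      by (rule F.real_cond_exp_intA[OF _ A]) (simp add: integrable_real_indicator emeasure_eq_measure)
    also have "\<dots> = (\<integral>\<omega>\<in>A. measure (P (X n \<omega>)) B \<partial>M)"
      unfolding set_lebesgue_integral_def using AE mk by (intro integral_cong_AE) auto
    finally have eq: "(\<integral>\<omega>. indicator A \<omega> * indicator ?I \<omega> \<partial>M) = (\<integral>\<omega>. indicator A \<omega> * measure (P (X n \<omega>)) B \<partial>M)"
      by (simp add: set_lebesgue_integral_def)
    have prP: "prob_space (P (X n \<omega>))" if "\<omega> \<in> space M" for \<omega>
      using measurable_space[OF P measurable_space[OF X that]] by (simp add: space_prob_algebra)
    have "emeasure M (A \<inter> ?I) = ennreal (\<integral>\<omega>. indicator A \<omega> * indicator ?I \<omega> \<partial>M)"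
      by (simp add: emeasure_eq_measure indicator_inter_arith[symmetric])
    also have "\<dots> = (\<integral>\<^sup>+\<omega>. ennreal (indicator A \<omega> * measure (P (X n \<omega>)) B) \<partial>M)"
      unfolding eq using mk prob_space.prob_le_1[OF prP]
      by (intro nn_integral_eq_integral[symmetric] integrable_const_bound[where B = 1] AE_I2)
        (auto simp: indicator_def)
    also have "\<dots> = (\<integral>\<^sup>+\<omega>. indicator A \<omega> * emeasure (P (X n \<omega>)) B \<partial>M)"
      by (intro nn_integral_cong)
        (auto simp: ennreal_mult' finite_measure.emeasure_eq_measure prob_space.finite_measure[OF prP] indicator_def)
    finally show "emeasure M (A \<inter> ?I) = (\<integral>\<^sup>+\<omega>. indicator A \<omega> * emeasure (P (X n \<omega>)) B \<partial>M)" .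
  qed
qed

text \<open>The law of the first \<open>k\<close> coordinates is \<open>IT.C 0 k\<close>, and
  \<open>IT.C 0 (Suc k)\<close> arises from it by one application of \<open>path_kernel\<close>,
  which for \<open>k \<ge> 1\<close> looks at the last coordinate only. The Markov property at time
  \<open>n\<close> is this recursion at \<open>k = Suc n\<close>; at \<open>k = 0\<close> it gives
  the initial point mass.\<close>

lemma markov_process_path_law:
  assumes P: "transition_kernel E P" and x: "x \<in> space E"
  shows "markov_process (path_law E P x) E P (\<lambda>n w. w n)" "distr (path_law E P x) E (\<lambda>w. w 0) = return E x"
    "space (path_law E P x) = space (\<Pi>\<^sub>M i\<in>UNIV. E)"
proof -
  interpret IT: Ionescu_Tulcea "path_kernel E P x" "\<lambda>_. E"
    by (rule Ionescu_Tulcea_path_kernel[OF P x])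
  let ?L = "path_law E P x" and ?u = "\<lambda>_. undefined :: 'a"
  have L: "?L = IT.PF.lim" by (simp add: path_law_def)
  have sets_L: "sets ?L = sets (\<Pi>\<^sub>M i\<in>UNIV. E)" by (simp add: L)
  show space_L: "space ?L = space (\<Pi>\<^sub>M i\<in>UNIV. E)" by (rule sets_eq_imp_space_eq[OF sets_L])
  have u: "?u \<in> space (\<Pi>\<^sub>M i\<in>{0..<0::nat}. E)" by (simp add: space_PiM PiE_iff)
  have fd: "emeasure ?L (prod_emb UNIV (\<lambda>_. E) {0..<k} A) = emeasure (IT.C 0 k ?u) A"
    if A: "A \<in> sets (\<Pi>\<^sub>M i\<in>{0..<k}. E)" for A k
  proof -
    have "emeasure ?L (prod_emb UNIV (\<lambda>_. E) {0..<k} A) = emeasure (IT.CI {0..<k}) A"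
      unfolding L by (rule IT.lim[OF _ A]) simp
    also have "\<dots> = emeasure (IT.C 0 k ?u) (prod_emb {0..<k} (\<lambda>_. E) {0..<k} A)"
      by (rule IT.emeasure_CI[OF _ A]) simp
    also have "prod_emb {0..<k} (\<lambda>_. E) {0..<k} A = A"
      using sets.sets_into_space[OF A] by (auto simp: prod_emb_def space_PiM PiE_restrict subset_iff)
    finally show ?thesis .
  qed
  interpret L: prob_space ?L
  proof
    have "emeasure ?L (prod_emb UNIV (\<lambda>_. E) {0..<0} (space (\<Pi>\<^sub>M i\<in>{0..<0}. E))) = 1"
      unfolding fd[OF sets.top] using prob_space.emeasure_space_1[OF IT.prob_space_C[OF u, of 0]]
      by (simp add: space_PiM)
    moreover have "prod_emb UNIV (\<lambda>_. E) {0..<0} (space (\<Pi>\<^sub>M i\<in>{0..<0}. E)) = space ?L"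
      by (auto simp: prod_emb_def space_L space_PiM)
    ultimately show "emeasure ?L (space ?L) = 1" by simp
  qed
  have X[measurable]: "(\<lambda>w. w n) \<in> ?L \<rightarrow>\<^sub>M E" for n
    unfolding measurable_cong_sets[OF sets_L refl] by simp
  have fd1: "emeasure (IT.C 0 (Suc k) ?u) A = (\<integral>\<^sup>+w. emeasure (path_kernel E P x k w) ((\<lambda>z. w(k := z)) -` A \<inter> space E) \<partial>IT.C 0 k ?u)"
    if A: "A \<in> sets (\<Pi>\<^sub>M i\<in>{0..<Suc k}. E)" for A k
  proof -
    have sp: "space (IT.C 0 k ?u) = space (\<Pi>\<^sub>M i\<in>{0..<k}. E)" using IT.space_C[OF u, of k] by simp
    have "emeasure (IT.C 0 (Suc k) ?u) A = (\<integral>\<^sup>+w. emeasure (IT.eP k w) A \<partial>IT.C 0 k ?u)"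
    proof -
      have "IT.eP k \<in> IT.C 0 k ?u \<rightarrow>\<^sub>M subprob_algebra (\<Pi>\<^sub>M i\<in>{0..<Suc k}. E)"
      proof -
        have "sets (IT.C 0 k ?u) = sets (\<Pi>\<^sub>M i\<in>{0..<k}. E)" using IT.sets_C[OF u, of k] by simp
        then show ?thesis by (subst measurable_cong_sets[OF _ refl]) (auto intro: IT.measurable_eP)
      qed
      moreover have "space (IT.C 0 k ?u) \<noteq> {}"
        using prob_space.not_empty[OF IT.prob_space_C[OF u, of k]] .
      ultimately show ?thesis using A by (simp add: emeasure_bind)
    qed
    also have "\<dots> = (\<integral>\<^sup>+w. emeasure (path_kernel E P x k w) ((\<lambda>z. w(k := z)) -` A \<inter> space E) \<partial>IT.C 0 k ?u)"
      by (intro nn_integral_cong IT.emeasure_eP A) (simp add: sp)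
    finally show ?thesis .
  qed
  show "markov_process ?L E P (\<lambda>n w. w n)"
  proof (unfold_locales; (fact P X)?)
    fix n A B assume A: "A \<in> sets (natural_filtration ?L E (\<lambda>n w. w n) n)" and B: "B \<in> sets E"
    have J: "{..n} = {0..<Suc n}" by auto
    have "(\<lambda>w. \<lambda>i\<in>{..n}. w i) \<in> space ?L \<rightarrow> space (\<Pi>\<^sub>M i\<in>{..n}. E)"
      by (auto simp: space_L space_PiM PiE_iff)
    then obtain A' where A': "A' \<in> sets (\<Pi>\<^sub>M i\<in>{0..<Suc n}. E)" and AA: "A = (\<lambda>w. \<lambda>i\<in>{..n}. w i) -` A' \<inter> space ?L"
      using A unfolding natural_filtration_def by (auto simp: sets_vimage_algebra2 J)
    have A_emb: "A = prod_emb UNIV (\<lambda>_. E) {0..<Suc n} A'"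
      by (simp add: AA prod_emb_def space_L space_PiM J)
    \<comment> \<open>The event together with the next step, seen in the first \<open>n + 2\<close>
      coordinates; its section over a past \<open>w\<close> is \<open>B\<close> or empty, according
      to whether \<open>w\<close> lies in \<open>A'\<close>.\<close>
    define D where "D = {w \<in> space (\<Pi>\<^sub>M i\<in>{0..<Suc (Suc n)}. E). restrict w {0..<Suc n} \<in> A' \<and> w (Suc n) \<in> B}"
    have D: "D \<in> sets (\<Pi>\<^sub>M i\<in>{0..<Suc (Suc n)}. E)"
    proof -
      have "(\<lambda>w. restrict w {0..<Suc n}) \<in> (\<Pi>\<^sub>M i\<in>{0..<Suc (Suc n)}. E) \<rightarrow>\<^sub>M (\<Pi>\<^sub>M i\<in>{0..<Suc n}. E)"
        by (rule measurable_restrict_subset) auto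
      then have "D = ((\<lambda>w. restrict w {0..<Suc n}) -` A' \<inter> space (\<Pi>\<^sub>M i\<in>{0..<Suc (Suc n)}. E)) \<inter> ((\<lambda>w. w (Suc n)) -` B \<inter> space (\<Pi>\<^sub>M i\<in>{0..<Suc (Suc n)}. E))"
        by (auto simp: D_def)
      also have "\<dots> \<in> sets (\<Pi>\<^sub>M i\<in>{0..<Suc (Suc n)}. E)"
        by (intro sets.Int measurable_sets[OF measurable_restrict_subset] measurable_sets[OF measurable_component_singleton] A' B) auto
      finally show ?thesis .
    qed
    have emb: "A \<inter> {w \<in> space ?L. w (Suc n) \<in> B} = prod_emb UNIV (\<lambda>_. E) {0..<Suc (Suc n)} D"
    proof -
      have "{0..<Suc (Suc n)} \<inter> {0..<Suc n} = {0..<Suc n}" by auto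
      then show ?thesis
        by (auto simp: A_emb prod_emb_def D_def space_L space_PiM PiE_iff)
    qed
    have spC: "space (IT.C 0 (Suc n) ?u) = space (\<Pi>\<^sub>M i\<in>{0..<Suc n}. E)"
      using IT.space_C[OF u, of "Suc n"] by simp
    have setsC: "sets (IT.C 0 (Suc n) ?u) = sets (\<Pi>\<^sub>M i\<in>{0..<Suc n}. E)"
      using IT.sets_C[OF u, of "Suc n"] by simp
    have mP: "(\<lambda>y. emeasure (P y) B) \<in> borel_measurable E"
      by (rule measurable_emeasure_kernel[OF measurable_prob_algebraD[OF P] B])
    have "emeasure ?L (A \<inter> {w \<in> space ?L. w (Suc n) \<in> B}) =
      (\<integral>\<^sup>+w. emeasure (path_kernel E P x (Suc n) w) ((\<lambda>z. w(Suc n := z)) -` D \<inter> space E) \<partial>IT.C 0 (Suc n) ?u)"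
      unfolding emb fd[OF D] by (rule fd1[OF D])
    also have "\<dots> = (\<integral>\<^sup>+w. indicator A' w * emeasure (P (w n)) B \<partial>IT.C 0 (Suc n) ?u)"
    proof (rule nn_integral_cong)
      fix w assume "w \<in> space (IT.C 0 (Suc n) ?u)"
      then have w: "w \<in> space (\<Pi>\<^sub>M i\<in>{0..<Suc n}. E)" by (simp add: spC del: IT.C.simps)
      have r: "restrict (w(Suc n := z)) {0..<Suc n} = w" for z
        using w by (auto simp: space_PiM PiE_iff extensional_def fun_eq_iff)
      have s: "w(Suc n := z) \<in> space (\<Pi>\<^sub>M i\<in>{0..<Suc (Suc n)}. E)" if "z \<in> space E" for z
        using w that by (auto simp: space_PiM PiE_iff extensional_def)
      have "(\<lambda>z. w(Suc n := z)) -` D \<inter> space E = (if w \<in> A' then B else {})"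
        using sets.sets_into_space[OF B] s by (auto simp: D_def r)
      then show "emeasure (path_kernel E P x (Suc n) w) ((\<lambda>z. w(Suc n := z)) -` D \<inter> space E) = indicator A' w * emeasure (P (w n)) B"
        by (simp add: path_kernel_def)
    qed
    also have "\<dots> = (\<integral>\<^sup>+w. indicator A' w * emeasure (P (w n)) B \<partial>distr ?L (\<Pi>\<^sub>M i\<in>{0..<Suc n}. E) (\<lambda>w. restrict w {0..<Suc n}))"
    proof -
      have "IT.C 0 (Suc n) ?u = distr ?L (\<Pi>\<^sub>M i\<in>{0..<Suc n}. E) (\<lambda>w. restrict w {0..<Suc n})"
      proof (rule measure_eqI)
        show "sets (IT.C 0 (Suc n) ?u) = sets (distr ?L (\<Pi>\<^sub>M i\<in>{0..<Suc n}. E) (\<lambda>w. restrict w {0..<Suc n}))"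
          by (simp add: setsC del: IT.C.simps)
        fix Q assume "Q \<in> sets (IT.C 0 (Suc n) ?u)"
        then have Q: "Q \<in> sets (\<Pi>\<^sub>M i\<in>{0..<Suc n}. E)" by (simp add: setsC del: IT.C.simps)
        have "(\<lambda>w. restrict w {0..<Suc n}) \<in> ?L \<rightarrow>\<^sub>M (\<Pi>\<^sub>M i\<in>{0..<Suc n}. E)"
          unfolding measurable_cong_sets[OF sets_L refl] by (rule measurable_restrict_subset) simp
        then show "emeasure (IT.C 0 (Suc n) ?u) Q = emeasure (distr ?L (\<Pi>\<^sub>M i\<in>{0..<Suc n}. E) (\<lambda>w. restrict w {0..<Suc n})) Q"
          using Q by (simp add: emeasure_distr fd[OF Q, symmetric] prod_emb_def space_L space_PiM del: IT.C.simps)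
      qed
      then show ?thesis by simp
    qed
    also have "\<dots> = (\<integral>\<^sup>+w. indicator A' (restrict w {0..<Suc n}) * emeasure (P (w n)) B \<partial>?L)"
    proof -
      have m: "(\<lambda>w. restrict w {0..<Suc n}) \<in> ?L \<rightarrow>\<^sub>M (\<Pi>\<^sub>M i\<in>{0..<Suc n}. E)"
        unfolding measurable_cong_sets[OF sets_L refl] by (rule measurable_restrict_subset) simp
      have "(\<lambda>w. w n) \<in> (\<Pi>\<^sub>M i\<in>{0..<Suc n}. E) \<rightarrow>\<^sub>M E" by (rule measurable_component_singleton) simp
      from measurable_compose[OF this mP]
      have "(\<lambda>w. indicator A' w * emeasure (P (w n)) B) \<in> borel_measurable (\<Pi>\<^sub>M i\<in>{0..<Suc n}. E)"
        using A' by measurable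
      then show ?thesis by (subst nn_integral_distr[OF m]) simp_all
    qed
    also have "\<dots> = (\<integral>\<^sup>+w. indicator A w * emeasure (P (w n)) B \<partial>?L)"
      by (intro nn_integral_cong) (auto simp: AA indicator_def J)
    finally show "emeasure ?L (A \<inter> {w \<in> space ?L. w (Suc n) \<in> B}) = (\<integral>\<^sup>+w. indicator A w * emeasure (P (w n)) B \<partial>?L)" .
  qed
  show "distr ?L E (\<lambda>w. w 0) = return E x"
  proof (rule measure_eqI)
    fix B assume "B \<in> sets (distr ?L E (\<lambda>w. w 0))"
    then have B: "B \<in> sets E" by simp
    define D where "D = (\<lambda>w. w 0) -` B \<inter> space (\<Pi>\<^sub>M i\<in>{0..<Suc 0}. E)"
    have D: "D \<in> sets (\<Pi>\<^sub>M i\<in>{0..<Suc 0}. E)"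
      unfolding D_def by (rule measurable_sets[OF measurable_component_singleton[of 0 "{0..<Suc 0}" "\<lambda>_. E"] B]) simp
    have emb: "(\<lambda>w. w 0) -` B \<inter> space ?L = prod_emb UNIV (\<lambda>_. E) {0..<Suc 0} D"
      by (auto simp: prod_emb_def D_def space_L space_PiM PiE_iff)
    have "emeasure (distr ?L E (\<lambda>w. w 0)) B = emeasure ?L ((\<lambda>w. w 0) -` B \<inter> space ?L)"
      using B by (intro emeasure_distr) auto
    also have "\<dots> = emeasure (IT.C 0 (Suc 0) ?u) D"
      unfolding emb by (rule fd[OF D])
    also have "\<dots> = (\<integral>\<^sup>+w. emeasure (path_kernel E P x 0 w) ((\<lambda>z. w(0 := z)) -` D \<inter> space E) \<partial>IT.C 0 0 ?u)"
      by (rule fd1[OF D])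
    also have "\<dots> = (\<integral>\<^sup>+w. indicator B x \<partial>IT.C 0 0 ?u)"
    proof (rule nn_integral_cong)
      fix w assume "w \<in> space (IT.C 0 0 ?u)"
      then have "w \<in> space (\<Pi>\<^sub>M i\<in>{0..<0::nat}. E)" by simp
      then have "(\<lambda>z. w(0 := z)) -` D \<inter> space E = B"
        using sets.sets_into_space[OF B] by (auto simp: D_def space_PiM PiE_iff extensional_def)
      then show "emeasure (path_kernel E P x 0 w) ((\<lambda>z. w(0 := z)) -` D \<inter> space E) = indicator B x"
        using B by (simp add: path_kernel_def)
    qed
    also have "\<dots> = indicator B x"
      using prob_space.emeasure_space_1[OF IT.prob_space_C[OF u, of 0]] by simp
    finally show "emeasure (distr ?L E (\<lambda>w. w 0)) B = emeasure (return E x) B" using B by simp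
  qed simp
qed

text \<open>The probability, from \<open>y\<close>, of staying outside \<alpha> at times 1 to
  \<open>m\<close>. Written as a recursion in the kernel, it does not refer to any process and so
  links the given chain with \<open>path_law\<close>.\<close>

primrec avoid_prob :: "('e \<Rightarrow> 'e measure) \<Rightarrow> 'e set \<Rightarrow> nat \<Rightarrow> 'e \<Rightarrow> ennreal" where
  "avoid_prob P \<alpha> 0 y = 1"
| "avoid_prob P \<alpha> (Suc m) y = (\<integral>\<^sup>+z. indicator (- \<alpha>) z * avoid_prob P \<alpha> m z \<partial>P y)"

text \<open>Started at \<open>y\<close>, the probability that the first visit to \<open>\<alpha>\<close> after time 0 happens at time
  \<open>Suc m\<close> and that \<open>s\<close> plus the sum of \<open>f\<close> along the excursion lies in \<open>B\<close>.\<close>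

primrec excursion_prob ::
  "('e \<Rightarrow> 'e measure) \<Rightarrow> 'e set \<Rightarrow> ('e \<Rightarrow> real) \<Rightarrow> real set \<Rightarrow> nat \<Rightarrow> real \<Rightarrow> 'e \<Rightarrow> ennreal" where
  "excursion_prob P \<alpha> f B 0 s y = (\<integral>\<^sup>+z. indicator \<alpha> z * indicator B (s + f z) \<partial>P y)"
| "excursion_prob P \<alpha> f B (Suc m) s y = (\<integral>\<^sup>+z. indicator (- \<alpha>) z * excursion_prob P \<alpha> f B m (s + f z) z \<partial>P y)"

locale markov_process_atom = markov_process N E P X
  for N :: "'w measure" and E :: "'e measure" and P X +
  fixes \<alpha> :: "'e set" and f :: "'e \<Rightarrow> real"
  assumes \<alpha>[measurable]: "\<alpha> \<in> sets E" and f[measurable]: "f \<in> borel_measurable E"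
    and atom: "\<And>x y. x \<in> \<alpha> \<Longrightarrow> y \<in> \<alpha> \<Longrightarrow> P x = P y"
begin

lemma avoid_prob_measurable [measurable]: "avoid_prob P \<alpha> m \<in> borel_measurable E"
proof (induction m)
  case (Suc m)
  note Suc[measurable]
  have "(\<lambda>y. \<integral>\<^sup>+z. indicator (- \<alpha>) z * avoid_prob P \<alpha> m z \<partial>P y) \<in> borel_measurable E"
    by (rule measurable_compose[OF subprob_P nn_integral_measurable_subprob_algebra]) measurable
  then show ?case by simp
qed simp

lemma avoid_prob_le_1: "y \<in> space E \<Longrightarrow> avoid_prob P \<alpha> m y \<le> 1"
proof (induction m arbitrary: y)
  case (Suc m)
  interpret Py: prob_space "P y" by (rule P_space(1)[OF Suc.prems])
  have "space (P y) = space E" by (rule sets_eq_imp_space_eq[OF P_space(2)[OF Suc.prems]])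
  then have "(\<integral>\<^sup>+z. indicator (- \<alpha>) z * avoid_prob P \<alpha> m z \<partial>P y) \<le> (\<integral>\<^sup>+z. 1 \<partial>P y)"
    using Suc.IH by (intro nn_integral_mono) (simp add: indicator_def)
  then show ?case by (simp add: Py.emeasure_space_1)
qed simp

lemma excursion_prob_measurable [measurable]:
  assumes [measurable]: "B \<in> sets borel"
  shows "(\<lambda>(s, y). excursion_prob P \<alpha> f B m s y) \<in> borel_measurable (borel \<Otimes>\<^sub>M E)"
proof (induction m)
  case 0
  have "(\<lambda>x. \<integral>\<^sup>+z. indicator \<alpha> z * indicator B (fst x + f z) \<partial>P (snd x)) \<in> borel_measurable (borel \<Otimes>\<^sub>M E)"
    by (rule nn_integral_measurable_subprob_algebra2[where N = E]) measurable
  then show ?case by (simp add: split_beta')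
next
  case (Suc m)
  note Suc[measurable]
  have "(\<lambda>x. \<integral>\<^sup>+z. indicator (- \<alpha>) z * (\<lambda>(s, y). excursion_prob P \<alpha> f B m s y) (fst x + f z, z) \<partial>P (snd x)) \<in> borel_measurable (borel \<Otimes>\<^sub>M E)"
    by (rule nn_integral_measurable_subprob_algebra2[where N = E]) measurable
  then show ?case by (simp add: split_beta')
qed

lemma excursion_prob_atom: "x \<in> \<alpha> \<Longrightarrow> y \<in> \<alpha> \<Longrightarrow> excursion_prob P \<alpha> f B m s x = excursion_prob P \<alpha> f B m s y"
  using atom[of x y] by (cases m) simp_all

lemma avoid_prob_atom: "x \<in> \<alpha> \<Longrightarrow> y \<in> \<alpha> \<Longrightarrow> avoid_prob P \<alpha> m x = avoid_prob P \<alpha> m y"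
  using atom[of x y] by (cases m) simp_all

lemma past_visit: "i \<le> n \<Longrightarrow> {\<omega> \<in> space N. X i \<omega> \<in> \<alpha>} \<in> sets (past n)"
  using measurable_sets[OF X_past \<alpha>, of i n] by (simp add: vimage_def Int_def conj_commute)

lemma past_avoid: "i \<le> n \<Longrightarrow> {\<omega> \<in> space N. X i \<omega> \<notin> \<alpha>} \<in> sets (past n)"
proof -
  assume "i \<le> n"
  then have "space (past n) - {\<omega> \<in> space N. X i \<omega> \<in> \<alpha>} \<in> sets (past n)"
    by (intro sets.compl_sets past_visit)
  also have "space (past n) - {\<omega> \<in> space N. X i \<omega> \<in> \<alpha>} = {\<omega> \<in> space N. X i \<omega> \<notin> \<alpha>}" by auto
  finally show ?thesis .
qed

text \<open>The requirement at time \<open>Suc n\<close> joins \<open>A\<close> as an event of the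
  past one step later; the Markov step then pulls the integrand back from \<open>X (Suc n)\<close>
  to \<open>X n\<close>.\<close>

lemma emeasure_avoid:
  assumes "A \<in> sets (past n)"
  shows "emeasure N (A \<inter> {\<omega> \<in> space N. \<forall>i\<in>{n<..n + m}. X i \<omega> \<notin> \<alpha>}) = (\<integral>\<^sup>+\<omega>. indicator A \<omega> * avoid_prob P \<alpha> m (X n \<omega>) \<partial>N)"
  using assms
proof (induction m arbitrary: n A)
  case 0
  then have "A \<in> sets N" using past_subset by auto
  then show ?case using sets.sets_into_space[of A N] by (simp add: Int_absorb2)
next
  case (Suc m)
  let ?A = "A \<inter> {\<omega> \<in> space N. X (Suc n) \<omega> \<notin> \<alpha>}"
  have A': "?A \<in> sets (past (Suc n))"
    using Suc.prems past_mono[of n "Suc n"] past_avoid[of "Suc n" "Suc n"] by auto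
  have "{n<..n + Suc m} = insert (Suc n) {Suc n<..Suc n + m}" by auto
  then have "A \<inter> {\<omega> \<in> space N. \<forall>i\<in>{n<..n + Suc m}. X i \<omega> \<notin> \<alpha>} = ?A \<inter> {\<omega> \<in> space N. \<forall>i\<in>{Suc n<..Suc n + m}. X i \<omega> \<notin> \<alpha>}"
    by auto
  then have "emeasure N (A \<inter> {\<omega> \<in> space N. \<forall>i\<in>{n<..n + Suc m}. X i \<omega> \<notin> \<alpha>}) = (\<integral>\<^sup>+\<omega>. indicator ?A \<omega> * avoid_prob P \<alpha> m (X (Suc n) \<omega>) \<partial>N)"
    using Suc.IH[OF A'] by simp
  also have "\<dots> = (\<integral>\<^sup>+\<omega>. indicator A \<omega> * (\<lambda>(s, z). indicator (- \<alpha>) z * avoid_prob P \<alpha> m z) (0 :: real, X (Suc n) \<omega>) \<partial>N)"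
    by (intro nn_integral_cong) (auto simp: indicator_def)
  also have "\<dots> = (\<integral>\<^sup>+\<omega>. indicator A \<omega> * (\<integral>\<^sup>+z. (\<lambda>(s, z). indicator (- \<alpha>) z * avoid_prob P \<alpha> m z) (0 :: real, z) \<partial>P (X n \<omega>)) \<partial>N)"
    by (rule nn_integral_markov_step[where S = "\<lambda>_. 0", OF Suc.prems]) measurable
  finally show ?case by simp
qed

text \<open>The offset \<open>S\<close> is arbitrary and known at time \<open>n\<close> so that the
  induction can move the first summand into it: \<open>S \<omega> + f (X (Suc n) \<omega>)\<close>
  is known one step later.\<close>

lemma emeasure_excursion:
  assumes "A \<in> sets (past n)" "S \<in> borel_measurable (past n)" "B \<in> sets borel"
  shows "emeasure N (A \<inter> {\<omega> \<in> space N. (\<forall>i\<in>{n<..n + m}. X i \<omega> \<notin> \<alpha>) \<and> X (Suc (n + m)) \<omega> \<in> \<alpha> \<and>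
      S \<omega> + (\<Sum>i\<in>{n<..Suc (n + m)}. f (X i \<omega>)) \<in> B})
    = (\<integral>\<^sup>+\<omega>. indicator A \<omega> * excursion_prob P \<alpha> f B m (S \<omega>) (X n \<omega>) \<partial>N)"
  using assms
proof (induction m arbitrary: n A S)
  case 0
  note [measurable] = past_measurable[OF 0(2)] 0(3)
  have [measurable]: "A \<in> sets N" using 0 past_subset by auto
  have eq: "{n<..Suc (n + 0)} = {Suc n}" by auto
  have "(\<integral>\<^sup>+\<omega>. indicator A \<omega> * excursion_prob P \<alpha> f B 0 (S \<omega>) (X n \<omega>) \<partial>N) =
    (\<integral>\<^sup>+\<omega>. indicator A \<omega> * (\<integral>\<^sup>+z. (\<lambda>(s, z). indicator \<alpha> z * indicator B (s + f z)) (S \<omega>, z) \<partial>P (X n \<omega>)) \<partial>N)"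
    by simp
  also have "\<dots> = (\<integral>\<^sup>+\<omega>. indicator A \<omega> * (\<lambda>(s, z). indicator \<alpha> z * indicator B (s + f z)) (S \<omega>, X (Suc n) \<omega>) \<partial>N)"
    by (rule nn_integral_markov_step[OF 0(1,2), symmetric]) measurable
  also have "\<dots> = (\<integral>\<^sup>+\<omega>. indicator (A \<inter> {\<omega> \<in> space N. (\<forall>i\<in>{n<..n + 0}. X i \<omega> \<notin> \<alpha>) \<and> X (Suc (n + 0)) \<omega> \<in> \<alpha> \<and>
      S \<omega> + (\<Sum>i\<in>{n<..Suc (n + 0)}. f (X i \<omega>)) \<in> B}) \<omega> \<partial>N)"
    unfolding eq by (intro nn_integral_cong) (auto simp: indicator_def)
  also have "\<dots> = emeasure N (A \<inter> {\<omega> \<in> space N. (\<forall>i\<in>{n<..n + 0}. X i \<omega> \<notin> \<alpha>) \<and> X (Suc (n + 0)) \<omega> \<in> \<alpha> \<and>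
      S \<omega> + (\<Sum>i\<in>{n<..Suc (n + 0)}. f (X i \<omega>)) \<in> B})"
    by (rule nn_integral_indicator) measurable
  finally show ?case ..
next
  case (Suc m)
  note [measurable] = past_measurable[OF Suc(3)] Suc(4)
  let ?A = "A \<inter> {\<omega> \<in> space N. X (Suc n) \<omega> \<notin> \<alpha>}"
  let ?S = "\<lambda>\<omega>. S \<omega> + f (X (Suc n) \<omega>)"
  have A': "?A \<in> sets (past (Suc n))"
    using Suc.prems past_mono[of n "Suc n"] past_avoid[of "Suc n" "Suc n"] by auto
  have S': "?S \<in> borel_measurable (past (Suc n))"
    using past_measurable_mono[OF _ Suc(3), of "Suc n"] measurable_compose[OF X_past f, of "Suc n" "Suc n"] by simp
  have 1: "{n<..n + Suc m} = insert (Suc n) {Suc n<..Suc n + m}" by auto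
  have 2: "{n<..Suc (n + Suc m)} = insert (Suc n) {Suc n<..Suc (Suc n + m)}" by auto
  have "A \<inter> {\<omega> \<in> space N. (\<forall>i\<in>{n<..n + Suc m}. X i \<omega> \<notin> \<alpha>) \<and> X (Suc (n + Suc m)) \<omega> \<in> \<alpha> \<and>
      S \<omega> + (\<Sum>i\<in>{n<..Suc (n + Suc m)}. f (X i \<omega>)) \<in> B} =
    ?A \<inter> {\<omega> \<in> space N. (\<forall>i\<in>{Suc n<..Suc n + m}. X i \<omega> \<notin> \<alpha>) \<and> X (Suc (Suc n + m)) \<omega> \<in> \<alpha> \<and>
      ?S \<omega> + (\<Sum>i\<in>{Suc n<..Suc (Suc n + m)}. f (X i \<omega>)) \<in> B}"
    unfolding 1 2 by (auto simp: add.assoc)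
  then have "emeasure N (A \<inter> {\<omega> \<in> space N. (\<forall>i\<in>{n<..n + Suc m}. X i \<omega> \<notin> \<alpha>) \<and> X (Suc (n + Suc m)) \<omega> \<in> \<alpha> \<and>
      S \<omega> + (\<Sum>i\<in>{n<..Suc (n + Suc m)}. f (X i \<omega>)) \<in> B}) =
    (\<integral>\<^sup>+\<omega>. indicator ?A \<omega> * excursion_prob P \<alpha> f B m (?S \<omega>) (X (Suc n) \<omega>) \<partial>N)"
    using Suc.IH[OF A' S' Suc(4)] by simp
  also have "\<dots> = (\<integral>\<^sup>+\<omega>. indicator A \<omega> * (\<lambda>(s, z). indicator (- \<alpha>) z * (\<lambda>(s, y). excursion_prob P \<alpha> f B m s y) (s + f z, z)) (S \<omega>, X (Suc n) \<omega>) \<partial>N)"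
    by (intro nn_integral_cong) (auto simp: indicator_def)
  also have "\<dots> = (\<integral>\<^sup>+\<omega>. indicator A \<omega> * (\<integral>\<^sup>+z. (\<lambda>(s, z). indicator (- \<alpha>) z * (\<lambda>(s, y). excursion_prob P \<alpha> f B m s y) (s + f z, z)) (S \<omega>, z) \<partial>P (X n \<omega>)) \<partial>N)"
    by (rule nn_integral_markov_step[OF Suc(2,3)]) measurable
  finally show ?case by simp
qed

end

lemma markov_process_atom_path_law:
  assumes "markov_process_atom N E P X \<alpha> f" "x \<in> space E"
  shows "markov_process_atom (path_law E P x) E P (\<lambda>n w. w n) \<alpha> f"
proof -
  interpret markov_process_atom N E P X \<alpha> f by fact
  show ?thesis
    unfolding markov_process_atom_def markov_process_atom_axioms_def
    using markov_process_path_law(1)[OF P assms(2)] \<alpha> f atom by blast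
qed

context markov_process_atom
begin

lemma avoid_prob_path_law:
  assumes x: "x \<in> space E"
  shows "avoid_prob P \<alpha> m x = emeasure (path_law E P x) {w \<in> space (path_law E P x). \<forall>i\<in>{0<..m}. w i \<notin> \<alpha>}"
proof -
  interpret L: markov_process_atom "path_law E P x" E P "\<lambda>n w. w n" \<alpha> f
    using markov_process_atom_axioms x by (rule markov_process_atom_path_law)
  have "space (path_law E P x) \<in> sets (L.past 0)"
    using sets.top[of "L.past 0"] by simp
  from L.emeasure_avoid[OF this, of m]
  have "emeasure (path_law E P x) {w \<in> space (path_law E P x). \<forall>i\<in>{0<..m}. w i \<notin> \<alpha>} =
    (\<integral>\<^sup>+w. indicator (space (path_law E P x)) w * avoid_prob P \<alpha> m (w 0) \<partial>path_law E P x)"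
    by (simp add: Int_def conj_ac cong: conj_cong)
  also have "\<dots> = (\<integral>\<^sup>+w. avoid_prob P \<alpha> m (w 0) \<partial>path_law E P x)"
    by (intro nn_integral_cong) simp
  also have "\<dots> = (\<integral>\<^sup>+y. avoid_prob P \<alpha> m y \<partial>distr (path_law E P x) E (\<lambda>w. w 0))"
    by (subst nn_integral_distr) (auto intro: L.X)
  also have "\<dots> = avoid_prob P \<alpha> m x"
    unfolding markov_process_path_law(2)[OF P x] using x by (subst nn_integral_return) auto
  finally show ?thesis ..
qed

lemma avoid_prob_tendsto_0:
  assumes x: "x \<in> space E" and io: "AE w in path_law E P x. \<exists>\<^sub>\<infinity>n. w n \<in> \<alpha>"
  shows "(\<lambda>m. avoid_prob P \<alpha> m x) \<longlonglongrightarrow> 0"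
proof -
  let ?L = "path_law E P x"
  interpret L: markov_process_atom ?L E P "\<lambda>n w. w n" \<alpha> f
    using markov_process_atom_axioms x by (rule markov_process_atom_path_law)
  let ?A = "\<lambda>m. {w \<in> space ?L. \<forall>i\<in>{0<..m}. w i \<notin> \<alpha>}"
  have [measurable]: "?A m \<in> sets ?L" for m by measurable
  have "(\<lambda>m. emeasure ?L (?A m)) \<longlonglongrightarrow> emeasure ?L (\<Inter>m. ?A m)"
    by (rule Lim_emeasure_decseq) (auto simp: decseq_def)
  also have "emeasure ?L (\<Inter>m. ?A m) = 0"
  proof -
    have "(\<Inter>m. ?A m) = {w \<in> space ?L. \<forall>m. w \<in> ?A m}" by auto
    moreover have "AE w in ?L. \<not> (\<forall>m. w \<in> ?A m)"
      using io
    proof eventually_elim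
      case (elim w)
      then obtain n where "n > 0" "w n \<in> \<alpha>" unfolding INFM_nat by blast
      then show ?case by force
    qed
    ultimately show ?thesis by (simp only: emeasure_eq_0_AE)
  qed
  finally show ?thesis by (simp add: avoid_prob_path_law[OF x])
qed

text \<open>The hypothesis speaks of trajectories from fixed points, the conclusion of a chain with
  any initial law. \<open>avoid_prob\<close> bridges them: the probability of no visit after
  \<open>n\<close> is at most the mean of \<open>avoid_prob P \<alpha> m (X n \<omega>)\<close>,
  which tends to 0 by dominated convergence.\<close>

lemma AE_visits:
  assumes io: "\<And>x. x \<in> space E \<Longrightarrow> AE w in path_law E P x. \<exists>\<^sub>\<infinity>n. w n \<in> \<alpha>"
  shows "AE \<omega> in N. \<forall>n. \<exists>i>n. X i \<omega> \<in> \<alpha>"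
  unfolding AE_all_countable
proof
  fix n
  let ?A = "{\<omega> \<in> space N. \<forall>i>n. X i \<omega> \<notin> \<alpha>}"
  have [measurable]: "?A \<in> sets N"
  proof -
    have "?A = {\<omega> \<in> space N. \<forall>i\<in>{n<..}. \<not> X i \<omega> \<in> \<alpha>}" by auto
    also have "\<dots> \<in> sets N" by measurable
    finally show ?thesis .
  qed
  have top: "space N \<in> sets (past n)" using sets.top[of "past n"] by simp
  have le: "emeasure N ?A \<le> (\<integral>\<^sup>+\<omega>. avoid_prob P \<alpha> m (X n \<omega>) \<partial>N)" for m
  proof -
    have "emeasure N ?A \<le> emeasure N (space N \<inter> {\<omega> \<in> space N. \<forall>i\<in>{n<..n + m}. X i \<omega> \<notin> \<alpha>})"
    proof (rule emeasure_mono)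
      have "space N \<inter> {\<omega> \<in> space N. \<forall>i\<in>{n<..n + m}. X i \<omega> \<notin> \<alpha>} = {\<omega> \<in> space N. \<forall>i\<in>{n<..n + m}. \<not> X i \<omega> \<in> \<alpha>}" by auto
      also have "\<dots> \<in> sets N" by measurable
      finally show "space N \<inter> {\<omega> \<in> space N. \<forall>i\<in>{n<..n + m}. X i \<omega> \<notin> \<alpha>} \<in> sets N" .
    qed auto
    also have "\<dots> = (\<integral>\<^sup>+\<omega>. avoid_prob P \<alpha> m (X n \<omega>) \<partial>N)"
      by (subst emeasure_avoid[OF top]) (auto intro!: nn_integral_cong)
    finally show ?thesis .
  qed
  have "(\<lambda>m. \<integral>\<^sup>+\<omega>. avoid_prob P \<alpha> m (X n \<omega>) \<partial>N) \<longlonglongrightarrow> (\<integral>\<^sup>+\<omega>. 0 \<partial>N)"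
  proof (rule nn_integral_dominated_convergence[where w = "\<lambda>_. 1"])
    show "AE \<omega> in N. avoid_prob P \<alpha> m (X n \<omega>) \<le> 1" for m
      using avoid_prob_le_1 measurable_space[OF X] by (intro AE_I2) blast
    show "AE \<omega> in N. (\<lambda>m. avoid_prob P \<alpha> m (X n \<omega>)) \<longlonglongrightarrow> 0"
      using avoid_prob_tendsto_0[OF _ io] measurable_space[OF X] by (intro AE_I2) blast
  qed (auto simp: emeasure_space_1)
  then have "emeasure N ?A \<le> 0"
    using le by (intro tendsto_lowerbound[of _ _ sequentially]) auto
  then have "AE \<omega> in N. \<not> (\<forall>i>n. X i \<omega> \<notin> \<alpha>)"
    by (intro AE_I[of _ _ ?A]) auto
  then show "AE \<omega> in N. \<exists>i>n. X i \<omega> \<in> \<alpha>" by eventually_elim auto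
qed

end

section \<open>The regeneration blocks are independent and identically distributed\<close>

text \<open>The infimum of an empty set is infinite and that of a nonempty set is attained, so a
  finite value identifies a first visit after a finite previous return time. All later reasoning
  about return times goes through this form.\<close>

lemma return_time_Suc_iff:
  "return_time \<alpha> w (Suc k) = enat n \<longleftrightarrow>
    (\<exists>m<n. return_time \<alpha> w k = enat m \<and> w n \<in> \<alpha> \<and> (\<forall>i\<in>{m<..<n}. w i \<notin> \<alpha>))"
proof (cases "return_time \<alpha> w k")
  case (enat m)
  let ?S = "{n. m < n \<and> w n \<in> \<alpha>}"
  have eq: "return_time \<alpha> w (Suc k) = (INF n\<in>?S. enat n)" by (simp add: enat)
  have "(INF n\<in>?S. enat n) = enat n \<longleftrightarrow> n \<in> ?S \<and> (\<forall>i\<in>?S. n \<le> i)"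
  proof
    assume inf: "(INF n\<in>?S. enat n) = enat n"
    then have "?S \<noteq> {}" by (auto simp: Inf_enat_def split: if_splits)
    then have "(INF n\<in>?S. enat n) \<in> enat ` ?S"
      by (metis (no_types, lifting) Inf_enat_def LeastI ex_in_conv image_is_empty)
    then have "n \<in> ?S" unfolding inf by auto
    moreover have "n \<le> i" if "i \<in> ?S" for i
      using INF_lower[of i ?S enat] that unfolding inf by simp
    ultimately show "n \<in> ?S \<and> (\<forall>i\<in>?S. n \<le> i)" by blast
  next
    assume "n \<in> ?S \<and> (\<forall>i\<in>?S. n \<le> i)"
    then show "(INF n\<in>?S. enat n) = enat n"
      by (intro antisym INF_greatest INF_lower) auto
  qed
  then show ?thesis unfolding eq enat by (auto simp: not_le)
next
  case infinity
  then show ?thesis by (simp add: top_enat_def)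
qed

lemma return_time_ge: "return_time \<alpha> w k = enat n \<Longrightarrow> k \<le> n"
proof (induction k arbitrary: n)
  case (Suc k)
  then obtain m where "m < n" "return_time \<alpha> w k = enat m" unfolding return_time_Suc_iff by blast
  with Suc.IH[of m] show ?case by simp
qed simp

lemma return_time_finite:
  assumes "\<forall>n. \<exists>i>n. w i \<in> \<alpha>"
  shows "\<exists>n. return_time \<alpha> w k = enat n"
proof (induction k)
  case (Suc k)
  then obtain m where m: "return_time \<alpha> w k = enat m" by auto
  define n where "n = (LEAST i. m < i \<and> w i \<in> \<alpha>)"
  obtain i where i: "m < i \<and> w i \<in> \<alpha>" using assms by blast
  have "m < n \<and> w n \<in> \<alpha>" unfolding n_def by (rule LeastI[of _ i]) (rule i)
  moreover have "w i \<notin> \<alpha>" if "i \<in> {m<..<n}" for i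
    using not_less_Least[of i "\<lambda>i. m < i \<and> w i \<in> \<alpha>"] that by (auto simp: n_def)
  ultimately show ?case using m unfolding return_time_Suc_iff by auto
qed (auto simp: zero_enat_def)

lemma return_time_finite_pred: "return_time \<alpha> w (Suc k) = enat n \<Longrightarrow> \<exists>m<n. return_time \<alpha> w k = enat m"
  unfolding return_time_Suc_iff by blast

lemma regen_block_eq:
  assumes "return_time \<alpha> w j = enat a" "return_time \<alpha> w (Suc j) = enat b"
  shows "regen_block \<alpha> w j = map w [Suc a..<Suc b]" "length (regen_block \<alpha> w j) = b - a"
    "block_sum f (regen_block \<alpha> w j) = (\<Sum>i\<in>{a<..b}. f (w i))"
proof -
  show *: "regen_block \<alpha> w j = map w [Suc a..<Suc b]"
    unfolding regen_block_def assms the_enat.simps ..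
  show "length (regen_block \<alpha> w j) = b - a" unfolding * by (simp del: upt_Suc)
  show "block_sum f (regen_block \<alpha> w j) = (\<Sum>i\<in>{a<..b}. f (w i))"
    unfolding * block_sum_def
    by (simp add: interv_sum_list_conv_sum_set_nat o_def atLeastLessThanSuc_atLeastAtMost atLeastSucAtMost_greaterThanAtMost del: upt_Suc)
qed

context markov_process_atom
begin

abbreviation rt :: "'w \<Rightarrow> nat \<Rightarrow> enat" where
  "rt \<omega> \<equiv> return_time \<alpha> (\<lambda>k. X k \<omega>)"

abbreviation blen :: "nat \<Rightarrow> 'w \<Rightarrow> nat" where
  "blen j \<omega> \<equiv> length (regen_block \<alpha> (\<lambda>k. X k \<omega>) j)"

abbreviation bsum :: "nat \<Rightarrow> 'w \<Rightarrow> real" where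
  "bsum j \<omega> \<equiv> block_sum f (regen_block \<alpha> (\<lambda>k. X k \<omega>) j)"

definition next_visit :: "nat \<Rightarrow> nat \<Rightarrow> 'w set" where
  "next_visit m n = {\<omega> \<in> space N. (\<forall>i\<in>{m<..<n}. X i \<omega> \<notin> \<alpha>) \<and> X n \<omega> \<in> \<alpha>}"

text \<open>\<open>C j m\<close> is the set of sums allowed for block \<open>j\<close> when its
  length is \<open>m\<close>, so one family expresses a joint event of length and sum. With return
  number \<open>k\<close> at time \<open>n\<close>, exactly the blocks before \<open>k\<close> are
  complete and the event is decided by time \<open>n\<close>.\<close>

definition blocks_event :: "(nat \<Rightarrow> nat \<Rightarrow> real set) \<Rightarrow> nat \<Rightarrow> nat \<Rightarrow> 'w set" where
  "blocks_event C k n = {\<omega> \<in> space N. rt \<omega> k = enat n \<and> (\<forall>j\<in>{1..<k}. bsum j \<omega> \<in> C j (blen j \<omega>))}"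

definition block_step :: "(nat \<Rightarrow> nat \<Rightarrow> real set) \<Rightarrow> nat \<Rightarrow> nat \<Rightarrow> nat \<Rightarrow> 'w set" where
  "block_step C k m n = next_visit m n \<inter> {\<omega> \<in> space N. (\<Sum>i\<in>{m<..n}. f (X i \<omega>)) \<in> C k (n - m)}"

lemma next_visit_past: "next_visit m n \<in> sets (past n)"
proof -
  have "next_visit m n = {\<omega> \<in> space N. X n \<omega> \<in> \<alpha>} \<inter> (\<Inter>i\<in>{m<..<n}. {\<omega> \<in> space N. X i \<omega> \<notin> \<alpha>})"
    if "{m<..<n} \<noteq> {}" using that by (auto simp: next_visit_def)
  moreover have "next_visit m n = {\<omega> \<in> space N. X n \<omega> \<in> \<alpha>}" if "{m<..<n} = {}"
    using that by (simp add: next_visit_def)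
  moreover have "(\<Inter>i\<in>{m<..<n}. {\<omega> \<in> space N. X i \<omega> \<notin> \<alpha>}) \<in> sets (past n)" if "{m<..<n} \<noteq> {}"
    using that by (intro sets.finite_INT past_avoid) auto
  ultimately show ?thesis using past_visit[of n n] by (cases "{m<..<n} = {}") auto
qed

lemma block_step_past:
  assumes "C k (n - m) \<in> sets borel"
  shows "block_step C k m n \<in> sets (past n)"
proof -
  have "(\<lambda>\<omega>. \<Sum>i\<in>{m<..n}. f (X i \<omega>)) \<in> borel_measurable (past n)"
    by (intro borel_measurable_sum measurable_compose[OF X_past f]) auto
  from measurable_sets[OF this assms]
  have "{\<omega> \<in> space N. (\<Sum>i\<in>{m<..n}. f (X i \<omega>)) \<in> C k (n - m)} \<in> sets (past n)"
    by (simp add: vimage_def Int_def conj_commute)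
  then show ?thesis unfolding block_step_def using next_visit_past by auto
qed

lemma blocks_event_Suc:
  assumes "k \<ge> 1"
  shows "blocks_event C (Suc k) n = (\<Union>m<n. blocks_event C k m \<inter> block_step C k m n)"
proof -
  have eq: "{1..<Suc k} = insert k {1..<k}" using assms by auto
  show ?thesis
  proof (intro equalityI subsetI)
    fix \<omega> assume \<omega>: "\<omega> \<in> blocks_event C (Suc k) n"
    then have n: "rt \<omega> (Suc k) = enat n" by (simp add: blocks_event_def)
    then obtain m where m: "m < n" "rt \<omega> k = enat m" "X n \<omega> \<in> \<alpha>" "\<forall>i\<in>{m<..<n}. X i \<omega> \<notin> \<alpha>"
      unfolding return_time_Suc_iff by blast
    have "\<omega> \<in> space N" "\<forall>j\<in>{1..<k}. bsum j \<omega> \<in> C j (blen j \<omega>)" "bsum k \<omega> \<in> C k (blen k \<omega>)"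
      using \<omega> unfolding blocks_event_def eq by auto
    then have "\<omega> \<in> blocks_event C k m \<inter> block_step C k m n"
      using m unfolding regen_block_eq(2,3)[OF m(2) n] by (simp add: blocks_event_def block_step_def next_visit_def)
    then show "\<omega> \<in> (\<Union>m<n. blocks_event C k m \<inter> block_step C k m n)" using m(1) by blast
  next
    fix \<omega> assume "\<omega> \<in> (\<Union>m<n. blocks_event C k m \<inter> block_step C k m n)"
    then obtain m where m: "m < n" "\<omega> \<in> blocks_event C k m" "\<omega> \<in> block_step C k m n" by blast
    have k': "rt \<omega> k = enat m" using m(2) by (simp add: blocks_event_def)
    have n: "rt \<omega> (Suc k) = enat n"
      unfolding return_time_Suc_iff using m(1,3) k' by (auto simp: block_step_def next_visit_def)
    have "bsum k \<omega> \<in> C k (blen k \<omega>)"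
      unfolding regen_block_eq(2,3)[OF k' n] using m(3) by (simp add: block_step_def)
    then show "\<omega> \<in> blocks_event C (Suc k) n"
      using m(2) n unfolding blocks_event_def eq by simp
  qed
qed

lemma blocks_event_1: "blocks_event C (Suc 0) n = (if n = 0 then {} else next_visit 0 n)"
  by (auto simp: blocks_event_def return_time_Suc_iff next_visit_def zero_enat_def simp del: return_time.simps(2))

lemma blocks_event_past:
  assumes "\<And>j m. C j m \<in> sets borel" "k \<ge> 1"
  shows "blocks_event C k n \<in> sets (past n)"
  using assms(2)
proof (induction k arbitrary: n rule: dec_induct)
  case base
  show ?case using next_visit_past[of 0 n] by (simp add: blocks_event_1)
next
  case (step k)
  have "blocks_event C k m \<in> sets (past n)" if "m < n" for m
    using step.IH[of m] past_mono[of m n] that by auto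
  moreover have "block_step C k m n \<in> sets (past n)" for m
    by (intro block_step_past assms)
  ultimately show ?case unfolding blocks_event_Suc[OF step(1)] by (intro sets.finite_UN) auto
qed

text \<open>The regeneration: at return number \<open>k\<close> the chain sits in the atom, where
  the probability of the next excursion is one and the same constant, so it leaves the integral over
  the past as a factor.\<close>

lemma emeasure_blocks_event_step:
  assumes C: "\<And>j m. C j m \<in> sets borel" and k: "k \<ge> 1" and a: "a \<in> \<alpha>"
  shows "emeasure N (blocks_event C k m \<inter> block_step C k m (Suc (m + i))) =
    emeasure N (blocks_event C k m) * excursion_prob P \<alpha> f (C k (Suc i)) i 0 a"
proof -
  have A: "blocks_event C k m \<in> sets (past m)" by (rule blocks_event_past[OF C k])
  have X\<alpha>: "X m \<omega> \<in> \<alpha>" if "\<omega> \<in> blocks_event C k m" for \<omega>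
    using that k by (cases k) (auto simp: blocks_event_def return_time_Suc_iff simp del: return_time.simps(2))
  have "{m<..<Suc (m + i)} = {m<..m + i}" by auto
  then have "blocks_event C k m \<inter> block_step C k m (Suc (m + i)) = blocks_event C k m \<inter>
    {\<omega> \<in> space N. (\<forall>l\<in>{m<..m + i}. X l \<omega> \<notin> \<alpha>) \<and> X (Suc (m + i)) \<omega> \<in> \<alpha> \<and> 0 + (\<Sum>l\<in>{m<..Suc (m + i)}. f (X l \<omega>)) \<in> C k (Suc i)}"
    by (auto simp: block_step_def next_visit_def Suc_diff_le)
  then have "emeasure N (blocks_event C k m \<inter> block_step C k m (Suc (m + i))) =
    (\<integral>\<^sup>+\<omega>. indicator (blocks_event C k m) \<omega> * excursion_prob P \<alpha> f (C k (Suc i)) i 0 (X m \<omega>) \<partial>N)"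
    using emeasure_excursion[OF A, of "\<lambda>_. 0" "C k (Suc i)" i] C by simp
  also have "\<dots> = (\<integral>\<^sup>+\<omega>. indicator (blocks_event C k m) \<omega> * excursion_prob P \<alpha> f (C k (Suc i)) i 0 a \<partial>N)"
    by (intro nn_integral_cong) (auto simp: indicator_def excursion_prob_atom[OF X\<alpha> a])
  also have "\<dots> = emeasure N (blocks_event C k m) * excursion_prob P \<alpha> f (C k (Suc i)) i 0 a"
    using A past_subset[of m] by (subst nn_integral_multc) auto
  finally show ?thesis .
qed

text \<open>The mass that the joint law of length and sum of one excursion from \<open>a\<close>
  gives to the pairs whose sum lies in \<open>D\<close> of the length; the shift by one reflects
  that \<open>excursion_prob\<close> with index \<open>i\<close> describes an excursion of length
  \<open>Suc i\<close>.\<close>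

definition block_law :: "'e \<Rightarrow> (nat \<Rightarrow> real set) \<Rightarrow> ennreal" where
  "block_law a D = (\<Sum>i. excursion_prob P \<alpha> f (D (Suc i)) i 0 a)"

text \<open>Splitting by the time \<open>m\<close> of return \<open>k\<close> and the length
  \<open>Suc i\<close> of the next block gives disjoint events, each a product. As the second factor
  does not involve \<open>m\<close>, the double sum factorises; as it depends on \<open>k\<close>
  only through \<open>C k\<close>, the blocks are independent and alike.\<close>

lemma emeasure_blocks_event_Suc:
  assumes C: "\<And>j m. C j m \<in> sets borel" and k: "k \<ge> 1" and a: "a \<in> \<alpha>"
  shows "emeasure N (\<Union>n. blocks_event C (Suc k) n) = emeasure N (\<Union>n. blocks_event C k n) * block_law a (C k)"
proof -
  let ?Q = "\<lambda>m i. blocks_event C k m \<inter> block_step C k m (Suc (m + i))"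
  have Hm: "blocks_event C k m \<in> sets N" for m by (rule subsetD[OF past_subset blocks_event_past[OF C k]])
  have Sm: "block_step C k m n \<in> sets N" for m n
    by (rule subsetD[OF past_subset block_step_past[OF C]])
  have Q: "?Q m i \<in> sets N" for m i by (intro sets.Int Hm Sm)
  have disjH: "disjoint_family (blocks_event C k)" by (auto simp: disjoint_family_on_def blocks_event_def)
  have disjQ: "disjoint_family (?Q m)" for m
  proof -
    have rt: "rt \<omega> (Suc k) = enat (Suc (m + i))" if "\<omega> \<in> ?Q m i" for \<omega> i
    proof -
      have "rt \<omega> k = enat m" "X (Suc (m + i)) \<omega> \<in> \<alpha>" "\<forall>l\<in>{m<..<Suc (m + i)}. X l \<omega> \<notin> \<alpha>"
        using that by (simp_all add: blocks_event_def block_step_def next_visit_def)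
      then show ?thesis unfolding return_time_Suc_iff by (intro exI[of _ m]) simp
    qed
    have "?Q m i \<inter> ?Q m i' = {}" if "i \<noteq> i'" for i i'
    proof (rule ccontr)
      assume "?Q m i \<inter> ?Q m i' \<noteq> {}"
      then obtain \<omega> where "\<omega> \<in> ?Q m i" "\<omega> \<in> ?Q m i'" by blast
      from rt[OF this(1)] rt[OF this(2)] that show False by simp
    qed
    then show ?thesis by (simp add: disjoint_family_on_def)
  qed
  have U: "(\<Union>n. blocks_event C (Suc k) n) = (\<Union>m. \<Union>i. ?Q m i)"
  proof (intro equalityI subsetI)
    fix \<omega> assume "\<omega> \<in> (\<Union>n. blocks_event C (Suc k) n)"
    then obtain n m where "m < n" "\<omega> \<in> blocks_event C k m \<inter> block_step C k m n"
      unfolding blocks_event_Suc[OF k] by blast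
    moreover obtain i where "n = Suc (m + i)" using less_imp_Suc_add[OF \<open>m < n\<close>] by blast
    ultimately show "\<omega> \<in> (\<Union>m. \<Union>i. ?Q m i)" by blast
  next
    fix \<omega> assume "\<omega> \<in> (\<Union>m. \<Union>i. ?Q m i)"
    then obtain m i where *: "\<omega> \<in> ?Q m i" by blast
    have "m < Suc (m + i)" by simp
    with * have "\<omega> \<in> blocks_event C (Suc k) (Suc (m + i))" unfolding blocks_event_Suc[OF k] by blast
    then show "\<omega> \<in> (\<Union>n. blocks_event C (Suc k) n)" by blast
  qed
  have "emeasure N (\<Union>n. blocks_event C (Suc k) n) = (\<Sum>m. emeasure N (\<Union>i. ?Q m i))"
    unfolding U
  proof (rule suminf_emeasure[symmetric])
    show "disjoint_family (\<lambda>m. \<Union>i. ?Q m i)"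
      unfolding disjoint_family_on_def
    proof (intro ballI impI)
      fix m m' :: nat assume "m \<noteq> m'"
      then have "blocks_event C k m \<inter> blocks_event C k m' = {}" using disjH by (simp add: disjoint_family_on_def)
      then show "(\<Union>i. ?Q m i) \<inter> (\<Union>i. ?Q m' i) = {}" by blast
    qed
    show "range (\<lambda>m. \<Union>i. ?Q m i) \<subseteq> sets N" using Q by (intro image_subsetI sets.countable_UN) blast
  qed
  also have "\<dots> = (\<Sum>m. \<Sum>i. emeasure N (?Q m i))"
    using Q disjQ by (intro suminf_cong suminf_emeasure[symmetric]) auto
  also have "\<dots> = (\<Sum>m. emeasure N (blocks_event C k m) * block_law a (C k))"
    unfolding emeasure_blocks_event_step[OF C k a] block_law_def by (simp add: ennreal_suminf_cmult)
  also have "\<dots> = (\<Sum>m. emeasure N (blocks_event C k m)) * block_law a (C k)"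
    by (rule ennreal_suminf_multc)
  also have "(\<Sum>m. emeasure N (blocks_event C k m)) = emeasure N (\<Union>n. blocks_event C k n)"
    using Hm disjH by (intro suminf_emeasure) auto
  finally show ?thesis .
qed

lemma rt_measurable [measurable]: "(\<lambda>\<omega>. rt \<omega> k) \<in> N \<rightarrow>\<^sub>M count_space UNIV"
proof -
  have fin: "{\<omega> \<in> space N. rt \<omega> k = enat n} \<in> sets N" for n
  proof (cases k)
    case 0
    then show ?thesis by (simp add: zero_enat_def)
  next
    case (Suc j)
    have "{\<omega> \<in> space N. rt \<omega> k = enat n} = blocks_event (\<lambda>_ _. UNIV) k n" by (simp add: blocks_event_def)
    then show ?thesis using subsetD[OF past_subset blocks_event_past[of "\<lambda>_ _. UNIV" k n]] Suc by simp
  qed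
  have "(\<lambda>\<omega>. rt \<omega> k) -` {a} \<inter> space N \<in> sets N" for a
  proof (cases a)
    case (enat n)
    have "(\<lambda>\<omega>. rt \<omega> k) -` {a} \<inter> space N = {\<omega> \<in> space N. rt \<omega> k = enat n}" by (auto simp: enat)
    then show ?thesis using fin[of n] by simp
  next
    case infinity
    have "(\<lambda>\<omega>. rt \<omega> k) -` {a} \<inter> space N = space N - (\<Union>n. {\<omega> \<in> space N. rt \<omega> k = enat n})"
      by (auto simp: infinity not_infinity_eq)
    moreover have "(\<Union>n. {\<omega> \<in> space N. rt \<omega> k = enat n}) \<in> sets N" using fin by blast
    ultimately show ?thesis by (simp only: sets.compl_sets)
  qed
  then show ?thesis by (subst measurable_count_space_eq2_countable) simp_all
qed

text \<open>Measurability is stated for functionals \<open>g\<close> of a block, which avoids a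
  sigma-algebra on lists of states. The two return times bounding a block take countably many
  values, and for fixed values the block is a fixed segment of the trajectory.\<close>

lemma regen_block_measurable:
  assumes g: "\<And>a b. (\<lambda>\<omega>. g (map (\<lambda>k. X k \<omega>) [Suc a..<Suc b])) \<in> N \<rightarrow>\<^sub>M K"
  shows "(\<lambda>\<omega>. g (regen_block \<alpha> (\<lambda>k. X k \<omega>) j)) \<in> N \<rightarrow>\<^sub>M K"
proof -
  let ?g = "\<lambda>ab \<omega>. g (map (\<lambda>k. X k \<omega>) [Suc (the_enat (fst ab))..<Suc (the_enat (snd ab))])"
  have "(\<lambda>\<omega>. (rt \<omega> j, rt \<omega> (Suc j))) \<in> N \<rightarrow>\<^sub>M count_space UNIV \<Otimes>\<^sub>M count_space UNIV"
    by (rule measurable_Pair[OF rt_measurable rt_measurable])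
  then have "(\<lambda>\<omega>. (rt \<omega> j, rt \<omega> (Suc j))) \<in> N \<rightarrow>\<^sub>M count_space UNIV"
    by (simp add: pair_measure_countable del: return_time.simps)
  then have "(\<lambda>\<omega>. ?g (rt \<omega> j, rt \<omega> (Suc j)) \<omega>) \<in> N \<rightarrow>\<^sub>M K"
    by (rule measurable_compose_countable[where f = ?g, OF g])
  then show ?thesis by (simp only: regen_block_def fst_conv snd_conv)
qed

lemma blen_measurable [measurable]: "blen j \<in> N \<rightarrow>\<^sub>M count_space UNIV"
  by (rule regen_block_measurable) simp

lemma bsum_measurable [measurable]: "bsum j \<in> borel_measurable N"
proof (rule regen_block_measurable)
  fix a b
  have "block_sum f (map (\<lambda>k. X k \<omega>) [Suc a..<Suc b]) = (\<Sum>i\<in>{Suc a..<Suc b}. f (X i \<omega>))" for \<omega>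
    by (simp add: block_sum_def interv_sum_list_conv_sum_set_nat o_def del: upt_Suc)
  then show "(\<lambda>\<omega>. block_sum f (map (\<lambda>k. X k \<omega>) [Suc a..<Suc b])) \<in> borel_measurable N" by simp
qed

end

text \<open>A finite set of indices sits inside an initial segment, and the missing indices impose
  no condition when given the whole space. Block events are computed along initial segments, so this
  is the form available.\<close>

lemma (in prob_space) indep_vars_prefixI:
  fixes Y :: "nat \<Rightarrow> 'a \<Rightarrow> 'b"
  assumes rv: "\<And>j. Y j \<in> M \<rightarrow>\<^sub>M K j"
    and prod: "\<And>k A. (\<And>j. A j \<in> sets (K j)) \<Longrightarrow>
      prob {\<omega> \<in> space M. \<forall>j\<in>{1..k}. Y j \<omega> \<in> A j} = (\<Prod>j=1..k. prob {\<omega> \<in> space M. Y j \<omega> \<in> A j})"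
  shows "indep_vars K Y {1..}"
  unfolding indep_vars_def2
proof (intro conjI ballI rv indep_setsI)
  show "{Y i -` A \<inter> space M |A. A \<in> sets (K i)} \<subseteq> events" for i
    using measurable_sets[OF rv] by blast
  fix A :: "nat \<Rightarrow> 'a set" and J
  assume J: "J \<noteq> {}" "J \<subseteq> {1..}" "finite J" and A: "\<forall>j\<in>J. A j \<in> {Y j -` A \<inter> space M |A. A \<in> sets (K j)}"
  then obtain B where B: "\<And>j. j \<in> J \<Longrightarrow> B j \<in> sets (K j)" "\<And>j. j \<in> J \<Longrightarrow> A j = Y j -` B j \<inter> space M"
    by (simp add: Bex_def[symmetric]) metis
  define B' where "B' j = (if j \<in> J then B j else space (K j))" for j
  have B': "B' j \<in> sets (K j)" for j using B(1) by (simp add: B'_def)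
  define k where "k = Max J"
  have Jk: "J \<subseteq> {1..k}" using J by (auto simp: k_def)
  have sp: "Y j \<omega> \<in> space (K j)" if "\<omega> \<in> space M" for j \<omega> using measurable_space[OF rv that] .
  have out: "{\<omega> \<in> space M. Y j \<omega> \<in> B' j} = space M" if "j \<notin> J" for j using that sp by (auto simp: B'_def)
  have in_J: "{\<omega> \<in> space M. Y j \<omega> \<in> B' j} = A j" if "j \<in> J" for j using that B(2) by (auto simp: B'_def)
  have "(\<Inter>j\<in>J. A j) = {\<omega> \<in> space M. \<forall>j\<in>{1..k}. Y j \<omega> \<in> B' j}"
  proof (intro equalityI subsetI)
    fix \<omega> assume \<omega>: "\<omega> \<in> (\<Inter>j\<in>J. A j)"
    then have \<omega>s: "\<omega> \<in> space M" using J(1) B(2) by auto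
    have "Y j \<omega> \<in> B' j" for j
      using \<omega> \<omega>s in_J[of j] out[of j] by (cases "j \<in> J") auto
    then show "\<omega> \<in> {\<omega> \<in> space M. \<forall>j\<in>{1..k}. Y j \<omega> \<in> B' j}" using \<omega>s by simp
  next
    fix \<omega> assume \<omega>: "\<omega> \<in> {\<omega> \<in> space M. \<forall>j\<in>{1..k}. Y j \<omega> \<in> B' j}"
    show "\<omega> \<in> (\<Inter>j\<in>J. A j)"
    proof
      fix j assume j: "j \<in> J"
      then have "Y j \<omega> \<in> B' j" using \<omega> Jk by auto
      then show "\<omega> \<in> A j" using \<omega> in_J[OF j] by auto
    qed
  qed
  then have "prob (\<Inter>j\<in>J. A j) = (\<Prod>j=1..k. prob {\<omega> \<in> space M. Y j \<omega> \<in> B' j})"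
    using prod[of B' k] B' by simp
  also have "\<dots> = (\<Prod>j\<in>J. prob {\<omega> \<in> space M. Y j \<omega> \<in> B' j})"
    by (rule prod.mono_neutral_right) (use Jk out prob_space in auto)
  also have "\<dots> = (\<Prod>j\<in>J. prob (A j))" by (intro prod.cong refl) (simp add: in_J)
  finally show "prob (\<Inter>j\<in>J. A j) = (\<Prod>j\<in>J. prob (A j))" .
qed

lemma less_return_time_1_iff: "enat n < return_time \<alpha> w 1 \<longleftrightarrow> (\<forall>i\<in>{0<..n}. w i \<notin> \<alpha>)"
proof
  assume *: "enat n < return_time \<alpha> w 1"
  show "\<forall>i\<in>{0<..n}. w i \<notin> \<alpha>"
  proof (intro ballI notI)
    fix i assume i: "i \<in> {0<..n}" "w i \<in> \<alpha>"
    have "return_time \<alpha> w 1 \<le> enat i"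
      unfolding One_nat_def return_time.simps by (rule INF_lower) (use i in \<open>simp add: zero_enat_def\<close>)
    then have "enat n < enat i" by (rule less_le_trans[OF *])
    then show False using i by simp
  qed
next
  assume *: "\<forall>i\<in>{0<..n}. w i \<notin> \<alpha>"
  have "enat (Suc n) \<le> return_time \<alpha> w 1"
    unfolding One_nat_def return_time.simps
  proof (rule INF_greatest)
    fix i assume "i \<in> {n. 0 < enat n \<and> w n \<in> \<alpha>}"
    then have "0 < i" "w i \<in> \<alpha>" by (simp_all add: zero_enat_def)
    then have "\<not> i \<le> n" using * by auto
    then show "enat (Suc n) \<le> enat i" by simp
  qed
  then show "enat n < return_time \<alpha> w 1" by (rule less_le_trans[rotated]) simp
qed

context markov_process_atom
begin

lemma block_event_sets:
  assumes D: "\<And>m. D m \<in> sets borel"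
  shows "{\<omega> \<in> space N. bsum j \<omega> \<in> D (blen j \<omega>)} \<in> sets N"
proof -
  have "{\<omega> \<in> space N. bsum j \<omega> \<in> D (blen j \<omega>)} =
      (\<Union>m. (blen j -` {m} \<inter> space N) \<inter> (bsum j -` D m \<inter> space N))" by auto
  also have "\<dots> \<in> sets N"
  proof (rule sets.countable_UN, rule image_subsetI)
    fix m
    have "blen j -` {m} \<inter> space N \<in> sets N" by (rule measurable_sets[OF blen_measurable]) simp
    moreover have "bsum j -` D m \<inter> space N \<in> sets N" by (rule measurable_sets[OF bsum_measurable D])
    ultimately show "(blen j -` {m} \<inter> space N) \<inter> (bsum j -` D m \<inter> space N) \<in> sets N" by (rule sets.Int)
  qed
  finally show ?thesis .
qed

context
  fixes a :: 'e
  assumes a: "a \<in> \<alpha>" and visits: "AE \<omega> in N. \<forall>n. \<exists>i>n. X i \<omega> \<in> \<alpha>"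
begin

lemma AE_rt_finite: "AE \<omega> in N. \<forall>k. \<exists>n. rt \<omega> k = enat n"
  using visits by eventually_elim (rule allI, rule return_time_finite, assumption)

lemma emeasure_blocks:
  assumes C: "\<And>j m. C j m \<in> sets borel"
  shows "emeasure N {\<omega> \<in> space N. \<forall>j\<in>{1..k}. bsum j \<omega> \<in> C j (blen j \<omega>)} = (\<Prod>j=1..k. block_law a (C j))"
proof -
  have "emeasure N (\<Union>n. blocks_event C (Suc k) n) = (\<Prod>j=1..k. block_law a (C j))"
  proof (induction k)
    case 0
    \<comment> \<open>The arbitrary initial law disappears here: the stretch before the first return
      is unrestricted and that return is almost surely finite.\<close>
    have "emeasure N (\<Union>n. blocks_event C (Suc 0) n) = emeasure N (space N)"
    proof (rule emeasure_eq_AE)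
      show "AE \<omega> in N. (\<omega> \<in> (\<Union>n. blocks_event C (Suc 0) n)) = (\<omega> \<in> space N)"
        using AE_rt_finite
      proof eventually_elim
        case (elim \<omega>)
        then have "\<exists>n. rt \<omega> (Suc 0) = enat n" by blast
        then show ?case by (simp add: blocks_event_def del: return_time.simps)
      qed
      have "blocks_event C (Suc 0) n \<in> sets N" for n
        by (rule subsetD[OF past_subset blocks_event_past[OF C]]) simp
      then show "(\<Union>n. blocks_event C (Suc 0) n) \<in> sets N" by blast
    qed simp
    then show ?case by (simp add: emeasure_space_1)
  next
    case (Suc k)
    show ?case
      using emeasure_blocks_event_Suc[OF C, of "Suc k" a] Suc.IH a
      by (simp add: prod.nat_ivl_Suc' mult.commute)
  qed
  moreover have "emeasure N {\<omega> \<in> space N. \<forall>j\<in>{1..k}. bsum j \<omega> \<in> C j (blen j \<omega>)} = emeasure N (\<Union>n. blocks_event C (Suc k) n)"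
  proof (rule emeasure_eq_AE)
    have eq: "{1..<Suc k} = {1..k}" by auto
    show "AE \<omega> in N. (\<omega> \<in> {\<omega> \<in> space N. \<forall>j\<in>{1..k}. bsum j \<omega> \<in> C j (blen j \<omega>)}) = (\<omega> \<in> (\<Union>n. blocks_event C (Suc k) n))"
      using AE_rt_finite
    proof eventually_elim
      case (elim \<omega>)
      then have "\<exists>n. rt \<omega> (Suc k) = enat n" by blast
      then show ?case unfolding blocks_event_def eq by (auto simp del: return_time.simps)
    qed
    have "{\<omega> \<in> space N. \<forall>j\<in>{1..k}. bsum j \<omega> \<in> C j (blen j \<omega>)} = space N \<inter> (\<Inter>j\<in>{1..k}. {\<omega> \<in> space N. bsum j \<omega> \<in> C j (blen j \<omega>)})"
      by auto
    also have "\<dots> \<in> sets N"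
    proof (cases "{1..k} = {}")
      case False
      have "(\<Inter>j\<in>{1..k}. {\<omega> \<in> space N. bsum j \<omega> \<in> C j (blen j \<omega>)}) \<in> sets N"
        by (rule sets.finite_INT[OF _ False]) (auto intro: block_event_sets C)
      then show ?thesis by blast
    qed simp
    finally show "{\<omega> \<in> space N. \<forall>j\<in>{1..k}. bsum j \<omega> \<in> C j (blen j \<omega>)} \<in> sets N" .
    have "blocks_event C (Suc k) n \<in> sets N" for n
      by (rule subsetD[OF past_subset blocks_event_past[OF C]]) simp
    then show "(\<Union>n. blocks_event C (Suc k) n) \<in> sets N" by blast
  qed
  ultimately show ?thesis by simp
qed

lemma block_law_UNIV: "block_law a (\<lambda>_. UNIV) = 1"
  using emeasure_blocks[of "\<lambda>_ _. UNIV" 1] by (simp add: emeasure_space_1)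

lemma emeasure_block:
  assumes D: "\<And>m. D m \<in> sets borel" and j: "j \<ge> 1"
  shows "emeasure N {\<omega> \<in> space N. bsum j \<omega> \<in> D (blen j \<omega>)} = block_law a D"
proof -
  define C where "C i = (if i = j then D else (\<lambda>_. UNIV))" for i
  have "{\<omega> \<in> space N. bsum j \<omega> \<in> D (blen j \<omega>)} = {\<omega> \<in> space N. \<forall>i\<in>{1..j}. bsum i \<omega> \<in> C i (blen i \<omega>)}"
    using j by (auto simp: C_def)
  also have "emeasure N \<dots> = (\<Prod>i=1..j. block_law a (C i))"
    by (rule emeasure_blocks) (simp add: C_def D)
  also have "\<dots> = (\<Prod>i=1..j. if i = j then block_law a D else 1)"
    by (intro prod.cong refl) (simp add: C_def block_law_UNIV)
  also have "\<dots> = block_law a D" using j by simp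
  finally show ?thesis .
qed

lemma prob_blocks:
  assumes C: "\<And>j m. C j m \<in> sets borel"
  shows "prob {\<omega> \<in> space N. \<forall>j\<in>{1..k}. bsum j \<omega> \<in> C j (blen j \<omega>)} =
    (\<Prod>j=1..k. prob {\<omega> \<in> space N. bsum j \<omega> \<in> C j (blen j \<omega>)})"
proof -
  have "ennreal (prob {\<omega> \<in> space N. \<forall>j\<in>{1..k}. bsum j \<omega> \<in> C j (blen j \<omega>)}) =
    (\<Prod>j=1..k. ennreal (prob {\<omega> \<in> space N. bsum j \<omega> \<in> C j (blen j \<omega>)}))"
    unfolding emeasure_eq_measure[symmetric] emeasure_blocks[where C = C, OF C]
    by (intro prod.cong refl emeasure_block[symmetric] C) simp
  also have "\<dots> = ennreal (\<Prod>j=1..k. prob {\<omega> \<in> space N. bsum j \<omega> \<in> C j (blen j \<omega>)})"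
    by (rule prod_ennreal) simp
  finally show ?thesis by (simp add: prod_nonneg)
qed

lemma indep_vars_blen: "indep_vars (\<lambda>_. count_space UNIV) blen {1..}"
proof (rule indep_vars_prefixI)
  fix k :: nat and A :: "nat \<Rightarrow> nat set"
  show "prob {\<omega> \<in> space N. \<forall>j\<in>{1..k}. blen j \<omega> \<in> A j} = (\<Prod>j=1..k. prob {\<omega> \<in> space N. blen j \<omega> \<in> A j})"
  proof -
    \<comment> \<open>A condition on the length alone, encoded as allowing every sum or
      none.\<close>
    have iff: "b \<in> (if m \<in> A j then UNIV else {}) \<longleftrightarrow> m \<in> A j" for b :: real and m j by simp
    show ?thesis
      using prob_blocks[where C = "\<lambda>j m. if m \<in> A j then UNIV else {}", of k] unfolding iff by simp
  qed
qed (rule blen_measurable)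

lemma indep_vars_bsum: "indep_vars (\<lambda>_. borel) bsum {1..}"
proof (rule indep_vars_prefixI)
  fix k :: nat and A :: "nat \<Rightarrow> real set" assume "\<And>j. A j \<in> sets borel"
  then show "prob {\<omega> \<in> space N. \<forall>j\<in>{1..k}. bsum j \<omega> \<in> A j} = (\<Prod>j=1..k. prob {\<omega> \<in> space N. bsum j \<omega> \<in> A j})"
    by (rule prob_blocks[of "\<lambda>j m. A j" k])
qed (rule bsum_measurable)

lemma distr_bsum:
  assumes "j \<ge> 1"
  shows "distr N borel (bsum j) = distr N borel (bsum 1)"
proof (rule measure_eqI)
  fix A assume "A \<in> sets (distr N borel (bsum j))"
  then have A: "A \<in> sets borel" by simp
  have "emeasure (distr N borel (bsum i)) A = block_law a (\<lambda>_. A)" if "i \<ge> 1" for i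
  proof -
    have "emeasure (distr N borel (bsum i)) A = emeasure N (bsum i -` A \<inter> space N)"
      by (rule emeasure_distr[OF bsum_measurable A])
    also have "bsum i -` A \<inter> space N = {\<omega> \<in> space N. bsum i \<omega> \<in> A}" by auto
    also have "emeasure N \<dots> = block_law a (\<lambda>_. A)"
      by (rule emeasure_block[OF A that])
    finally show ?thesis .
  qed
  then show "emeasure (distr N borel (bsum j)) A = emeasure (distr N borel (bsum 1)) A"
    using assms by simp
qed simp

text \<open>The regeneration argument once more, now with \<open>avoid_prob\<close> in place of the
  excursion probability, since the tail has to be matched with that of the first return time under
  \<open>path_law\<close>, which has this form too.\<close>

lemma emeasure_blen_greater:
  assumes j: "j \<ge> 1"
  shows "emeasure N {\<omega> \<in> space N. blen j \<omega> > n} = avoid_prob P \<alpha> n a"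
proof -
  define H where "H = blocks_event (\<lambda>_ _. UNIV) j"
  have Hp: "H m \<in> sets (past m)" for m unfolding H_def by (rule blocks_event_past) (use j in auto)
  have HN: "H m \<in> sets N" for m by (rule subsetD[OF past_subset Hp])
  have H: "\<omega> \<in> H m \<longleftrightarrow> \<omega> \<in> space N \<and> rt \<omega> j = enat m" for \<omega> m by (simp add: H_def blocks_event_def)
  have disj: "disjoint_family H" by (auto simp: disjoint_family_on_def H)
  let ?Q = "\<lambda>m. H m \<inter> {\<omega> \<in> space N. \<forall>i\<in>{m<..m + n}. X i \<omega> \<notin> \<alpha>}"
  have "{\<omega> \<in> space N. \<forall>i\<in>{m<..m + n}. \<not> X i \<omega> \<in> \<alpha>} \<in> sets N" for m by measurable
  then have Q: "?Q m \<in> sets N" for m using HN[of m] by (intro sets.Int) auto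
  have disjQ: "disjoint_family ?Q" using disj by (auto simp: disjoint_family_on_def)
  have X\<alpha>: "X m \<omega> \<in> \<alpha>" if "\<omega> \<in> H m" for \<omega> m
  proof -
    obtain i where "j = Suc i" using j by (cases j) auto
    then show ?thesis using that unfolding H by (auto simp only: return_time_Suc_iff)
  qed
  have "emeasure N {\<omega> \<in> space N. blen j \<omega> > n} = emeasure N (\<Union>m. ?Q m)"
  proof (rule emeasure_eq_AE)
    show "{\<omega> \<in> space N. blen j \<omega> > n} \<in> sets N" by measurable
    show "(\<Union>m. ?Q m) \<in> sets N" using Q by blast
    show "AE \<omega> in N. (\<omega> \<in> {\<omega> \<in> space N. blen j \<omega> > n}) = (\<omega> \<in> (\<Union>m. ?Q m))"
      using AE_rt_finite AE_space
    proof eventually_elim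
      case (elim \<omega>)
      obtain m b where m: "rt \<omega> j = enat m" and b: "rt \<omega> (Suc j) = enat b" using elim(1) by meson
      have first: "m < b" "X b \<omega> \<in> \<alpha>" "\<forall>i\<in>{m<..<b}. X i \<omega> \<notin> \<alpha>"
        using b m unfolding return_time_Suc_iff by auto
      have "blen j \<omega> > n \<longleftrightarrow> b > m + n" unfolding regen_block_eq(2)[OF m b] by auto
      also have "\<dots> \<longleftrightarrow> (\<forall>i\<in>{m<..m + n}. X i \<omega> \<notin> \<alpha>)" using first by force
      also have "\<dots> \<longleftrightarrow> \<omega> \<in> (\<Union>m. ?Q m)" using m elim(2) by (auto simp: H)
      finally show ?case using elim(2) by simp
    qed
  qed
  also have "\<dots> = (\<Sum>m. emeasure N (?Q m))" using Q disjQ by (intro suminf_emeasure[symmetric]) auto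
  also have "\<dots> = (\<Sum>m. emeasure N (H m) * avoid_prob P \<alpha> n a)"
  proof (rule suminf_cong)
    fix m
    have "emeasure N (?Q m) = (\<integral>\<^sup>+\<omega>. indicator (H m) \<omega> * avoid_prob P \<alpha> n (X m \<omega>) \<partial>N)"
      by (rule emeasure_avoid[OF Hp])
    also have "\<dots> = (\<integral>\<^sup>+\<omega>. indicator (H m) \<omega> * avoid_prob P \<alpha> n a \<partial>N)"
      by (intro nn_integral_cong) (auto simp: indicator_def avoid_prob_atom[OF X\<alpha> a])
    also have "\<dots> = emeasure N (H m) * avoid_prob P \<alpha> n a"
      using HN[of m] by (subst nn_integral_multc) auto
    finally show "emeasure N (?Q m) = emeasure N (H m) * avoid_prob P \<alpha> n a" .
  qed
  also have "\<dots> = (\<Sum>m. emeasure N (H m)) * avoid_prob P \<alpha> n a" by (rule ennreal_suminf_multc)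
  also have "(\<Sum>m. emeasure N (H m)) = emeasure N (\<Union>m. H m)"
    using HN disj by (intro suminf_emeasure) auto
  also have "\<dots> = emeasure N (space N)"
  proof (rule emeasure_eq_AE)
    show "AE \<omega> in N. (\<omega> \<in> (\<Union>m. H m)) = (\<omega> \<in> space N)"
      using AE_rt_finite by eventually_elim (auto simp: H)
    show "(\<Union>m. H m) \<in> sets N" using HN by blast
  qed simp
  finally show ?thesis by (simp add: emeasure_space_1)
qed

text \<open>\<open>atom_law\<close> starts from a chosen point of the atom;
  \<open>avoid_prob\<close> is constant on the atom, so the choice is harmless and the block lengths
  inherit the assumed regularly varying tail.\<close>

lemma prob_blen_greater:
  assumes j: "j \<ge> 1"
  shows "prob {\<omega> \<in> space N. blen j \<omega> > n} =
    measure (atom_law E P \<alpha>) {w \<in> space (atom_law E P \<alpha>). enat n < return_time \<alpha> w 1}"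
proof -
  define x0 where "x0 = (SOME x. x \<in> \<alpha>)"
  have x0: "x0 \<in> \<alpha>" unfolding x0_def using a by (rule someI)
  have x0E: "x0 \<in> space E" using sets.sets_into_space[OF \<alpha>] x0 by blast
  have "emeasure N {\<omega> \<in> space N. blen j \<omega> > n} = avoid_prob P \<alpha> n x0"
    unfolding emeasure_blen_greater[OF j] by (rule avoid_prob_atom[OF a x0])
  also have "\<dots> = emeasure (atom_law E P \<alpha>) {w \<in> space (atom_law E P \<alpha>). enat n < return_time \<alpha> w 1}"
    unfolding avoid_prob_path_law[OF x0E] atom_law_def x0_def[symmetric] less_return_time_1_iff ..
  finally show ?thesis by (simp add: measure_def)
qed

end

end

section \<open>Heavy-tailed block lengths\<close>

text \<open>A Chernoff bound with exponent -1: since \<open>exp (- 1) \<le> 1 / 2\<close>, each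
  factor has mean at most \<open>1 - p / 2\<close>, hence at most
  \<open>exp (- (p / 2))\<close>.\<close>

lemma (in prob_space) prob_card_events_le:
  fixes Y :: "'i \<Rightarrow> 'a \<Rightarrow> 'b"
  assumes indep: "indep_vars K Y J" and J: "finite J"
    and A: "\<And>j. j \<in> J \<Longrightarrow> A j \<in> sets (K j)" and p: "\<And>j. j \<in> J \<Longrightarrow> p \<le> prob {\<omega> \<in> space M. Y j \<omega> \<in> A j}"
  shows "prob {\<omega> \<in> space M. real (card {j\<in>J. Y j \<omega> \<in> A j}) \<le> c} \<le> exp (c - real (card J) * p / 2)"
proof -
  define Z :: "'i \<Rightarrow> 'a \<Rightarrow> real" where "Z j \<omega> = exp (- indicator (A j) (Y j \<omega>))" for j \<omega>
  have rv: "Y j \<in> M \<rightarrow>\<^sub>M K j" if "j \<in> J" for j using indep that by (auto simp: indep_vars_def)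
  have meas: "(\<lambda>\<omega>. indicator (A j) (Y j \<omega>) :: real) \<in> borel_measurable M" if "j \<in> J" for j
    using measurable_compose[OF rv borel_measurable_indicator[OF A]] that by blast
  have indepZ: "indep_vars (\<lambda>_. borel) Z J"
    unfolding Z_def
    by (rule indep_vars_compose2[OF indep]) (auto intro!: measurable_compose[OF borel_measurable_uminus[OF borel_measurable_indicator[OF A]] borel_measurable_exp])
  have Zm: "Z j \<in> borel_measurable M" if "j \<in> J" for j using indepZ that by (auto simp: indep_vars_def)
  have Zb: "0 \<le> Z j \<omega>" "Z j \<omega> \<le> 1" for j \<omega> by (auto simp: Z_def)
  have Zint: "integrable M (Z j)" if "j \<in> J" for j
    by (rule integrable_const_bound[where B = 1]) (use Zb Zm[OF that] in auto)
  have EZ: "expectation (Z j) \<le> exp (- (p / 2))" if j: "j \<in> J" for j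
  proof -
    have half: "exp (- 1 :: real) \<le> 1 / 2"
    proof -
      have "2 \<le> exp (1 :: real)" using exp_ge_add_one_self[of 1] by simp
      then show ?thesis by (simp add: exp_minus field_simps)
    qed
    have "expectation (Z j) \<le> expectation (\<lambda>\<omega>. 1 - 1 / 2 * indicator {\<omega> \<in> space M. Y j \<omega> \<in> A j} \<omega>)"
    proof (rule integral_mono[OF Zint[OF j]])
      have "{\<omega> \<in> space M. Y j \<omega> \<in> A j} \<in> events" using measurable_sets[OF rv[OF j] A[OF j]] by (simp add: vimage_def Int_def conj_commute)
      then show "integrable M (\<lambda>\<omega>. 1 - 1 / 2 * indicator {\<omega> \<in> space M. Y j \<omega> \<in> A j} \<omega> :: real)"
        by (intro integrable_const_bound[where B = 1]) (auto simp: indicator_def)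
      show "Z j \<omega> \<le> 1 - 1 / 2 * indicator {\<omega> \<in> space M. Y j \<omega> \<in> A j} \<omega>" if "\<omega> \<in> space M" for \<omega>
        using half that by (auto simp: Z_def indicator_def)
    qed
    also have "\<dots> = 1 - prob {\<omega> \<in> space M. Y j \<omega> \<in> A j} / 2"
    proof -
      have "{\<omega> \<in> space M. Y j \<omega> \<in> A j} \<in> events" using measurable_sets[OF rv[OF j] A[OF j]] by (simp add: vimage_def Int_def conj_commute)
      then show ?thesis by (subst Bochner_Integration.integral_diff) (auto simp: prob_space less_top[symmetric])
    qed
    also have "\<dots> \<le> 1 + - (p / 2)" using p[OF j] by simp
    also have "\<dots> \<le> exp (- (p / 2))" by (rule exp_ge_add_one_self)
    finally show ?thesis .
  qed
  have card_eq: "(\<Prod>j\<in>J. Z j \<omega>) = exp (- real (card {j\<in>J. Y j \<omega> \<in> A j}))" for \<omega>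
  proof -
    have "(\<Sum>j\<in>J. indicator (A j) (Y j \<omega>) :: real) = real (card {j\<in>J. Y j \<omega> \<in> A j})"
      using J by (simp add: indicator_def sum.If_cases Int_def)
    then show ?thesis unfolding Z_def exp_sum[OF J, symmetric] by (simp add: sum_negf)
  qed
  let ?W = "\<lambda>\<omega>. \<Prod>j\<in>J. Z j \<omega>"
  have W: "integrable M ?W" by (rule indep_vars_integrable[OF J indepZ Zint])
  have "prob {\<omega> \<in> space M. real (card {j\<in>J. Y j \<omega> \<in> A j}) \<le> c} = prob {\<omega> \<in> space M. exp (- c) \<le> ?W \<omega>}"
    unfolding card_eq by simp
  also have "\<dots> \<le> expectation ?W / exp (- c)"
    by (rule integral_Markov_inequality_measure[OF W]) (auto intro!: prod_nonneg Zb)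
  also have "expectation ?W = (\<Prod>j\<in>J. expectation (Z j))"
    by (rule indep_vars_lebesgue_integral[OF J indepZ Zint])
  also have "\<dots> \<le> (\<Prod>j\<in>J. exp (- (p / 2)))"
    by (intro prod_mono conjI EZ Bochner_Integration.integral_nonneg Zb)
  also have "\<dots> = exp (- (real (card J) * p / 2))"
    by (simp add: exp_of_nat_mult[symmetric])
  also have "\<dots> / exp (- c) = exp (c - real (card J) * p / 2)" by (simp add: exp_diff[symmetric] add.commute)
  finally show ?thesis by (simp add: divide_right_mono)
qed

text \<open>In the ratio the Gamma factor cancels and the slowly varying factor tends to 1. Later
  estimates compare the tail at \<open>n\<close> with the tail at integer multiples, so natural
  \<open>lam\<close> suffices.\<close>

lemma regularly_varying_ratio:
  fixes F :: "nat \<Rightarrow> real"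
  assumes F: "F \<sim>[at_top] (\<lambda>n. 1 / (Gamma (1 - \<beta>) * real n powr \<beta> * L (real n)))"
    and L: "slowly_varying L" and \<beta>: "0 < \<beta>" "\<beta> < 1" and lam: "lam \<ge> 1"
  shows "(\<lambda>n. F (lam * n) / F n) \<longlonglongrightarrow> real lam powr (- \<beta>)"
    and "\<forall>\<^sub>F n in sequentially. F n > 0"
proof -
  define h where "h n = 1 / (Gamma (1 - \<beta>) * real n powr \<beta> * L (real n))" for n
  have G: "Gamma (1 - \<beta>) > 0" using \<beta> by (intro Gamma_real_pos) simp
  obtain a where a: "\<And>x. x \<ge> a \<Longrightarrow> L x > 0" using L unfolding slowly_varying_def by blast
  have ev: "\<forall>\<^sub>F n in sequentially. L (real n) > 0 \<and> n \<ge> 1"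
    using eventually_ge_at_top[of "nat \<lceil>a\<rceil>"] eventually_ge_at_top[of 1]
    by eventually_elim (auto intro!: a)
  have hpos: "\<forall>\<^sub>F n in sequentially. h n > 0"
    using ev by eventually_elim (use G in \<open>simp add: h_def\<close>)
  have Fh: "F \<sim>[at_top] h" using F by (simp add: h_def[abs_def])
  show Fpos: "\<forall>\<^sub>F n in sequentially. F n > 0"
    using asymp_equiv_eventually_pos_iff[OF Fh] hpos by eventually_elim simp
  have fl: "filterlim (\<lambda>n. lam * n) at_top sequentially"
    using lam by (intro filterlim_at_top_mono[OF filterlim_ident]) (auto intro!: eventually_sequentiallyI)
  have "(\<lambda>n. F (lam * n) / F n) \<sim>[at_top] (\<lambda>n. h (lam * n) / h n)"
    by (intro asymp_equiv_divide asymp_equiv_compose'[OF Fh fl] Fh)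
  moreover have "(\<lambda>n. h (lam * n) / h n) \<longlonglongrightarrow> real lam powr (- \<beta>)"
  proof -
    have "((\<lambda>x. L (real lam * x) / L x) \<longlongrightarrow> 1) at_top"
      using L lam unfolding slowly_varying_def by simp
    then have "(\<lambda>n. L (real lam * real n) / L (real n)) \<longlonglongrightarrow> 1"
      by (rule filterlim_compose[OF _ filterlim_real_sequentially])
    then have "(\<lambda>n. real lam powr (- \<beta>) * inverse (L (real lam * real n) / L (real n))) \<longlonglongrightarrow> real lam powr (- \<beta>) * inverse 1"
      by (intro tendsto_intros) auto
    moreover have "\<forall>\<^sub>F n in sequentially. real lam powr (- \<beta>) * inverse (L (real lam * real n) / L (real n)) = h (lam * n) / h n"
      using ev
    proof eventually_elim
      case (elim n)
      then show ?case using G lam by (simp add: h_def powr_mult powr_minus field_simps)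
    qed
    ultimately show ?thesis by (simp add: Lim_transform_eventually)
  qed
  ultimately show "(\<lambda>n. F (lam * n) / F n) \<longlonglongrightarrow> real lam powr (- \<beta>)"
    by (simp add: tendsto_asymp_equiv_cong)
qed

text \<open>Induction from \<open>n div lam\<close> to \<open>n\<close>, for \<open>lam\<close> so large that \<open>lam * (lam + 1) powr (- \<beta>) > 1\<close>.\<close>

lemma karamata_bound:
  fixes F :: "nat \<Rightarrow> real"
  assumes anti: "antimono F" and pos: "\<And>n. F n > 0" and le1: "\<And>n. F n \<le> 1"
    and ratio: "\<And>lam. lam \<ge> 1 \<Longrightarrow> (\<lambda>n. F (lam * n) / F n) \<longlonglongrightarrow> real lam powr (- \<beta>)"
    and \<beta>: "0 < \<beta>" "\<beta> < 1"
  shows "\<exists>C>0. \<forall>n\<ge>1. (\<Sum>i<n. F i) \<le> C * real n * F n"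
proof -
  have "\<forall>\<^sub>F x in at_top. 1 < x * (x + 1) powr (- \<beta>)"
    using \<beta> by real_asymp
  then have "\<forall>\<^sub>F n in sequentially. 1 < real n * (real n + 1) powr (- \<beta>)"
    by (rule eventually_compose_filterlim[OF _ filterlim_real_sequentially])
  then have "\<forall>\<^sub>F n in sequentially. 1 < real n * (real n + 1) powr (- \<beta>) \<and> 2 \<le> n"
    using eventually_ge_at_top[of 2] by eventually_elim simp
  then obtain lam :: nat where lam: "1 < real lam * (real lam + 1) powr (- \<beta>)" "2 \<le> lam"
    by (auto simp: eventually_at_top_linorder)
  \<comment> \<open>The midpoint between \<open>1 / lam\<close> and the limit ratio at
    \<open>lam + 1\<close>: below the latter, so eventually a lower bound for the ratio, yet with
    \<open>lam * q > 1\<close>.\<close>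
  define q where "q = ((real lam + 1) powr (- \<beta>) + 1 / real lam) / 2"
  have q: "q < (real lam + 1) powr (- \<beta>)" "1 < real lam * q" "q > 0"
    using lam by (auto simp: q_def field_simps intro: add_pos_nonneg)
  have "\<forall>\<^sub>F n in sequentially. q < F ((lam + 1) * n) / F n"
    using ratio[of "lam + 1"] q(1) by (intro order_tendstoD) (auto simp: add.commute)
  then obtain m0 where m0: "\<And>m. m \<ge> m0 \<Longrightarrow> q < F ((lam + 1) * m) / F m"
    by (auto simp: eventually_at_top_linorder)
  \<comment> \<open>For \<open>n > B\<close> the quotient \<open>m = n div lam\<close> exceeds
    \<open>m0\<close>, so the ratio bound holds at \<open>m\<close>, and it exceeds
    \<open>lam\<close>, so that \<open>n \<le> (lam + 1) * m\<close>.\<close>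
  define B where "B = lam * (max m0 lam + 1)"
  \<comment> \<open>The first entry closes the induction, as it yields
    \<open>C + lam \<le> C * (lam * q)\<close>; the second covers \<open>n \<le> B\<close>, where
    each summand is at most 1 and \<open>F n \<ge> F B\<close>.\<close>
  define C where "C = max (real lam / (real lam * q - 1)) (1 / F B)"
  have C1: "C * (real lam * q) \<ge> C + real lam"
  proof -
    have "real lam / (real lam * q - 1) \<le> C" by (simp add: C_def)
    then have "real lam \<le> C * (real lam * q - 1)" using q(2) by (simp add: pos_divide_le_eq)
    then show ?thesis by (simp add: right_diff_distrib)
  qed
  have C0: "C > 0" using pos[of B] by (auto simp: C_def less_max_iff_disj)
  have "(\<Sum>i<n. F i) \<le> C * real n * F n" if "n \<ge> 1" for n
    using that
  proof (induction n rule: less_induct)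
    case (less n)
    show ?case
    proof (cases "n \<le> B")
      case True
      have "(\<Sum>i<n. F i) \<le> (\<Sum>i<n. 1)" by (rule sum_mono) (rule le1)
      also have "\<dots> = real n * (1 / F B * F B)" using pos[of B] by simp
      also have "\<dots> \<le> real n * (C * F n)"
        using True pos[of B] C0 antimonoD[OF anti True] by (intro mult_left_mono mult_mono) (auto simp: C_def)
      finally show ?thesis by (simp add: mult_ac)
    next
      case False
      define m where "m = n div lam"
      have n: "lam * m \<le> n" "n < lam * m + lam"
        using lam(2) mult_div_mod_eq[of lam n] mod_less_divisor[of lam n] unfolding m_def by linarith+
      have "lam * (m + 1) = lam * m + lam" by simp
      then have "B < lam * (m + 1)" using False n(2) by linarith
      then have "lam * (max m0 lam + 1) < lam * (m + 1)" by (simp only: B_def)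
      then have m: "max m0 lam < m" using lam(2) by (simp only: mult_less_cancel1) linarith
      have "2 * m \<le> lam * m" using lam(2) by (rule mult_right_mono) simp
      then have mn: "m < n" using n(1) m by linarith
      have n2: "n \<le> (lam + 1) * m" using n(2) m by simp
      have "(\<Sum>i<n. F i) \<le> (\<Sum>i<(lam + 1) * m. F i)"
        using n2 pos by (intro sum_mono2) (auto intro: less_imp_le)
      also have "\<dots> = (\<Sum>i<m. F i) + (\<Sum>i\<in>{m..<(lam + 1) * m}. F i)"
        by (subst sum.union_disjoint[symmetric]) (auto intro!: sum.cong)
      also have "(\<Sum>i\<in>{m..<(lam + 1) * m}. F i) \<le> (\<Sum>i\<in>{m..<(lam + 1) * m}. F m)"
        by (intro sum_mono antimonoD[OF anti]) auto
      also have "\<dots> = real lam * real m * F m" by simp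
      also have "(\<Sum>i<m. F i) \<le> C * real m * F m" using less.IH[OF mn] m by simp
      also have "C * real m * F m + real lam * real m * F m = (C + real lam) * (real m * F m)" by (simp add: algebra_simps)
      also have "\<dots> \<le> (C * (real lam * q)) * (real m * F m)"
        using C1 pos[of m] by (intro mult_right_mono) auto
      also have "\<dots> = C * (real (lam * m) * (q * F m))" by simp
      also have "\<dots> \<le> C * (real n * F n)"
      proof -
        have "q * F m \<le> F ((lam + 1) * m)" using m0[of m] m pos[of m] by (simp add: pos_less_divide_eq less_imp_le)
        also have "\<dots> \<le> F n" by (rule antimonoD[OF anti n2])
        finally show ?thesis using n(1) C0 q(3) pos[of m] by (intro mult_left_mono mult_mono) (auto simp del: of_nat_mult)
      qed
      finally show ?thesis by (simp add: mult_ac)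
    qed
  qed
  then show ?thesis using C0 by blast
qed

text \<open>\<open>l j\<close> are the block lengths, \<open>t1\<close> the first return time, \<open>T n\<close> the number of complete blocks up to
  time \<open>n\<close>.\<close>

locale heavy_blocks = prob_space M for M :: "'w measure" +
  fixes l :: "nat \<Rightarrow> 'w \<Rightarrow> nat" and t1 :: "'w \<Rightarrow> nat" and T :: "nat \<Rightarrow> 'w \<Rightarrow> nat" and F :: "nat \<Rightarrow> real" and \<beta> :: real
  assumes indep: "indep_vars (\<lambda>_. count_space UNIV) l {1..}"
    and l_meas [measurable]: "\<And>j. l j \<in> M \<rightarrow>\<^sub>M count_space UNIV"
    and tail: "\<And>j n. j \<ge> 1 \<Longrightarrow> prob {\<omega> \<in> space M. n < l j \<omega>} = F n"
    and t1_meas [measurable]: "t1 \<in> M \<rightarrow>\<^sub>M count_space UNIV"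
    and T_meas [measurable]: "\<And>n. T n \<in> M \<rightarrow>\<^sub>M count_space UNIV"
    and T_iff: "AE \<omega> in M. \<forall>n k. 1 \<le> k \<longrightarrow> (k \<le> T n \<omega> \<longleftrightarrow> t1 \<omega> + (\<Sum>j=1..k. l j \<omega>) \<le> n)"
    and F_pos: "\<And>n. F n > 0"
    and ratio: "\<And>lam. lam \<ge> 1 \<Longrightarrow> (\<lambda>n. F (lam * n) / F n) \<longlonglongrightarrow> real lam powr (- \<beta>)"
    and \<beta>: "0 < \<beta>" "\<beta> < 1"
begin

lemma count_sets: "f \<in> M \<rightarrow>\<^sub>M count_space UNIV \<Longrightarrow> {\<omega> \<in> space M. R (f \<omega>)} \<in> sets M"
  using measurable_sets[of f M "count_space UNIV" "Collect R"] by (simp add: vimage_def Int_def conj_commute)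

lemma real_of_nat_measurable: "f \<in> M \<rightarrow>\<^sub>M count_space UNIV \<Longrightarrow> (\<lambda>\<omega>. h (f \<omega>) :: real) \<in> borel_measurable M"
  by (rule measurable_compose[where N = "count_space UNIV"]) simp_all

lemma block_sum_measurable: "(\<lambda>\<omega>. \<Sum>j=1..k. (\<phi> (l j \<omega>) :: real)) \<in> borel_measurable M"
  by (intro borel_measurable_sum real_of_nat_measurable l_meas)

lemma random_block_sum_measurable: "(\<lambda>\<omega>. \<Sum>j=1..T n \<omega>. (\<phi> (l j \<omega>) :: real)) \<in> borel_measurable M"
  by (rule measurable_compose_countable[where f = "\<lambda>k \<omega>. \<Sum>j=1..k. \<phi> (l j \<omega>)" and g = "T n", OF block_sum_measurable T_meas])

lemma F_le_1: "F n \<le> 1"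
  using prob_le_1[of "{\<omega> \<in> space M. n < l 1 \<omega>}"] unfolding tail[OF order_refl] .

lemma F_antimono: "antimono F"
proof (rule antimonoI)
  fix m n :: nat assume "m \<le> n"
  then have "prob {\<omega> \<in> space M. n < l 1 \<omega>} \<le> prob {\<omega> \<in> space M. m < l 1 \<omega>}"
    by (intro finite_measure_mono count_sets l_meas) auto
  then show "F n \<le> F m" using tail[of 1] by simp
qed

lemma prob_nat_tail:
  assumes f: "f \<in> M \<rightarrow>\<^sub>M count_space (UNIV :: nat set)"
  shows "(\<lambda>n. prob {\<omega> \<in> space M. n < f \<omega>}) \<longlonglongrightarrow> 0"
proof -
  have "(\<lambda>n. prob {\<omega> \<in> space M. n < f \<omega>}) \<longlonglongrightarrow> prob (\<Inter>n. {\<omega> \<in> space M. n < f \<omega>})"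
    by (rule finite_Lim_measure_decseq) (auto simp: decseq_def intro: count_sets[OF f])
  also have "(\<Inter>n. {\<omega> \<in> space M. n < f \<omega>}) = {}" by force
  finally show ?thesis by simp
qed

lemma F_tendsto_0: "F \<longlonglongrightarrow> 0"
  using prob_nat_tail[OF l_meas[of 1]] tail[of 1] by simp

lemma expectation_min:
  assumes "j \<ge> 1"
  shows "expectation (\<lambda>\<omega>. real (min (l j \<omega>) m)) = (\<Sum>i<m. F i)"
proof -
  have min_eq: "real (min a m) = (\<Sum>i<m. if i < a then 1 else 0)" for a
  proof -
    have "{..<m} \<inter> {i. i < a} = {..<min a m}" by auto
    then show ?thesis by (simp add: sum.If_cases)
  qed
  have "expectation (\<lambda>\<omega>. real (min (l j \<omega>) m)) = expectation (\<lambda>\<omega>. \<Sum>i<m. indicator {\<omega> \<in> space M. i < l j \<omega>} \<omega>)"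
    unfolding min_eq by (intro Bochner_Integration.integral_cong sum.cong refl) (simp add: indicator_def)
  also have "\<dots> = (\<Sum>i<m. prob {\<omega> \<in> space M. i < l j \<omega>})"
    by (subst Bochner_Integration.integral_sum) (auto intro!: integrable_real_indicator count_sets simp: less_top[symmetric])
  finally show ?thesis using tail[OF assms] by simp
qed

text \<open>Truncation at \<open>m\<close> makes first moments usable for heavy-tailed lengths: the
  truncated mean is the sum of the tail up to \<open>m\<close>, which the Karamata bound compares
  with \<open>m * F m\<close>.\<close>

lemma prob_sum_min_le:
  assumes C: "\<And>n. n \<ge> 1 \<Longrightarrow> (\<Sum>i<n. F i) \<le> C * real n * F n" and m: "m \<ge> 1" and a: "a > 0"
  shows "prob {\<omega> \<in> space M. a < (\<Sum>j=1..k. real (min (l j \<omega>) m))} \<le> real k * (C * real m * F m) / a"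
proof -
  have int: "integrable M (\<lambda>\<omega>. real (min (l j \<omega>) m))" for j
    by (rule integrable_const_bound[where B = "real m"]) (auto intro!: real_of_nat_measurable[where h = "\<lambda>x. real (min x m)"])
  have "prob {\<omega> \<in> space M. a < (\<Sum>j=1..k. real (min (l j \<omega>) m))} \<le> prob {\<omega> \<in> space M. a \<le> (\<Sum>j=1..k. real (min (l j \<omega>) m))}"
  proof (rule finite_measure_mono)
    have [measurable]: "(\<lambda>\<omega>. \<Sum>j=1..k. real (min (l j \<omega>) m)) \<in> borel_measurable M" by (rule block_sum_measurable)
    show "{\<omega> \<in> space M. a \<le> (\<Sum>j=1..k. real (min (l j \<omega>) m))} \<in> events" by measurable
  qed auto
  also have "\<dots> \<le> expectation (\<lambda>\<omega>. \<Sum>j=1..k. real (min (l j \<omega>) m)) / a"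
    by (rule integral_Markov_inequality_measure[where A = "{}"]) (auto intro!: int a sum_nonneg)
  also have "expectation (\<lambda>\<omega>. \<Sum>j=1..k. real (min (l j \<omega>) m)) = (\<Sum>j=1..k. \<Sum>i<m. F i)"
    by (subst Bochner_Integration.integral_sum[OF int]) (intro sum.cong refl expectation_min, simp)
  also have "\<dots> / a \<le> real k * (C * real m * F m) / a"
    using C[OF m] a by (auto intro!: divide_right_mono mult_left_mono)
  finally show ?thesis .
qed

text \<open>If \<open>k\<close> blocks are complete by time \<open>n\<close>, none of them is longer
  than \<open>n\<close>. For \<open>k \<ge> K / F n\<close> the expected number of longer blocks is
  at least \<open>K\<close>, so the Chernoff bound with \<open>c = 0\<close> applies.\<close>

lemma prob_T_upper:
  assumes K: "K > 0"
  shows "prob {\<omega> \<in> space M. real (T n \<omega>) > K / F n} \<le> exp (- K / 2)"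
proof -
  define k where "k = nat \<lceil>K / F n\<rceil>"
  have KF: "K / F n > 0" using K F_pos by simp
  then have k: "k \<ge> 1" "real k \<ge> K / F n" unfolding k_def by linarith+
  have "prob {\<omega> \<in> space M. real (T n \<omega>) > K / F n} \<le> prob {\<omega> \<in> space M. real (card {j\<in>{1..k}. l j \<omega> \<in> {n<..}}) \<le> 0}"
  proof (rule finite_measure_mono_AE)
    show "AE \<omega> in M. \<omega> \<in> {\<omega> \<in> space M. real (T n \<omega>) > K / F n} \<longrightarrow> \<omega> \<in> {\<omega> \<in> space M. real (card {j\<in>{1..k}. l j \<omega> \<in> {n<..}}) \<le> 0}"
      using T_iff
    proof eventually_elim
      case (elim \<omega>)
      show ?case
      proof
        assume \<omega>: "\<omega> \<in> {\<omega> \<in> space M. real (T n \<omega>) > K / F n}"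
        have "k \<le> T n \<omega>"
        proof -
          have "K / F n < real (T n \<omega>)" using \<omega> by simp
          then have "\<lceil>K / F n\<rceil> \<le> int (T n \<omega>)" by linarith
          then show ?thesis by (simp add: k_def nat_le_iff)
        qed
        then have le: "t1 \<omega> + (\<Sum>j=1..k. l j \<omega>) \<le> n" using elim k(1) by blast
        have "l j \<omega> \<le> n" if "j \<in> {1..k}" for j
          using member_le_sum[OF that, of "\<lambda>j. l j \<omega>"] le by simp
        then have "{j\<in>{1..k}. l j \<omega> \<in> {n<..}} = {}" by (auto simp: not_less)
        then show "\<omega> \<in> {\<omega> \<in> space M. real (card {j\<in>{1..k}. l j \<omega> \<in> {n<..}}) \<le> 0}" using \<omega> by simp
      qed
    qed
    have "{\<omega> \<in> space M. real (card {j\<in>{1..k}. l j \<omega> \<in> {n<..}}) \<le> 0} = {\<omega> \<in> space M. \<forall>j\<in>{1..k}. \<not> n < l j \<omega>}" by (auto simp: card_eq_0_iff)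
    also have "\<dots> \<in> events" by measurable
    finally show "{\<omega> \<in> space M. real (card {j\<in>{1..k}. l j \<omega> \<in> {n<..}}) \<le> 0} \<in> events" .
  qed
  also have "\<dots> \<le> exp (0 - real (card {1..k}) * F n / 2)"
    by (rule prob_card_events_le[OF indep_vars_subset[OF indep]]) (use tail in auto)
  also have "\<dots> \<le> exp (- K / 2)"
    using k(2) F_pos[of n] by (simp add: pos_divide_le_eq)
  finally show ?thesis .
qed

lemma karamata: "\<exists>C>0. \<forall>n\<ge>1. (\<Sum>i<n. F i) \<le> C * real n * F n"
  by (rule karamata_bound[OF F_antimono F_pos F_le_1 ratio \<beta>])

text \<open>If fewer than about \<open>d / F n\<close> blocks are complete, then the first return
  comes after \<open>n div 2\<close>, or one of these blocks is longer than \<open>n\<close>, or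
  their lengths truncated at \<open>n\<close> exceed \<open>n / 4\<close>. The last two have
  probability proportional to \<open>k * F n\<close>, which is close to \<open>d\<close>.\<close>

lemma prob_T_lower:
  assumes e: "e > 0"
  shows "\<exists>d>0. \<forall>\<^sub>F n in sequentially. prob {\<omega> \<in> space M. real (T n \<omega>) < d / F n} \<le> e"
proof -
  obtain C where C: "C > 0" "\<And>n. n \<ge> 1 \<Longrightarrow> (\<Sum>i<n. F i) \<le> C * real n * F n" using karamata by blast
  \<comment> \<open>The 1 stands for the union over long blocks, \<open>4 * C\<close> for Markov's
    inequality at level \<open>n / 4\<close>.\<close>
  define D where "D = 1 + 4 * C"
  have D: "D > 0" using C by (simp add: D_def)
  define d where "d = e / (3 * D)"
  have d: "d > 0" using e D by (simp add: d_def)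
  have "\<forall>\<^sub>F n in sequentially. F n < e / (3 * D)" using F_tendsto_0 e D by (intro order_tendstoD) auto
  moreover have "\<forall>\<^sub>F n in sequentially. prob {\<omega> \<in> space M. n div 2 < t1 \<omega>} < e / 3"
  proof (rule eventually_compose_filterlim[where f = "\<lambda>n. n div 2"])
    show "\<forall>\<^sub>F n in sequentially. prob {\<omega> \<in> space M. n < t1 \<omega>} < e / 3"
      using prob_nat_tail[OF t1_meas] e by (intro order_tendstoD) auto
    show "filterlim (\<lambda>n::nat. n div 2) sequentially sequentially"
      by (rule filterlim_at_top_div_const_nat) simp
  qed
  ultimately have "\<forall>\<^sub>F n in sequentially. prob {\<omega> \<in> space M. real (T n \<omega>) < d / F n} \<le> e"
    using eventually_ge_at_top[of 2]
  proof eventually_elim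
    case (elim n)
    define k where "k = nat \<lceil>d / F n\<rceil>"
    have dF: "d / F n > 0" using d F_pos by simp
    then have k: "k \<ge> 1" "real k \<ge> d / F n" "real k \<le> d / F n + 1" unfolding k_def by linarith+
    let ?A = "{\<omega> \<in> space M. n div 2 < t1 \<omega>}"
    let ?B = "\<Union>j\<in>{1..k}. {\<omega> \<in> space M. n < l j \<omega>}"
    let ?C = "{\<omega> \<in> space M. real n / 4 < (\<Sum>j=1..k. real (min (l j \<omega>) n))}"
    have [measurable]: "(\<lambda>\<omega>. \<Sum>j=1..k. real (min (l j \<omega>) n)) \<in> borel_measurable M" by (rule block_sum_measurable)
    have sets: "?A \<in> events" "?B \<in> events" "?C \<in> events" by measurable
    have "prob {\<omega> \<in> space M. real (T n \<omega>) < d / F n} \<le> prob (?A \<union> ?B \<union> ?C)"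
    proof (rule finite_measure_mono_AE)
      show "AE \<omega> in M. \<omega> \<in> {\<omega> \<in> space M. real (T n \<omega>) < d / F n} \<longrightarrow> \<omega> \<in> ?A \<union> ?B \<union> ?C"
        using T_iff
      proof eventually_elim
        case (elim \<omega>)
        show ?case
        proof
          assume \<omega>: "\<omega> \<in> {\<omega> \<in> space M. real (T n \<omega>) < d / F n}"
          have "\<not> k \<le> T n \<omega>"
          proof
            assume "k \<le> T n \<omega>"
            then have "real k \<le> real (T n \<omega>)" by simp
            then show False using \<omega> k(2) by simp
          qed
          then have gt: "n < t1 \<omega> + (\<Sum>j=1..k. l j \<omega>)" using elim k(1) by (meson not_le)
          show "\<omega> \<in> ?A \<union> ?B \<union> ?C"
          proof (rule ccontr)
            assume out: "\<omega> \<notin> ?A \<union> ?B \<union> ?C"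
            then have t: "t1 \<omega> \<le> n div 2" and lj: "\<And>j. j \<in> {1..k} \<Longrightarrow> l j \<omega> \<le> n"
              and s: "(\<Sum>j=1..k. real (min (l j \<omega>) n)) \<le> real n / 4" using \<omega> by (auto simp: not_less)
            have "(\<Sum>j=1..k. real (min (l j \<omega>) n)) = real (\<Sum>j=1..k. l j \<omega>)"
              unfolding of_nat_sum by (intro sum.cong refl) (use lj in \<open>simp add: min_absorb1\<close>)
            then have "real (\<Sum>j=1..k. l j \<omega>) \<le> real n / 4" using s by simp
            moreover have "real (t1 \<omega>) \<le> real n / 2" using t by linarith
            moreover have "real n < real (t1 \<omega>) + real (\<Sum>j=1..k. l j \<omega>)" using gt by (metis of_nat_add of_nat_less_iff)
            ultimately show False by linarith
          qed
        qed
      qed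
      show "?A \<union> ?B \<union> ?C \<in> events" using sets by blast
    qed
    also have "\<dots> \<le> prob ?A + prob ?B + prob ?C"
      using measure_Un_le[OF sets(1,2)] measure_Un_le[of "?A \<union> ?B" M ?C] sets by auto
    also have "prob ?B \<le> (\<Sum>j=1..k. prob {\<omega> \<in> space M. n < l j \<omega>})"
      by (rule finite_measure_subadditive_finite) (auto intro!: count_sets)
    also have "\<dots> = real k * F n" using tail by simp
    also have "prob ?C \<le> real k * (C * real n * F n) / (real n / 4)"
      by (rule prob_sum_min_le[OF C(2)]) (use elim in auto)
    also have "\<dots> = real k * F n * (4 * C)" using elim by (simp add: field_simps)
    also have "prob ?A + real k * F n + real k * F n * (4 * C) = prob ?A + real k * F n * D"
      by (simp add: D_def algebra_simps)
    also have "real k * F n \<le> d + F n"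
    proof -
      have "real k * F n \<le> (d / F n + 1) * F n" using k(3) F_pos[of n] by (intro mult_right_mono) auto
      also have "\<dots> = d + F n" using F_pos[of n] by (simp add: field_simps)
      finally show ?thesis .
    qed
    also have "(d + F n) * D \<le> (2 * (e / (3 * D))) * D"
      using elim D by (intro mult_right_mono) (auto simp: d_def)
    also have "(2 * (e / (3 * D))) * D = 2 * e / 3" using D by simp
    finally show ?case using elim D by simp
  qed
  then show ?thesis using d by blast
qed

text \<open>There are at least \<open>d0 / F n\<close> blocks with high probability, and each
  exceeds \<open>n / lam\<close> with probability about \<open>lam powr \<beta> * F n\<close>. The
  expected count thus grows like \<open>lam powr \<beta>\<close>, and the Chernoff bound makes a
  count far below it unlikely once \<open>lam\<close> is large.\<close>

lemma prob_many_big: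
  assumes e: "e > 0"
  shows "\<exists>d>0. \<exists>lam0. \<forall>lam\<ge>lam0. \<forall>\<^sub>F n in sequentially.
    prob {\<omega> \<in> space M. (\<Sum>j=1..T n \<omega>. if real (l j \<omega>) > 1 / real lam * n then 1 else 0) < d * real lam powr \<beta>} \<le> e"
proof -
  obtain d0 where d0: "d0 > 0" "\<forall>\<^sub>F n in sequentially. prob {\<omega> \<in> space M. real (T n \<omega>) < d0 / F n} \<le> e / 2"
    using prob_T_lower[of "e / 2"] e by auto
  \<comment> \<open>A factor 2 is lost in the ratio of the tails; the remaining 4 makes the Chernoff
    exponent \<open>d * lam powr \<beta> - 4 * d * lam powr \<beta> / 2\<close>, that is, minus the
    threshold.\<close>
  define d where "d = d0 / 8"
  have d: "d > 0" using d0 by (simp add: d_def)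
  have "((\<lambda>x::real. exp (- (d * x powr \<beta>))) \<longlongrightarrow> 0) at_top" using d \<beta> by real_asymp
  then have "(\<lambda>lam::nat. exp (- (d * real lam powr \<beta>))) \<longlonglongrightarrow> 0"
    by (rule filterlim_compose[OF _ filterlim_real_sequentially])
  then have "\<forall>\<^sub>F lam::nat in sequentially. exp (- (d * real lam powr \<beta>)) < e / 2"
    using e by (intro order_tendstoD) auto
  then obtain lam1 :: nat where lam1: "\<And>lam. lam \<ge> lam1 \<Longrightarrow> exp (- (d * real lam powr \<beta>)) < e / 2"
    by (auto simp: eventually_at_top_linorder)
  have "\<forall>\<^sub>F n in sequentially.
    prob {\<omega> \<in> space M. (\<Sum>j=1..T n \<omega>. if real (l j \<omega>) > 1 / real lam * n then 1 else 0) < d * real lam powr \<beta>} \<le> e"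
    if lam: "lam \<ge> max 1 lam1" for lam
  proof -
    have lam': "lam \<ge> 1" "lam \<ge> lam1" using lam by auto
    have pw: "real lam powr \<beta> > 0" using lam' by simp
    have "\<forall>\<^sub>F m in sequentially. real lam powr (- \<beta>) * (1 / 2) < F (lam * m) / F m \<and> F (lam * m) / F m < real lam powr (- \<beta>) * 2"
      using ratio[OF lam'(1)] lam' by (intro eventually_conj order_tendstoD) auto
    then have "\<forall>\<^sub>F n in sequentially. F (lam * (n div lam)) / F (n div lam) < real lam powr (- \<beta>) * 2"
      using lam' by (intro eventually_compose_filterlim[where f = "\<lambda>n. n div lam" and F = sequentially, OF _ filterlim_at_top_div_const_nat]) (auto elim: eventually_mono)
    then show ?thesis using d0(2)
    proof eventually_elim
      case (elim n)
      define m where "m = n div lam"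
      have nm: "lam * m \<le> n" "n < lam * (m + 1)"
      proof -
        have "lam * m + n mod lam = n" "n mod lam < lam" using lam'(1) by (simp_all add: m_def)
        then show "lam * m \<le> n" "n < lam * (m + 1)" by simp_all
      qed
      have big: "real a > 1 / real lam * n \<longleftrightarrow> a > m" for a :: nat
      proof -
        have "real a > 1 / real lam * n \<longleftrightarrow> n < lam * a"
          using lam' by (simp add: field_simps flip: of_nat_mult)
        also have "\<dots> \<longleftrightarrow> m < a"
        proof
          assume "n < lam * a"
          then have "lam * m < lam * a" using nm(1) by linarith
          then show "m < a" by simp
        next
          assume "m < a"
          then have "m + 1 \<le> a" by simp
          then have "lam * (m + 1) \<le> lam * a" by (rule mult_le_mono2)
          then show "n < lam * a" using nm(2) by linarith
        qed
        finally show ?thesis .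
      qed
      have Fm: "F m / F n \<ge> real lam powr \<beta> / 2"
      proof -
        have "F (lam * m) < real lam powr (- \<beta>) * 2 * F m" using elim(1) F_pos[of m] by (simp add: m_def pos_divide_less_eq)
        moreover have "F n \<le> F (lam * m)" by (rule antimonoD[OF F_antimono nm(1)])
        ultimately have "F n * real lam powr \<beta> \<le> real lam powr (- \<beta>) * 2 * F m * real lam powr \<beta>"
          using pw by (intro mult_right_mono) auto
        also have "\<dots> = 2 * F m" using pw by (simp add: powr_minus field_simps)
        finally show ?thesis using F_pos[of n] by (simp add: field_simps)
      qed
      define k where "k = nat \<lceil>d0 / F n\<rceil>"
      have dF: "d0 / F n > 0" using d0 F_pos by simp
      then have k: "k \<ge> 1" "real k \<ge> d0 / F n" unfolding k_def by linarith+
      have kF: "real k * F m \<ge> 4 * (d * real lam powr \<beta>)"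
      proof -
        have "4 * (d * real lam powr \<beta>) = d0 * (real lam powr \<beta> / 2)" by (simp add: d_def)
        also have "\<dots> \<le> d0 * (F m / F n)" using Fm d0 by (intro mult_left_mono) auto
        also have "\<dots> = d0 / F n * F m" by simp
        also have "\<dots> \<le> real k * F m" using k F_pos[of m] by (intro mult_right_mono) auto
        finally show ?thesis .
      qed
      let ?L = "{\<omega> \<in> space M. (\<Sum>j=1..T n \<omega>. if real (l j \<omega>) > 1 / real lam * n then 1 else 0) < d * real lam powr \<beta>}"
      let ?A = "{\<omega> \<in> space M. real (T n \<omega>) < d0 / F n}"
      let ?B = "{\<omega> \<in> space M. real (card {j\<in>{1..k}. l j \<omega> \<in> {m<..}}) \<le> d * real lam powr \<beta>}"
      have card: "(\<Sum>j=1..k. if real (l j \<omega>) > 1 / real lam * n then 1 else 0) = real (card {j\<in>{1..k}. l j \<omega> \<in> {m<..}})" for k \<omega>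
        unfolding big by (simp add: sum.If_cases Int_def)
      have "(\<lambda>\<omega>. real (card {j\<in>{1..k}. l j \<omega> \<in> {m<..}})) \<in> borel_measurable M"
        unfolding card[symmetric] by (rule block_sum_measurable)
      then have B: "?B \<in> events" by measurable
      have A: "?A \<in> events" by (rule count_sets[OF T_meas])
      have "?L \<subseteq> ?A \<union> ?B"
      proof
        fix \<omega> assume \<omega>: "\<omega> \<in> ?L"
        show "\<omega> \<in> ?A \<union> ?B"
        proof (cases "\<omega> \<in> ?A")
          case False
          then have "d0 / F n \<le> real (T n \<omega>)" using \<omega> by simp
          then have "\<lceil>d0 / F n\<rceil> \<le> int (T n \<omega>)" by linarith
          then have "k \<le> T n \<omega>" by (simp add: k_def nat_le_iff)
          then have "card {j\<in>{1..k}. l j \<omega> \<in> {m<..}} \<le> card {j\<in>{1..T n \<omega>}. l j \<omega> \<in> {m<..}}"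
            by (intro card_mono) auto
          then show ?thesis using \<omega> unfolding card by simp
        qed simp
      qed
      then have "prob ?L \<le> prob (?A \<union> ?B)" using A B by (intro finite_measure_mono) auto
      also have "\<dots> \<le> prob ?A + prob ?B" by (rule measure_Un_le[OF A B])
      also have "prob ?B \<le> exp (d * real lam powr \<beta> - real (card {1..k}) * F m / 2)"
        by (rule prob_card_events_le[OF indep_vars_subset[OF indep]]) (use tail in auto)
      also have "\<dots> \<le> exp (- (d * real lam powr \<beta>))" using kF by simp
      also have "\<dots> \<le> e / 2" using lam1[OF lam'(2)] by simp
      finally show ?case using elim(2) by simp
    qed
  qed
  then show ?thesis using d by blast
qed

text \<open>With at most \<open>K / F n\<close> blocks, the expected total of the lengths truncated
  near \<open>n / lam\<close> is at most a multiple of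
  \<open>n * (lam + 1) powr \<beta> / lam\<close> by the Karamata bound and the ratio of the tails.
  Since \<beta> < 1 this is a small fraction of \<open>n\<close> for large \<open>lam\<close>: short
  blocks carry little of the time.\<close>

lemma prob_small_sum:
  fixes e r :: real and lam0 :: nat
  assumes e: "e > 0" and r: "r > 0"
  shows "\<exists>lam\<ge>lam0. \<forall>\<^sub>F n in sequentially.
    prob {\<omega> \<in> space M. (\<Sum>j=1..T n \<omega>. if real (l j \<omega>) > 1 / real lam * n then 0 else real (l j \<omega>)) > r * n} \<le> e"
proof -
  obtain C where C: "C > 0" "\<And>n. n \<ge> 1 \<Longrightarrow> (\<Sum>i<n. F i) \<le> C * real n * F n" using karamata by blast
  define K where "K = max 1 (- 2 * ln (e / 2))"
  have K: "K > 0" "exp (- K / 2) \<le> e / 2"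
  proof -
    show "K > 0" by (simp add: K_def)
    have "- K / 2 \<le> ln (e / 2)" by (simp add: K_def)
    then show "exp (- K / 2) \<le> e / 2" using e by (metis exp_le_cancel_iff exp_ln half_gt_zero)
  qed
  have "((\<lambda>x::real. 2 * K * C * (x + 1) powr \<beta> / (x * r)) \<longlongrightarrow> 0) at_top" using \<beta> r by real_asymp
  then have "(\<lambda>lam::nat. 2 * K * C * (real lam + 1) powr \<beta> / (real lam * r)) \<longlonglongrightarrow> 0"
    by (rule filterlim_compose[OF _ filterlim_real_sequentially])
  then have "\<forall>\<^sub>F lam::nat in sequentially. 2 * K * C * (real lam + 1) powr \<beta> / (real lam * r) < e / 2"
    using e by (intro order_tendstoD) auto
  then have "\<forall>\<^sub>F lam::nat in sequentially. 2 * K * C * (real lam + 1) powr \<beta> / (real lam * r) < e / 2 \<and> max 1 lam0 \<le> lam"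
    using eventually_ge_at_top[of "max 1 lam0"] by eventually_elim simp
  then obtain lam :: nat where lam: "2 * K * C * (real lam + 1) powr \<beta> / (real lam * r) < e / 2" "lam \<ge> 1" "lam \<ge> lam0"
    by (auto simp: eventually_at_top_linorder)
  have pw: "(real lam + 1) powr \<beta> > 0" by simp
  have "\<forall>\<^sub>F m in sequentially. (real lam + 1) powr (- \<beta>) * (1 / 2) < F ((lam + 1) * m) / F m"
    using ratio[of "lam + 1"] by (intro order_tendstoD) (auto simp: add.commute)
  then have "\<forall>\<^sub>F n in sequentially. (real lam + 1) powr (- \<beta>) * (1 / 2) < F ((lam + 1) * (n div lam)) / F (n div lam)"
    using lam by (intro eventually_compose_filterlim[where f = "\<lambda>n. n div lam" and F = sequentially, OF _ filterlim_at_top_div_const_nat]) auto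
  then have "\<forall>\<^sub>F n in sequentially.
    prob {\<omega> \<in> space M. (\<Sum>j=1..T n \<omega>. if real (l j \<omega>) > 1 / real lam * n then 0 else real (l j \<omega>)) > r * n} \<le> e"
    using eventually_ge_at_top[of "lam * lam"]
  proof eventually_elim
    case (elim n)
    define m where "m = n div lam"
    have nm: "lam * m \<le> n" "n < lam * m + lam"
      using lam mult_div_mod_eq[of lam n] mod_less_divisor[of lam n] unfolding m_def by linarith+
    \<comment> \<open>The remainder of the division is below \<open>lam\<close>, so
      \<open>m \<ge> lam\<close> gives \<open>n \<le> (lam + 1) * m\<close> and the tail at
      \<open>n\<close> can be compared with the tail at this multiple.\<close>
    have m: "m \<ge> lam" using elim(2) lam by (simp add: m_def less_eq_div_iff_mult_less_eq)
    have n0: "real n > 0" using elim(2) lam by (cases n) auto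
    have small: "real a \<le> 1 / real lam * n \<Longrightarrow> a \<le> m" for a :: nat
    proof -
      assume "real a \<le> 1 / real lam * n"
      then have "lam * a \<le> n" using lam by (simp add: field_simps flip: of_nat_mult)
      then show "a \<le> m" using lam by (simp add: m_def less_eq_div_iff_mult_less_eq mult.commute)
    qed
    have Fm: "F m / F n \<le> 2 * (real lam + 1) powr \<beta>"
    proof -
      have "n \<le> (lam + 1) * m" using nm(2) m by simp
      then have "F ((lam + 1) * m) \<le> F n" by (rule antimonoD[OF F_antimono])
      moreover have "(real lam + 1) powr (- \<beta>) * (1 / 2) * F m < F ((lam + 1) * m)"
        using elim(1) F_pos[of m] by (simp add: m_def pos_less_divide_eq)
      ultimately have "(real lam + 1) powr (- \<beta>) * (1 / 2) * F m \<le> F n" by linarith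
      then have "(real lam + 1) powr (- \<beta>) * (1 / 2) * F m * (2 * (real lam + 1) powr \<beta>) \<le> F n * (2 * (real lam + 1) powr \<beta>)"
        using pw by (intro mult_right_mono) auto
      moreover have "(real lam + 1) powr (- \<beta>) * (1 / 2) * F m * (2 * (real lam + 1) powr \<beta>) =
        ((real lam + 1) powr (- \<beta>) * (real lam + 1) powr \<beta>) * F m"
        by simp
      moreover have "(real lam + 1) powr (- \<beta>) * (real lam + 1) powr \<beta> = 1"
        using powr_add[of "real lam + 1" "- \<beta>" \<beta>] by simp
      ultimately have "1 * F m \<le> F n * (2 * (real lam + 1) powr \<beta>)" by (simp only:)
      then show ?thesis using F_pos[of n] by (simp add: pos_divide_le_eq mult.commute)
    qed
    define k where "k = nat \<lfloor>K / F n\<rfloor>"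
    have kK: "real k \<le> K / F n" using K F_pos[of n] by (simp add: k_def)
    let ?S = "{\<omega> \<in> space M. (\<Sum>j=1..T n \<omega>. if real (l j \<omega>) > 1 / real lam * n then 0 else real (l j \<omega>)) > r * n}"
    let ?A = "{\<omega> \<in> space M. real (T n \<omega>) > K / F n}"
    let ?B = "{\<omega> \<in> space M. r * n < (\<Sum>j=1..k. real (min (l j \<omega>) m))}"
    have [measurable]: "(\<lambda>\<omega>. \<Sum>j=1..k. real (min (l j \<omega>) m)) \<in> borel_measurable M" by (rule block_sum_measurable)
    have A: "?A \<in> events" by (rule count_sets[OF T_meas])
    have B: "?B \<in> events" by measurable
    have "?S \<subseteq> ?A \<union> ?B"
    proof
      fix \<omega> assume \<omega>: "\<omega> \<in> ?S"
      show "\<omega> \<in> ?A \<union> ?B"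
      proof (cases "\<omega> \<in> ?A")
        case False
        then have "real (T n \<omega>) \<le> K / F n" using \<omega> by simp
        then have "int (T n \<omega>) \<le> \<lfloor>K / F n\<rfloor>" by linarith
        then have Tk: "T n \<omega> \<le> k" by (simp add: k_def le_nat_iff)
        have "(\<Sum>j=1..T n \<omega>. if real (l j \<omega>) > 1 / real lam * n then 0 else real (l j \<omega>)) \<le> (\<Sum>j=1..T n \<omega>. real (min (l j \<omega>) m))"
          by (intro sum_mono) (auto simp: not_less min_absorb1 small)
        also have "\<dots> \<le> (\<Sum>j=1..k. real (min (l j \<omega>) m))" by (rule sum_mono2) (use Tk in auto)
        finally show ?thesis using \<omega> by simp
      qed simp
    qed
    then have "prob ?S \<le> prob (?A \<union> ?B)" using A B by (intro finite_measure_mono) auto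
    also have "\<dots> \<le> prob ?A + prob ?B" by (rule measure_Un_le[OF A B])
    also have "prob ?A \<le> e / 2" using prob_T_upper[OF K(1), of n] K(2) by linarith
    also have "prob ?B \<le> real k * (C * real m * F m) / (r * n)"
      by (rule prob_sum_min_le[OF C(2)]) (use m lam r n0 in auto)
    also have "\<dots> \<le> e / 2"
    proof -
      have "real k * (C * real m * F m) / (r * n) \<le> K / F n * (C * (real n / real lam) * F m) / (r * n)"
        using kK C K F_pos r n0 nm(1) lam
        by (intro divide_right_mono mult_mono) (auto simp: field_simps less_imp_le simp flip: of_nat_mult)
      also have "\<dots> = K * C / (real lam * r) * (F m / F n)" using n0 by (simp add: field_simps)
      also have "\<dots> \<le> K * C / (real lam * r) * (2 * (real lam + 1) powr \<beta>)"
        using Fm K C lam r by (intro mult_left_mono) auto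
      also have "\<dots> = 2 * K * C * (real lam + 1) powr \<beta> / (real lam * r)" by simp
      finally show ?thesis using lam(1) by linarith
    qed
    finally show ?case by simp
  qed
  then show ?thesis using lam by blast
qed

end

section \<open>Sample variance and maximum of square integrable variables\<close>

text \<open>Borel-Cantelli: the probabilities that \<open>(Y 1)\<^sup>2\<close> exceeds
  \<open>c\<^sup>2 * j\<close> are summable, because the number of such \<open>j\<close> at a point
  is at most \<open>(Y 1)\<^sup>2 / c\<^sup>2\<close>, an integrable variable.\<close>

lemma (in prob_space) AE_eventually_le_sqrt:
  fixes Y :: "nat \<Rightarrow> 'a \<Rightarrow> real"
  assumes meas: "\<And>j. Y j \<in> borel_measurable M"
    and distr: "\<And>j. j \<ge> 1 \<Longrightarrow> distr M borel (Y j) = distr M borel (Y 1)"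
    and sq: "integrable M (\<lambda>\<omega>. (Y 1 \<omega>)\<^sup>2)" and c: "c > 0"
  shows "AE \<omega> in M. \<forall>\<^sub>F j in sequentially. \<bar>Y j \<omega>\<bar> \<le> c * sqrt j"
proof -
  let ?A = "\<lambda>j. {\<omega> \<in> space M. 1 \<le> j \<and> c * sqrt (real j) < \<bar>Y j \<omega>\<bar>}"
  let ?B = "\<lambda>j. {\<omega> \<in> space M. 1 \<le> j \<and> c * sqrt (real j) < \<bar>Y 1 \<omega>\<bar>}"
  note [measurable] = meas
  have A: "?A j \<in> events" and B: "?B j \<in> events" for j by measurable
  have AB: "prob (?A j) = prob (?B j)" for j
  proof (cases "1 \<le> j")
    case True
    have "prob {\<omega> \<in> space M. c * sqrt (real j) < \<bar>Y i \<omega>\<bar>} = measure (distr M borel (Y i)) {y. c * sqrt (real j) < \<bar>y\<bar>}" for i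
      by (subst measure_distr[OF meas]) (auto simp: vimage_def Int_def conj_commute)
    then show ?thesis using distr[OF True] True by simp
  qed simp
  define Z where "Z \<omega> = (Y 1 \<omega>)\<^sup>2 / c\<^sup>2" for \<omega>
  have Z: "integrable M Z" "\<And>\<omega>. Z \<omega> \<ge> 0" using sq by (auto simp: Z_def[abs_def])
  have "(\<Sum>j<n. prob (?B j)) \<le> expectation Z" for n
  proof -
    have "(\<Sum>j<n. prob (?B j)) = expectation (\<lambda>\<omega>. \<Sum>j<n. indicator (?B j) \<omega>)"
      by (subst Bochner_Integration.integral_sum) (auto intro!: integrable_real_indicator B simp: less_top[symmetric])
    also have "\<dots> \<le> expectation Z"
    proof (rule integral_mono[OF _ Z(1)])
      show "integrable M (\<lambda>\<omega>. \<Sum>j<n. indicator (?B j) \<omega> :: real)"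
        by (intro Bochner_Integration.integrable_sum integrable_real_indicator B) (simp add: less_top[symmetric])
      fix \<omega> assume \<omega>: "\<omega> \<in> space M"
      have "(\<Sum>j<n. indicator (?B j) \<omega> :: real) \<le> (\<Sum>j<n. if j \<in> {1..nat \<lfloor>Z \<omega>\<rfloor>} then 1 else 0)"
      proof (rule sum_mono)
        fix j assume "j \<in> {..<n}"
        have "real j \<le> Z \<omega>" if "c * sqrt (real j) < \<bar>Y 1 \<omega>\<bar>"
        proof -
          have "(c * sqrt (real j))\<^sup>2 \<le> \<bar>Y 1 \<omega>\<bar>\<^sup>2" using that c by (intro power_mono) auto
          then show ?thesis using c by (simp add: Z_def power_mult_distrib field_simps)
        qed
        then have "j \<le> nat \<lfloor>Z \<omega>\<rfloor>" if "c * sqrt (real j) < \<bar>Y 1 \<omega>\<bar>" using that by (simp add: le_nat_floor)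
        then show "(indicator (?B j) \<omega> :: real) \<le> (if j \<in> {1..nat \<lfloor>Z \<omega>\<rfloor>} then 1 else 0)"
          by (auto simp: indicator_def)
      qed
      also have "\<dots> = real (card ({..<n} \<inter> {1..nat \<lfloor>Z \<omega>\<rfloor>}))"
        by (subst sum.inter_restrict[symmetric]) simp_all
      also have "\<dots> \<le> real (card {1..nat \<lfloor>Z \<omega>\<rfloor>})" by (intro of_nat_mono card_mono) auto
      also have "\<dots> \<le> Z \<omega>" using Z(2)[of \<omega>] by simp
      finally show "(\<Sum>j<n. indicator (?B j) \<omega>) \<le> Z \<omega>" .
    qed
    finally show ?thesis .
  qed
  then have "summable (\<lambda>j. prob (?A j))" unfolding AB by (intro summableI_nonneg_bounded[where x = "expectation Z"]) auto
  then have "AE \<omega> in M. \<forall>\<^sub>F j in sequentially. \<omega> \<in> space M - ?A j"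
    by (intro borel_cantelli_AE1 A) (simp_all add: less_top[symmetric])
  then show ?thesis
  proof eventually_elim
    case (elim \<omega>)
    then show ?case using eventually_ge_at_top[of 1] by eventually_elim auto
  qed
qed

text \<open>From some index on each term obeys its own bound, which is weaker at \<open>N\<close>;
  the finitely many earlier terms have a fixed total, eventually below \<open>c * sqrt N\<close>. As
  \<open>c\<close> is arbitrary, the maximum is of smaller order than \<open>sqrt N\<close>.\<close>

lemma (in prob_space) AE_max_le_sqrt:
  fixes Y :: "nat \<Rightarrow> 'a \<Rightarrow> real"
  assumes "\<And>j. Y j \<in> borel_measurable M" "\<And>j. j \<ge> 1 \<Longrightarrow> distr M borel (Y j) = distr M borel (Y 1)"
    "integrable M (\<lambda>\<omega>. (Y 1 \<omega>)\<^sup>2)" and c: "c > 0"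
  shows "AE \<omega> in M. \<forall>\<^sub>F N in sequentially. \<forall>j\<in>{1..N}. \<bar>Y j \<omega>\<bar> \<le> c * sqrt N"
proof -
  have "AE \<omega> in M. \<forall>\<^sub>F j in sequentially. \<bar>Y j \<omega>\<bar> \<le> c * sqrt j"
    by (rule AE_eventually_le_sqrt) (fact assms)+
  then show ?thesis
proof eventually_elim
  case (elim \<omega>)
  then obtain J where J: "\<And>j. j \<ge> J \<Longrightarrow> \<bar>Y j \<omega>\<bar> \<le> c * sqrt j" by (auto simp: eventually_at_top_linorder)
  have "\<forall>\<^sub>F N in sequentially. K \<le> c * sqrt (real N)" for K
    using c by real_asymp
  from this[of "\<Sum>j<J. \<bar>Y j \<omega>\<bar>"] show ?case
  proof eventually_elim
    case (elim N)
    show ?case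
    proof
      fix j assume j: "j \<in> {1..N}"
      show "\<bar>Y j \<omega>\<bar> \<le> c * sqrt N"
      proof (cases "j \<ge> J")
        case True
        have "\<bar>Y j \<omega>\<bar> \<le> c * sqrt j" by (rule J[OF True])
        also have "\<dots> \<le> c * sqrt N" using j c by simp
        finally show ?thesis .
      next
        case False
        then have "\<bar>Y j \<omega>\<bar> \<le> (\<Sum>j<J. \<bar>Y j \<omega>\<bar>)" by (intro member_le_sum) auto
        then show ?thesis using elim by simp
      qed
    qed
  qed
qed
qed

text \<open>The Chernoff bound tolerates counts below half of the mean; at a quarter the failure
  probabilities decay geometrically and Borel-Cantelli applies.\<close>

lemma (in prob_space) AE_eventually_many:
  fixes Y :: "nat \<Rightarrow> 'a \<Rightarrow> real"
  assumes indep: "indep_vars (\<lambda>_. borel) Y {1..}" and A: "A \<in> sets borel"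
    and p: "\<And>j. j \<ge> 1 \<Longrightarrow> p \<le> prob {\<omega> \<in> space M. Y j \<omega> \<in> A}" "p > 0"
  shows "AE \<omega> in M. \<forall>\<^sub>F N in sequentially. p / 4 * N \<le> real (card {j\<in>{1..N}. Y j \<omega> \<in> A})"
proof -
  let ?E = "\<lambda>N. {\<omega> \<in> space M. real (card {j\<in>{1..N}. Y j \<omega> \<in> A}) \<le> p / 4 * N}"
  have rv: "Y j \<in> borel_measurable M" if "j \<ge> 1" for j using indep that by (auto simp: indep_vars_def)
  have ev: "?E N \<in> events" for N
  proof -
    have card: "real (card {j\<in>{1..N}. Y j \<omega> \<in> A}) = (\<Sum>j=1..N. if Y j \<omega> \<in> A then 1 else 0)" for \<omega>
      by (simp add: sum.If_cases Int_def)
    have "(\<lambda>\<omega>. \<Sum>j=1..N. indicator A (Y j \<omega>) :: real) \<in> borel_measurable M"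
      by (intro borel_measurable_sum measurable_compose[OF rv borel_measurable_indicator[OF A]]) auto
    then have [measurable]: "(\<lambda>\<omega>. real (card {j\<in>{1..N}. Y j \<omega> \<in> A})) \<in> borel_measurable M"
      unfolding card indicator_def of_bool_def .
    show ?thesis by measurable
  qed
  have bound: "prob (?E N) \<le> exp (- (p / 4)) ^ N" for N
  proof -
    have "prob (?E N) \<le> exp (p / 4 * N - real (card {1..N}) * p / 2)"
      by (rule prob_card_events_le[where A = "\<lambda>_. A", OF indep_vars_subset[OF indep]]) (use A p(1) in auto)
    also have "p / 4 * N - real (card {1..N}) * p / 2 = real N * (- (p / 4))" by simp
    also have "exp \<dots> = exp (- (p / 4)) ^ N" by (rule exp_of_nat_mult)
    finally show ?thesis .
  qed
  have "summable (\<lambda>N. prob (?E N))"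
  proof (rule summable_comparison_test')
    show "summable (\<lambda>N. exp (- (p / 4)) ^ N)" using p(2) by (intro summable_geometric) simp
    show "norm (prob (?E N)) \<le> exp (- (p / 4)) ^ N" if "0 \<le> N" for N
      using bound[of N] by (simp only: real_norm_def abs_of_nonneg[OF measure_nonneg])
  qed
  then have "AE \<omega> in M. \<forall>\<^sub>F N in sequentially. \<omega> \<in> space M - ?E N"
    by (intro borel_cantelli_AE1 ev) (simp_all add: less_top[symmetric])
  then show ?thesis
  proof eventually_elim
    case (elim \<omega>)
    then show ?case by (rule eventually_mono) auto
  qed
qed

text \<open>A nondegenerate variable has mass both below its mean \<open>m\<close> and above some
  \<open>b > m\<close>, so a positive fraction of the sample ends up on either side of the gap. No
  centre is close to both groups. The bound is uniform in the centre \<open>c\<close> so that the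
  sample mean can be inserted.\<close>

lemma (in prob_space) AE_sample_variance_ge:
  fixes Y :: "nat \<Rightarrow> 'a \<Rightarrow> real"
  assumes indep: "indep_vars (\<lambda>_. borel) Y {1..}"
    and distr: "\<And>j. j \<ge> 1 \<Longrightarrow> distr M borel (Y j) = distr M borel (Y 1)"
    and sq: "integrable M (\<lambda>\<omega>. (Y 1 \<omega>)\<^sup>2)" and var: "variance (Y 1) > 0"
  shows "\<exists>s>0. AE \<omega> in M. \<forall>\<^sub>F N in sequentially. \<forall>c. s * real N \<le> (\<Sum>j=1..N. (Y j \<omega> - c)\<^sup>2)"
proof -
  have Y1: "Y 1 \<in> borel_measurable M" using indep by (auto simp: indep_vars_def)
  note [measurable] = Y1 Y1[unfolded One_nat_def]
  have int: "integrable M (Y 1)" by (rule square_integrable_imp_integrable[OF Y1 sq])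
  define m where "m = expectation (Y 1)"
  have var0: False if "AE \<omega> in M. Y 1 \<omega> = m"
  proof -
    have "variance (Y 1) = expectation (\<lambda>_. 0)"
      using that unfolding m_def[symmetric] by (intro integral_cong_AE) (auto elim: eventually_mono)
    then show False using var by simp
  qed
  have "\<not> (AE \<omega> in M. Y 1 \<omega> \<le> m)"
  proof
    assume le: "AE \<omega> in M. Y 1 \<omega> \<le> m"
    have "expectation (\<lambda>\<omega>. m - Y 1 \<omega>) = 0" using int by (simp add: m_def prob_space)
    moreover have "integrable M (\<lambda>\<omega>. m - Y 1 \<omega>)" using int by simp
    ultimately have "AE \<omega> in M. m - Y 1 \<omega> = 0"
      using le by (subst integral_nonneg_eq_0_iff_AE[symmetric]) (auto elim: eventually_mono)
    then show False by (intro var0) (auto elim: eventually_mono)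
  qed
  moreover have "\<not> (AE \<omega> in M. Y 1 \<omega> > m)"
  proof
    assume gt: "AE \<omega> in M. Y 1 \<omega> > m"
    have "expectation (\<lambda>\<omega>. Y 1 \<omega> - m) = 0" using int by (simp add: m_def prob_space)
    moreover have "integrable M (\<lambda>\<omega>. Y 1 \<omega> - m)" using int by simp
    ultimately have "AE \<omega> in M. Y 1 \<omega> - m = 0"
      using gt by (subst integral_nonneg_eq_0_iff_AE[symmetric]) (auto elim: eventually_mono)
    then show False by (intro var0) (auto elim: eventually_mono)
  qed
  ultimately have n: "\<not> (AE \<omega> in M. Y 1 \<omega> \<le> m)" "\<not> (AE \<omega> in M. \<not> Y 1 \<omega> \<le> m)" by (auto simp: not_le)
  have null: "AE \<omega> in M. Y 1 \<omega> \<notin> A" if "prob {\<omega> \<in> space M. Y 1 \<omega> \<in> A} = 0" "A \<in> sets borel" for A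
  proof (rule AE_I[where N = "{\<omega> \<in> space M. Y 1 \<omega> \<in> A}"])
    show "{\<omega> \<in> space M. Y 1 \<omega> \<in> A} \<in> events" using that(2) by measurable
    show "emeasure M {\<omega> \<in> space M. Y 1 \<omega> \<in> A} = 0" using that(1) by (simp add: emeasure_eq_measure)
  qed auto
  have "\<exists>b>m. prob {\<omega> \<in> space M. Y 1 \<omega> \<in> {b..}} > 0"
  proof (rule ccontr)
    assume none: "\<not> ?thesis"
    have "prob {\<omega> \<in> space M. Y 1 \<omega> \<in> {b..}} = 0" if "b > m" for b
    proof -
      have "\<not> prob {\<omega> \<in> space M. Y 1 \<omega> \<in> {b..}} > 0" using none that by blast
      then show ?thesis using measure_nonneg[of M "{\<omega> \<in> space M. Y 1 \<omega> \<in> {b..}}"] by linarith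
    qed
    then have "AE \<omega> in M. Y 1 \<omega> \<notin> {m + 1 / real (Suc k)..}" for k
      by (intro null) simp_all
    then have "AE \<omega> in M. \<forall>k. \<not> Y 1 \<omega> \<in> {m + 1 / real (Suc k)..}" by (simp add: AE_all_countable)
    then have "AE \<omega> in M. Y 1 \<omega> \<le> m"
    proof eventually_elim
      case (elim \<omega>)
      show ?case
      proof (rule ccontr)
        assume "\<not> Y 1 \<omega> \<le> m"
        then obtain k where "1 / real (Suc k) < Y 1 \<omega> - m"
          using reals_Archimedean[of "Y 1 \<omega> - m"] by (auto simp: inverse_eq_divide)
        then show False using elim by (auto dest: spec[of _ k])
      qed
    qed
    then show False using n(1) by simp
  qed
  then obtain b where b: "b > m" "prob {\<omega> \<in> space M. Y 1 \<omega> \<in> {b..}} > 0" by blast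
  have b': "prob {\<omega> \<in> space M. Y 1 \<omega> \<in> {..m}} > 0"
  proof -
    have "prob {\<omega> \<in> space M. Y 1 \<omega> \<in> {..m}} \<noteq> 0" using null[of "{..m}"] n(2) by auto
    then show ?thesis using measure_nonneg[of M "{\<omega> \<in> space M. Y 1 \<omega> \<in> {..m}}"] by linarith
  qed
  define p where "p = min (prob {\<omega> \<in> space M. Y 1 \<omega> \<in> {b..}}) (prob {\<omega> \<in> space M. Y 1 \<omega> \<in> {..m}})"
  have p: "p > 0" using b b' by (simp add: p_def)
  have same: "prob {\<omega> \<in> space M. Y j \<omega> \<in> A} = prob {\<omega> \<in> space M. Y 1 \<omega> \<in> A}" if "j \<ge> 1" "A \<in> sets borel" for j A
  proof -
    have "prob {\<omega> \<in> space M. Y i \<omega> \<in> A} = measure (distr M borel (Y i)) A" if "i \<ge> 1" for i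
    proof -
      have "Y i \<in> borel_measurable M" using indep that by (auto simp: indep_vars_def)
      then show ?thesis using \<open>A \<in> sets borel\<close> by (subst measure_distr) (auto simp: vimage_def Int_def conj_commute)
    qed
    then show ?thesis using distr[OF that(1)] that(1) by simp
  qed
  have 1: "AE \<omega> in M. \<forall>\<^sub>F N in sequentially. p / 4 * N \<le> real (card {j\<in>{1..N}. Y j \<omega> \<in> {b..}})"
  proof (rule AE_eventually_many[OF indep _ _ p])
    show "p \<le> prob {\<omega> \<in> space M. Y j \<omega> \<in> {b..}}" if "j \<ge> 1" for j
      unfolding p_def by (subst same[OF that]) simp_all
  qed simp
  have 2: "AE \<omega> in M. \<forall>\<^sub>F N in sequentially. p / 4 * N \<le> real (card {j\<in>{1..N}. Y j \<omega> \<in> {..m}})"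
  proof (rule AE_eventually_many[OF indep _ _ p])
    show "p \<le> prob {\<omega> \<in> space M. Y j \<omega> \<in> {..m}}" if "j \<ge> 1" for j
      unfolding p_def by (subst same[OF that]) simp_all
  qed simp
  define s where "s = p / 4 * ((b - m) / 2)\<^sup>2"
  have s: "s > 0" using p b by (simp add: s_def)
  have AE: "AE \<omega> in M. \<forall>\<^sub>F N in sequentially. \<forall>c. s * real N \<le> (\<Sum>j=1..N. (Y j \<omega> - c)\<^sup>2)"
    using 1 2
  proof eventually_elim
    case (elim \<omega>)
    show ?case
      using elim
    proof eventually_elim
      case (elim N)
      show ?case
      proof
        fix c
        have gen: "s * real N \<le> (\<Sum>j=1..N. (Y j \<omega> - c)\<^sup>2)"
          if A: "p / 4 * N \<le> real (card {j\<in>{1..N}. Y j \<omega> \<in> A})" "\<And>y. y \<in> A \<Longrightarrow> (b - m) / 2 \<le> \<bar>y - c\<bar>" for A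
        proof -
          have "s * real N = (p / 4 * N) * ((b - m) / 2)\<^sup>2" by (simp add: s_def)
          also have "\<dots> \<le> real (card {j\<in>{1..N}. Y j \<omega> \<in> A}) * ((b - m) / 2)\<^sup>2"
            by (intro mult_right_mono A) auto
          also have "\<dots> = (\<Sum>j\<in>{j\<in>{1..N}. Y j \<omega> \<in> A}. ((b - m) / 2)\<^sup>2)" by simp
          also have "\<dots> \<le> (\<Sum>j\<in>{j\<in>{1..N}. Y j \<omega> \<in> A}. (Y j \<omega> - c)\<^sup>2)"
          proof (rule sum_mono)
            fix j assume "j \<in> {j\<in>{1..N}. Y j \<omega> \<in> A}"
            then have "(b - m) / 2 \<le> \<bar>Y j \<omega> - c\<bar>" using A(2) by simp
            then have "((b - m) / 2)\<^sup>2 \<le> \<bar>Y j \<omega> - c\<bar>\<^sup>2" using b by (intro power_mono) auto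
            then show "((b - m) / 2)\<^sup>2 \<le> (Y j \<omega> - c)\<^sup>2" by simp
          qed
          also have "\<dots> \<le> (\<Sum>j=1..N. (Y j \<omega> - c)\<^sup>2)" by (rule sum_mono2) auto
          finally show ?thesis .
        qed
        show "s * real N \<le> (\<Sum>j=1..N. (Y j \<omega> - c)\<^sup>2)"
        \<comment> \<open>A centre on the left half is far from the group above \<open>b\<close>, a
          centre on the right half is far from the group below \<open>m\<close>.\<close>
        proof (cases "c \<le> (b + m) / 2")
          case True
          have "(b - m) / 2 \<le> \<bar>y - c\<bar>" if "y \<in> {b..}" for y
            using that True abs_ge_self[of "y - c"] by (simp add: field_simps)
          then show ?thesis using gen[OF elim(1)] by blast
        next
          case False
          have "(b - m) / 2 \<le> \<bar>y - c\<bar>" if "y \<in> {..m}" for y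
            using that False abs_ge_minus_self[of "y - c"] by (simp add: field_simps)
          then show ?thesis using gen[OF elim(2)] by blast
        qed
      qed
    qed
  qed
  show ?thesis by (rule exI[of _ s], rule conjI[OF s AE])
qed

section \<open>The bootstrap distribution given the data\<close>

lemma return_time_le_antimono:
  assumes "return_time \<alpha> w k \<le> enat n" "j \<le> k"
  shows "return_time \<alpha> w j \<le> enat n"
  using assms(2,1)
proof (induction k rule: dec_induct)
  case (step k)
  obtain b where b: "return_time \<alpha> w (Suc k) = enat b" "b \<le> n"
    using step.prems by (cases "return_time \<alpha> w (Suc k)") auto
  then obtain m where "m < b" "return_time \<alpha> w k = enat m" using return_time_finite_pred by blast
  then show ?case using b by (intro step.IH) simp
qed

lemma num_blocks_ge_iff:
  assumes k: "k \<ge> 1"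
  shows "k \<le> num_blocks \<alpha> w n \<longleftrightarrow> return_time \<alpha> w (Suc k) \<le> enat n"
proof -
  let ?S = "{k. k = 0 \<or> return_time \<alpha> w (Suc k) \<le> enat n}"
  have "k \<le> n" if kS: "k \<in> ?S" for k
  proof (cases "k = 0")
    case False
    then have "return_time \<alpha> w (Suc k) \<le> enat n" using kS by simp
    then obtain b where "return_time \<alpha> w (Suc k) = enat b" "b \<le> n"
      by (cases "return_time \<alpha> w (Suc k)") auto
    then show ?thesis using return_time_ge[of \<alpha> w "Suc k" b] by simp
  qed simp
  then have fin: "finite ?S" by (intro finite_subset[of ?S "{..n}"]) auto
  have ne: "?S \<noteq> {}" by blast
  show ?thesis
  proof
    assume "k \<le> num_blocks \<alpha> w n"
    then have le: "k \<le> Max ?S" by (simp only: num_blocks_def)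
    have "Max ?S \<in> ?S" by (rule Max_in[OF fin ne])
    then have "return_time \<alpha> w (Suc (Max ?S)) \<le> enat n" using le k by simp
    then show "return_time \<alpha> w (Suc k) \<le> enat n" by (rule return_time_le_antimono) (use le in simp)
  next
    assume "return_time \<alpha> w (Suc k) \<le> enat n"
    then show "k \<le> num_blocks \<alpha> w n" unfolding num_blocks_def by (intro Max_ge fin) simp
  qed
qed

lemma return_time_eq_sum:
  assumes "return_time \<alpha> w 1 = enat t" "return_time \<alpha> w (Suc k) = enat b"
  shows "b = t + (\<Sum>j=1..k. length (regen_block \<alpha> w j))"
  using assms(2)
proof (induction k arbitrary: b)
  case 0
  then show ?case using assms(1) by (simp del: return_time.simps)
next
  case (Suc k)
  obtain m where m: "m < b" "return_time \<alpha> w (Suc k) = enat m" using return_time_finite_pred[OF Suc.prems] by blast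
  have "length (regen_block \<alpha> w (Suc k)) = b - m" by (rule regen_block_eq(2)[OF m(2) Suc.prems])
  then show ?case using Suc.IH[OF m(2)] m(1) by simp
qed

lemma length_regen_block_ge_1:
  assumes j: "j \<in> {1..num_blocks \<alpha> w n}"
  shows "length (regen_block \<alpha> w j) \<ge> 1"
proof -
  have "return_time \<alpha> w (Suc j) \<le> enat n" using num_blocks_ge_iff[of j \<alpha> w n] j by simp
  then obtain b where b: "return_time \<alpha> w (Suc j) = enat b" by (cases "return_time \<alpha> w (Suc j)") auto
  then obtain a where "a < b" "return_time \<alpha> w j = enat a" using return_time_finite_pred by blast
  then show ?thesis using regen_block_eq(2)[OF _ b] by simp
qed

lemma sum_length_num_blocks_le: "(\<Sum>j=1..num_blocks \<alpha> w n. length (regen_block \<alpha> w j)) \<le> n"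
proof (cases "num_blocks \<alpha> w n = 0")
  case False
  define N where "N = num_blocks \<alpha> w n"
  have "return_time \<alpha> w (Suc N) \<le> enat n" using num_blocks_ge_iff[of N \<alpha> w n] False by (simp add: N_def)
  then obtain b where b: "return_time \<alpha> w (Suc N) = enat b" "b \<le> n" by (cases "return_time \<alpha> w (Suc N)") auto
  have "return_time \<alpha> w 1 \<le> enat n" by (rule return_time_le_antimono[of _ _ "Suc N"]) (use b in simp_all)
  then obtain t where "return_time \<alpha> w 1 = enat t" by (cases "return_time \<alpha> w 1") auto
  from return_time_eq_sum[OF this b(1)] b(2) show ?thesis by (simp add: N_def)
qed simp

text \<open>The bootstrap law is an infinite product, the estimates use finite ones. An event may be
  decided by the coordinates in \<open>J\<close> merely when these lie in the support, which is
  almost sure: for the bootstrap the stopping index is bounded because actual blocks have positive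
  length.\<close>

lemma measure_PiM_pmf_eq_Pi_pmf:
  fixes p :: "'b pmf"
  assumes fin: "finite (set_pmf p)" and J: "finite J" "J \<noteq> {}"
    and A: "A \<in> sets (\<Pi>\<^sub>M j\<in>(UNIV :: nat set). measure_pmf p)"
    and dep: "\<And>b b'. (\<And>j. j \<in> J \<Longrightarrow> b j = b' j) \<Longrightarrow> (\<And>j. j \<in> J \<Longrightarrow> b j \<in> set_pmf p) \<Longrightarrow> b \<in> A \<longleftrightarrow> b' \<in> A"
  shows "measure (\<Pi>\<^sub>M j\<in>(UNIV :: nat set). measure_pmf p) A = measure_pmf.prob (Pi_pmf J d (\<lambda>_. p)) A"
proof -
  let ?L = "\<Pi>\<^sub>M j\<in>(UNIV :: nat set). measure_pmf p" and ?Q = "Pi_pmf J d (\<lambda>_. p)"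
  let ?PJ = "\<Pi>\<^sub>M j\<in>J. measure_pmf p"
  interpret PP: product_prob_space "\<lambda>_ :: nat. measure_pmf p" UNIV by unfold_locales
  \<comment> \<open>The event as a finite set of vectors over \<open>J\<close>; the default
    \<open>d\<close> fills the other coordinates exactly as \<open>Pi_pmf\<close> does.\<close>
  define F where "F = {v \<in> PiE J (\<lambda>_. set_pmf p). (\<lambda>i. if i \<in> J then v i else d) \<in> A}"
  have finF: "finite F" unfolding F_def by (rule finite_subset[of _ "PiE J (\<lambda>_. set_pmf p)"]) (auto intro: finite_PiE J fin)
  have F: "F \<in> sets ?PJ"
  proof (rule sets.countable[OF _ countable_finite[OF finF]])
    fix v assume "v \<in> F"
    then have "v \<in> PiE J (\<lambda>_. set_pmf p)" by (simp add: F_def)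
    then have "{v} = PiE J (\<lambda>i. {v i})" using PiE_singleton[of v J] by (simp add: PiE_iff)
    also have "\<dots> \<in> sets ?PJ" by (rule sets_PiM_I_finite) (use J in auto)
    finally show "{v} \<in> sets ?PJ" .
  qed
  have iff: "b \<in> A \<longleftrightarrow> restrict b J \<in> F" if "\<And>j. j \<in> J \<Longrightarrow> b j \<in> set_pmf p" for b
    using dep[of b "\<lambda>i. if i \<in> J then restrict b J i else d"] that by (auto simp: F_def)
  have emb: "PP.emb UNIV J F \<in> sets ?L" by (rule measurable_prod_emb) (use F in auto)
  have "measure ?L A = measure ?L (PP.emb UNIV J F)"
  proof (rule PP.P.finite_measure_eq_AE)
    have "AE b in ?L. \<forall>j\<in>J. b j \<in> set_pmf p"
    proof (subst AE_finite_all[OF J(1)], intro ballI)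
      fix j
      show "AE b in ?L. b j \<in> set_pmf p"
        by (rule PP.AE_component) (simp_all add: AE_measure_pmf)
    qed
    then show "AE b in ?L. (b \<in> A) = (b \<in> PP.emb UNIV J F)"
    proof eventually_elim
      case (elim b)
      then have "b \<in> A \<longleftrightarrow> restrict b J \<in> F" by (intro iff) simp
      then show ?case by (simp add: prod_emb_def)
    qed
  qed (rule A, rule emb)
  also have "\<dots> = measure ?PJ F"
    using PP.emeasure_PiM_emb'[OF subset_UNIV J(1) F] by (simp add: measure_def)
  also have "\<dots> = measure (distr ?Q (\<Pi>\<^sub>M j\<in>J. count_space UNIV) (\<lambda>f. \<lambda>j\<in>J. f j)) F"
  proof -
    have "distr ?Q (\<Pi>\<^sub>M j\<in>J. count_space UNIV) (\<lambda>f. \<lambda>j\<in>J. f j) = (\<Pi>\<^sub>M j\<in>J. distr ?Q (count_space UNIV) (\<lambda>f. f j))"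
      by (rule prob_space.indep_vars_iff_distr_eq_PiM'[OF measure_pmf.prob_space_axioms J(2), THEN iffD1])
        (simp_all add: indep_vars_Pi_pmf[OF J(1)])
    also have "\<dots> = ?PJ"
    proof (rule PiM_cong[OF refl])
      fix j assume "j \<in> J"
      then have "map_pmf (\<lambda>f. f j) ?Q = p" by (subst Pi_pmf_component[OF J(1)]) simp
      then show "distr ?Q (count_space UNIV) (\<lambda>f. f j) = measure_pmf p" by (metis map_pmf_rep_eq)
    qed
    finally show ?thesis by simp
  qed
  also have "\<dots> = measure_pmf.prob ?Q {f. (\<lambda>j\<in>J. f j) \<in> F}"
  proof -
    have "sets (\<Pi>\<^sub>M j\<in>J. measure_pmf p) = sets (\<Pi>\<^sub>M j\<in>J. count_space UNIV)" by (rule sets_PiM_cong) auto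
    moreover have "(\<lambda>f. \<lambda>j\<in>J. f j) \<in> ?Q \<rightarrow>\<^sub>M (\<Pi>\<^sub>M j\<in>J. count_space UNIV)"
      by (rule measurable_restrict) simp
    ultimately show ?thesis using F by (subst measure_distr) (simp_all add: vimage_def)
  qed
  also have "\<dots> = measure_pmf.prob ?Q A"
  proof (rule measure_pmf.finite_measure_eq_AE)
    show "AE f in ?Q. (f \<in> {f. (\<lambda>j\<in>J. f j) \<in> F}) = (f \<in> A)"
    proof (rule AE_pmfI)
      fix f assume "f \<in> set_pmf ?Q"
      then have "f j \<in> set_pmf p" if "j \<in> J" for j
        using that by (auto simp: set_Pi_pmf[OF J(1)] PiE_dflt_def)
      then show "(f \<in> {f. (\<lambda>j\<in>J. f j) \<in> F}) = (f \<in> A)" using iff[of f] by simp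
    qed
  qed simp_all
  finally show ?thesis .
qed

lemma boot_num_eq_passage: "boot_num n b = passage n (\<lambda>j. length (b j))"
  by (simp add: boot_num_def passage_def boot_length_def)

lemma rbb_stat_eq:
  "rbb_stat \<alpha> f w n b = (\<Sum>j=1..boot_num n b. (block_sum f (b j) - mu_hat \<alpha> f w n) / sigma_hat \<alpha> f w n) / sqrt (boot_num n b)"
proof -
  define T where "T = boot_num n b"
  \<comment> \<open>For \<open>T = 0\<close> both sides are 0, since division by 0 gives 0; the
    rewriting needs no exception for an empty bootstrap sample.\<close>
  have "sqrt (real T) * (1 / real T) = 1 / sqrt (real T)" by (cases "T = 0") (simp_all add: field_simps)
  then have "(sqrt (real T) * (1 / real T)) * (x / s) = 1 / sqrt (real T) * (x / s)" for s x :: real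
    by (simp only:)
  then have eq: "sqrt (real T) / s * (1 / real T * x) = x / s / sqrt (real T)" for s x :: real
    by (simp add: mult.commute)
  show ?thesis unfolding rbb_stat_def T_def[symmetric] sum_divide_distrib[symmetric] by (rule eq)
qed

lemma boot_num_measurable:
  assumes len: "\<And>j. (\<lambda>b. length (c j b)) \<in> K \<rightarrow>\<^sub>M count_space UNIV"
  shows "(\<lambda>b. boot_num n (\<lambda>j. c j b)) \<in> K \<rightarrow>\<^sub>M count_space UNIV"
proof -
  have L: "(\<lambda>b. \<Sum>j=1..k. length (c j b)) \<in> K \<rightarrow>\<^sub>M count_space UNIV" for k
  proof (induction k)
    case (Suc k)
    have "(\<lambda>b. (\<Sum>j=1..k. length (c j b), length (c (Suc k) b))) \<in> K \<rightarrow>\<^sub>M count_space UNIV \<Otimes>\<^sub>M count_space UNIV"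
      by (rule measurable_Pair[OF Suc len])
    then have "(\<lambda>b. (\<Sum>j=1..k. length (c j b), length (c (Suc k) b))) \<in> K \<rightarrow>\<^sub>M count_space UNIV"
      by (simp only: pair_measure_countable countableI_type UNIV_Times_UNIV)
    then have "(\<lambda>b. fst (\<Sum>j=1..k. length (c j b), length (c (Suc k) b)) + snd (\<Sum>j=1..k. length (c j b), length (c (Suc k) b))) \<in> K \<rightarrow>\<^sub>M count_space UNIV"
      by (rule measurable_compose[where g = "\<lambda>z. fst z + snd z"]) simp
    moreover have "fst (\<Sum>j=1..k. length (c j b), length (c (Suc k) b)) + snd (\<Sum>j=1..k. length (c j b), length (c (Suc k) b)) =
        (\<Sum>j=1..Suc k. length (c j b))" for b by simp
    ultimately show ?case by (simp only:)
  qed simp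
  have "(\<lambda>b. LEAST k. 1 \<le> k \<and> n < (\<Sum>j=1..k. length (c j b))) \<in> K \<rightarrow>\<^sub>M count_space UNIV"
  proof (rule measurable_Least)
    show "Measurable.pred K (\<lambda>b. 1 \<le> k \<and> n < (\<Sum>j=1..k. length (c j b)))" for k
      by (rule measurable_compose[OF L[of k], where g = "\<lambda>s. 1 \<le> k \<and> n < s"]) simp
  qed
  then have "(\<lambda>b. (LEAST k. 1 \<le> k \<and> n < (\<Sum>j=1..k. length (c j b))) - 1) \<in> K \<rightarrow>\<^sub>M count_space UNIV"
    by (rule measurable_compose[where g = "\<lambda>k. k - 1"]) simp
  then show ?thesis by (simp only: boot_num_def boot_length_def)
qed

lemma rbb_stat_sets:
  "{b \<in> space (\<Pi>\<^sub>M j\<in>(UNIV :: nat set). measure_pmf p). rbb_stat \<alpha> f w n b \<le> x} \<in> sets (\<Pi>\<^sub>M j\<in>(UNIV :: nat set). measure_pmf p)"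
proof -
  let ?L = "\<Pi>\<^sub>M j\<in>(UNIV :: nat set). measure_pmf p"
  have comp: "(\<lambda>b. h (b j)) \<in> ?L \<rightarrow>\<^sub>M K" if "h \<in> count_space UNIV \<rightarrow>\<^sub>M K" for h j and K :: "'z measure"
    by (rule measurable_compose[OF measurable_component_singleton]) (use that in auto)
  have T: "(\<lambda>b. boot_num n b) \<in> ?L \<rightarrow>\<^sub>M count_space UNIV"
    using boot_num_measurable[of "\<lambda>j b. b j" ?L n] comp[of length "count_space UNIV"] by simp
  let ?h = "\<lambda>T b. (\<Sum>j=1..T. (block_sum f (b j) - mu_hat \<alpha> f w n) / sigma_hat \<alpha> f w n) / sqrt (real T)"
  have c: "(\<lambda>b. (block_sum f (b j) - mu_hat \<alpha> f w n) / sigma_hat \<alpha> f w n) \<in> borel_measurable ?L" for j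
    by (rule comp) simp
  have "?h T \<in> borel_measurable ?L" for T
    by (intro borel_measurable_divide borel_measurable_sum c borel_measurable_const)
  then have "(\<lambda>b. ?h (boot_num n b) b) \<in> borel_measurable ?L"
    by (rule measurable_compose_countable[where f = ?h, OF _ T])
  then have [measurable]: "rbb_stat \<alpha> f w n \<in> borel_measurable ?L" unfolding rbb_stat_eq by simp
  show ?thesis by measurable
qed

text \<open>Blocks have length at least 1, so \<open>H > n\<close> draws always exceed the level
  \<open>n\<close>, and the statistic is settled within them.\<close>

lemma boot_num_cong:
  assumes "\<And>j. j \<in> {1..H} \<Longrightarrow> b j = b' j" "\<And>j. j \<in> {1..H} \<Longrightarrow> length (b j) \<ge> 1" "n < H"
  shows "boot_num n b = boot_num n b'" "boot_num n b < H"
proof -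
  let ?Q = "\<lambda>b k. 1 \<le> k \<and> n < boot_length b k"
  have eq: "boot_length b k = boot_length b' k" if "k \<le> H" for k
    unfolding boot_length_def using assms(1) that by (intro sum.cong) auto
  have "H = (\<Sum>j=1..H. 1)" by simp
  also have "\<dots> \<le> boot_length b H" unfolding boot_length_def by (intro sum_mono assms(2))
  finally have QH: "?Q b H" using assms(3) by simp
  have le: "Least (?Q b) \<le> H" by (rule Least_le[of "?Q b", OF QH])
  have Q1: "?Q b (Least (?Q b))" by (rule LeastI[of "?Q b", OF QH])
  have QH': "?Q b' H" using QH eq[of H] by simp
  have le': "Least (?Q b') \<le> H" by (rule Least_le[of "?Q b'", OF QH'])
  have Q1': "?Q b' (Least (?Q b'))" by (rule LeastI[of "?Q b'", OF QH'])
  have "Least (?Q b) = Least (?Q b')"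
  proof (rule antisym)
    show "Least (?Q b) \<le> Least (?Q b')" by (rule Least_le) (use Q1' eq[OF le'] in simp)
    show "Least (?Q b') \<le> Least (?Q b)" by (rule Least_le) (use Q1 eq[OF le] in simp)
  qed
  then show "boot_num n b = boot_num n b'" by (simp add: boot_num_def)
  have "1 \<le> Least (?Q b)" using Q1 by (rule conjunct1)
  then show "boot_num n b < H" using le unfolding boot_num_def by linarith
qed

lemma set_pmf_empirical_block_pmf:
  assumes "num_blocks \<alpha> w n \<ge> 1"
  shows "set_pmf (empirical_block_pmf \<alpha> w n) = regen_block \<alpha> w ` {1..num_blocks \<alpha> w n}"
  using assms by (simp add: empirical_block_pmf_def set_pmf_of_set)

lemma rbb_prob_le_eq:
  assumes N: "num_blocks \<alpha> w n \<ge> 1" and H: "n < H"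
  shows "rbb_prob_le \<alpha> f w n x =
    measure_pmf.prob (Pi_pmf {1..H} d (\<lambda>_. empirical_block_pmf \<alpha> w n)) {b. rbb_stat \<alpha> f w n b \<le> x}"
proof -
  let ?p = "empirical_block_pmf \<alpha> w n"
  note sp = set_pmf_empirical_block_pmf[OF N]
  have fin: "finite (set_pmf ?p)" unfolding sp by simp
  have sL: "space (\<Pi>\<^sub>M j\<in>(UNIV :: nat set). measure_pmf ?p) = UNIV" by (simp add: space_PiM)
  have "rbb_prob_le \<alpha> f w n x = measure (\<Pi>\<^sub>M j\<in>(UNIV :: nat set). measure_pmf ?p) {b. rbb_stat \<alpha> f w n b \<le> x}"
    unfolding rbb_prob_le_def rbb_law_def sL by simp
  also have "\<dots> = measure_pmf.prob (Pi_pmf {1..H} d (\<lambda>_. ?p)) {b. rbb_stat \<alpha> f w n b \<le> x}"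
  proof (rule measure_PiM_pmf_eq_Pi_pmf[OF fin])
    show "{b. rbb_stat \<alpha> f w n b \<le> x} \<in> sets (\<Pi>\<^sub>M j\<in>(UNIV :: nat set). measure_pmf ?p)"
      using rbb_stat_sets[of ?p \<alpha> f w n x] by (simp add: sL)
    fix b b' assume eq: "\<And>j. j \<in> {1..H} \<Longrightarrow> b j = b' j" and inp: "\<And>j. j \<in> {1..H} \<Longrightarrow> b j \<in> set_pmf ?p"
    have len: "length (b j) \<ge> 1" if "j \<in> {1..H}" for j
      using inp[OF that] length_regen_block_ge_1[of _ \<alpha> w n] unfolding sp by auto
    have T1: "boot_num n b = boot_num n b'" by (rule boot_num_cong(1)[OF eq len H])
    have T2: "boot_num n b < H" by (rule boot_num_cong(2)[OF eq len H])
    have "(\<Sum>j=1..boot_num n b. (block_sum f (b j) - mu_hat \<alpha> f w n) / sigma_hat \<alpha> f w n) =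
      (\<Sum>j=1..boot_num n b. (block_sum f (b' j) - mu_hat \<alpha> f w n) / sigma_hat \<alpha> f w n)"
      by (intro sum.cong refl) (use eq T2 in simp)
    then show "b \<in> {b. rbb_stat \<alpha> f w n b \<le> x} \<longleftrightarrow> b' \<in> {b. rbb_stat \<alpha> f w n b \<le> x}"
      unfolding mem_Collect_eq rbb_stat_eq T1[symmetric] by simp
  qed (use H in simp_all)
  finally show ?thesis .
qed

text \<open>Without complete blocks the estimated deviation is 0 and the statistic, a division by 0,
  is constantly 0. The value is recorded because measurability in the data has to cover this
  case.\<close>

lemma rbb_prob_le_0:
  assumes "num_blocks \<alpha> w n = 0"
  shows "rbb_prob_le \<alpha> f w n x = (if 0 \<le> x then 1 else 0)"
proof -
  interpret PP: product_prob_space "\<lambda>_ :: nat. measure_pmf (empirical_block_pmf \<alpha> w n)" UNIV by unfold_locales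
  have "rbb_stat \<alpha> f w n b = 0" for b by (simp add: rbb_stat_def sigma_hat_def assms)
  then show ?thesis
    unfolding rbb_prob_le_def rbb_law_def using PP.P.prob_space by simp
qed

lemma expectation_empirical_block_pmf:
  fixes \<phi> :: "'e list \<Rightarrow> real"
  assumes N: "num_blocks \<alpha> w n \<ge> 1"
  shows "measure_pmf.expectation (empirical_block_pmf \<alpha> w n) \<phi> =
    (\<Sum>j=1..num_blocks \<alpha> w n. \<phi> (regen_block \<alpha> w j)) / num_blocks \<alpha> w n"
  using N by (simp add: empirical_block_pmf_def integral_pmf_of_set)

text \<open>A deterministic statement about one trajectory: the standardised empirical law has mean
  0 and second moment 1 by construction, and the mean block length is at most \<open>n / N\<close>
  because the blocks fit into time \<open>n\<close>. The rest is assumed of the data, with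
  \<open>lam'\<close> free after \<open>r\<close>, since the truncation that makes the small total
  at most \<open>r * n\<close> depends on \<open>r\<close>.\<close>

lemma rbb_prob_le_close:
  fixes \<epsilon> d \<beta> x :: real and lam0 :: nat and f :: "'e \<Rightarrow> real"
  assumes \<epsilon>: "\<epsilon> > 0" and d: "d > 0" and \<beta>: "\<beta> > 0"
  shows "\<exists>lam\<ge>max 2 lam0. \<exists>r>0. \<forall>lam'\<ge>lam. \<exists>\<gamma>>0. \<exists>N0. \<forall>\<alpha> w n. N0 \<le> num_blocks \<alpha> w n \<longrightarrow>
    1 \<le> num_blocks \<alpha> w n \<longrightarrow> 0 < sigma_hat \<alpha> f w n \<longrightarrow>
    (\<forall>j\<in>{1..num_blocks \<alpha> w n}. \<bar>block_sum f (regen_block \<alpha> w j) - mu_hat \<alpha> f w n\<bar> \<le> \<gamma> * sigma_hat \<alpha> f w n * sqrt (num_blocks \<alpha> w n)) \<longrightarrow>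
    d * real lam powr \<beta> \<le> (\<Sum>j=1..num_blocks \<alpha> w n. if real (length (regen_block \<alpha> w j)) > 1 / real lam * n then 1 else 0) \<longrightarrow>
    (\<Sum>j=1..num_blocks \<alpha> w n. if real (length (regen_block \<alpha> w j)) > 1 / real lam' * n then 0 else real (length (regen_block \<alpha> w j))) \<le> r * real n \<longrightarrow>
    \<bar>rbb_prob_le \<alpha> f w n x - cdf std_normal_distribution x\<bar> \<le> \<epsilon>"
proof -
  obtain e where e: "e > 0" and levy: "\<forall>\<mu>. real_distribution \<mu> \<longrightarrow>
      (\<forall>t. \<bar>t\<bar> \<le> 1 / e \<longrightarrow> cmod (char \<mu> t - exp (- (t\<^sup>2 / 2))) \<le> e) \<longrightarrow>
      \<bar>cdf \<mu> x - cdf std_normal_distribution x\<bar> \<le> \<epsilon>"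
    using cdf_close_of_char_close[OF \<epsilon>, of x] by (elim exE conjE) (rule that)
  have R: "1 / e > 0" using e by simp
  note boot = bootstrap_char_close[where 'b = "'e list", OF e R d \<beta>, of lam0]
  from boot obtain lam :: nat and r :: real where lam: "max 2 lam0 \<le> lam" and r: "r > 0" and
    boot1: "\<forall>\<epsilon>' :: real. 0 < \<epsilon>' \<and> \<epsilon>' \<le> 1 / real lam \<longrightarrow> (\<exists>\<gamma>0>0. \<exists>N0. \<forall>(\<gamma> :: real) (N :: nat) (n :: nat) (H :: nat).
    \<forall>(p :: 'e list pmf) (len :: 'e list \<Rightarrow> nat) (g :: 'e list \<Rightarrow> real) (dflt :: 'e list) (t :: real).
      0 < \<gamma> \<and> \<gamma> \<le> \<gamma>0 \<and> N0 \<le> N \<and> 1 \<le> n \<and> (lam + 2) * N \<le> H \<and> finite (set_pmf p) \<and>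
      measure_pmf.expectation p g = 0 \<and> measure_pmf.expectation p (\<lambda>y. (g y)\<^sup>2) = 1 \<and>
      (\<forall>y\<in>set_pmf p. \<bar>g y\<bar> \<le> \<gamma> * sqrt N) \<and>
      measure_pmf.expectation p (\<lambda>y. real (len y)) \<le> n / N \<and>
      d * lam powr \<beta> / N \<le> measure_pmf.prob p {y. real (len y) > 1 / lam * n} \<and>
      measure_pmf.expectation p (\<lambda>y. if real (len y) > \<epsilon>' * n then 0 else real (len y)) \<le> r * n / N \<and>
      \<bar>t\<bar> \<le> 1 / e \<longrightarrow>
      cmod (measure_pmf.expectation (Pi_pmf {1..H} dflt (\<lambda>_. p))
          (\<lambda>c. iexp (t * ((\<Sum>j=1..passage n (\<lambda>j. len (c j)). g (c j)) / sqrt (passage n (\<lambda>j. len (c j))))))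
        - exp (- (t\<^sup>2 / 2))) \<le> e)"
    by (elim exE conjE) (rule that)
  show ?thesis
  proof (rule exI[of _ lam], rule conjI[OF lam], rule exI[of _ r], rule conjI[OF r], intro allI impI)
    fix lam' assume lam': "lam \<le> lam'"
    have \<epsilon>': "0 < 1 / real lam' \<and> 1 / real lam' \<le> 1 / real lam"
      using lam lam' by (auto intro!: divide_left_mono)
    from boot1[rule_format, OF \<epsilon>'] obtain \<gamma> N0 where \<gamma>: "\<gamma> > 0" and boot2: "\<forall>(\<gamma>' :: real) (N :: nat) (n :: nat) (H :: nat).
    \<forall>(p :: 'e list pmf) (len :: 'e list \<Rightarrow> nat) (g :: 'e list \<Rightarrow> real) (dflt :: 'e list) (t :: real).
      0 < \<gamma>' \<and> \<gamma>' \<le> \<gamma> \<and> N0 \<le> N \<and> 1 \<le> n \<and> (lam + 2) * N \<le> H \<and> finite (set_pmf p) \<and>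
      measure_pmf.expectation p g = 0 \<and> measure_pmf.expectation p (\<lambda>y. (g y)\<^sup>2) = 1 \<and>
      (\<forall>y\<in>set_pmf p. \<bar>g y\<bar> \<le> \<gamma>' * sqrt N) \<and>
      measure_pmf.expectation p (\<lambda>y. real (len y)) \<le> n / N \<and>
      d * lam powr \<beta> / N \<le> measure_pmf.prob p {y. real (len y) > 1 / lam * n} \<and>
      measure_pmf.expectation p (\<lambda>y. if real (len y) > 1 / real lam' * n then 0 else real (len y)) \<le> r * n / N \<and>
      \<bar>t\<bar> \<le> 1 / e \<longrightarrow>
      cmod (measure_pmf.expectation (Pi_pmf {1..H} dflt (\<lambda>_. p))
          (\<lambda>c. iexp (t * ((\<Sum>j=1..passage n (\<lambda>j. len (c j)). g (c j)) / sqrt (passage n (\<lambda>j. len (c j))))))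
        - exp (- (t\<^sup>2 / 2))) \<le> e"
      by (elim exE conjE) (rule that)
    show "\<exists>\<gamma>>0. \<exists>N0. \<forall>\<alpha> w n. N0 \<le> num_blocks \<alpha> w n \<longrightarrow>
      1 \<le> num_blocks \<alpha> w n \<longrightarrow> 0 < sigma_hat \<alpha> f w n \<longrightarrow>
      (\<forall>j\<in>{1..num_blocks \<alpha> w n}. \<bar>block_sum f (regen_block \<alpha> w j) - mu_hat \<alpha> f w n\<bar> \<le> \<gamma> * sigma_hat \<alpha> f w n * sqrt (num_blocks \<alpha> w n)) \<longrightarrow>
      d * real lam powr \<beta> \<le> (\<Sum>j=1..num_blocks \<alpha> w n. if real (length (regen_block \<alpha> w j)) > 1 / real lam * n then 1 else 0) \<longrightarrow>
      (\<Sum>j=1..num_blocks \<alpha> w n. if real (length (regen_block \<alpha> w j)) > 1 / real lam' * n then 0 else real (length (regen_block \<alpha> w j))) \<le> r * real n \<longrightarrow>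
      \<bar>rbb_prob_le \<alpha> f w n x - cdf std_normal_distribution x\<bar> \<le> \<epsilon>"
    proof (rule exI[of _ \<gamma>], rule conjI[OF \<gamma>], rule exI[of _ N0], intro allI impI)
      fix \<alpha> :: "'e set" and w :: "nat \<Rightarrow> 'e" and n :: nat
      define N where "N = num_blocks \<alpha> w n"
      define \<mu> where "\<mu> = mu_hat \<alpha> f w n"
      define \<sigma> where "\<sigma> = sigma_hat \<alpha> f w n"
      let ?B = "regen_block \<alpha> w"
      assume "N0 \<le> num_blocks \<alpha> w n" "1 \<le> num_blocks \<alpha> w n" "0 < sigma_hat \<alpha> f w n"
        "\<forall>j\<in>{1..num_blocks \<alpha> w n}. \<bar>block_sum f (?B j) - mu_hat \<alpha> f w n\<bar> \<le> \<gamma> * sigma_hat \<alpha> f w n * sqrt (num_blocks \<alpha> w n)"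
        "d * real lam powr \<beta> \<le> (\<Sum>j=1..num_blocks \<alpha> w n. if real (length (?B j)) > 1 / real lam * n then 1 else 0)"
        "(\<Sum>j=1..num_blocks \<alpha> w n. if real (length (?B j)) > 1 / real lam' * n then 0 else real (length (?B j))) \<le> r * real n"
      note as = this[folded N_def \<mu>_def \<sigma>_def]
      have N0: "real N > 0" using as(2) by simp
      let ?p = "empirical_block_pmf \<alpha> w n"
      let ?g = "\<lambda>B. (block_sum f B - \<mu>) / \<sigma>"
      have Ep: "measure_pmf.expectation ?p \<phi> = (\<Sum>j=1..N. \<phi> (?B j)) / N" for \<phi> :: "'e list \<Rightarrow> real"
        using expectation_empirical_block_pmf[of \<alpha> w n \<phi>] as(2) by (simp add: N_def)
      have sp: "set_pmf ?p = ?B ` {1..N}" using set_pmf_empirical_block_pmf as(2) by (simp add: N_def)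
      have len_sum: "(\<Sum>j=1..N. length (?B j)) \<le> n" unfolding N_def by (rule sum_length_num_blocks_le)
      have n1: "1 \<le> n"
      proof -
        have "1 \<le> length (?B 1)" by (rule length_regen_block_ge_1[of _ _ _ n]) (use as(2) in \<open>simp add: N_def\<close>)
        also have "\<dots> \<le> (\<Sum>j=1..N. length (?B j))" by (rule member_le_sum) (use as(2) in auto)
        finally show ?thesis using len_sum by simp
      qed
      have mean: "measure_pmf.expectation ?p ?g = 0"
      proof -
        have "(\<Sum>j=1..N. block_sum f (?B j)) = \<mu> * N" using N0 by (simp add: \<mu>_def mu_hat_def N_def)
        then have "(\<Sum>j=1..N. ?g (?B j)) = 0"
          unfolding sum_divide_distrib[symmetric] by (simp add: sum_subtractf)
        then show ?thesis unfolding Ep by simp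
      qed
      have var: "measure_pmf.expectation ?p (\<lambda>y. (?g y)\<^sup>2) = 1"
      proof -
        have sq: "\<sigma>\<^sup>2 = (\<Sum>j=1..N. (block_sum f (?B j) - \<mu>)\<^sup>2) / N"
          unfolding \<sigma>_def sigma_hat_def N_def \<mu>_def by (rule real_sqrt_pow2) (simp add: sum_nonneg)
        have "(\<Sum>j=1..N. (?g (?B j))\<^sup>2) / N = ((\<Sum>j=1..N. (block_sum f (?B j) - \<mu>)\<^sup>2) / N) / \<sigma>\<^sup>2"
          by (simp add: power_divide sum_divide_distrib[symmetric])
        also have "\<dots> = \<sigma>\<^sup>2 / \<sigma>\<^sup>2" by (simp only: sq)
        finally show ?thesis unfolding Ep using as(3) by simp
      qed
      have bnd: "\<forall>y\<in>set_pmf ?p. \<bar>?g y\<bar> \<le> \<gamma> * sqrt N"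
      proof
        fix y assume "y \<in> set_pmf ?p"
        then obtain j where "j \<in> {1..N}" "y = ?B j" unfolding sp by blast
        then have "\<bar>block_sum f y - \<mu>\<bar> \<le> \<gamma> * \<sigma> * sqrt N" using as(4) by simp
        then show "\<bar>?g y\<bar> \<le> \<gamma> * sqrt N" using as(3) by (simp add: abs_divide pos_divide_le_eq mult_ac)
      qed
      have Elen: "measure_pmf.expectation ?p (\<lambda>y. real (length y)) \<le> n / N"
        unfolding Ep of_nat_sum[symmetric] using len_sum N0 by (intro divide_right_mono) (simp_all only: of_nat_le_iff of_nat_0_le_iff)
      have big: "d * lam powr \<beta> / N \<le> measure_pmf.prob ?p {y. real (length y) > 1 / lam * n}"
      proof -
        have "measure_pmf.prob ?p {y. real (length y) > 1 / lam * n} = measure_pmf.expectation ?p (indicator {y. real (length y) > 1 / lam * n})"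
          by simp
        also have "\<dots> = (\<Sum>j=1..N. if real (length (?B j)) > 1 / real lam * n then 1 else 0) / N"
          unfolding Ep by (intro arg_cong2[where f = "(/)"] sum.cong refl) (simp add: indicator_def)
        finally show ?thesis using divide_right_mono[OF as(5), of "real N"] by simp
      qed
      have small: "measure_pmf.expectation ?p (\<lambda>y. if real (length y) > 1 / real lam' * n then 0 else real (length y)) \<le> r * n / N"
        unfolding Ep by (rule divide_right_mono[OF as(6)]) simp
      \<comment> \<open>Beyond \<open>n\<close>, so that the statistic is determined by
        \<open>H\<close> draws; at least \<open>(lam + 2) * N\<close>, so that the windows and the
        stretch behind them fit.\<close>
      define H where "H = max (Suc n) ((lam + 2) * N)"
      let ?Q = "Pi_pmf {1..H} [] (\<lambda>_. ?p)"
      let ?Y = "rbb_stat \<alpha> f w n"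
      let ?D = "distr (measure_pmf ?Q) borel ?Y"
      have rd: "real_distribution ?D"
        by (rule prob_space.real_distribution_distr[OF measure_pmf.prob_space_axioms]) simp
      have Y: "?Y c = (\<Sum>j=1..passage n (\<lambda>j. length (c j)). ?g (c j)) / sqrt (passage n (\<lambda>j. length (c j)))" for c
        unfolding rbb_stat_eq boot_num_eq_passage \<mu>_def \<sigma>_def ..
      have "cmod (char ?D t - exp (- (t\<^sup>2 / 2))) \<le> e" if t: "\<bar>t\<bar> \<le> 1 / e" for t
      proof -
        have "char ?D t = measure_pmf.expectation ?Q (\<lambda>c. iexp (t * ?Y c))"
          by (simp add: char_def integral_distr)
        moreover have "cmod (measure_pmf.expectation ?Q (\<lambda>c. iexp (t * ((\<Sum>j=1..passage n (\<lambda>j. length (c j)). ?g (c j)) / sqrt (passage n (\<lambda>j. length (c j))))))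
          - exp (- (t\<^sup>2 / 2))) \<le> e"
        proof (rule boot2[rule_format, of \<gamma> N n H ?p ?g length t "[]"], intro conjI)
          show "finite (set_pmf ?p)" unfolding sp by simp
          show "(lam + 2) * N \<le> H" by (simp add: H_def)
        qed (fact \<gamma> order_refl as(1) n1 mean var bnd Elen big small t)+
        ultimately show ?thesis unfolding Y by simp
      qed
      then have "\<bar>cdf ?D x - cdf std_normal_distribution x\<bar> \<le> \<epsilon>" by (rule levy[rule_format, OF rd])
      moreover have "cdf ?D x = rbb_prob_le \<alpha> f w n x"
      proof -
        have "rbb_prob_le \<alpha> f w n x = measure_pmf.prob ?Q {b. ?Y b \<le> x}"
          by (rule rbb_prob_le_eq) (use as(2) in \<open>auto simp: N_def H_def\<close>)
        moreover have "cdf ?D x = measure_pmf.prob ?Q (?Y -` {..x} \<inter> space (measure_pmf ?Q))"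
          unfolding cdf_def by (rule measure_distr) simp_all
        moreover have "?Y -` {..x} \<inter> space (measure_pmf ?Q) = {b. ?Y b \<le> x}" by auto
        ultimately show ?thesis by simp
      qed
      ultimately show "\<bar>rbb_prob_le \<alpha> f w n x - cdf std_normal_distribution x\<bar> \<le> \<epsilon>" by simp
    qed
  qed
qed

text \<open>Drawing blocks is drawing indices: the conditional probability is the share of index
  sequences of length \<open>n + 1\<close> that satisfy the inequality. For a fixed number of blocks
  this is a finite sum of indicators in the data.\<close>

lemma rbb_prob_le_eq_sum:
  assumes N: "num_blocks \<alpha> w n \<ge> 1"
  shows "rbb_prob_le \<alpha> f w n x =
    (\<Sum>h\<in>PiE_dflt {1..Suc n} 1 (\<lambda>_. {1..num_blocks \<alpha> w n}).
       if rbb_stat \<alpha> f w n (\<lambda>j. regen_block \<alpha> w (h j)) \<le> x then 1 else 0)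
     / card (PiE_dflt {1..Suc n} (1 :: nat) (\<lambda>_. {1..num_blocks \<alpha> w n}))"
proof -
  let ?N = "num_blocks \<alpha> w n" and ?J = "{1..Suc n}"
  let ?D = "PiE_dflt ?J (1 :: nat) (\<lambda>_. {1..?N})"
  have finD: "finite ?D" by (rule finite_PiE_dflt) auto
  have neD: "?D \<noteq> {}" using N by auto
  have "rbb_prob_le \<alpha> f w n x =
    measure_pmf.prob (Pi_pmf ?J (regen_block \<alpha> w 1) (\<lambda>_. map_pmf (regen_block \<alpha> w) (pmf_of_set {1..?N}))) {b. rbb_stat \<alpha> f w n b \<le> x}"
    using rbb_prob_le_eq[OF N, of "Suc n" f x "regen_block \<alpha> w 1"] by (simp add: empirical_block_pmf_def)
  also have "Pi_pmf ?J (regen_block \<alpha> w 1) (\<lambda>_. map_pmf (regen_block \<alpha> w) (pmf_of_set {1..?N})) =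
      map_pmf (\<lambda>h. regen_block \<alpha> w \<circ> h) (Pi_pmf ?J 1 (\<lambda>_. pmf_of_set {1..?N}))"
    by (rule Pi_pmf_map) auto
  also have "Pi_pmf ?J 1 (\<lambda>_. pmf_of_set {1..?N}) = pmf_of_set ?D"
    by (rule Pi_pmf_of_set) (use N in auto)
  also have "measure_pmf.prob (map_pmf (\<lambda>h. regen_block \<alpha> w \<circ> h) (pmf_of_set ?D)) {b. rbb_stat \<alpha> f w n b \<le> x} =
      measure_pmf.prob (pmf_of_set ?D) {h. rbb_stat \<alpha> f w n (\<lambda>j. regen_block \<alpha> w (h j)) \<le> x}"
    by (simp add: vimage_def comp_def)
  also have "\<dots> = card (?D \<inter> {h. rbb_stat \<alpha> f w n (\<lambda>j. regen_block \<alpha> w (h j)) \<le> x}) / card ?D"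
    by (rule measure_pmf_of_set[OF neD finD])
  also have "real (card (?D \<inter> {h. rbb_stat \<alpha> f w n (\<lambda>j. regen_block \<alpha> w (h j)) \<le> x})) =
      (\<Sum>h\<in>?D. if rbb_stat \<alpha> f w n (\<lambda>j. regen_block \<alpha> w (h j)) \<le> x then 1 else 0)"
    by (subst sum.If_cases[OF finD]) simp
  finally show ?thesis .
qed

section \<open>Measurability of the bootstrap probabilities in the data\<close>

context markov_process_atom
begin

abbreviation nblocks :: "nat \<Rightarrow> 'w \<Rightarrow> nat" where
  "nblocks n \<omega> \<equiv> num_blocks \<alpha> (\<lambda>k. X k \<omega>) n"

lemma nblocks_measurable: "nblocks n \<in> N \<rightarrow>\<^sub>M count_space UNIV"
proof -
  have ge: "{\<omega> \<in> space N. k \<le> nblocks n \<omega>} \<in> sets N" for k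
  proof (cases "k \<ge> 1")
    case True
    have "{\<omega> \<in> space N. k \<le> nblocks n \<omega>} = (\<lambda>\<omega>. rt \<omega> (Suc k)) -` {..enat n} \<inter> space N"
      unfolding num_blocks_ge_iff[OF True] by (simp add: vimage_def Int_def conj_commute del: return_time.simps)
    also have "\<dots> \<in> sets N" by (rule measurable_sets[OF rt_measurable]) simp
    finally show ?thesis .
  next
    case False
    then show ?thesis by (simp add: not_le)
  qed
  have "nblocks n -` {k} \<inter> space N \<in> sets N" for k
  proof -
    have "nblocks n -` {k} \<inter> space N = {\<omega> \<in> space N. k \<le> nblocks n \<omega>} - {\<omega> \<in> space N. Suc k \<le> nblocks n \<omega>}"
      by (simp only: set_eq_iff vimage_eq Int_iff Diff_iff mem_Collect_eq singleton_iff) (meson Suc_leI Suc_n_not_le_n le_antisym le_refl not_less order_trans)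
    then show ?thesis using sets.Diff[OF ge[of k] ge[of "Suc k"]] by simp
  qed
  then show ?thesis by (subst measurable_count_space_eq2_countable) simp_all
qed

lemma mu_hat_measurable: "(\<lambda>\<omega>. mu_hat \<alpha> f (\<lambda>k. X k \<omega>) n) \<in> borel_measurable N"
proof -
  have "(\<lambda>\<omega>. (\<Sum>i=1..k. bsum i \<omega>) / real k) \<in> borel_measurable N" for k
    by (intro borel_measurable_divide borel_measurable_sum bsum_measurable borel_measurable_const)
  from measurable_compose_countable[where f = "\<lambda>k \<omega>. (\<Sum>i=1..k. bsum i \<omega>) / real k", OF this nblocks_measurable[of n]]
  show ?thesis by (simp only: mu_hat_def)
qed

lemma sigma_hat_measurable: "(\<lambda>\<omega>. sigma_hat \<alpha> f (\<lambda>k. X k \<omega>) n) \<in> borel_measurable N"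
proof -
  let ?s = "\<lambda>k \<omega>. sqrt ((\<Sum>j=1..k. (bsum j \<omega> - mu_hat \<alpha> f (\<lambda>k. X k \<omega>) n)\<^sup>2) / real k)"
  have "(\<lambda>\<omega>. (\<Sum>j=1..k. (bsum j \<omega> - mu_hat \<alpha> f (\<lambda>k. X k \<omega>) n)\<^sup>2) / real k) \<in> borel_measurable N" for k
    by (intro borel_measurable_divide borel_measurable_sum borel_measurable_power borel_measurable_diff
        bsum_measurable mu_hat_measurable borel_measurable_const)
  from measurable_compose[OF this borel_measurable_sqrt] have "?s k \<in> borel_measurable N" for k .
  from measurable_compose_countable[where f = ?s, OF this nblocks_measurable[of n]]
  show ?thesis by (simp only: sigma_hat_def)
qed

lemma rbb_stat_blocks_measurable:
  "(\<lambda>\<omega>. rbb_stat \<alpha> f (\<lambda>k. X k \<omega>) n (\<lambda>j. regen_block \<alpha> (\<lambda>k. X k \<omega>) (h j))) \<in> borel_measurable N"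
proof -
  let ?y = "\<lambda>T \<omega>. (\<Sum>j=1..T. (bsum (h j) \<omega> - mu_hat \<alpha> f (\<lambda>k. X k \<omega>) n) / sigma_hat \<alpha> f (\<lambda>k. X k \<omega>) n) / sqrt (real T)"
  have "?y T \<in> borel_measurable N" for T
    by (intro borel_measurable_divide borel_measurable_sum borel_measurable_diff bsum_measurable
        mu_hat_measurable sigma_hat_measurable borel_measurable_const)
  moreover have "(\<lambda>\<omega>. boot_num n (\<lambda>j. regen_block \<alpha> (\<lambda>k. X k \<omega>) (h j))) \<in> N \<rightarrow>\<^sub>M count_space UNIV"
    by (rule boot_num_measurable) (rule blen_measurable)
  ultimately show ?thesis
    unfolding rbb_stat_eq by (rule measurable_compose_countable[where f = ?y])
qed

lemma rbb_prob_le_measurable: "(\<lambda>\<omega>. rbb_prob_le \<alpha> f (\<lambda>k. X k \<omega>) n x) \<in> borel_measurable N"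
proof -
  let ?D = "\<lambda>k. PiE_dflt {1..Suc n} (1 :: nat) (\<lambda>_. {1..k :: nat})"
  let ?Z = "\<lambda>k \<omega>. if k = 0 then (if 0 \<le> x then 1 else 0) else
    (\<Sum>h\<in>?D k. if rbb_stat \<alpha> f (\<lambda>k. X k \<omega>) n (\<lambda>j. regen_block \<alpha> (\<lambda>k. X k \<omega>) (h j)) \<le> x then 1 else 0) / real (card (?D k))"
  have "(\<lambda>\<omega>. if rbb_stat \<alpha> f (\<lambda>k. X k \<omega>) n (\<lambda>j. regen_block \<alpha> (\<lambda>k. X k \<omega>) (h j)) \<le> x then 1 else 0 :: real) \<in> borel_measurable N" for h
    by (rule measurable_If[OF borel_measurable_const borel_measurable_const
        borel_measurable_le[OF rbb_stat_blocks_measurable borel_measurable_const]])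
  then have sum: "(\<lambda>\<omega>. (\<Sum>h\<in>?D k. if rbb_stat \<alpha> f (\<lambda>k. X k \<omega>) n (\<lambda>j. regen_block \<alpha> (\<lambda>k. X k \<omega>) (h j)) \<le> x then 1 else 0) / real (card (?D k)))
      \<in> borel_measurable N" for k
    by (intro borel_measurable_divide borel_measurable_sum borel_measurable_const)
  have "?Z k \<in> borel_measurable N" for k
  proof (cases "k = 0")
    case True
    show ?thesis unfolding if_P[OF True] by (rule borel_measurable_const)
  next
    case False
    show ?thesis unfolding if_not_P[OF False] by (rule sum)
  qed
  then have "(\<lambda>\<omega>. ?Z (nblocks n \<omega>) \<omega>) \<in> borel_measurable N"
    by (rule measurable_compose_countable[where f = ?Z, OF _ nblocks_measurable])
  moreover have "rbb_prob_le \<alpha> f (\<lambda>k. X k \<omega>) n x = ?Z (nblocks n \<omega>) \<omega>" for \<omega>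
  proof (cases "nblocks n \<omega> = 0")
    case True
    show ?thesis unfolding if_P[OF True] by (rule rbb_prob_le_0[OF True])
  next
    case False
    then have "1 \<le> nblocks n \<omega>" by (rule Suc_leI[OF neq0_conv[THEN iffD1], unfolded One_nat_def[symmetric]])
    from rbb_prob_le_eq_sum[OF this] show ?thesis unfolding if_not_P[OF False] .
  qed
  ultimately show ?thesis by (simp only:)
qed

end

section \<open>Convergence in probability\<close>

lemma (in prob_space) prob_tendsto_0_of_AE_eventually:
  assumes A: "\<And>n. A n \<in> events" and AE: "AE \<omega> in M. \<forall>\<^sub>F n in sequentially. \<omega> \<notin> A n"
  shows "(\<lambda>n. prob (A n)) \<longlonglongrightarrow> 0"
proof -
  have "(\<lambda>n. expectation (indicator (A n) :: 'a \<Rightarrow> real)) \<longlonglongrightarrow> expectation (\<lambda>_. 0 :: real)"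
  proof (rule integral_dominated_convergence[where w = "\<lambda>_. 1"])
    show "AE \<omega> in M. (\<lambda>n. indicator (A n) \<omega> :: real) \<longlonglongrightarrow> 0"
      using AE
    proof eventually_elim
      case (elim \<omega>)
      then have "\<forall>\<^sub>F n in sequentially. (indicator (A n) \<omega> :: real) = 0" by eventually_elim simp
      then show ?case by (rule tendsto_eventually)
    qed
  qed (simp_all add: borel_measurable_indicator[OF A] split: split_indicator)
  then show ?thesis using A by simp
qed

context markov_process_atom
begin

context
  fixes a :: 'e and \<beta> :: real
  assumes a: "a \<in> \<alpha>" and visits: "AE \<omega> in N. \<forall>n. \<exists>i>n. X i \<omega> \<in> \<alpha>" and null: "beta_null_recurrent E P \<alpha> \<beta>"
begin

abbreviation Fbar :: "nat \<Rightarrow> real" where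
  "Fbar n \<equiv> measure (atom_law E P \<alpha>) {w \<in> space (atom_law E P \<alpha>). enat n < return_time \<alpha> w 1}"

lemma heavy_blocks_blen: "heavy_blocks N blen (\<lambda>\<omega>. the_enat (rt \<omega> 1)) nblocks Fbar \<beta>"
proof -
  obtain L where \<beta>: "0 < \<beta>" "\<beta> < 1" and L: "slowly_varying L"
    and F: "Fbar \<sim>[at_top] (\<lambda>n. 1 / (Gamma (1 - \<beta>) * real n powr \<beta> * L (real n)))"
    using null unfolding beta_null_recurrent_def by (elim conjE exE) (rule that)
  have tail: "prob {\<omega> \<in> space N. n < blen j \<omega>} = Fbar n" if "j \<ge> 1" for j n
    by (rule prob_blen_greater[OF a visits that])
  have anti: "Fbar n \<le> Fbar m" if "m \<le> n" for m n
  proof -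
    have "prob {\<omega> \<in> space N. n < blen 1 \<omega>} \<le> prob {\<omega> \<in> space N. m < blen 1 \<omega>}"
    proof (rule finite_measure_mono)
      have "{\<omega> \<in> space N. m < blen 1 \<omega>} = blen 1 -` {m<..} \<inter> space N" by auto
      then show "{\<omega> \<in> space N. m < blen 1 \<omega>} \<in> events" using measurable_sets[OF blen_measurable[of 1]] by simp
    qed (use that in auto)
    then show ?thesis unfolding tail[OF order_refl] .
  qed
  \<comment> \<open>Regular variation gives positivity for large arguments; monotonicity extends it
    to all, as the divisions by the tail require.\<close>
  have pos: "Fbar n > 0" for n
  proof -
    have "\<forall>\<^sub>F m in sequentially. Fbar m > 0" by (rule regularly_varying_ratio(2)[OF F L \<beta> order_refl])
    then have "\<forall>\<^sub>F m in sequentially. Fbar m > 0 \<and> n \<le> m" using eventually_ge_at_top[of n] by eventually_elim simp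
    then obtain m where "Fbar m > 0" "n \<le> m" by (auto simp: eventually_at_top_linorder)
    then show ?thesis using anti[of n m] by linarith
  qed
  show ?thesis
  proof (unfold_locales)
    show "indep_vars (\<lambda>_. count_space UNIV) blen {1..}" by (rule indep_vars_blen[OF a visits])
    show "blen j \<in> N \<rightarrow>\<^sub>M count_space UNIV" for j by (rule blen_measurable)
    show "prob {\<omega> \<in> space N. n < blen j \<omega>} = Fbar n" if "1 \<le> j" for j n by (rule tail[OF that])
    show "(\<lambda>\<omega>. the_enat (rt \<omega> 1)) \<in> N \<rightarrow>\<^sub>M count_space UNIV" by (rule measurable_compose[OF rt_measurable]) simp
    show "nblocks n \<in> N \<rightarrow>\<^sub>M count_space UNIV" for n by (rule nblocks_measurable)
    show "AE \<omega> in N. \<forall>n k. 1 \<le> k \<longrightarrow> (k \<le> nblocks n \<omega> \<longleftrightarrow> the_enat (rt \<omega> 1) + (\<Sum>j=1..k. blen j \<omega>) \<le> n)"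
      using AE_rt_finite[OF a visits]
    proof eventually_elim
      case (elim \<omega>)
      show ?case
      proof (intro allI impI)
        fix n k :: nat assume k: "1 \<le> k"
        obtain t b where t: "rt \<omega> 1 = enat t" and b: "rt \<omega> (Suc k) = enat b" using elim by meson
        have "k \<le> nblocks n \<omega> \<longleftrightarrow> b \<le> n" unfolding num_blocks_ge_iff[OF k] b by simp
        then show "k \<le> nblocks n \<omega> \<longleftrightarrow> the_enat (rt \<omega> 1) + (\<Sum>j=1..k. blen j \<omega>) \<le> n"
          unfolding return_time_eq_sum[OF t b] t by simp
      qed
    qed
    show "0 < Fbar n" for n by (rule pos)
    show "(\<lambda>n. Fbar (lam * n) / Fbar n) \<longlonglongrightarrow> real lam powr - \<beta>" if "1 \<le> lam" for lam
      by (rule regularly_varying_ratio(1)[OF F L \<beta> that])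
    show "0 < \<beta>" "\<beta> < 1" by (fact \<beta>)+
  qed
qed

lemma AE_nblocks_at_top: "AE \<omega> in N. filterlim (\<lambda>n. nblocks n \<omega>) at_top sequentially"
  using AE_rt_finite[OF a visits]
proof eventually_elim
  case (elim \<omega>)
  show ?case
    unfolding filterlim_at_top
  proof
    fix K
    obtain b where b: "rt \<omega> (Suc (Suc K)) = enat b" using elim by blast
    show "\<forall>\<^sub>F n in sequentially. K \<le> nblocks n \<omega>"
      using eventually_ge_at_top[of b]
    proof eventually_elim
      case (elim n)
      then have "Suc K \<le> nblocks n \<omega>" using num_blocks_ge_iff[of "Suc K" \<alpha> "\<lambda>k. X k \<omega>" n] b by simp
      then show ?case by simp
    qed
  qed
qed

lemma irregular_blocks_sets:
  "{\<omega> \<in> space N. \<not> (K \<le> nblocks n \<omega> \<and> 0 < sigma_hat \<alpha> f (\<lambda>k. X k \<omega>) n \<and>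
    (\<forall>j\<in>{1..nblocks n \<omega>}. \<bar>bsum j \<omega> - mu_hat \<alpha> f (\<lambda>k. X k \<omega>) n\<bar>
       \<le> \<gamma> * sigma_hat \<alpha> f (\<lambda>k. X k \<omega>) n * sqrt (nblocks n \<omega>)))} \<in> events"
    (is "{\<omega> \<in> space N. \<not> ?G \<omega>} \<in> _")
proof -
  let ?\<mu> = "\<lambda>\<omega>. mu_hat \<alpha> f (\<lambda>k. X k \<omega>) n" and ?\<sigma> = "\<lambda>\<omega>. sigma_hat \<alpha> f (\<lambda>k. X k \<omega>) n"
  let ?H = "\<lambda>k \<omega>. \<not> (K \<le> k \<and> 0 < ?\<sigma> \<omega> \<and> (\<forall>j\<in>{1..k}. \<bar>bsum j \<omega> - ?\<mu> \<omega>\<bar> \<le> \<gamma> * ?\<sigma> \<omega> * sqrt (real k)))"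
  have dev: "{\<omega> \<in> space N. \<bar>bsum j \<omega> - ?\<mu> \<omega>\<bar> \<le> \<gamma> * ?\<sigma> \<omega> * sqrt (real k)} \<in> events" for j k
    by (intro borel_measurable_le borel_measurable_abs borel_measurable_diff borel_measurable_times
        bsum_measurable mu_hat_measurable sigma_hat_measurable borel_measurable_const)
  have pos: "{\<omega> \<in> space N. 0 < ?\<sigma> \<omega>} \<in> events"
    by (rule borel_measurable_less[OF borel_measurable_const sigma_hat_measurable])
  have all: "{\<omega> \<in> space N. \<forall>j\<in>{1..k}. \<bar>bsum j \<omega> - ?\<mu> \<omega>\<bar> \<le> \<gamma> * ?\<sigma> \<omega> * sqrt (real k)} \<in> events" for k
    by (rule sets.sets_Collect_finite_All[OF _ finite_atLeastAtMost]) (rule dev)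
  have "Measurable.pred N (?H k)" for k
    unfolding pred_def
    by (rule sets.sets_Collect_neg) (rule sets.sets_Collect_conj[OF sets.sets_Collect_conj[OF all pos] sets.sets_Collect_const])
  from measurable_compose_countable[where f = ?H, OF this nblocks_measurable[of n]] show ?thesis
    unfolding pred_def .
qed

text \<open>The bounds on the maximum and on the sample variance hold almost surely for all large
  sample sizes. They may therefore be read off at the random size \<open>nblocks n \<omega>\<close>,
  which tends to infinity.\<close>

lemma prob_irregular_blocks_tendsto_0:
  assumes sq: "integrable N (\<lambda>\<omega>. (bsum 1 \<omega>)\<^sup>2)" and var: "variance (bsum 1) > 0" and \<gamma>: "\<gamma> > 0"
  shows "(\<lambda>n. prob {\<omega> \<in> space N. \<not> (K \<le> nblocks n \<omega> \<and> 0 < sigma_hat \<alpha> f (\<lambda>k. X k \<omega>) n \<and>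
    (\<forall>j\<in>{1..nblocks n \<omega>}. \<bar>bsum j \<omega> - mu_hat \<alpha> f (\<lambda>k. X k \<omega>) n\<bar>
       \<le> \<gamma> * sigma_hat \<alpha> f (\<lambda>k. X k \<omega>) n * sqrt (nblocks n \<omega>)))}) \<longlonglongrightarrow> 0"
    (is "(\<lambda>n. prob {\<omega> \<in> space N. \<not> ?G n \<omega>}) \<longlonglongrightarrow> 0")
proof (rule prob_tendsto_0_of_AE_eventually)
  have distr: "distr N borel (bsum j) = distr N borel (bsum 1)" if "j \<ge> 1" for j by (rule distr_bsum[OF a visits that])
  have "\<exists>s>0. AE \<omega> in N. \<forall>\<^sub>F M in sequentially. \<forall>c. s * real M \<le> (\<Sum>j=1..M. (bsum j \<omega> - c)\<^sup>2)"
    by (rule AE_sample_variance_ge[OF indep_vars_bsum[OF a visits] _ sq var]) (rule distr)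
  then obtain s where s: "s > 0" and AE_s: "AE \<omega> in N. \<forall>\<^sub>F M in sequentially. \<forall>c. s * real M \<le> (\<Sum>j=1..M. (bsum j \<omega> - c)\<^sup>2)"
    by (elim exE conjE) (rule that)
  \<comment> \<open>Block sum and sample mean are each at most \<open>c * sqrt M\<close> in absolute
    value, and \<open>2 * c = \<gamma> * sqrt s\<close> is at most \<open>\<gamma>\<close> times the
    estimated deviation.\<close>
  define c where "c = \<gamma> * sqrt s / 2"
  have c: "c > 0" using \<gamma> s by (simp add: c_def)
  have AE_c: "AE \<omega> in N. \<forall>\<^sub>F M in sequentially. \<forall>j\<in>{1..M}. \<bar>bsum j \<omega>\<bar> \<le> c * sqrt M"
    by (rule AE_max_le_sqrt[where Y = bsum, OF bsum_measurable _ sq c]) (rule distr)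
  show "AE \<omega> in N. \<forall>\<^sub>F n in sequentially. \<omega> \<notin> {\<omega> \<in> space N. \<not> ?G n \<omega>}"
    using AE_s AE_c AE_nblocks_at_top
  proof eventually_elim
    case (elim \<omega>)
    have "\<forall>\<^sub>F M in sequentially. (\<forall>c. s * real M \<le> (\<Sum>j=1..M. (bsum j \<omega> - c)\<^sup>2)) \<and> (\<forall>j\<in>{1..M}. \<bar>bsum j \<omega>\<bar> \<le> c * sqrt M) \<and> max K 1 \<le> M"
      using elim(1,2) eventually_ge_at_top[of "max K 1"] by eventually_elim blast
    from eventually_compose_filterlim[OF this elim(3)]
    show ?case
    proof eventually_elim
      case (elim n)
      define M where "M = nblocks n \<omega>"
      define \<mu> where "\<mu> = mu_hat \<alpha> f (\<lambda>k. X k \<omega>) n"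
      define \<sigma> where "\<sigma> = sigma_hat \<alpha> f (\<lambda>k. X k \<omega>) n"
      note el = elim[folded M_def]
      have M: "real M > 0" "K \<le> M" using el by auto
      have "\<sigma> = sqrt ((\<Sum>j=1..M. (bsum j \<omega> - \<mu>)\<^sup>2) / real M)" by (simp add: \<sigma>_def sigma_hat_def M_def \<mu>_def)
      moreover have "s \<le> (\<Sum>j=1..M. (bsum j \<omega> - \<mu>)\<^sup>2) / real M" using el M by (simp add: pos_le_divide_eq)
      ultimately have \<sigma>: "sqrt s \<le> \<sigma>" by simp
      then have \<sigma>0: "\<sigma> > 0" using s by (smt (verit) real_sqrt_gt_zero)
      have b: "\<bar>bsum j \<omega>\<bar> \<le> c * sqrt M" if "j \<in> {1..M}" for j using el that by blast
      have "\<bar>\<mu>\<bar> \<le> c * sqrt M"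
      proof -
        have "\<bar>\<Sum>i=1..M. bsum i \<omega>\<bar> \<le> (\<Sum>i=1..M. c * sqrt M)" by (rule order_trans[OF sum_abs sum_mono[OF b]])
        also have "\<dots> = c * sqrt M * real M" by simp
        finally have "\<bar>\<Sum>i=1..M. bsum i \<omega>\<bar> / real M \<le> c * sqrt M" using M(1) by (simp add: pos_divide_le_eq)
        moreover have "\<mu> = (\<Sum>i=1..M. bsum i \<omega>) / real M" by (simp add: \<mu>_def mu_hat_def M_def)
        ultimately show ?thesis by (simp add: abs_divide)
      qed
      moreover have "2 * (c * sqrt M) \<le> \<gamma> * \<sigma> * sqrt M"
      proof -
        have "2 * (c * sqrt M) = \<gamma> * sqrt s * sqrt M" by (simp add: c_def)
        also have "\<dots> \<le> \<gamma> * \<sigma> * sqrt M" using \<gamma> \<sigma> by (intro mult_right_mono mult_left_mono) auto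
        finally show ?thesis .
      qed
      ultimately have "\<bar>bsum j \<omega> - \<mu>\<bar> \<le> \<gamma> * \<sigma> * sqrt M" if "j \<in> {1..M}" for j
        using b[OF that] by linarith
      then show ?case using M(2) \<sigma>0 by (simp add: M_def \<mu>_def \<sigma>_def)
    qed
  qed
qed (rule irregular_blocks_sets)

lemma rbb_prob_le_tendsto_in_probability:
  assumes sq: "integrable N (\<lambda>\<omega>. (bsum 1 \<omega>)\<^sup>2)" and var: "variance (bsum 1) > 0"
  shows "tendsto_in_probability N (\<lambda>n \<omega>. rbb_prob_le \<alpha> f (\<lambda>k. X k \<omega>) n x) (cdf std_normal_distribution x)"
  unfolding tendsto_in_probability_def
proof (intro conjI allI impI)
  show "(\<lambda>\<omega>. rbb_prob_le \<alpha> f (\<lambda>k. X k \<omega>) n x) \<in> borel_measurable N" for n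
    by (rule rbb_prob_le_measurable)
  fix \<epsilon> :: real assume \<epsilon>: "\<epsilon> > 0"
  interpret HB: heavy_blocks N blen "\<lambda>\<omega>. the_enat (rt \<omega> 1)" nblocks Fbar \<beta> by (rule heavy_blocks_blen)
  let ?Z = "\<lambda>n \<omega>. rbb_prob_le \<alpha> f (\<lambda>k. X k \<omega>) n x"
  let ?bad = "\<lambda>n. {\<omega> \<in> space N. \<bar>?Z n \<omega> - cdf std_normal_distribution x\<bar> > \<epsilon>}"
  \<comment> \<open>Three data conditions, each failing with probability at most \<open>e\<close>.
    The choices follow the dependencies: \<open>d\<close> and \<open>lam0\<close> from the long
    blocks, then \<open>lam\<close> and \<open>r\<close> from the bootstrap, then
    \<open>lam'\<close> from the short blocks with tolerance \<open>r\<close>, and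
    \<open>\<gamma>\<close> and \<open>N0\<close> last.\<close>
  have main: "\<forall>\<^sub>F n in sequentially. prob (?bad n) \<le> 3 * e" if e: "e > 0" for e
  proof -
    obtain d lam0 where d: "d > 0" and many: "\<forall>lam\<ge>lam0. \<forall>\<^sub>F n in sequentially.
      prob {\<omega> \<in> space N. (\<Sum>j=1..nblocks n \<omega>. if real (blen j \<omega>) > 1 / real lam * n then 1 else 0) < d * real lam powr \<beta>} \<le> e"
      using HB.prob_many_big[OF e] by (elim exE conjE) (rule that)
    obtain lam r where lam: "lam \<ge> max 2 lam0" and r: "r > 0" and close: "\<forall>lam'\<ge>lam. \<exists>\<gamma>>0. \<exists>N0. \<forall>\<alpha> w n. N0 \<le> num_blocks \<alpha> w n \<longrightarrow>
    1 \<le> num_blocks \<alpha> w n \<longrightarrow> 0 < sigma_hat \<alpha> f w n \<longrightarrow>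
    (\<forall>j\<in>{1..num_blocks \<alpha> w n}. \<bar>block_sum f (regen_block \<alpha> w j) - mu_hat \<alpha> f w n\<bar> \<le> \<gamma> * sigma_hat \<alpha> f w n * sqrt (num_blocks \<alpha> w n)) \<longrightarrow>
    d * real lam powr \<beta> \<le> (\<Sum>j=1..num_blocks \<alpha> w n. if real (length (regen_block \<alpha> w j)) > 1 / real lam * n then 1 else 0) \<longrightarrow>
    (\<Sum>j=1..num_blocks \<alpha> w n. if real (length (regen_block \<alpha> w j)) > 1 / real lam' * n then 0 else real (length (regen_block \<alpha> w j))) \<le> r * real n \<longrightarrow>
    \<bar>rbb_prob_le \<alpha> f w n x - cdf std_normal_distribution x\<bar> \<le> \<epsilon>"
      using rbb_prob_le_close[OF \<epsilon> d HB.\<beta>(1), of lam0 f x] by (elim exE conjE) (rule that)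
    obtain lam' where lam': "lam' \<ge> lam" and small: "\<forall>\<^sub>F n in sequentially.
      prob {\<omega> \<in> space N. (\<Sum>j=1..nblocks n \<omega>. if real (blen j \<omega>) > 1 / real lam' * n then 0 else real (blen j \<omega>)) > r * n} \<le> e"
      using HB.prob_small_sum[OF e r, of lam] by (elim exE conjE) (rule that)
    obtain \<gamma> N0 where \<gamma>: "\<gamma> > 0" and close': "\<forall>\<alpha> w n. N0 \<le> num_blocks \<alpha> w n \<longrightarrow>
    1 \<le> num_blocks \<alpha> w n \<longrightarrow> 0 < sigma_hat \<alpha> f w n \<longrightarrow>
    (\<forall>j\<in>{1..num_blocks \<alpha> w n}. \<bar>block_sum f (regen_block \<alpha> w j) - mu_hat \<alpha> f w n\<bar> \<le> \<gamma> * sigma_hat \<alpha> f w n * sqrt (num_blocks \<alpha> w n)) \<longrightarrow>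
    d * real lam powr \<beta> \<le> (\<Sum>j=1..num_blocks \<alpha> w n. if real (length (regen_block \<alpha> w j)) > 1 / real lam * n then 1 else 0) \<longrightarrow>
    (\<Sum>j=1..num_blocks \<alpha> w n. if real (length (regen_block \<alpha> w j)) > 1 / real lam' * n then 0 else real (length (regen_block \<alpha> w j))) \<le> r * real n \<longrightarrow>
    \<bar>rbb_prob_le \<alpha> f w n x - cdf std_normal_distribution x\<bar> \<le> \<epsilon>"
      using close[rule_format, OF lam'] by (elim exE conjE) (rule that)
    let ?A = "\<lambda>n. {\<omega> \<in> space N. \<not> (max N0 1 \<le> nblocks n \<omega> \<and> 0 < sigma_hat \<alpha> f (\<lambda>k. X k \<omega>) n \<and>
      (\<forall>j\<in>{1..nblocks n \<omega>}. \<bar>bsum j \<omega> - mu_hat \<alpha> f (\<lambda>k. X k \<omega>) n\<bar>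
        \<le> \<gamma> * sigma_hat \<alpha> f (\<lambda>k. X k \<omega>) n * sqrt (nblocks n \<omega>)))}"
    let ?B = "\<lambda>n. {\<omega> \<in> space N. (\<Sum>j=1..nblocks n \<omega>. if real (blen j \<omega>) > 1 / real lam * n then 1 else 0) < d * real lam powr \<beta>}"
    let ?C = "\<lambda>n. {\<omega> \<in> space N. (\<Sum>j=1..nblocks n \<omega>. if real (blen j \<omega>) > 1 / real lam' * n then 0 else real (blen j \<omega>)) > r * n}"
    have "\<forall>\<^sub>F n in sequentially. prob (?A n) < e"
      using order_tendstoD(2)[OF prob_irregular_blocks_tendsto_0[OF sq var \<gamma>, of "max N0 1"] e] .
    moreover have "\<forall>\<^sub>F n in sequentially. prob (?B n) \<le> e" using many lam by simp
    ultimately show ?thesis using small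
    proof eventually_elim
      case (elim n)
      have B: "?B n \<in> events"
        by (rule borel_measurable_less[OF HB.random_block_sum_measurable borel_measurable_const])
      have C: "?C n \<in> events"
        by (rule borel_measurable_less[OF borel_measurable_const HB.random_block_sum_measurable])
      have sub: "?bad n \<subseteq> ?A n \<union> ?B n \<union> ?C n"
      proof (rule subsetI, rule ccontr)
        fix \<omega> assume bad: "\<omega> \<in> ?bad n" and good: "\<omega> \<notin> ?A n \<union> ?B n \<union> ?C n"
        have \<omega>: "\<omega> \<in> space N" using bad by (simp only: mem_Collect_eq)
        have A: "max N0 1 \<le> nblocks n \<omega> \<and> 0 < sigma_hat \<alpha> f (\<lambda>k. X k \<omega>) n \<and>
          (\<forall>j\<in>{1..nblocks n \<omega>}. \<bar>bsum j \<omega> - mu_hat \<alpha> f (\<lambda>k. X k \<omega>) n\<bar> \<le> \<gamma> * sigma_hat \<alpha> f (\<lambda>k. X k \<omega>) n * sqrt (nblocks n \<omega>))"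
          and B: "d * real lam powr \<beta> \<le> (\<Sum>j=1..nblocks n \<omega>. if real (blen j \<omega>) > 1 / real lam * n then 1 else 0)"
          and C: "(\<Sum>j=1..nblocks n \<omega>. if real (blen j \<omega>) > 1 / real lam' * n then 0 else real (blen j \<omega>)) \<le> r * n"
          using good \<omega> by (simp_all only: Un_iff mem_Collect_eq simp_thms de_Morgan_disj not_not not_less) (elim conjE, assumption)
        have M: "N0 \<le> nblocks n \<omega>" "1 \<le> nblocks n \<omega>" using A by simp_all
        have "\<bar>?Z n \<omega> - cdf std_normal_distribution x\<bar> \<le> \<epsilon>"
          by (rule close'[THEN spec, THEN spec, THEN spec, THEN mp, THEN mp, THEN mp, THEN mp, THEN mp, THEN mp,
              OF M A[THEN conjunct2, THEN conjunct1] A[THEN conjunct2, THEN conjunct2] B C])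
        then show False using bad by (simp only: mem_Collect_eq not_less[symmetric] simp_thms)
      qed
      have A: "?A n \<in> events" by (rule irregular_blocks_sets)
      have "prob (?bad n) \<le> prob (?A n \<union> ?B n \<union> ?C n)" by (rule finite_measure_mono[OF sub sets.Un[OF sets.Un[OF A B] C]])
      also have "\<dots> \<le> prob (?A n) + prob (?B n) + prob (?C n)"
        using measure_Un_le[OF A B] measure_Un_le[OF sets.Un[OF A B] C] by linarith
      finally show ?case using elim by linarith
    qed
  qed
  show "(\<lambda>n. prob (?bad n)) \<longlonglongrightarrow> 0"
  proof (rule tendstoI)
    fix e :: real assume e: "e > 0"
    have "\<forall>\<^sub>F n in sequentially. prob (?bad n) \<le> 3 * (e / 6)" using e by (intro main) simp
    then show "\<forall>\<^sub>F n in sequentially. dist (prob (?bad n)) 0 < e"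
      by eventually_elim (use e in simp)
  qed
qed

end

end

theorem theorem2p1:
  fixes E :: "'e measure" and P :: "'e \<Rightarrow> 'e measure" and \<psi> :: "'e measure"
    and M :: "'w measure" and X :: "nat \<Rightarrow> 'w \<Rightarrow> 'e"
    and \<alpha> :: "'e set" and \<beta> :: real and f :: "'e \<Rightarrow> real" and x :: real
  assumes "countably_generated E"
    and "transition_kernel E P"
    and "markov_chain E P M X"
    and "maximal_irreducibility_measure E P \<psi>"
    and "aperiodic_chain E P \<psi>"
    and "recurrent_chain E P \<psi>"
    and "accessible_atom E P \<psi> \<alpha>"
    and "\<And>y. y \<in> space E \<Longrightarrow> AE w in path_law E P y. \<exists>\<^sub>\<infinity>n. w n \<in> \<alpha>"
    and "beta_null_recurrent E P \<alpha> \<beta>"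
    and "integrable (atom_measure E P \<alpha>) f"
    and "integrable M (\<lambda>\<omega>. (block_sum f (regen_block \<alpha> (\<lambda>k. X k \<omega>) 1))\<^sup>2)"
    and "prob_space.variance M (\<lambda>\<omega>. block_sum f (regen_block \<alpha> (\<lambda>k. X k \<omega>) 1)) > 0"
  shows "tendsto_in_probability M
           (\<lambda>n \<omega>. rbb_prob_le \<alpha> f (\<lambda>k. X k \<omega>) n x)
           (cdf std_normal_distribution x)"
proof -
  interpret markov_process M E P X
    by (rule markov_process_markov_chain[OF assms(2,3)])
  \<comment> \<open>Integrability refers to \<open>atom_measure\<close>, whose sigma-algebra is that
    of \<open>E\<close>; this is how \<open>f\<close> becomes measurable on the state space.\<close>
  have sets_atom: "sets (atom_measure E P \<alpha>) = sets E"
    unfolding atom_measure_def by (rule sets.sets_measure_of_eq)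
  have f: "f \<in> borel_measurable E"
    using borel_measurable_integrable[OF assms(10)] by (simp only: measurable_cong_sets[OF sets_atom refl])
  note accessible = assms(7)[unfolded accessible_atom_def]
  note acc = accessible[THEN conjunct1] accessible[THEN conjunct2, THEN conjunct1]
    accessible[THEN conjunct2, THEN conjunct2]
  interpret markov_process_atom M E P X \<alpha> f
  proof unfold_locales
    show "P x = P y" if "x \<in> \<alpha>" "y \<in> \<alpha>" for x y by (rule acc(3)[THEN bspec, THEN bspec, OF that])
  qed (rule acc(1) f)+
  \<comment> \<open>A point of the atom exists because \<psi> charges it.\<close>
  have "\<alpha> \<noteq> {}"
  proof
    assume "\<alpha> = {}"
    then show False using acc(2) by simp
  qed
  then obtain a where a: "a \<in> \<alpha>" unfolding ex_in_conv[symmetric] by (rule exE)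
  have visits: "AE \<omega> in M. \<forall>n. \<exists>i>n. X i \<omega> \<in> \<alpha>" by (rule AE_visits) (rule assms(8))
  show ?thesis by (rule rbb_prob_le_tendsto_in_probability[OF a visits assms(9,11,12)])
qed

end
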